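(* If the system $X_{t+1}=AX_t+BU_t+W_t$ is mean square stable over the cascade network (with $L-1$ half-duplex relays), then $$\log\left(|\det(A)|\right)<\frac{1}{2L}\log\left(1+L\min\left\{\frac{P_S}{N_1},\frac{P_R}{\sum_{i=2}^{L}N_i}\right\}\right).$$
   Context: Notation: $\mathbb N=\{0,1,2,\dots\}$, $X_{[0,t]}=(X_0,\dots,X_t)$, $\log$ is base 2, $h(\cdot)$ is differential entropy. Plant: $X_{t+1}=AX_t+BU_t+W_t$, $t\in\mathbb N$, with state $X_t\in\mathbb R^n$, control $U_t\in\mathbb R^m$, plant noise $W_t\in\mathbb R^n$. The initial state $X_0$ is a random vector with $|h(X_0)|<\infty$ and a given covariance matrix $\Lambda_0$. $\{W_t\}$ is a zero-mean white Gaussian sequence with covariance $K_W$, independent of $X_0$. The pair $(A,B)$ is controllable and all eigenvalues $\lambda_i$ of $A$ satisfy $|\lambda_i|\ge 1$. The system is mean square stable if there is a constant $M<\infty$ with $\mathbb E[\|X_t\|^2]<M$ for all $t$. Cascade network: a state encoder, relays $\mathcal R_1,\dots,\mathcal R_{L-1}$ in series, and a remote decoder/controller. Only one node transmits in each time step: - the encoder sends $S_{e,t}=f_t(X_{[0,t]},U_{[0,t-1]})$ for $t=1+nL$, $n\in\mathbb N$, and $S_{e,t}=0$ otherwise; - relay $\mathcal R_i$ sends $S^i_{r,t}=g^i_t(Y^i_{[0,t]})$ for $t=1+i+nL$, $n\in\mathbb N$, and $S^i_{r,t}=0$ otherwise; - $\mathcal R_1$ receives $Y^1_t=S_{e,t}+Z^1_t$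 at $t=nL+1$; for $2\le i\le L-1$, $\mathcal R_i$ receives $Y^i_t=S^{i-1}_{r,t}+Z^i_t$ at $t=nL+i$; and $Y^i_t=0$ at all other times; - the controller receives $R_t=S^{L-1}_{r,t}+Z^L_t$ at $t=nL$ and $R_t=0$ otherwise, and applies $U_t=\pi_t(R_{[0,t]})$. The transmitted signals satisfy, at the respective transmission times, $\mathbb E[S_{e,t}^2]=LP_S$ and $\mathbb E[(S^i_{r,t})^2]=LP_r^i$, with $\sum_{i=1}^{L-1}P_r^i\le P_R$. The noises $Z^i_t\sim\mathcal N(0,N_i)$, $i=1,\dots,L$, are mutually independent, white, and independent of $X_0$ and $\{W_t\}$. The policies $f_t,g^i_t,\pi_t$ are otherwise arbitrary. *)

theory Defs
  imports "HOL-Probability.Probability"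
begin

text \<open>
  Vectors are elements of \<open>real ^ 'n\<close>; a random process is a function \<open>X t \<omega>\<close> of time and outcome.
  Since Bochner integrals of non-integrable functions are 0, every second moment below comes with
  an explicit integrability condition.
\<close>

text \<open>Eigenvalues of a real matrix are complex: the matrix acts on \<open>complex ^ 'n\<close>.\<close>

definition eigenvalue :: "real ^ 'n ^ 'n \<Rightarrow> complex \<Rightarrow> bool" where
  "eigenvalue A c \<longleftrightarrow> (\<exists>v. v \<noteq> 0 \<and> map_matrix complex_of_real A *v v = c *s v)"

text \<open>Every state of the noise-free system can be steered to every other one in finite time.\<close>

definition controllable :: "real ^ 'n ^ 'n \<Rightarrow> real ^ 'm ^ 'n \<Rightarrow> bool" where
  "controllable A B \<longleftrightarrow>
     (\<forall>x0 x1. \<exists>(T::nat) u x. x 0 = x0 \<and> (\<forall>t<T. x (Suc t) = A *v x t + B *v u t) \<and> x T = x1)"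

definition has_covariance :: "'w measure \<Rightarrow> ('w \<Rightarrow> real ^ 'n) \<Rightarrow> real ^ 'n ^ 'n \<Rightarrow> bool" where
  "has_covariance M X K \<longleftrightarrow>
     X \<in> borel_measurable M \<and> integrable M (\<lambda>\<omega>. (norm (X \<omega>))\<^sup>2) \<and>
     (\<forall>i j. K $ i $ j =
        (\<integral>\<omega>. (X \<omega> $ i - (\<integral>\<omega>'. X \<omega>' $ i \<partial>M)) * (X \<omega> $ j - (\<integral>\<omega>'. X \<omega>' $ j \<partial>M)) \<partial>M))"

text \<open>
  A Gaussian vector is one all of whose linear functionals are Gaussian. Constants count as
  Gaussian, so a singular covariance is allowed.
\<close>

definition gaussian_real :: "'w measure \<Rightarrow> ('w \<Rightarrow> real) \<Rightarrow> bool" where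
  "gaussian_real M Y \<longleftrightarrow>
     (\<exists>\<mu>. (\<exists>\<sigma>>0. distributed M lborel Y (normal_density \<mu> \<sigma>)) \<or>
          (Y \<in> borel_measurable M \<and> (AE \<omega> in M. Y \<omega> = \<mu>)))"

definition gaussian_vector :: "'w measure \<Rightarrow> ('w \<Rightarrow> real ^ 'n) \<Rightarrow> bool" where
  "gaussian_vector M X \<longleftrightarrow> (\<forall>v. gaussian_real M (\<lambda>\<omega>. v \<bullet> X \<omega>))"

text \<open>The library's \<open>indep_var\<close> for random variables whose value types may differ.\<close>

definition (in prob_space) indep_rv ::
    "'b measure \<Rightarrow> ('a \<Rightarrow> 'b) \<Rightarrow> 'c measure \<Rightarrow> ('a \<Rightarrow> 'c) \<Rightarrow> bool" where
  "indep_rv S X T Y \<longleftrightarrow> random_variable S X \<and> random_variable T Y \<and>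
     indep_set {X -` E \<inter> space M | E. E \<in> sets S} {Y -` E \<inter> space M | E. E \<in> sets T}"

definition mean_square_stable :: "'w measure \<Rightarrow> (nat \<Rightarrow> 'w \<Rightarrow> real ^ 'n) \<Rightarrow> bool" where
  "mean_square_stable M X \<longleftrightarrow>
     (\<exists>C. \<forall>t. integrable M (\<lambda>\<omega>. (norm (X t \<omega>))\<^sup>2) \<and> (\<integral>\<omega>. (norm (X t \<omega>))\<^sup>2 \<partial>M) < C)"

text \<open>
  The condition \<open>\<bar>h(X\<^sub>0)\<bar> < \<infinity>\<close> says that \<open>X\<^sub>0\<close> has a Lebesgue density \<open>p\<close> with
  \<open>p log p\<close> integrable. A white Gaussian sequence is a sequence of independent Gaussian vectors.
\<close>

locale linear_plant = information_space M 2
  for M :: "'w measure" +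
  fixes A :: "real ^ 'n ^ 'n" and B :: "real ^ 'm ^ 'n"
    and Lambda0 K_W :: "real ^ 'n ^ 'n"
    and X :: "nat \<Rightarrow> 'w \<Rightarrow> real ^ 'n"
    and U :: "nat \<Rightarrow> 'w \<Rightarrow> real ^ 'm"
    and W :: "nat \<Rightarrow> 'w \<Rightarrow> real ^ 'n"
  assumes controllable: "controllable A B"
    and eigenvalues: "\<And>c. eigenvalue A c \<Longrightarrow> cmod c \<ge> 1"
    and dynamics: "\<And>t \<omega>. \<omega> \<in> space M \<Longrightarrow> X (Suc t) \<omega> = A *v X t \<omega> + B *v U t \<omega> + W t \<omega>"
    and init_entropy: "\<exists>p. finite_entropy lborel (X 0) p"
    and init_covariance: "has_covariance M (X 0) Lambda0"
    and noise_gaussian: "\<And>t. gaussian_vector M (W t)"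
    and noise_mean: "\<And>t. expectation (W t) = 0"
    and noise_covariance: "\<And>t. has_covariance M (W t) K_W"
    and noise_white: "indep_vars (\<lambda>_. borel) W UNIV"
    and noise_indep_init:
      "indep_rv borel (X 0) (\<Pi>\<^sub>M t\<in>UNIV. borel) (\<lambda>\<omega> t. W t \<omega>)"

text \<open>
  The network has \<open>L \<ge> 2\<close> hops: the encoder, the relays \<open>1, \<dots>, L - 1\<close> and the controller.
  \<open>Se t\<close> is the encoder output; \<open>Sr i t\<close>, \<open>Y i t\<close> and \<open>P_r i\<close> are the output, the
  input and the power of relay \<open>i\<close>; \<open>R t\<close> is what the controller receives; \<open>Z i t\<close>, with
  variance \<open>N i\<close>, is the noise on hop \<open>i\<close>. Histories such as \<open>X\<^sub>0, \<dots>, X\<^sub>t\<close>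
  are functions restricted to a finite set of times, and the policies \<open>f\<close>, \<open>g\<close>, \<open>ctrl\<close> (the
  control law \<open>\<pi>\<close>) are measurable functions of them.
\<close>

locale cascade_loop = linear_plant M A B Lambda0 K_W X U W
  for M :: "'w measure"
    and A :: "real ^ 'n ^ 'n" and B :: "real ^ 'm ^ 'n"
    and Lambda0 K_W :: "real ^ 'n ^ 'n"
    and X :: "nat \<Rightarrow> 'w \<Rightarrow> real ^ 'n"
    and U :: "nat \<Rightarrow> 'w \<Rightarrow> real ^ 'm"
    and W :: "nat \<Rightarrow> 'w \<Rightarrow> real ^ 'n" +
  fixes L :: nat
    and P_S P_R :: real and P_r N :: "nat \<Rightarrow> real"
    and f :: "nat \<Rightarrow> (nat \<Rightarrow> real ^ 'n) \<times> (nat \<Rightarrow> real ^ 'm) \<Rightarrow> real"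
    and g :: "nat \<Rightarrow> nat \<Rightarrow> (nat \<Rightarrow> real) \<Rightarrow> real"
    and ctrl :: "nat \<Rightarrow> (nat \<Rightarrow> real) \<Rightarrow> real ^ 'm"
    and Se R :: "nat \<Rightarrow> 'w \<Rightarrow> real"
    and Sr Y Z :: "nat \<Rightarrow> nat \<Rightarrow> 'w \<Rightarrow> real"
  assumes hops: "L \<ge> 2"
    and powers_pos: "P_S > 0" "P_R > 0"
    and noise_var_pos: "\<And>i. i \<in> {1..L} \<Longrightarrow> N i > 0"
    and Z_dist: "\<And>i t. i \<in> {1..L} \<Longrightarrow>
          distributed M lborel (Z i t) (normal_density 0 (sqrt (N i)))"
    and Z_indep: "indep_vars (\<lambda>_. borel) (\<lambda>(i, t). Z i t) ({1..L} \<times> UNIV)"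
    and Z_indep_plant:
      "indep_rv (borel \<Otimes>\<^sub>M (\<Pi>\<^sub>M t\<in>UNIV. borel)) (\<lambda>\<omega>. (X 0 \<omega>, \<lambda>t. W t \<omega>))
         (\<Pi>\<^sub>M p\<in>{1..L} \<times> UNIV. borel) (\<lambda>\<omega>. \<lambda>(i, t)\<in>{1..L} \<times> UNIV. Z i t \<omega>)"
    and f_meas: "\<And>t. f t \<in> borel_measurable ((\<Pi>\<^sub>M s\<in>{..t}. borel) \<Otimes>\<^sub>M (\<Pi>\<^sub>M s\<in>{..<t}. borel))"
    and g_meas: "\<And>i t. i \<in> {1..L - 1} \<Longrightarrow> g i t \<in> borel_measurable (\<Pi>\<^sub>M s\<in>{..t}. borel)"
    and ctrl_meas: "\<And>t. ctrl t \<in> borel_measurable (\<Pi>\<^sub>M s\<in>{..t}. borel)"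
    and Se_eq: "\<And>t \<omega>. \<omega> \<in> space M \<Longrightarrow>
          Se t \<omega> = (if \<exists>n. t = 1 + n * L
            then f t (\<lambda>s\<in>{..t}. X s \<omega>, \<lambda>s\<in>{..<t}. U s \<omega>) else 0)"
    and Sr_eq: "\<And>i t \<omega>. i \<in> {1..L - 1} \<Longrightarrow> \<omega> \<in> space M \<Longrightarrow>
          Sr i t \<omega> = (if \<exists>n. t = 1 + i + n * L then g i t (\<lambda>s\<in>{..t}. Y i s \<omega>) else 0)"
    and Y1_eq: "\<And>t \<omega>. \<omega> \<in> space M \<Longrightarrow>
          Y 1 t \<omega> = (if \<exists>n. t = n * L + 1 then Se t \<omega> + Z 1 t \<omega> else 0)"
    and Y_eq: "\<And>i t \<omega>. i \<in> {2..L - 1} \<Longrightarrow> \<omega> \<in> space M \<Longrightarrow>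
          Y i t \<omega> = (if \<exists>n. t = n * L + i then Sr (i - 1) t \<omega> + Z i t \<omega> else 0)"
    and R_eq: "\<And>t \<omega>. \<omega> \<in> space M \<Longrightarrow>
          R t \<omega> = (if \<exists>n. t = n * L then Sr (L - 1) t \<omega> + Z L t \<omega> else 0)"
    and U_eq: "\<And>t \<omega>. \<omega> \<in> space M \<Longrightarrow> U t \<omega> = ctrl t (\<lambda>s\<in>{..t}. R s \<omega>)"
    and Se_power: "\<And>n. integrable M (\<lambda>\<omega>. (Se (1 + n * L) \<omega>)\<^sup>2) \<and>
          expectation (\<lambda>\<omega>. (Se (1 + n * L) \<omega>)\<^sup>2) = real L * P_S"
    and Sr_power: "\<And>i n. i \<in> {1..L - 1} \<Longrightarrow>
          integrable M (\<lambda>\<omega>. (Sr i (1 + i + n * L) \<omega>)\<^sup>2) \<and>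
          expectation (\<lambda>\<omega>. (Sr i (1 + i + n * L) \<omega>)\<^sup>2) = real L * P_r i"
    and relay_power: "(\<Sum>i = 1..L - 1. P_r i) \<le> P_R"

end

theory Submission
  imports Defs
begin

text \<open>
  Cut the loop at two hops. Given the initial state and all other noises, the two cut signals are the
  white noises of these hops plus feedback, and their law has an explicit density with respect to
  white noise. Comparing this density with one that treats the channel output \<open>y\<close> of the bounded hop as
  white of variance \<open>1 + P\<close>, and integrating the initial state against a Gaussian factor of the current
  state (which costs \<open>\<bar>det A\<bar>\<close> per step), gives \<open>L log \<bar>det A\<bar> \<le> log (1 + P) / 2\<close>.

  In the case of equality all terms of the estimate stay bounded. Hence there are arbitrarily long
  windows of time on which \<open>y\<close> is almost white and almost independent of the past, and the
  empirical energies \<open>\<Sum> y\<^sup>2 / (1 + P) - z\<^sup>2\<close> of the windows have bounded mean absolute value. But whiteness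
  forces the Laplace transform of this energy to be that of a sum with variance growing linearly in
  the length of the window, a contradiction. For a hop before the last one, the other cut is the
  controller input; for the last hop it is the previous hop. The weakest hop then satisfies
  \<open>P_i / N_i \<le> min (P_S / N_1) (P_R / \<Sum> N_i)\<close> by averaging over the relays.
\<close>


section \<open>Gaussian sequences\<close>

text \<open>The Gibbs estimate alone gives only the weak inequality; strictness shapes the proof.
  The negation of the claim is carried as \<open>cap\<close> in \<open>info_loop\<close>, and the
  loop locales end in \<open>False\<close>. Divergences from the ideal law add up along time and
  stay bounded in the limiting case, so some window of any given length carries an arbitrarily small
  share. Whiteness by itself is harmless: the contradiction is that the log-likelihood ratio
  \<open>LL k\<close> stays bounded in absolute mean, while its energy part would have variance
  \<open>P / (1 + P) > 0\<close> per step. To compute that fluctuation the noise \<open>z\<close> on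
  the window has to be averaged, but \<open>y\<close> reacts to \<open>z\<close> and, through
  feedback, so does the later \<open>t\<close>. The second cut solves this: the white noise in
  \<open>t\<close> turns the feedback into a likelihood factor \<open>r\<close>, which is split off
  from the measure. Since \<open>t\<close> is almost independent of \<open>y\<close> on the window,
  \<open>r\<close> still integrates to one after \<open>y\<close> has been perturbed. Laplace
  transforms are used because the weight \<open>exp (lam * z\<^sup>2 / 2)\<close> is equivalent to
  adding Gaussian noise to \<open>y\<close>.\<close>

abbreviation (input) nn_integral_lborel :: "('a::euclidean_space \<Rightarrow> ennreal) \<Rightarrow> ennreal" (binder "\<LL>" 10) where
 "nn_integral_lborel f \<equiv> nn_integral lborel f"

abbreviation sq :: "(nat \<Rightarrow> real) measure" where
 "sq \<equiv> \<Pi>\<^sub>M i\<in>UNIV. borel"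

abbreviation N01 :: "real measure" where
 "N01 \<equiv> density lborel (\<lambda>x. ennreal (std_normal_density x))"

definition gseq :: "(nat \<Rightarrow> real) measure" where
 "gseq = (\<Pi>\<^sub>M i\<in>UNIV. N01)"

abbreviation (input) nn_integral_gseq :: "((nat \<Rightarrow> real) \<Rightarrow> ennreal) \<Rightarrow> ennreal" (binder "\<GG>" 10) where
 "nn_integral_gseq f \<equiv> nn_integral gseq f"

text \<open>Cameron-Martin density: with \<open>x\<close> standard Gaussian, the law of
  \<open>s + x\<close> has density \<open>gl s\<close> with respect to \<open>N01\<close>.\<close>

definition gl :: "real \<Rightarrow> real \<Rightarrow> real" where
 "gl s y = exp (s * y - s\<^sup>2 / 2)"

lemma gl_pos: "0 < gl s y"
 by (simp add: gl_def)

lemma gl_0 [simp]: "gl 0 y = 1"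
 by (simp add: gl_def)

lemma measurable_gl [measurable]:
 assumes [measurable]: "f \<in> borel_measurable M" "g \<in> borel_measurable M"
 shows "(\<lambda>x. gl (f x) (g x)) \<in> borel_measurable M"
 unfolding gl_def by measurable

lemma prob_space_N01: "prob_space N01"
 by (rule prob_space_normal_density) simp

lemma prob_space_gseq: "prob_space gseq"
 unfolding gseq_def by (rule prob_space_PiM) (rule prob_space_N01)

lemma sets_gseq [measurable_cong, simp]: "sets gseq = sets sq"
 unfolding gseq_def by (intro sets_PiM_cong) auto

lemma space_gseq [simp]: "space gseq = UNIV"
 by (simp add: gseq_def space_PiM)

lemma space_sq [simp]: "space sq = UNIV"
 by (simp add: space_PiM)

lemma measurable_sqI [measurable (raw)]:
 assumes "\<And>i. (\<lambda>w. f w i) \<in> borel_measurable M"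
 shows "f \<in> measurable M sq"
 using assms by (intro measurable_PiM_single') auto

lemma measurable_sq_upd [measurable (raw)]:
 assumes [measurable]: "f \<in> measurable M sq" "g \<in> borel_measurable M"
 shows "(\<lambda>w. (f w)(j := g w)) \<in> measurable M sq"
 by (rule measurable_sqI) (simp add: fun_upd_def)

lemma sigma_finite_gseq: "sigma_finite_measure gseq"
 using prob_space_gseq by (rule prob_space_imp_sigma_finite)

lemma sigma_finite_N01: "sigma_finite_measure N01"
 using prob_space_N01 by (rule prob_space_imp_sigma_finite)

lemma nn_integral_swap:
 assumes "sigma_finite_measure M1" "sigma_finite_measure M2"
  and "(\<lambda>(x, y). f x y) \<in> borel_measurable (M1 \<Otimes>\<^sub>M M2)"
 shows "(\<integral>\<^sup>+x. \<integral>\<^sup>+y. f x y \<partial>M2 \<partial>M1) = (\<integral>\<^sup>+y. \<integral>\<^sup>+x. f x y \<partial>M1 \<partial>M2)"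
proof -
 interpret pair_sigma_finite M1 M2
  using assms(1,2) by (simp add: pair_sigma_finite_def)
 show ?thesis
  using Fubini[of "\<lambda>(x, y). f x y"] assms(3) by simp
qed

lemmas nn_integral_swap_gseq = nn_integral_swap[OF sigma_finite_gseq sigma_finite_gseq]
lemmas nn_integral_swap_lborel_gseq = nn_integral_swap[OF sigma_finite_lborel sigma_finite_gseq]

text \<open>Cylinders determine a product measure, and on a cylinder the product over
  \<open>J\<close> splits into \<open>J \<inter> A\<close> (coordinates from \<open>u\<close>) and
  \<open>J - A\<close> (coordinates from \<open>v\<close>). Resampling coordinates in this way
  replaces a splitting of the sequence space into a product throughout.\<close>

lemma distr_gseq_override:
 "distr (gseq \<Otimes>\<^sub>M gseq) gseq (\<lambda>(u, v). \<lambda>i. if i \<in> A then u i else v i) = gseq"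
proof -
 interpret P: product_prob_space "\<lambda>_. N01" "UNIV :: nat set"
  by (simp add: product_prob_space_def product_sigma_finite_def product_prob_space_axioms_def
   prob_space_N01 sigma_finite_N01)
 interpret G: prob_space gseq by (rule prob_space_gseq)
 interpret GG: pair_prob_space gseq gseq by unfold_locales
 let ?f = "\<lambda>(u, v). \<lambda>i::nat. if i \<in> A then u i else v i :: real"
 have meas: "?f \<in> measurable (gseq \<Otimes>\<^sub>M gseq) gseq"
  by (simp add: split_beta' cong: measurable_cong_sets) measurable
 have "distr (gseq \<Otimes>\<^sub>M gseq) gseq ?f = Pi\<^sub>M UNIV (\<lambda>_. N01)"
 proof (rule P.PiM_eq)
  show "sets (distr (gseq \<Otimes>\<^sub>M gseq) gseq ?f) = sets (Pi\<^sub>M UNIV (\<lambda>_. N01))"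
   by (simp add: gseq_def)
  fix J :: "nat set" and E assume J: "finite J" "J \<subseteq> UNIV" "\<And>j. j \<in> J \<Longrightarrow> E j \<in> sets N01"
  let ?E = "\<lambda>K. prod_emb UNIV (\<lambda>_. N01) K (Pi\<^sub>E K E)"
  have EK: "?E K \<in> sets gseq" "emeasure gseq (?E K) = (\<Prod>j\<in>K. emeasure N01 (E j))" if "K \<subseteq> J" for K
   using J that finite_subset[OF that J(1)] unfolding gseq_def
   by (auto intro!: sets_PiM_I P.emeasure_PiM_emb)
  have "?f -` ?E J \<inter> space (gseq \<Otimes>\<^sub>M gseq) = ?E (J \<inter> A) \<times> ?E (J - A)"
   by (auto simp: prod_emb_def space_pair_measure PiE_iff split: if_splits)
  then have "emeasure (distr (gseq \<Otimes>\<^sub>M gseq) gseq ?f) (?E J)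
    = emeasure (gseq \<Otimes>\<^sub>M gseq) (?E (J \<inter> A) \<times> ?E (J - A))"
   using EK(1)[of J] by (subst emeasure_distr[OF meas]) auto
  also have "\<dots> = (\<Prod>j\<in>J \<inter> A. emeasure N01 (E j)) * (\<Prod>j\<in>J - A. emeasure N01 (E j))"
   using EK[of "J \<inter> A"] EK[of "J - A"] by (subst G.emeasure_pair_measure_Times) auto
  also have "\<dots> = (\<Prod>j\<in>J. emeasure N01 (E j))"
   using J(1) by (subst prod.Int_Diff[of J _ A]) auto
  finally show "emeasure (distr (gseq \<Otimes>\<^sub>M gseq) gseq ?f) (?E J) = (\<Prod>j\<in>J. emeasure N01 (E j))" .
 qed
 then show ?thesis by (simp add: gseq_def)
qed

lemma nn_integral_gseq_override:
 assumes [measurable]: "f \<in> borel_measurable sq"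
 shows "(\<GG> v. \<GG> u. f (\<lambda>i. if i \<in> A then u i else v i)) = (\<GG> v. f v)"
proof -
 interpret G: prob_space gseq by (rule prob_space_gseq)
 have meas: "(\<lambda>(u, v). \<lambda>i::nat. if i \<in> A then u i else v i :: real) \<in> measurable (gseq \<Otimes>\<^sub>M gseq) gseq"
  by (simp add: split_beta' cong: measurable_cong_sets) measurable
 have "(\<GG> v. f v) = (\<integral>\<^sup>+x. f (case x of (u, v) \<Rightarrow> \<lambda>i. if i \<in> A then u i else v i) \<partial>(gseq \<Otimes>\<^sub>M gseq))"
  by (subst distr_gseq_override[of A, symmetric], subst nn_integral_distr[OF meas]) (auto simp: split_beta')
 also have "\<dots> = (\<GG> u. \<GG> v. f (\<lambda>i. if i \<in> A then u i else v i))"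
  by (subst G.nn_integral_fst[symmetric]) auto
 also have "\<dots> = (\<GG> v. \<GG> u. f (\<lambda>i. if i \<in> A then u i else v i))"
  by (rule nn_integral_swap_gseq) measurable
 finally show ?thesis by simp
qed

lemma distr_gseq_coord: "distr gseq N01 (\<lambda>u. u j) = N01"
 unfolding gseq_def using distr_PiM_component[of UNIV "\<lambda>_. N01" j] prob_space_N01 by simp

text \<open>The case of one resampled coordinate; it lets one-dimensional Gaussian identities act
  inside a sequence.\<close>

lemma nn_integral_gseq_coord:
 assumes [measurable]: "f \<in> borel_measurable sq"
 shows "(\<GG> v. \<integral>\<^sup>+x. f (v(j := x)) \<partial>N01) = (\<GG> v. f v)"
proof -
 have "(\<integral>\<^sup>+x. f (v(j := x)) \<partial>N01) = (\<GG> u. f (\<lambda>i. if i \<in> {j} then u i else v i))" for v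
 proof -
  have "(\<lambda>i. if i \<in> {j} then u i else v i) = v(j := u j)" for u :: "nat \<Rightarrow> real"
   by auto
  moreover have "(\<integral>\<^sup>+x. f (v(j := x)) \<partial>N01) = (\<GG> u. f (v(j := u j)))"
   by (subst distr_gseq_coord[of j, symmetric], subst nn_integral_distr) auto
  ultimately show ?thesis by simp
 qed
 then show ?thesis using nn_integral_gseq_override[of f "{j}"] by simp
qed

text \<open>Completing the square:
  \<open>(x - c)\<^sup>2 / 2 = x\<^sup>2 / 2 - c * x + c\<^sup>2 / 2\<close>.\<close>

lemma nn_integral_N01_shift:
 assumes [measurable]: "f \<in> borel_measurable borel"
 shows "(\<integral>\<^sup>+x. f (x + c) \<partial>N01) = (\<integral>\<^sup>+x. f x * ennreal (gl c x) \<partial>N01)"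
proof -
 have eq: "std_normal_density (x - c) = std_normal_density x * gl c x" for x
  by (simp add: std_normal_density_def gl_def exp_add[symmetric] power2_eq_square algebra_simps
   exp_diff[symmetric] diff_divide_distrib add_divide_distrib)
 have "(\<integral>\<^sup>+x. f (x + c) \<partial>N01) = (\<LL> x. std_normal_density x * f (x + c))"
  by (simp add: nn_integral_density)
 also have "\<dots> = (\<LL> x. std_normal_density (x - c) * f x)"
  using nn_integral_real_affine[of "\<lambda>x. std_normal_density (x - c) * f x" 1 c]
  by (simp add: add.commute)
 also have "\<dots> = (\<integral>\<^sup>+x. f x * ennreal (gl c x) \<partial>N01)"
  by (simp add: nn_integral_density eq ennreal_mult gl_pos less_imp_le mult_ac)
 finally show ?thesis .
qed

text \<open>The shift may depend on every coordinate except \<open>j\<close> itself. This generality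
  is what feedback requires: the shift of the current coordinate is computed from the
  others.\<close>

lemma nn_integral_gseq_shift1:
 assumes [measurable]: "f \<in> borel_measurable sq" "c \<in> borel_measurable sq"
  and c: "\<And>y u. c (y(j := u)) = c y"
 shows "(\<GG> y. f (y(j := y j + c y))) = (\<GG> y. f y * ennreal (gl (c y) (y j)))"
proof -
 have "(\<GG> y. f (y(j := y j + c y))) = (\<GG> y. \<integral>\<^sup>+x. f (y(j := x + c y)) \<partial>N01)"
  by (subst nn_integral_gseq_coord[of _ j, symmetric]) (auto simp: c)
 also have "\<dots> = (\<GG> y. \<integral>\<^sup>+x. f (y(j := x)) * ennreal (gl (c y) x) \<partial>N01)"
  by (subst nn_integral_N01_shift) auto
 also have "\<dots> = (\<GG> y. f y * ennreal (gl (c y) (y j)))"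
  by (subst (2) nn_integral_gseq_coord[of _ j, symmetric]) (auto simp: c)
 finally show ?thesis .
qed

definition shiftw :: "nat set \<Rightarrow> (nat \<Rightarrow> real) \<Rightarrow> (nat \<Rightarrow> real) \<Rightarrow> nat \<Rightarrow> real" where
 "shiftw w s y = (\<lambda>i. if i \<in> w then y i + s i else y i)"

lemma measurable_shiftw [measurable]:
 assumes [measurable]: "f \<in> measurable M sq" "g \<in> measurable M sq"
 shows "(\<lambda>x. shiftw w (f x) (g x)) \<in> measurable M sq"
 unfolding shiftw_def by measurable

lemma nn_integral_gseq_shift:
 assumes "finite w" and "f \<in> borel_measurable sq"
 shows "(\<GG> y. f (shiftw w s y)) = (\<GG> y. f y * ennreal (\<Prod>j\<in>w. gl (s j) (y j)))"
 using assms
proof (induction w arbitrary: f rule: finite_induct)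
 case empty then show ?case by (simp add: shiftw_def)
next
 case (insert j w)
 note [measurable] = insert.prems
 have eq: "shiftw (insert j w) s y = (shiftw w s y)(j := shiftw w s y j + s j)" for y
  using insert.hyps by (auto simp: shiftw_def)
 have "(\<GG> y. f (shiftw (insert j w) s y)) = (\<GG> y. f (y(j := y j + s j)) * ennreal (\<Prod>j\<in>w. gl (s j) (y j)))"
  unfolding eq by (rule insert.IH) measurable
 also have "\<dots> = (\<GG> y. f (y(j := y j + s j)) * ennreal (\<Prod>i\<in>w. gl (s i) ((y(j := y j + s j)) i)))"
  using insert.hyps by (intro nn_integral_cong arg_cong2[where f="(*)"] arg_cong[where f=ennreal] prod.cong) auto
 also have "\<dots> = (\<GG> y. f y * ennreal (\<Prod>i\<in>w. gl (s i) (y i)) * ennreal (gl (s j) (y j)))"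
  by (rule nn_integral_gseq_shift1[where c="\<lambda>_. s j" and f="\<lambda>y. f y * ennreal (\<Prod>i\<in>w. gl (s i) (y i))"]) auto
 also have "\<dots> = (\<GG> y. f y * ennreal (\<Prod>j\<in>insert j w. gl (s j) (y j)))"
  using insert.hyps by (intro nn_integral_cong) (simp add: ennreal_mult prod_nonneg gl_pos less_imp_le mult_ac)
 finally show ?case .
qed

lemma nn_integral_gseq_prod_gl:
 assumes "finite w"
 shows "(\<GG> y. ennreal (\<Prod>j\<in>w. gl (s j) (y j))) = 1"
proof -
 interpret G: prob_space gseq by (rule prob_space_gseq)
 show ?thesis
  using nn_integral_gseq_shift[OF assms, of "\<lambda>_. 1" s] by (simp add: G.emeasure_space_1[simplified])
qed

lemma nn_integral_gseq_prod:
 assumes "finite w" "\<And>j. j \<in> w \<Longrightarrow> h j \<in> borel_measurable borel"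
 shows "(\<GG> y. (\<Prod>j\<in>w. h j (y j))) = (\<Prod>j\<in>w. \<integral>\<^sup>+x. h j x \<partial>N01)"
 using assms
proof (induction w rule: finite_induct)
 case empty
 interpret G: prob_space gseq by (rule prob_space_gseq)
 show ?case using G.emeasure_space_1 by simp
next
 case (insert j w)
 have [measurable]: "h i \<in> borel_measurable borel" if "i \<in> insert j w" for i using insert.prems that by auto
 have [measurable]: "h j \<in> borel_measurable borel" "(\<lambda>y. \<Prod>i\<in>w. h i (y i)) \<in> borel_measurable sq"
  by (auto intro!: borel_measurable_prod)
 have "(\<GG> y. (\<Prod>j\<in>insert j w. h j (y j))) = (\<GG> y. h j (y j) * (\<Prod>i\<in>w. h i (y i)))"
  using insert.hyps by simp
 also have "\<dots> = (\<GG> y. \<integral>\<^sup>+x. h j x * (\<Prod>i\<in>w. h i (y i)) \<partial>N01)"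
 proof (subst nn_integral_gseq_coord[of _ j, symmetric], measurable, intro nn_integral_cong)
  fix y :: "nat \<Rightarrow> real" and x
  have "(\<Prod>i\<in>w. h i ((y(j := x)) i)) = (\<Prod>i\<in>w. h i (y i))"
   using insert.hyps by (intro prod.cong) auto
  then show "h j ((y(j := x)) j) * (\<Prod>i\<in>w. h i ((y(j := x)) i)) = h j x * (\<Prod>i\<in>w. h i (y i))"
   by simp
 qed
 also have "\<dots> = (\<integral>\<^sup>+x. h j x \<partial>N01) * (\<GG> y. (\<Prod>i\<in>w. h i (y i)))"
  by (simp add: nn_integral_multc nn_integral_cmult)
 finally show ?case using insert by simp
qed

text \<open>The weight turns variance 1 into \<open>1 / (1 - l) = 1 + l / (1 - l)\<close>, which is
  also the variance after adding independent Gaussian noise of variance \<open>l / (1 - l)\<close>.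
  An unbounded weight in the noise is thus traded for a random perturbation of the argument; this is
  how the term \<open>z\<^sup>2\<close> of the energy is removed later.\<close>

lemma nn_integral_N01_smooth:
 assumes [measurable]: "f \<in> borel_measurable borel" and l: "0 < l" "l < 1"
 shows "(\<integral>\<^sup>+x. f x * ennreal (exp (l * x\<^sup>2 / 2)) \<partial>N01)
  = ennreal (1 / sqrt (1 - l)) * (\<integral>\<^sup>+x. \<integral>\<^sup>+g. f (x + sqrt (l / (1 - l)) * g) \<partial>N01 \<partial>N01)"
proof -
 define s t where "s = 1 / sqrt (1 - l)" and "t = sqrt (l / (1 - l))"
 have st: "0 < s" "0 < t" "s\<^sup>2 = 1 / (1 - l)" "t\<^sup>2 = l / (1 - l)"
  using l by (auto simp: s_def t_def power_divide)
 have s2: "s\<^sup>2 = 1 + t\<^sup>2" unfolding st using l by (simp add: field_simps)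
 then have ss: "sqrt (1\<^sup>2 + t\<^sup>2) = s" using st(1) by (metis one_power2 real_sqrt_abs abs_of_pos)
 have d1: "std_normal_density x * exp (l * x\<^sup>2 / 2) = s * normal_density 0 s x" for x
 proof -
  have "s * normal_density 0 s x = 1 / sqrt (2 * pi) * exp (- x\<^sup>2 / (2 * s\<^sup>2))"
   using st(1) by (simp add: normal_density_def real_sqrt_mult)
  also have "- x\<^sup>2 / (2 * s\<^sup>2) = - x\<^sup>2 / 2 + l * x\<^sup>2 / 2"
   unfolding st using l by (simp add: field_simps)
  finally show ?thesis by (simp add: std_normal_density_def exp_add[symmetric])
 qed
 have d2: "normal_density 0 t (t * g) * t = std_normal_density g" for g
 proof -
  have "sqrt (2 * pi * t\<^sup>2) = sqrt (2 * pi) * t" using st(2) by (simp add: real_sqrt_mult)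
  then show ?thesis using st(2) by (simp add: normal_density_def power_mult_distrib field_simps)
 qed
 have "(\<integral>\<^sup>+x. f x * ennreal (exp (l * x\<^sup>2 / 2)) \<partial>N01)
  = (\<LL> x. ennreal (std_normal_density x) * (f x * ennreal (exp (l * x\<^sup>2 / 2))))"
  by (simp add: nn_integral_density)
 also have "\<dots> = (\<LL> x. ennreal s * (ennreal (normal_density 0 s x) * f x))"
 proof (intro nn_integral_cong)
  fix x
  have "ennreal (std_normal_density x) * ennreal (exp (l * x\<^sup>2 / 2)) = ennreal s * ennreal (normal_density 0 s x)"
   using st(1) by (subst (1 2) ennreal_mult[symmetric]) (auto simp: d1)
  then show "ennreal (std_normal_density x) * (f x * ennreal (exp (l * x\<^sup>2 / 2))) = ennreal s * (ennreal (normal_density 0 s x) * f x)"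
   by (metis mult.assoc mult.commute)
 qed
 also have "\<dots> = ennreal s * (\<LL> x. ennreal (normal_density 0 s x) * f x)"
  by (simp add: nn_integral_cmult)
 \<comment> \<open>The normal density of variance \<open>s\<^sup>2\<close> is the convolution of
   those of variances 1 and \<open>t\<^sup>2\<close>.\<close>
 also have "(\<LL> x. ennreal (normal_density 0 s x) * f x)
   = (\<LL> x. (\<LL> y. ennreal (normal_density 0 1 (x - y) * normal_density 0 t y)) * f x)"
  using fun_cong[OF conv_normal_density_zero_mean[of 1 t]] st ss by simp
 also have "\<dots> = (\<LL> x. \<LL> y. ennreal (normal_density 0 1 (x - y) * normal_density 0 t y) * f x)"
  by (simp add: nn_integral_multc)
 also have "\<dots> = (\<LL> y. \<LL> x. ennreal (normal_density 0 1 (x - y) * normal_density 0 t y) * f x)"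
  by (rule nn_integral_swap) (auto intro: sigma_finite_lborel)
 also have "\<dots> = (\<LL> y. \<LL> x. ennreal (normal_density 0 t y) * (ennreal (normal_density 0 1 x) * f (x + y)))"
 proof (rule nn_integral_cong)
  fix y
  show "(\<LL> x. ennreal (normal_density 0 1 (x - y) * normal_density 0 t y) * f x)
   = (\<LL> x. ennreal (normal_density 0 t y) * (ennreal (normal_density 0 1 x) * f (x + y)))"
   using nn_integral_real_affine[of "\<lambda>x. ennreal (normal_density 0 1 (x - y) * normal_density 0 t y) * f x" 1 y]
   by (simp add: add.commute ennreal_mult mult_ac)
 qed
 also have "\<dots> = (\<LL> y. ennreal (normal_density 0 t y) * (\<integral>\<^sup>+x. f (x + y) \<partial>N01))"
  by (simp add: nn_integral_cmult nn_integral_density)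
 also have "\<dots> = (\<LL> g. ennreal (std_normal_density g) * (\<integral>\<^sup>+x. f (x + t * g) \<partial>N01))"
 proof -
  define I where "I y = (\<integral>\<^sup>+x. f (x + y) \<partial>N01)" for y
  have [measurable]: "I \<in> borel_measurable borel"
   unfolding I_def by (intro sigma_finite_measure.borel_measurable_nn_integral[OF sigma_finite_N01]) measurable
  have "(\<LL> y. ennreal (normal_density 0 t y) * I y)
    = ennreal t * (\<LL> g. ennreal (normal_density 0 t (t * g)) * I (t * g))"
   using nn_integral_real_affine[of "\<lambda>y. ennreal (normal_density 0 t y) * I y" t 0] st(2) by simp
  also have "\<dots> = (\<LL> g. ennreal (std_normal_density g) * I (t * g))"
   using st(2) by (simp add: nn_integral_cmult[symmetric] d2[symmetric] ennreal_mult mult_ac)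
  finally show ?thesis by (simp add: I_def)
 qed
 also have "\<dots> = (\<integral>\<^sup>+g. \<integral>\<^sup>+x. f (x + t * g) \<partial>N01 \<partial>N01)"
  using sigma_finite_N01[THEN sigma_finite_measure.borel_measurable_nn_integral]
  by (simp add: nn_integral_density)
 also have "\<dots> = (\<integral>\<^sup>+x. \<integral>\<^sup>+g. f (x + t * g) \<partial>N01 \<partial>N01)"
  by (rule nn_integral_swap[OF sigma_finite_N01 sigma_finite_N01]) measurable
 finally show ?thesis by (simp add: s_def t_def)
qed


lemma nn_integral_gseq_smooth:
 assumes "finite w" "f \<in> borel_measurable sq" and l: "0 < l" "l < 1"
 shows "(\<GG> z. f z * ennreal (exp (l * (\<Sum>j\<in>w. (z j)\<^sup>2) / 2)))
  = ennreal ((1 / sqrt (1 - l)) ^ card w)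
   * (\<GG> z. \<GG> g. f (shiftw w (\<lambda>i. sqrt (l / (1 - l)) * g i) z))"
 using assms(1,2)
proof (induction w arbitrary: f rule: finite_induct)
 case empty
 interpret G: prob_space gseq by (rule prob_space_gseq)
 show ?case using G.emeasure_space_1 by (simp add: shiftw_def)
next
 case (insert j w)
 note [measurable] = insert.prems
 define s t where "s = 1 / sqrt (1 - l)" and "t = sqrt (l / (1 - l))"
 have s: "0 < s" using l by (simp add: s_def)
 \<comment> \<open>\<open>f'\<close> carries the smoothing of coordinate \<open>j\<close> alone, so
   that the induction hypothesis can smooth the remaining coordinates.\<close>
 define f' where "f' z = (\<integral>\<^sup>+x. \<integral>\<^sup>+g. f (z(j := x + t * g)) \<partial>N01 \<partial>N01)" for z
 have [measurable]: "(\<lambda>x. \<integral>\<^sup>+g. F x g \<partial>N01) \<in> borel_measurable K"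
  if [measurable]: "(\<lambda>(x, g). F x g) \<in> borel_measurable (K \<Otimes>\<^sub>M borel)" for F :: "'k \<Rightarrow> real \<Rightarrow> ennreal" and K
  by (intro sigma_finite_measure.borel_measurable_nn_integral[OF sigma_finite_N01]) (simp cong: measurable_cong_sets)
 have [measurable]: "(\<lambda>x. (\<GG> g. F x g)) \<in> borel_measurable K"
  if [measurable]: "(\<lambda>(x, g). F x g) \<in> borel_measurable (K \<Otimes>\<^sub>M sq)" for F :: "'k \<Rightarrow> _ \<Rightarrow> ennreal" and K
  by (intro sigma_finite_measure.borel_measurable_nn_integral[OF sigma_finite_gseq]) (simp cong: measurable_cong_sets)
 have f'_m [measurable]: "f' \<in> borel_measurable sq"
  unfolding f'_def by measurable
 have "(\<GG> z. f z * ennreal (exp (l * (\<Sum>i\<in>insert j w. (z i)\<^sup>2) / 2)))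
   = (\<GG> z. \<integral>\<^sup>+x. (f (z(j := x)) * ennreal (exp (l * x\<^sup>2 / 2))) * ennreal (exp (l * (\<Sum>i\<in>w. (z i)\<^sup>2) / 2)) \<partial>N01)"
 proof (subst nn_integral_gseq_coord[of _ j, symmetric], measurable, intro nn_integral_cong)
  fix z :: "nat \<Rightarrow> real" and x
  have "(\<Sum>i\<in>w. ((z(j := x)) i)\<^sup>2) = (\<Sum>i\<in>w. (z i)\<^sup>2)"
   using insert.hyps by (intro sum.cong) auto
  then have "exp (l * (\<Sum>i\<in>insert j w. ((z(j := x)) i)\<^sup>2) / 2) = exp (l * x\<^sup>2 / 2) * exp (l * (\<Sum>i\<in>w. (z i)\<^sup>2) / 2)"
   using insert.hyps by (simp add: exp_add[symmetric] field_simps)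
  then show "f (z(j := x)) * ennreal (exp (l * (\<Sum>i\<in>insert j w. ((z(j := x)) i)\<^sup>2) / 2))
    = (f (z(j := x)) * ennreal (exp (l * x\<^sup>2 / 2))) * ennreal (exp (l * (\<Sum>i\<in>w. (z i)\<^sup>2) / 2))"
   by (simp add: ennreal_mult mult_ac)
 qed
 also have "\<dots> = (\<GG> z. (ennreal s * f' z) * ennreal (exp (l * (\<Sum>i\<in>w. (z i)\<^sup>2) / 2)))"
  unfolding f'_def s_def t_def
  by (rule nn_integral_cong, subst nn_integral_multc, measurable)
   (subst nn_integral_N01_smooth[OF _ l], auto)
 also have "\<dots> = ennreal (s ^ card w) * (\<GG> z. \<GG> g. ennreal s * f' (shiftw w (\<lambda>i. t * g i) z))"
  unfolding s_def t_def by (rule insert.IH) measurable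
 also have "\<dots> = ennreal (s ^ card (insert j w)) * (\<GG> z. \<GG> g. f' (shiftw w (\<lambda>i. t * g i) z))"
  using s insert.hyps by (simp add: nn_integral_cmult ennreal_mult mult_ac)
 also have "(\<GG> z. \<GG> g. f' (shiftw w (\<lambda>i. t * g i) z))
   = (\<GG> z. \<integral>\<^sup>+x. (\<GG> g. \<integral>\<^sup>+h. f (shiftw (insert j w) (\<lambda>i. t * (g(j := h)) i) (z(j := x))) \<partial>N01) \<partial>N01)"
 proof (rule nn_integral_cong)
  fix z :: "nat \<Rightarrow> real"
  have eq: "(shiftw w (\<lambda>i. t * g i) z)(j := x + t * h) = shiftw (insert j w) (\<lambda>i. t * (g(j := h)) i) (z(j := x))" for g x h
   using insert.hyps by (auto simp: shiftw_def)
  have "(\<GG> g. f' (shiftw w (\<lambda>i. t * g i) z))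
   = (\<integral>\<^sup>+x. (\<GG> g. \<integral>\<^sup>+h. f ((shiftw w (\<lambda>i. t * g i) z)(j := x + t * h)) \<partial>N01) \<partial>N01)"
   unfolding f'_def by (rule nn_integral_swap[OF sigma_finite_gseq sigma_finite_N01]) measurable
  then show "(\<GG> g. f' (shiftw w (\<lambda>i. t * g i) z))
   = (\<integral>\<^sup>+x. (\<GG> g. \<integral>\<^sup>+h. f (shiftw (insert j w) (\<lambda>i. t * (g(j := h)) i) (z(j := x))) \<partial>N01) \<partial>N01)"
   unfolding eq .
 qed
 also have "\<dots> = (\<GG> z. \<integral>\<^sup>+x. (\<GG> g. f (shiftw (insert j w) (\<lambda>i. t * g i) (z(j := x)))) \<partial>N01)"
  by (rule nn_integral_cong, rule nn_integral_cong, rule nn_integral_gseq_coord) measurable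
 also have "\<dots> = (\<GG> z. \<GG> g. f (shiftw (insert j w) (\<lambda>i. t * g i) z))"
  by (rule nn_integral_gseq_coord) measurable
 finally show ?case by (simp add: s_def t_def)
qed

text \<open>The integrand becomes a multiple of the normal density with mean
  \<open>b / (1 + 2 * a)\<close> and variance \<open>1 / (1 + 2 * a)\<close>.\<close>

lemma nn_integral_N01_quad:
 assumes a: "-1/2 < a"
 shows "(\<integral>\<^sup>+x. ennreal (exp (b * x - a * x\<^sup>2)) \<partial>N01) = ennreal (exp (b\<^sup>2 / (2 * (1 + 2 * a))) / sqrt (1 + 2 * a))"
proof -
 define s where "s = 1 / sqrt (1 + 2 * a)"
 have s: "0 < s" "s\<^sup>2 = 1 / (1 + 2 * a)" using a by (auto simp: s_def power_divide)
 have eq: "std_normal_density x * exp (b * x - a * x\<^sup>2) = (exp (b\<^sup>2 / (2 * (1 + 2 * a))) * s) * normal_density (b * s\<^sup>2) s x" for x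
 proof -
  have "sqrt (2 * pi * s\<^sup>2) = sqrt (2 * pi) * s" using s(1) by (simp add: real_sqrt_mult)
  then have "(exp (b\<^sup>2 / (2 * (1 + 2 * a))) * s) * normal_density (b * s\<^sup>2) s x
    = 1 / sqrt (2 * pi) * exp (b\<^sup>2 / (2 * (1 + 2 * a)) - (x - b * s\<^sup>2)\<^sup>2 / (2 * s\<^sup>2))"
   using s(1) by (simp add: normal_density_def exp_add[symmetric])
  also have "b\<^sup>2 / (2 * (1 + 2 * a)) - (x - b * s\<^sup>2)\<^sup>2 / (2 * s\<^sup>2) = - x\<^sup>2 / 2 + (b * x - a * x\<^sup>2)"
  proof -
   define k where "k = 1 + 2 * a"
   have k: "0 < k" "a = (k - 1) / 2" using a by (auto simp: k_def)
   show ?thesis unfolding s k_def[symmetric] using k(1) unfolding k(2)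
    by (simp add: divide_simps) (simp add: power2_eq_square algebra_simps)
  qed
  finally show ?thesis by (simp add: std_normal_density_def exp_add[symmetric])
 qed
 have "(\<integral>\<^sup>+x. ennreal (exp (b * x - a * x\<^sup>2)) \<partial>N01)
   = (\<LL> x. ennreal (exp (b\<^sup>2 / (2 * (1 + 2 * a))) * s) * ennreal (normal_density (b * s\<^sup>2) s x))"
  using s(1) by (simp add: nn_integral_density ennreal_mult[symmetric] eq)
 also have "\<dots> = ennreal (exp (b\<^sup>2 / (2 * (1 + 2 * a))) * s)"
  using s(1) prob_space.emeasure_space_1[OF prob_space_normal_density[of s "b * s\<^sup>2"]]
  by (simp add: nn_integral_cmult emeasure_density)
 finally show ?thesis by (simp add: s_def)
qed

lemma nn_integral_N01_sq: "(\<integral>\<^sup>+x. ennreal (x\<^sup>2) \<partial>N01) = 1"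
proof -
 have "(\<integral>\<^sup>+x. ennreal (x\<^sup>2) \<partial>N01) = (\<LL> x. ennreal (std_normal_density x * x ^ (2 * 1)))"
  by (simp add: nn_integral_density ennreal_mult)
 also have "\<dots> = ennreal (\<integral>x. std_normal_density x * x ^ (2 * 1) \<partial>lborel)"
  using std_normal_moment_even[of 1]
  by (intro nn_integral_eq_integral) (auto simp: has_bochner_integral_iff)
 also have "\<dots> = 1"
  using std_normal_moment_even[of 1] by (simp add: has_bochner_integral_iff)
 finally show ?thesis .
qed

lemma nn_integral_gseq_coord1:
 assumes [measurable]: "h \<in> borel_measurable borel"
 shows "(\<GG> y. h (y j)) = (\<integral>\<^sup>+x. h x \<partial>N01)"
 using nn_integral_gseq_prod[of "{j}" "\<lambda>_. h"] by simp

lemma nn_integral_gseq_sum_sq: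
 assumes "finite w"
 shows "(\<GG> y. ennreal (\<Sum>j\<in>w. (y j)\<^sup>2)) = ennreal (card w)"
proof -
 have "(\<GG> y. ennreal (\<Sum>j\<in>w. (y j)\<^sup>2)) = (\<GG> y. (\<Sum>j\<in>w. ennreal ((y j)\<^sup>2)))"
  by simp
 also have "\<dots> = (\<Sum>j\<in>w. (\<GG> y. ennreal ((y j)\<^sup>2)))"
  by (rule nn_integral_sum) measurable
 also have "\<dots> = (\<Sum>j\<in>w. 1)"
  by (intro sum.cong refl) (subst nn_integral_gseq_coord1[where h="\<lambda>x. ennreal (x\<^sup>2)"], auto simp: nn_integral_N01_sq)
 finally show ?thesis by (simp add: ennreal_of_nat_eq_real_of_nat)
qed

text \<open>Because \<open>(gl s y)\<^sup>2 = exp (s\<^sup>2) * gl (2 * s) y\<close>, and the second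
  factor integrates to one.\<close>

lemma nn_integral_gseq_prod_gl_sq:
 assumes "finite w"
 shows "(\<GG> y. ennreal ((\<Prod>j\<in>w. gl (s j) (y j))\<^sup>2)) = ennreal (exp (\<Sum>j\<in>w. (s j)\<^sup>2))"
proof -
 have eq: "(\<Prod>j\<in>w. gl (s j) (y j))\<^sup>2 = exp (\<Sum>j\<in>w. (s j)\<^sup>2) * (\<Prod>j\<in>w. gl (2 * s j) (y j))" for y
  using assms by (simp add: gl_def exp_sum prod_power_distrib prod.distrib[symmetric])
   (intro prod.cong refl, simp add: exp_double[symmetric] exp_add[symmetric] algebra_simps power2_eq_square)
 show ?thesis
  unfolding eq using assms nn_integral_gseq_prod_gl[OF assms, of "\<lambda>j. 2 * s j"]
  by (simp add: ennreal_mult prod_nonneg gl_pos less_imp_le nn_integral_cmult)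
qed

text \<open>Closeness of \<open>q\<close> to 1 will be known only under the weight \<open>r\<close>.
  Where \<open>r \<ge> 1 / C\<close>, removing the weight costs the factor \<open>C\<close>. On the
  remaining set \<open>A\<close> the mass of 1 is controlled by the mass of \<open>q\<close>: both
  have total mass one, so an excess of 1 over \<open>q\<close> on \<open>A\<close> is a deficit off
  \<open>A\<close>. Hence only the \<open>q\<close>-mass of small \<open>r\<close> enters.\<close>

lemma (in prob_space) unweight_L1:
 assumes [measurable]: "q \<in> borel_measurable M" "r \<in> borel_measurable M"
  and q: "\<And>a. 0 \<le> q a" "(\<integral>\<^sup>+a. ennreal (q a) \<partial>M) = 1" and r: "\<And>a. 0 < r a" and C: "0 < C"
 shows "(\<integral>\<^sup>+a. ennreal \<bar>1 - q a\<bar> \<partial>M)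
  \<le> 2 * (ennreal C * (\<integral>\<^sup>+a. ennreal (r a) * ennreal \<bar>1 - q a\<bar> \<partial>M))
   + 2 * (\<integral>\<^sup>+a. ennreal (q a) * indicator {a. r a < 1 / C} a \<partial>M)"
proof -
 define A where "A = {a. r a < 1 / C}"
 have [measurable]: "Measurable.pred M (\<lambda>a. a \<in> A)" "Measurable.pred M (\<lambda>a. a \<in> -A)" unfolding A_def by auto
 have pw1: "ennreal (q a) \<le> 1 + ennreal \<bar>1 - q a\<bar>" and pw2: "ennreal \<bar>1 - q a\<bar> \<le> 1 + ennreal (q a)" for a
  using q(1)[of a] by (auto simp flip: ennreal_1 ennreal_plus simp del: ennreal_1 ennreal_plus intro!: ennreal_leI)
 define d where "d = (\<integral>\<^sup>+a. ennreal \<bar>1 - q a\<bar> * indicator (-A) a \<partial>M)"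
 have pw: "ennreal \<bar>1 - q a\<bar> * indicator (-A) a \<le> ennreal C * (ennreal (r a) * ennreal \<bar>1 - q a\<bar>)" for a
 proof (cases "a \<in> A")
  case False
  then have "1 \<le> C * r a" using C by (simp add: A_def field_simps)
  then have "\<bar>1 - q a\<bar> \<le> (C * r a) * \<bar>1 - q a\<bar>" using mult_right_mono[of 1 "C * r a" "\<bar>1 - q a\<bar>"] by simp
  then have "ennreal \<bar>1 - q a\<bar> \<le> ennreal (C * (r a * \<bar>1 - q a\<bar>))"
   by (intro ennreal_leI) (simp add: mult_ac)
  then show ?thesis using False C r[of a] by (simp add: ennreal_mult)
 qed simp
 have d: "d \<le> ennreal C * (\<integral>\<^sup>+a. ennreal (r a) * ennreal \<bar>1 - q a\<bar> \<partial>M)"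
  unfolding d_def by (subst nn_integral_cmult[symmetric]) (auto intro!: nn_integral_mono pw)
 define qA where "qA = (\<integral>\<^sup>+a. ennreal (q a) * indicator A a \<partial>M)"
 define u where "u = (\<integral>\<^sup>+a. indicator (-A) a \<partial>M)"
 define v where "v = (\<integral>\<^sup>+a. indicator A a \<partial>M)"
 have uv: "u + v = 1"
 proof -
  have "indicator (-A) x + indicator A x = (1::ennreal)" for x by (simp split: split_indicator)
  then show ?thesis
   unfolding u_def v_def by (subst nn_integral_add[symmetric]) (auto simp: emeasure_space_1)
 qed
 have "1 = (\<integral>\<^sup>+a. ennreal (q a) * indicator (-A) a \<partial>M) + qA"
  unfolding qA_def q(2)[symmetric]
  by (subst nn_integral_add[symmetric]) (auto intro!: nn_integral_cong split: split_indicator)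
 also have "(\<integral>\<^sup>+a. ennreal (q a) * indicator (-A) a \<partial>M) \<le> u + d"
  unfolding u_def d_def
  by (subst nn_integral_add[symmetric])
   (auto intro!: nn_integral_mono simp: pw1 pw2 split: split_indicator)
 finally have "u + v \<le> u + (d + qA)" using uv by (simp add: add.assoc add_right_mono)
 then have v: "v \<le> d + qA"
  using uv by (subst (asm) ennreal_add_left_cancel_le) (auto simp: top_unique)
 have "(\<integral>\<^sup>+a. ennreal \<bar>1 - q a\<bar> \<partial>M) \<le> d + (v + qA)"
  unfolding d_def v_def qA_def
  by (subst nn_integral_add[symmetric], simp, simp, subst nn_integral_add[symmetric])
   (auto intro!: nn_integral_mono simp: pw1 pw2 split: split_indicator)
 also have "\<dots> \<le> d + ((d + qA) + qA)" using v by (intro add_mono) auto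
 also have "\<dots> = 2 * d + 2 * qA" by (simp add: mult_2 add_ac)
 also have "\<dots> \<le> 2 * (ennreal C * (\<integral>\<^sup>+a. ennreal (r a) * ennreal \<bar>1 - q a\<bar> \<partial>M)) + 2 * qA"
  using d by (intro add_mono mult_left_mono) auto
 finally show ?thesis by (simp add: qA_def A_def)
qed

text \<open>The value that the Laplace transform of the window energy has for a \<open>y\<close>
  exactly white of variance \<open>1 + P\<close>. Per coordinate it is the transform of
  \<open>(y\<^sup>2 / (1 + P) - z\<^sup>2) / 2\<close> for \<open>y = s + z\<close> with independent
  Gaussian \<open>s\<close> and \<open>z\<close> of variances \<open>P\<close> and 1; that variable
  has variance \<open>P / (1 + P)\<close>.\<close>

lemma nn_integral_window_value:
 assumes w: "finite w" and l: "0 < l" "l < 1" and P: "0 \<le> P"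
 defines "t \<equiv> sqrt (l / (1 - l))"
 shows "ennreal ((1 / sqrt (1 - l)) ^ card w)
   * (\<GG> y. \<GG> g. ennreal (exp (- (l / (2 * (1 + P))) * (\<Sum>j\<in>w. (sqrt (1 + P) * y j + t * g j)\<^sup>2))))
  = ennreal ((1 / sqrt (1 - l\<^sup>2 * (P / (1 + P)))) ^ card w)"
proof -
 define c where "c = l / (2 * (1 + P))"
 define p where "p = sqrt (1 + P)"
 have p: "0 < p" "p\<^sup>2 = 1 + P" using P by (auto simp: p_def)
 have "1 + P \<noteq> 0" using P by simp
 then have c: "0 < c" "c * p\<^sup>2 = l / 2" using l P unfolding p by (auto simp: c_def divide_simps)
 have t: "t\<^sup>2 = l / (1 - l)" "0 < t" using l by (auto simp: t_def)
 \<comment> \<open>Integrating out \<open>g\<close> divides the coefficient \<open>c\<close> by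
   \<open>D\<close> and leaves \<open>1 / sqrt D\<close>; integrating out \<open>y\<close> then
   gives \<open>1 / sqrt (D + l)\<close>.\<close>
 define D where "D = 1 + 2 * (c * t\<^sup>2)"
 have D: "1 < D" using mult_pos_pos[OF c(1) zero_less_power[OF t(2), of 2]] unfolding D_def by simp
 have J: "(\<integral>\<^sup>+g. ennreal (exp (- c * (b + t * g)\<^sup>2)) \<partial>N01) = ennreal (exp (- (c / D) * b\<^sup>2) / sqrt D)" for b
 proof -
  have "(\<integral>\<^sup>+g. ennreal (exp (- c * (b + t * g)\<^sup>2)) \<partial>N01)
   = (\<integral>\<^sup>+g. ennreal (exp (- c * b\<^sup>2)) * ennreal (exp ((- 2 * c * b * t) * g - (c * t\<^sup>2) * g\<^sup>2)) \<partial>N01)"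
   by (intro nn_integral_cong)
    (simp add: ennreal_mult[symmetric] exp_add[symmetric] power2_eq_square algebra_simps)
  also have "\<dots> = ennreal (exp (- c * b\<^sup>2)) * ennreal (exp ((- 2 * c * b * t)\<^sup>2 / (2 * D)) / sqrt D)"
   using D unfolding D_def by (subst nn_integral_cmult) (auto simp only: nn_integral_N01_quad, auto)
  also have "\<dots> = ennreal (exp (- c * b\<^sup>2 + (- 2 * c * b * t)\<^sup>2 / (2 * D)) / sqrt D)"
   using D unfolding exp_add by (simp add: ennreal_mult[symmetric])
  also have "- c * b\<^sup>2 + (- 2 * c * b * t)\<^sup>2 / (2 * D) = - (c / D) * b\<^sup>2"
  proof -
   have "(- 2 * c * b * t)\<^sup>2 = 2 * (D - 1) * c * b\<^sup>2"
    by (simp add: D_def power2_eq_square algebra_simps)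
   then have "- c * b\<^sup>2 + (- 2 * c * b * t)\<^sup>2 / (2 * D) = - c * b\<^sup>2 + 2 * (D - 1) * c * b\<^sup>2 / (2 * D)"
    by (simp only:)
   also have "\<dots> = - (c / D) * b\<^sup>2" using D by (simp add: divide_simps) (simp add: algebra_simps)
   finally show ?thesis .
  qed
  finally show ?thesis .
 qed
 have J2: "(\<integral>\<^sup>+x. ennreal (exp (- (c / D) * (p * x)\<^sup>2) / sqrt D) \<partial>N01) = ennreal (1 / sqrt (D + l))"
 proof -
  have "(\<integral>\<^sup>+x. ennreal (exp (- (c / D) * (p * x)\<^sup>2) / sqrt D) \<partial>N01)
    = (\<integral>\<^sup>+x. ennreal (1 / sqrt D) * ennreal (exp (0 * x - (l / (2 * D)) * x\<^sup>2)) \<partial>N01)"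
   using c D by (intro nn_integral_cong) (simp add: ennreal_mult[symmetric] power_mult_distrib field_simps)
  also have "\<dots> = ennreal (1 / sqrt D) * ennreal (1 / sqrt (1 + l / D))"
  proof -
   have "- 1 / 2 < l / (2 * D)" using D l by (intro less_le_trans[OF _ divide_nonneg_pos]) auto
   moreover have "1 + 2 * (l / (2 * D)) = 1 + l / D" using D by (simp add: field_simps)
   ultimately have "(\<integral>\<^sup>+x. ennreal (exp (0 * x - (l / (2 * D)) * x\<^sup>2)) \<partial>N01) = ennreal (1 / sqrt (1 + l / D))"
    using nn_integral_N01_quad[of "l / (2 * D)" 0] by simp
   then show ?thesis by (subst nn_integral_cmult) (simp, simp only:)
  qed
  also have "\<dots> = ennreal (1 / sqrt (D * (1 + l / D)))"
   using D l by (simp add: ennreal_mult[symmetric] real_sqrt_mult)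
  also have "D * (1 + l / D) = D + l" using D by (simp add: field_simps)
  finally show ?thesis .
 qed
 have "(\<GG> g. ennreal (exp (- c * (\<Sum>j\<in>w. (p * y j + t * g j)\<^sup>2))))
   = (\<Prod>j\<in>w. ennreal (exp (- (c / D) * (p * y j)\<^sup>2) / sqrt D))" for y
 proof -
  have "(\<GG> g. ennreal (exp (- c * (\<Sum>j\<in>w. (p * y j + t * g j)\<^sup>2))))
    = (\<GG> g. (\<Prod>j\<in>w. ennreal (exp (- c * (p * y j + t * g j)\<^sup>2))))"
   using w by (intro nn_integral_cong)
    (simp add: prod_ennreal exp_sum[symmetric] sum_distrib_left sum_negf)
  also have "\<dots> = (\<Prod>j\<in>w. \<integral>\<^sup>+g. ennreal (exp (- c * (p * y j + t * g)\<^sup>2)) \<partial>N01)"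
   by (rule nn_integral_gseq_prod[OF w]) measurable
  finally show ?thesis by (simp only: J)
 qed
 then have "(\<GG> y. \<GG> g. ennreal (exp (- c * (\<Sum>j\<in>w. (p * y j + t * g j)\<^sup>2))))
   = (\<GG> y. (\<Prod>j\<in>w. ennreal (exp (- (c / D) * (p * y j)\<^sup>2) / sqrt D)))"
  by simp
 also have "\<dots> = (\<Prod>j\<in>w. ennreal (1 / sqrt (D + l)))"
  by (subst nn_integral_gseq_prod[OF w]) (measurable, simp only: J2)
 also have "\<dots> = ennreal ((1 / sqrt (D + l)) ^ card w)"
  using D l by (simp add: ennreal_power)
 finally have "ennreal ((1 / sqrt (1 - l)) ^ card w)
   * (\<GG> y. \<GG> g. ennreal (exp (- c * (\<Sum>j\<in>w. (p * y j + t * g j)\<^sup>2))))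
   = ennreal ((1 / sqrt ((1 - l) * (D + l))) ^ card w)"
  using D l by (simp add: ennreal_mult[symmetric] power_mult_distrib[symmetric] real_sqrt_mult)
 also have "(1 - l) * (D + l) = 1 - l\<^sup>2 * (P / (1 + P))"
 proof -
  have "(1 - l) * (D + l) = (1 - l) * (1 + l) + 2 * c * ((1 - l) * t\<^sup>2)"
   unfolding D_def by (simp add: algebra_simps)
  also have "(1 - l) * t\<^sup>2 = l" using l by (simp add: t)
  also have "2 * c = l / (1 + P)" using P by (simp add: c_def field_simps)
  also have "(1 - l) * (1 + l) + l / (1 + P) * l = 1 - l\<^sup>2 * (1 - 1 / (1 + P))"
   by (simp add: power2_eq_square algebra_simps)
  also have "1 - 1 / (1 + P) = P / (1 + P)" using P by (simp add: field_simps)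
  finally show ?thesis .
 qed
 finally show ?thesis by (simp add: c_def p_def)
qed

section \<open>Likelihood windows\<close>

text \<open>Intended reading: \<open>PP\<close> is the loop law without the likelihood of
  \<open>t\<close> on the window \<open>w\<close>, and \<open>r\<close> is that omitted likelihood.
  \<open>q\<close> is a competing density under which \<open>t\<close> on the window is fresh noise
  (\<open>indep\<close>). The identity \<open>smooth\<close> can hold under \<open>PP\<close>
  because there \<open>t\<close> does not react to \<open>y\<close> on the window.\<close>

locale window = prob_space PP for PP :: "'a measure" +
 fixes N :: "'g measure" and w :: "nat set" and G :: "'a \<Rightarrow> 'g"
  and t y z :: "'a \<Rightarrow> nat \<Rightarrow> real" and e :: "'g \<Rightarrow> (nat \<Rightarrow> real) \<Rightarrow> nat \<Rightarrow> real"
  and q :: "'a \<Rightarrow> real" and P Ce eps lam :: real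
 assumes w: "finite w"
  and G [measurable]: "G \<in> measurable PP N"
  and tyz [measurable]: "t \<in> measurable PP sq" "y \<in> measurable PP sq" "z \<in> measurable PP sq"
  and e [measurable]: "(\<lambda>(g, y). e g y) \<in> measurable (N \<Otimes>\<^sub>M sq) sq"
  and q [measurable]: "q \<in> borel_measurable PP" and q_nonneg: "\<And>a. 0 \<le> q a"
  and q_prob: "(\<integral>\<^sup>+a. ennreal (q a) \<partial>PP) = 1"
  and param: "0 \<le> P" "0 \<le> Ce" "0 \<le> eps" "0 < lam" "2 * lam < 1"
  and indep: "\<And>F. F \<in> borel_measurable (N \<Otimes>\<^sub>M sq \<Otimes>\<^sub>M sq) \<Longrightarrow>
   (\<integral>\<^sup>+a. ennreal (q a) * F (G a, t a, y a) \<partial>PP)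
   = (\<integral>\<^sup>+a. ennreal (q a) * (\<GG> u. F (G a, (\<lambda>i. if i \<in> w then u i else t a i), y a)) \<partial>PP)"
  and smooth: "\<And>F l. F \<in> borel_measurable (N \<Otimes>\<^sub>M sq \<Otimes>\<^sub>M sq) \<Longrightarrow> 0 < l \<Longrightarrow> l < 1 \<Longrightarrow>
   (\<integral>\<^sup>+a. F (G a, t a, y a) * ennreal (exp (l * (\<Sum>j\<in>w. (z a j)\<^sup>2) / 2)) \<partial>PP)
   = ennreal ((1 / sqrt (1 - l)) ^ card w)
    * (\<integral>\<^sup>+a. (\<GG> g. F (G a, t a, shiftw w (\<lambda>i. sqrt (l / (1 - l)) * g i) (y a))) \<partial>PP)"
begin

definition R :: "'g \<times> (nat \<Rightarrow> real) \<times> (nat \<Rightarrow> real) \<Rightarrow> real" where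
 "R = (\<lambda>(g, t, y). \<Prod>j\<in>w. gl (e g y j) (t j))"

definition r :: "'a \<Rightarrow> real" where "r a = R (G a, t a, y a)"

text \<open>Energy of the feedback; \<open>exp E\<close> is the conditional second moment of
  \<open>R\<close> when \<open>t\<close> is fresh on the window.\<close>

definition E :: "'g \<times> (nat \<Rightarrow> real) \<times> (nat \<Rightarrow> real) \<Rightarrow> real" where
 "E = (\<lambda>(g, t, y). \<Sum>j\<in>w. (e g y j)\<^sup>2)"

text \<open>The \<open>y\<close>-part of \<open>exp (- lam * Q)\<close>; the \<open>z\<close>-part
  is the weight handled by \<open>smooth\<close>.\<close>

definition Wt :: "'g \<times> (nat \<Rightarrow> real) \<times> (nat \<Rightarrow> real) \<Rightarrow> real" where
 "Wt = (\<lambda>(g, t, y). exp (- (lam / (2 * (1 + P))) * (\<Sum>j\<in>w. (y j)\<^sup>2)))"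

text \<open>\<open>Wt\<close> averaged over the perturbation of \<open>y\<close> that smoothing
  introduces.\<close>

definition kW :: "(nat \<Rightarrow> real) \<Rightarrow> ennreal" where
 "kW v = (\<GG> g. ennreal (exp (- (lam / (2 * (1 + P))) * (\<Sum>j\<in>w. (v j + sqrt (lam / (1 - lam)) * g j)\<^sup>2))))"

definition Q :: "'a \<Rightarrow> real" where
 "Q a = (\<Sum>j\<in>w. (y a j)\<^sup>2 / (1 + P) - (z a j)\<^sup>2) / 2"

definition sg :: real where "sg = (1 / sqrt (1 - lam)) ^ card w"

text \<open>The smoothing factor at \<open>2 * lam\<close>, which is the mean of
  \<open>exp (lam * \<Sum> z\<^sup>2)\<close> and thus the second moment of the weight
  \<open>exp (lam * \<Sum> z\<^sup>2 / 2)\<close>.\<close>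

definition A2 :: real where "A2 = (1 / sqrt (1 - 2 * lam)) ^ card w"

lemma e_comp [measurable]:
 assumes [measurable]: "f \<in> measurable K N" "h \<in> measurable K sq"
 shows "(\<lambda>x. e (f x) (h x) j) \<in> borel_measurable K"
proof -
 have "(\<lambda>x. (case (f x, h x) of (g, y) \<Rightarrow> e g y) j) \<in> borel_measurable K"
  by (rule measurable_compose[OF measurable_compose[OF _ e] measurable_component_singleton]) auto
 then show ?thesis by simp
qed

lemma R_m [measurable]: "R \<in> borel_measurable (N \<Otimes>\<^sub>M sq \<Otimes>\<^sub>M sq)"
 and E_m [measurable]: "E \<in> borel_measurable (N \<Otimes>\<^sub>M sq \<Otimes>\<^sub>M sq)"
 and Wt_m [measurable]: "Wt \<in> borel_measurable (N \<Otimes>\<^sub>M sq \<Otimes>\<^sub>M sq)"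
 unfolding R_def E_def Wt_def by measurable

lemma r_m [measurable]: "r \<in> borel_measurable PP"
 unfolding r_def by measurable

lemma R_pos: "0 < R x"
 by (cases x) (auto simp: R_def intro!: prod_pos gl_pos)

lemma r_pos: "0 < r a"
 unfolding r_def by (rule R_pos)

lemma E_nonneg: "0 \<le> E x"
 by (cases x) (auto simp: E_def intro!: sum_nonneg)

lemma Wt_pos: "0 < Wt x"
 by (cases x) (simp add: Wt_def)

lemma Wt_le: "Wt x \<le> 1"
proof (cases x)
 case (fields g u v)
 have "0 \<le> (lam / (2 * (1 + P))) * (\<Sum>j\<in>w. (v j)\<^sup>2)"
  using param by (intro mult_nonneg_nonneg sum_nonneg) auto
 then show ?thesis by (simp add: fields Wt_def)
qed

lemma gseq_nn_m [measurable]: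
 assumes [measurable]: "(\<lambda>(x, g). F x g) \<in> borel_measurable (K \<Otimes>\<^sub>M sq)"
 shows "(\<lambda>x. (\<GG> g. F x g) :: ennreal) \<in> borel_measurable K"
 by (intro sigma_finite_measure.borel_measurable_nn_integral[OF sigma_finite_gseq]) (simp cong: measurable_cong_sets)

lemma kW_m [measurable]: "kW \<in> borel_measurable sq"
 unfolding kW_def by measurable

lemma kW_le: "kW v \<le> 1"
proof -
 interpret S: prob_space gseq by (rule prob_space_gseq)
 have "kW v \<le> (\<GG> g. 1)"
  unfolding kW_def
 proof (rule nn_integral_mono)
  fix g
  have "0 \<le> (lam / (2 * (1 + P))) * (\<Sum>j\<in>w. (v j + sqrt (lam / (1 - lam)) * g j)\<^sup>2)"
   using param by (intro mult_nonneg_nonneg sum_nonneg) auto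
  then show "ennreal (exp (- (lam / (2 * (1 + P))) * (\<Sum>j\<in>w. (v j + sqrt (lam / (1 - lam)) * g j)\<^sup>2))) \<le> 1"
   by (simp add: ennreal_le_1)
 qed
 then show ?thesis using S.emeasure_space_1 by simp
qed

abbreviation sub :: "(nat \<Rightarrow> real) \<Rightarrow> (nat \<Rightarrow> real) \<Rightarrow> nat \<Rightarrow> real" where
 "sub u v \<equiv> (\<lambda>i. if i \<in> w then u i else v i)"

abbreviation sh :: "(nat \<Rightarrow> real) \<Rightarrow> 'a \<Rightarrow> nat \<Rightarrow> real" where
 "sh g a \<equiv> shiftw w (\<lambda>i. sqrt (lam / (1 - lam)) * g i) (y a)"

lemma int_R: "(\<GG> u. ennreal (R (g, sub u v, yy))) = 1"
proof -
 have "R (g, sub u v, yy) = (\<Prod>j\<in>w. gl (e g yy j) (u j))" for u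
  by (auto simp: R_def intro!: prod.cong)
 then show ?thesis using nn_integral_gseq_prod_gl[OF w] by simp
qed

lemma int_R_sq: "(\<GG> u. ennreal ((R (g, sub u v, yy))\<^sup>2)) = ennreal (exp (E (g, v, yy)))"
proof -
 have "R (g, sub u v, yy) = (\<Prod>j\<in>w. gl (e g yy j) (u j))" for u
  by (auto simp: R_def intro!: prod.cong)
 then show ?thesis using nn_integral_gseq_prod_gl_sq[OF w] by (simp add: E_def)
qed

lemma E_sub: "E (g, v, yy) = E (g, v', yy)"
 by (simp add: E_def)

lemma Wt_sub: "Wt (g, v, yy) = Wt (g', v', yy)"
 by (simp add: Wt_def)

text \<open>Under \<open>q\<close> the window of \<open>t\<close> is fresh noise, over which the
  likelihood integrates to one; so \<open>r\<close> may be inserted or removed as long as nothing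
  else sees \<open>t\<close>.\<close>

lemma q_indep_R:
 assumes [measurable]: "F \<in> borel_measurable (N \<Otimes>\<^sub>M sq)"
 shows "(\<integral>\<^sup>+a. ennreal (q a) * (ennreal (r a) * F (G a, y a)) \<partial>PP) = (\<integral>\<^sup>+a. ennreal (q a) * F (G a, y a) \<partial>PP)"
proof -
 have "(\<integral>\<^sup>+a. ennreal (q a) * (ennreal (r a) * F (G a, y a)) \<partial>PP)
  = (\<integral>\<^sup>+a. ennreal (q a) * (\<GG> u. ennreal (R (G a, sub u (t a), y a)) * F (G a, y a)) \<partial>PP)"
  unfolding r_def
  using indep[of "\<lambda>(g, t, y). ennreal (R (g, t, y)) * F (g, y)"] by simp
 also have "\<dots> = (\<integral>\<^sup>+a. ennreal (q a) * F (G a, y a) \<partial>PP)"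
 proof (rule nn_integral_cong)
  fix a assume [simp]: "a \<in> space PP"
  have Ga [simp]: "G a \<in> space N" using measurable_space[OF G] by simp
  have "(\<GG> u. ennreal (R (G a, sub u (t a), y a)) * F (G a, y a))
    = (\<GG> u. ennreal (R (G a, sub u (t a), y a))) * F (G a, y a)"
   by (rule nn_integral_multc) measurable
  then show "ennreal (q a) * (\<GG> u. ennreal (R (G a, sub u (t a), y a)) * F (G a, y a)) = ennreal (q a) * F (G a, y a)"
   by (simp add: int_R)
 qed
 finally show ?thesis .
qed

lemma swap_q:
 assumes [measurable]: "F \<in> borel_measurable PP" and F: "\<And>a. F a \<le> 1"
 shows "(\<integral>\<^sup>+a. ennreal (q a) * F a \<partial>PP) \<le> (\<integral>\<^sup>+a. F a \<partial>PP) + (\<integral>\<^sup>+a. ennreal \<bar>1 - q a\<bar> \<partial>PP)"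
  and "(\<integral>\<^sup>+a. F a \<partial>PP) \<le> (\<integral>\<^sup>+a. ennreal (q a) * F a \<partial>PP) + (\<integral>\<^sup>+a. ennreal \<bar>1 - q a\<bar> \<partial>PP)"
  and "(\<integral>\<^sup>+a. ennreal (q a) * (ennreal (r a) * F a) \<partial>PP) \<le> (\<integral>\<^sup>+a. ennreal (r a) * F a \<partial>PP) + (\<integral>\<^sup>+a. ennreal (r a) * ennreal \<bar>1 - q a\<bar> \<partial>PP)"
  and "(\<integral>\<^sup>+a. ennreal (r a) * F a \<partial>PP) \<le> (\<integral>\<^sup>+a. ennreal (q a) * (ennreal (r a) * F a) \<partial>PP) + (\<integral>\<^sup>+a. ennreal (r a) * ennreal \<bar>1 - q a\<bar> \<partial>PP)"
proof -
 have pw: "ennreal (q a) \<le> 1 + ennreal \<bar>1 - q a\<bar>" "1 \<le> ennreal (q a) + ennreal \<bar>1 - q a\<bar>" for a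
  using q_nonneg[of a]
  by (auto simp flip: ennreal_1 ennreal_plus simp del: ennreal_1 ennreal_plus intro!: ennreal_leI)
 have p1: "ennreal (q a) * F a \<le> F a + ennreal \<bar>1 - q a\<bar>" for a
 proof -
  have "ennreal (q a) * F a \<le> (1 + ennreal \<bar>1 - q a\<bar>) * F a" by (intro mult_right_mono pw) auto
  also have "\<dots> \<le> F a + ennreal \<bar>1 - q a\<bar> * 1"
   using F[of a] by (simp only: distrib_right mult_1) (intro add_mono mult_left_mono, auto)
  finally show ?thesis by simp
 qed
 have p2: "F a \<le> ennreal (q a) * F a + ennreal \<bar>1 - q a\<bar>" for a
 proof -
  have "1 * F a \<le> (ennreal (q a) + ennreal \<bar>1 - q a\<bar>) * F a" by (intro mult_right_mono pw) auto
  also have "\<dots> \<le> ennreal (q a) * F a + ennreal \<bar>1 - q a\<bar> * 1"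
   using F[of a] by (simp only: distrib_right) (intro add_mono mult_left_mono, auto)
  finally show ?thesis by simp
 qed
 show "(\<integral>\<^sup>+a. ennreal (q a) * F a \<partial>PP) \<le> (\<integral>\<^sup>+a. F a \<partial>PP) + (\<integral>\<^sup>+a. ennreal \<bar>1 - q a\<bar> \<partial>PP)"
  by (subst nn_integral_add[symmetric]) (auto intro!: nn_integral_mono p1)
 show "(\<integral>\<^sup>+a. F a \<partial>PP) \<le> (\<integral>\<^sup>+a. ennreal (q a) * F a \<partial>PP) + (\<integral>\<^sup>+a. ennreal \<bar>1 - q a\<bar> \<partial>PP)"
  by (subst nn_integral_add[symmetric]) (auto intro!: nn_integral_mono p2)
 have p3: "ennreal (q a) * (ennreal (r a) * F a) \<le> ennreal (r a) * F a + ennreal (r a) * ennreal \<bar>1 - q a\<bar>" for a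
  using mult_left_mono[OF p1[of a], of "ennreal (r a)"] by (simp add: distrib_left mult_ac)
 have p4: "ennreal (r a) * F a \<le> ennreal (q a) * (ennreal (r a) * F a) + ennreal (r a) * ennreal \<bar>1 - q a\<bar>" for a
  using mult_left_mono[OF p2[of a], of "ennreal (r a)"] by (simp add: distrib_left mult_ac)
 show "(\<integral>\<^sup>+a. ennreal (q a) * (ennreal (r a) * F a) \<partial>PP) \<le> (\<integral>\<^sup>+a. ennreal (r a) * F a \<partial>PP) + (\<integral>\<^sup>+a. ennreal (r a) * ennreal \<bar>1 - q a\<bar> \<partial>PP)"
  by (subst nn_integral_add[symmetric]) (auto intro!: nn_integral_mono p3)
 show "(\<integral>\<^sup>+a. ennreal (r a) * F a \<partial>PP) \<le> (\<integral>\<^sup>+a. ennreal (q a) * (ennreal (r a) * F a) \<partial>PP) + (\<integral>\<^sup>+a. ennreal (r a) * ennreal \<bar>1 - q a\<bar> \<partial>PP)"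
  by (subst nn_integral_add[symmetric]) (auto intro!: nn_integral_mono p4)
qed

end

lemma emeasure_gseq_UNIV [simp]: "emeasure gseq UNIV = 1"
 using prob_space.emeasure_space_1[OF prob_space_gseq] by simp

text \<open>Closeness and moments are stated under the weight \<open>r\<close>, which stands for the
  true loop law: there the divergence and power estimates live. Whiteness is demanded only of the
  single statistic \<open>kW\<close>.\<close>

locale tight_window = window PP N w G t y z e q P Ce eps lam
 for PP :: "'a measure" and N :: "'g measure" and w G t y z e q P Ce eps lam +
 assumes r_prob: "(\<integral>\<^sup>+a. ennreal (r a) \<partial>PP) = 1"
  and close: "(\<integral>\<^sup>+a. ennreal (r a) * ennreal \<bar>1 - q a\<bar> \<partial>PP) \<le> ennreal eps"
  and white: "(\<integral>\<^sup>+a. ennreal (r a) * kW (y a) \<partial>PP) \<le> (\<GG> u. kW (\<lambda>j. sqrt (1 + P) * u j)) + ennreal eps"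
   "(\<GG> u. kW (\<lambda>j. sqrt (1 + P) * u j)) \<le> (\<integral>\<^sup>+a. ennreal (r a) * kW (y a) \<partial>PP) + ennreal eps"
  and e_power: "(\<integral>\<^sup>+a. ennreal (r a) * ennreal (E (G a, t a, y a)) \<partial>PP) \<le> ennreal Ce"
  and z_exp: "(\<integral>\<^sup>+a. ennreal (r a) * ennreal (exp (lam * (\<Sum>j\<in>w. (z a j)\<^sup>2))) \<partial>PP) \<le> ennreal A2"
  and v_power: "(\<integral>\<^sup>+a. ennreal (r a) * ennreal (\<Sum>j\<in>w. (t a j - e (G a) (y a) j)\<^sup>2) \<partial>PP) \<le> ennreal (card w)"
begin

section \<open>Tail estimates under the window law\<close>

lemma markov_nn:
 assumes [measurable]: "f \<in> borel_measurable PP" "m \<in> borel_measurable PP"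
  and "\<And>a. 0 \<le> m a" "\<And>a. 0 \<le> f a" "0 < B" "(\<integral>\<^sup>+a. ennreal (m a) * ennreal (f a) \<partial>PP) \<le> ennreal K" "0 \<le> K"
 shows "(\<integral>\<^sup>+a. ennreal (m a) * indicator {a. B < f a} a \<partial>PP) \<le> ennreal (K / B)"
proof -
 have "(\<integral>\<^sup>+a. ennreal (m a) * indicator {a. B < f a} a \<partial>PP) \<le> (\<integral>\<^sup>+a. (ennreal (m a) * ennreal (f a)) * ennreal (1 / B) \<partial>PP)"
 proof (rule nn_integral_mono)
  fix a
  have "indicator {a. B < f a} a \<le> ennreal (f a) * ennreal (1 / B)"
   using assms(4)[of a] assms(5) by (auto simp: ennreal_mult[symmetric] ennreal_ge_1 split: split_indicator)
  then show "ennreal (m a) * indicator {a. B < f a} a \<le> (ennreal (m a) * ennreal (f a)) * ennreal (1 / B)"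
   by (simp add: mult.assoc mult_left_mono)
 qed
 also have "\<dots> \<le> ennreal K * ennreal (1 / B)"
  by (subst nn_integral_multc) (auto intro!: mult_right_mono assms)
 finally show ?thesis using assms by (simp add: ennreal_mult[symmetric])
qed

text \<open>\<open>E\<close> does not involve \<open>t\<close>, so the weight \<open>r\<close> can
  be inserted for free under \<open>q\<close>; then \<open>q\<close> is exchanged for 1 at the cost
  \<open>eps\<close>, and the energy bound of the loop law applies.\<close>

lemma q_E_tail:
 assumes B: "0 < B"
 shows "(\<integral>\<^sup>+a. ennreal (q a) * indicator {a. B < E (G a, t a, y a)} a \<partial>PP) \<le> ennreal (Ce / B + eps)"
proof -
 define F :: "'g \<times> (nat \<Rightarrow> real) \<Rightarrow> ennreal" where "F = (\<lambda>(g, v). indicator {x. B < E x} (g, \<lambda>_. 0, v))"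
 have [measurable]: "F \<in> borel_measurable (N \<Otimes>\<^sub>M sq)" unfolding F_def by measurable
 have F: "F (G a, y a) = indicator {a. B < E (G a, t a, y a)} a" for a
  unfolding F_def using E_sub[of "G a" "t a" "y a" "\<lambda>_. 0"] by (auto split: split_indicator)
 have "(\<integral>\<^sup>+a. ennreal (q a) * F (G a, y a) \<partial>PP) = (\<integral>\<^sup>+a. ennreal (q a) * (ennreal (r a) * F (G a, y a)) \<partial>PP)"
  by (rule q_indep_R[symmetric]) measurable
 also have "\<dots> \<le> (\<integral>\<^sup>+a. ennreal (r a) * F (G a, y a) \<partial>PP) + (\<integral>\<^sup>+a. ennreal (r a) * ennreal \<bar>1 - q a\<bar> \<partial>PP)"
  by (rule swap_q(3)) (auto simp: F split: split_indicator)
 also have "\<dots> \<le> ennreal (Ce / B) + ennreal eps"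
  unfolding F using param B
  by (intro add_mono close markov_nn e_power) (auto simp: E_nonneg r_pos less_imp_le)
 finally show ?thesis unfolding F using param B by simp
qed

text \<open>The outcome of \<open>unweight_L1\<close> with threshold \<open>C1\<close>; the
  logarithmic terms bound the \<open>q\<close>-mass of \<open>r < 1 / C1\<close>.\<close>

definition e1 :: "real \<Rightarrow> real" where
 "e1 C1 = 2 * C1 * eps + 2 * (card w / ln C1 + (2 * Ce / ln C1 + eps))"

text \<open>A likelihood below \<open>1 / C1\<close> forces a large energy of \<open>t\<close> or of
  the feedback, because \<open>e * t - e\<^sup>2 / 2 \<ge> - t\<^sup>2 / 2 - e\<^sup>2\<close>.
  Under \<open>q\<close> the first is the energy of fresh noise and the second is covered by
  \<open>q_E_tail\<close>.\<close>

lemma L1_close: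
 assumes C1: "1 < C1"
 shows "(\<integral>\<^sup>+a. ennreal \<bar>1 - q a\<bar> \<partial>PP) \<le> ennreal (e1 C1)"
proof -
 interpret S: prob_space gseq by (rule prob_space_gseq)
 define L where "L = ln C1"
 have L: "0 < L" using C1 by (simp add: L_def)
 have pw: "indicator {a. r a < 1 / C1} a
   \<le> (indicator {a. L < (\<Sum>j\<in>w. (t a j)\<^sup>2)} a + indicator {a. L / 2 < E (G a, t a, y a)} a :: ennreal)" for a
 proof (cases "r a < 1 / C1")
  case True
  have "r a = exp (\<Sum>j\<in>w. e (G a) (y a) j * t a j - (e (G a) (y a) j)\<^sup>2 / 2)"
   using w by (simp add: r_def R_def gl_def exp_sum)
  moreover have "1 / C1 = exp (- L)" using C1 by (simp add: L_def exp_minus field_simps)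
  ultimately have "(\<Sum>j\<in>w. e (G a) (y a) j * t a j - (e (G a) (y a) j)\<^sup>2 / 2) < - L"
   using True by simp
  moreover have "(\<Sum>j\<in>w. - (t a j)\<^sup>2 / 2 - (e (G a) (y a) j)\<^sup>2) \<le> (\<Sum>j\<in>w. e (G a) (y a) j * t a j - (e (G a) (y a) j)\<^sup>2 / 2)"
  proof (rule sum_mono)
   fix j
   show "- (t a j)\<^sup>2 / 2 - (e (G a) (y a) j)\<^sup>2 \<le> e (G a) (y a) j * t a j - (e (G a) (y a) j)\<^sup>2 / 2"
    using zero_le_power2[of "e (G a) (y a) j + t a j"] by (simp add: power2_sum field_simps)
  qed
  ultimately have "L < (\<Sum>j\<in>w. (t a j)\<^sup>2) / 2 + E (G a, t a, y a)"
   by (simp add: E_def sum_subtractf sum_negf sum_divide_distrib)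
  then have "L < (\<Sum>j\<in>w. (t a j)\<^sup>2) \<or> L / 2 < E (G a, t a, y a)" by argo
  then show ?thesis by (auto split: split_indicator)
 qed simp
 have m1: "(\<GG> u. indicator {u. L < (\<Sum>j\<in>w. (u j)\<^sup>2)} u) \<le> ennreal (card w / L)"
 proof -
  have "(\<GG> u. indicator {u. L < (\<Sum>j\<in>w. (u j)\<^sup>2)} u) \<le> (\<GG> u. ennreal (\<Sum>j\<in>w. (u j)\<^sup>2) * ennreal (1 / L))"
   using L by (intro nn_integral_mono)
    (auto simp: ennreal_mult[symmetric] ennreal_ge_1 sum_nonneg split: split_indicator)
  also have "\<dots> = ennreal (card w / L)"
   using L by (subst nn_integral_multc) (auto simp: nn_integral_gseq_sum_sq[OF w] ennreal_mult[symmetric])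
  finally show ?thesis .
 qed
 have "(\<integral>\<^sup>+a. ennreal (q a) * indicator {a. L < (\<Sum>j\<in>w. (t a j)\<^sup>2)} a \<partial>PP)
   = (\<integral>\<^sup>+a. ennreal (q a) * (\<GG> u. indicator {u. L < (\<Sum>j\<in>w. (u j)\<^sup>2)} u) \<partial>PP)"
 proof -
  have eq: "(\<Sum>j\<in>w. (sub u v j)\<^sup>2) = (\<Sum>j\<in>w. (u j)\<^sup>2)" for u v by (intro sum.cong) auto
  show ?thesis
   using indep[of "\<lambda>(g, t, y). indicator {u. L < (\<Sum>j\<in>w. (u j)\<^sup>2)} t"]
   by (simp add: indicator_def eq)
 qed
 also have "\<dots> \<le> (\<integral>\<^sup>+a. ennreal (q a) * ennreal (card w / L) \<partial>PP)"
  by (intro nn_integral_mono mult_left_mono m1) auto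
 also have "\<dots> = ennreal (card w / L)" by (simp add: nn_integral_multc q_prob)
 finally have b1: "(\<integral>\<^sup>+a. ennreal (q a) * indicator {a. L < (\<Sum>j\<in>w. (t a j)\<^sup>2)} a \<partial>PP) \<le> ennreal (card w / L)" .
 have "(\<integral>\<^sup>+a. ennreal (q a) * indicator {a. r a < 1 / C1} a \<partial>PP)
   \<le> (\<integral>\<^sup>+a. ennreal (q a) * indicator {a. L < (\<Sum>j\<in>w. (t a j)\<^sup>2)} a + ennreal (q a) * indicator {a. L / 2 < E (G a, t a, y a)} a \<partial>PP)"
  by (intro nn_integral_mono) (simp only: distrib_left[symmetric], intro mult_left_mono pw, simp)
 also have "\<dots> = (\<integral>\<^sup>+a. ennreal (q a) * indicator {a. L < (\<Sum>j\<in>w. (t a j)\<^sup>2)} a \<partial>PP)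
   + (\<integral>\<^sup>+a. ennreal (q a) * indicator {a. L / 2 < E (G a, t a, y a)} a \<partial>PP)"
  by (rule nn_integral_add) measurable
 also have "\<dots> \<le> ennreal (card w / L) + ennreal (Ce / (L / 2) + eps)"
  using L by (intro add_mono b1 q_E_tail) auto
 finally have b: "(\<integral>\<^sup>+a. ennreal (q a) * indicator {a. r a < 1 / C1} a \<partial>PP) \<le> ennreal (card w / L + (2 * Ce / L + eps))"
  using L param by (simp add: ennreal_plus[symmetric] mult.commute del: ennreal_plus)
 have "(\<integral>\<^sup>+a. ennreal \<bar>1 - q a\<bar> \<partial>PP)
  \<le> 2 * (ennreal C1 * (\<integral>\<^sup>+a. ennreal (r a) * ennreal \<bar>1 - q a\<bar> \<partial>PP))
   + 2 * (\<integral>\<^sup>+a. ennreal (q a) * indicator {a. r a < 1 / C1} a \<partial>PP)"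
  using C1 by (intro unweight_L1) (auto simp: q_nonneg q_prob r_pos)
 also have "\<dots> \<le> 2 * (ennreal C1 * ennreal eps) + 2 * ennreal (card w / L + (2 * Ce / L + eps))"
  by (intro add_mono mult_left_mono close b) auto
 also have "\<dots> = ennreal (2 * C1 * eps + 2 * (card w / L + (2 * Ce / L + eps)))"
 proof -
  have two: "2 * ennreal x = ennreal (2 * x)" if "0 \<le> x" for x
   using that by (simp add: ennreal_mult)
  have "0 \<le> card w / L + (2 * Ce / L + eps)" using L param by auto
  then show ?thesis using C1 param by (simp add: two ennreal_mult[symmetric] ennreal_plus[symmetric] mult.assoc del: ennreal_plus)
 qed
 finally show ?thesis by (simp add: e1_def L_def)
qed

lemma e1_nonneg: "1 < C1 \<Longrightarrow> 0 \<le> e1 C1"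
 using param by (auto simp: e1_def intro!: add_nonneg_nonneg mult_nonneg_nonneg)

lemma sg_pos: "0 < sg"
 using param by (simp add: sg_def)

lemma A2_pos: "0 < A2"
 using param by (simp add: A2_def)

text \<open>Stands in for Cauchy-Schwarz: a square root is split into a small multiple of the
  variable and a constant, with \<open>k\<close> to be chosen later.\<close>

lemma young: "0 < k \<Longrightarrow> exp (u / 2) \<le> k * exp u + 1 / k" for k u :: real
proof -
 assume k: "0 < k"
 define x where "x = exp (u / 2)"
 have x: "0 < x" "x * x = exp u" by (simp_all add: x_def exp_add[symmetric])
 have "2 * (k * x) \<le> (k * x)\<^sup>2 + 1" using sum_squares_bound[of "k * x" 1] by (simp add: mult.assoc)
 moreover have "k * x \<le> 2 * (k * x)" using k x by simp
 ultimately have "k * x \<le> (k * x)\<^sup>2 + 1" by linarith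
 then have "k * x \<le> k * (k * exp u + 1 / k)" using k x(2) by (simp add: power2_eq_square algebra_simps)
 then show ?thesis using k by (simp add: x_def)
qed

text \<open>Makes the exponential weight of \<open>z\<close> small on an unlikely event
  \<open>B\<close>: \<open>k\<close> is taken small first, then the mass of \<open>B\<close> small
  compared with \<open>k\<close>.\<close>

lemma exp_young_nn:
 assumes [measurable]: "m \<in> borel_measurable PP" and m: "\<And>a. 0 \<le> m a"
  and B [measurable]: "Measurable.pred PP B" and k: "0 < k"
  and bound: "(\<integral>\<^sup>+a. ennreal (m a) * ennreal (exp (lam * (\<Sum>j\<in>w. (z a j)\<^sup>2))) \<partial>PP) \<le> ennreal A2"
 shows "(\<integral>\<^sup>+a. ennreal (m a) * (indicator {a. B a} a * ennreal (exp (lam * (\<Sum>j\<in>w. (z a j)\<^sup>2) / 2))) \<partial>PP)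
  \<le> ennreal (k * A2) + ennreal (1 / k) * (\<integral>\<^sup>+a. ennreal (m a) * indicator {a. B a} a \<partial>PP)"
proof -
 have "(\<integral>\<^sup>+a. ennreal (m a) * (indicator {a. B a} a * ennreal (exp (lam * (\<Sum>j\<in>w. (z a j)\<^sup>2) / 2))) \<partial>PP)
  \<le> (\<integral>\<^sup>+a. ennreal k * (ennreal (m a) * ennreal (exp (lam * (\<Sum>j\<in>w. (z a j)\<^sup>2)))) + ennreal (1 / k) * (ennreal (m a) * indicator {a. B a} a) \<partial>PP)"
 proof (rule nn_integral_mono)
  fix a
  let ?x = "exp (lam * (\<Sum>j\<in>w. (z a j)\<^sup>2))"
  have "ennreal (exp (lam * (\<Sum>j\<in>w. (z a j)\<^sup>2) / 2)) \<le> ennreal k * ennreal ?x + ennreal (1 / k)"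
   using k young[OF k, of "lam * (\<Sum>j\<in>w. (z a j)\<^sup>2)"]
   by (simp add: ennreal_mult[symmetric] ennreal_plus[symmetric] ennreal_leI del: ennreal_plus)
  then have *: "indicator {a. B a} a * ennreal (exp (lam * (\<Sum>j\<in>w. (z a j)\<^sup>2) / 2)) \<le> ennreal k * ennreal ?x + ennreal (1 / k) * indicator {a. B a} a"
   by (auto split: split_indicator)
  then show "ennreal (m a) * (indicator {a. B a} a * ennreal (exp (lam * (\<Sum>j\<in>w. (z a j)\<^sup>2) / 2)))
   \<le> ennreal k * (ennreal (m a) * ennreal ?x) + ennreal (1 / k) * (ennreal (m a) * indicator {a. B a} a)"
   using mult_left_mono[OF *, of "ennreal (m a)"]
   by (simp add: distrib_left mult_ac)
 qed
 also have "\<dots> = ennreal k * (\<integral>\<^sup>+a. ennreal (m a) * ennreal (exp (lam * (\<Sum>j\<in>w. (z a j)\<^sup>2))) \<partial>PP)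
   + ennreal (1 / k) * (\<integral>\<^sup>+a. ennreal (m a) * indicator {a. B a} a \<partial>PP)"
  by (subst nn_integral_add) (auto simp: nn_integral_cmult)
 also have "\<dots> \<le> ennreal k * ennreal A2 + ennreal (1 / k) * (\<integral>\<^sup>+a. ennreal (m a) * indicator {a. B a} a \<partial>PP)"
  by (intro add_mono mult_left_mono bound) auto
 finally show ?thesis using k A2_pos by (simp add: ennreal_mult)
qed

lemma smooth_lam:
 assumes "F \<in> borel_measurable (N \<Otimes>\<^sub>M sq \<Otimes>\<^sub>M sq)"
 shows "ennreal sg * (\<integral>\<^sup>+a. (\<GG> g. F (G a, t a, sh g a)) \<partial>PP)
  = (\<integral>\<^sup>+a. F (G a, t a, y a) * ennreal (exp (lam * (\<Sum>j\<in>w. (z a j)\<^sup>2) / 2)) \<partial>PP)"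
 using smooth[of F lam] assms param by (simp add: sg_def)

lemma nn_half:
 assumes "0 \<le> p" "0 \<le> s" "0 \<le> b" "0 \<le> (h :: real)"
 shows "ennreal p * ennreal (h * s + b) = ennreal h * (ennreal p * ennreal s) + ennreal p * ennreal b"
 using assms by (simp add: ennreal_mult[symmetric] ennreal_plus[symmetric] algebra_simps del: ennreal_plus)

text \<open>Under the loop law \<open>t - e\<close> is pure noise, and
  \<open>e * t - e\<^sup>2 / 2 \<le> (t - e)\<^sup>2 / 2 + e\<^sup>2\<close>. So \<open>ln r\<close>
  is dominated by a variable of bounded mean, and Markov's inequality gives decay like
  \<open>1 / ln C\<close>.\<close>

lemma r_tail:
 assumes C: "1 < C"
 shows "(\<integral>\<^sup>+a. ennreal (r a) * indicator {a. C < r a} a \<partial>PP) \<le> ennreal ((card w / 2 + Ce) / ln C)"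
proof -
 have L: "0 < ln C" using C by simp
 have pw: "indicator {a. C < r a} a \<le> (indicator {a. ln C < (\<Sum>j\<in>w. (t a j - e (G a) (y a) j)\<^sup>2) / 2 + E (G a, t a, y a)} a :: ennreal)" for a
 proof (cases "C < r a")
  case True
  have "r a = exp (\<Sum>j\<in>w. e (G a) (y a) j * t a j - (e (G a) (y a) j)\<^sup>2 / 2)"
   using w by (simp add: r_def R_def gl_def exp_sum)
  then have "ln C < (\<Sum>j\<in>w. e (G a) (y a) j * t a j - (e (G a) (y a) j)\<^sup>2 / 2)"
   using True C ln_less_cancel_iff[of C "r a"] by simp
  also have "\<dots> \<le> (\<Sum>j\<in>w. (t a j - e (G a) (y a) j)\<^sup>2 / 2 + (e (G a) (y a) j)\<^sup>2)"
  proof (rule sum_mono)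
   fix j
   show "e (G a) (y a) j * t a j - (e (G a) (y a) j)\<^sup>2 / 2 \<le> (t a j - e (G a) (y a) j)\<^sup>2 / 2 + (e (G a) (y a) j)\<^sup>2"
    using zero_le_power2[of "2 * e (G a) (y a) j - t a j"] by (simp add: power2_diff power2_eq_square field_simps)
  qed
  finally show ?thesis using True by (simp add: E_def sum.distrib sum_divide_distrib)
 qed simp
 have "(\<integral>\<^sup>+a. ennreal (r a) * indicator {a. C < r a} a \<partial>PP)
   \<le> (\<integral>\<^sup>+a. ennreal (r a) * indicator {a. ln C < (\<Sum>j\<in>w. (t a j - e (G a) (y a) j)\<^sup>2) / 2 + E (G a, t a, y a)} a \<partial>PP)"
  by (intro nn_integral_mono mult_left_mono pw) auto
 also have "\<dots> \<le> ennreal ((card w / 2 + Ce) / ln C)"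
 proof (rule markov_nn)
  have "(\<integral>\<^sup>+a. ennreal (r a) * ennreal ((\<Sum>j\<in>w. (t a j - e (G a) (y a) j)\<^sup>2) / 2 + E (G a, t a, y a)) \<partial>PP)
    = (\<integral>\<^sup>+a. ennreal (1 / 2) * (ennreal (r a) * ennreal (\<Sum>j\<in>w. (t a j - e (G a) (y a) j)\<^sup>2)) + ennreal (r a) * ennreal (E (G a, t a, y a)) \<partial>PP)"
  proof (rule nn_integral_cong)
   fix a
   have "0 \<le> (\<Sum>j\<in>w. (t a j - e (G a) (y a) j)\<^sup>2)" by (rule sum_nonneg) simp
   then show "ennreal (r a) * ennreal ((\<Sum>j\<in>w. (t a j - e (G a) (y a) j)\<^sup>2) / 2 + E (G a, t a, y a))
    = ennreal (1 / 2) * (ennreal (r a) * ennreal (\<Sum>j\<in>w. (t a j - e (G a) (y a) j)\<^sup>2)) + ennreal (r a) * ennreal (E (G a, t a, y a))"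
    using nn_half[of "r a" "\<Sum>j\<in>w. (t a j - e (G a) (y a) j)\<^sup>2" "E (G a, t a, y a)" "1 / 2"] r_pos[of a] E_nonneg[of "(G a, t a, y a)"]
    by (simp del: ennreal_plus ennreal_half)
  qed
  also have "\<dots> = ennreal (1 / 2) * (\<integral>\<^sup>+a. ennreal (r a) * ennreal (\<Sum>j\<in>w. (t a j - e (G a) (y a) j)\<^sup>2) \<partial>PP)
    + (\<integral>\<^sup>+a. ennreal (r a) * ennreal (E (G a, t a, y a)) \<partial>PP)"
   by (subst nn_integral_add) (auto simp: nn_integral_cmult)
  also have "\<dots> \<le> ennreal (1 / 2) * ennreal (card w) + ennreal Ce"
   by (intro add_mono mult_left_mono v_power e_power) auto
  also have "\<dots> = ennreal (card w / 2 + Ce)"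
   using param nn_half[of 1 "real (card w)" Ce "1 / 2"] by (simp del: ennreal_plus ennreal_half)
  finally show "(\<integral>\<^sup>+a. ennreal (r a) * ennreal ((\<Sum>j\<in>w. (t a j - e (G a) (y a) j)\<^sup>2) / 2 + E (G a, t a, y a)) \<partial>PP)
    \<le> ennreal (card w / 2 + Ce)" .
 qed (use L param in \<open>auto simp: r_pos less_imp_le E_nonneg intro!: add_nonneg_nonneg sum_nonneg\<close>)
 finally show ?thesis .
qed

text \<open>Smoothing is undone to return from the perturbed \<open>y\<close> to the loop law, where
  \<open>r_tail\<close> applies; the exponential weight in \<open>z\<close> that reappears is
  absorbed by \<open>exp_young_nn\<close>.\<close>

lemma big_R_tail:
 assumes C: "1 < C" and k: "0 < k"
 shows "ennreal sg * (\<integral>\<^sup>+a. (\<GG> g. ennreal (R (G a, t a, sh g a) * Wt (G a, t a, sh g a)) * indicator {x. C < R x} (G a, t a, sh g a)) \<partial>PP)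
  \<le> ennreal (k * A2 + (card w / 2 + Ce) / (k * ln C))"
proof -
 have L: "0 < ln C" using C by simp
 have "ennreal sg * (\<integral>\<^sup>+a. (\<GG> g. ennreal (R (G a, t a, sh g a) * Wt (G a, t a, sh g a)) * indicator {x. C < R x} (G a, t a, sh g a)) \<partial>PP)
  = (\<integral>\<^sup>+a. (ennreal (R (G a, t a, y a) * Wt (G a, t a, y a)) * indicator {x. C < R x} (G a, t a, y a)) * ennreal (exp (lam * (\<Sum>j\<in>w. (z a j)\<^sup>2) / 2)) \<partial>PP)"
  by (rule smooth_lam[of "\<lambda>x. ennreal (R x * Wt x) * indicator {x. C < R x} x"]) measurable
 also have "\<dots> \<le> (\<integral>\<^sup>+a. ennreal (r a) * (indicator {a. C < r a} a * ennreal (exp (lam * (\<Sum>j\<in>w. (z a j)\<^sup>2) / 2))) \<partial>PP)"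
 proof (rule nn_integral_mono)
  fix a
  have "R (G a, t a, y a) * Wt (G a, t a, y a) \<le> r a * 1"
   unfolding r_def using R_pos Wt_le by (intro mult_left_mono) (auto simp: less_imp_le)
  then show "(ennreal (R (G a, t a, y a) * Wt (G a, t a, y a)) * indicator {x. C < R x} (G a, t a, y a)) * ennreal (exp (lam * (\<Sum>j\<in>w. (z a j)\<^sup>2) / 2))
   \<le> ennreal (r a) * (indicator {a. C < r a} a * ennreal (exp (lam * (\<Sum>j\<in>w. (z a j)\<^sup>2) / 2)))"
   by (auto simp: r_def intro!: mult_right_mono ennreal_leI split: split_indicator)
 qed
 also have "\<dots> \<le> ennreal (k * A2) + ennreal (1 / k) * (\<integral>\<^sup>+a. ennreal (r a) * indicator {a. C < r a} a \<partial>PP)"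
  using r_pos z_exp k by (intro exp_young_nn) (auto simp: less_imp_le)
 also have "\<dots> \<le> ennreal (k * A2) + ennreal (1 / k) * ennreal ((card w / 2 + Ce) / ln C)"
  by (intro add_mono mult_left_mono r_tail C) auto
 also have "\<dots> = ennreal (k * A2 + 1 / k * ((card w / 2 + Ce) / ln C))"
 proof -
  define x where "x = (card w / 2 + Ce) / ln C"
  have "0 \<le> x" using L param by (simp add: x_def)
  then show ?thesis
   unfolding x_def[symmetric] using k A2_pos
   by (simp add: ennreal_mult[symmetric] ennreal_plus[symmetric] del: ennreal_plus)
 qed
 also have "k * A2 + 1 / k * ((card w / 2 + Ce) / ln C) = k * A2 + (card w / 2 + Ce) / (k * ln C)"
  by simp
 finally show ?thesis .
qed

text \<open>Undoing the smoothing leaves \<open>PP\<close> without the weight \<open>r\<close>. The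
  event is then moved to \<open>q\<close>, at the cost of the unweighted L1 distance, where
  \<open>q_E_tail\<close> bounds it.\<close>

lemma big_E_tail:
 assumes C1: "1 < C1" and k: "0 < k" and B: "0 < B"
 shows "ennreal sg * (\<integral>\<^sup>+a. (\<GG> g. indicator {x. B < E x} (G a, t a, sh g a)) \<partial>PP)
  \<le> ennreal (k * A2 + (e1 C1 + (Ce / B + eps)) / k)"
proof -
 have "ennreal sg * (\<integral>\<^sup>+a. (\<GG> g. indicator {x. B < E x} (G a, t a, sh g a)) \<partial>PP)
  = (\<integral>\<^sup>+a. indicator {x. B < E x} (G a, t a, y a) * ennreal (exp (lam * (\<Sum>j\<in>w. (z a j)\<^sup>2) / 2)) \<partial>PP)"
  by (rule smooth_lam[of "\<lambda>x. indicator {x. B < E x} x"]) measurable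
 also have "\<dots> = (\<integral>\<^sup>+a. ennreal 1 * (indicator {a. B < E (G a, t a, y a)} a * ennreal (exp (lam * (\<Sum>j\<in>w. (z a j)\<^sup>2) / 2))) \<partial>PP)"
  by (intro nn_integral_cong) (auto split: split_indicator)
 also have "\<dots> \<le> ennreal (k * A2) + ennreal (1 / k) * (\<integral>\<^sup>+a. ennreal 1 * indicator {a. B < E (G a, t a, y a)} a \<partial>PP)"
 proof (rule exp_young_nn)
  interpret S: prob_space gseq by (rule prob_space_gseq)
  have "(\<integral>\<^sup>+a. ennreal 1 * ennreal (exp (lam * (\<Sum>j\<in>w. (z a j)\<^sup>2))) \<partial>PP)
   = (\<integral>\<^sup>+a. 1 * ennreal (exp (2 * lam * (\<Sum>j\<in>w. (z a j)\<^sup>2) / 2)) \<partial>PP)"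
   by simp
  also have "\<dots> = ennreal A2"
   using param S.emeasure_space_1 by (subst smooth[where F="\<lambda>_. 1"]) (auto simp: A2_def emeasure_space_1)
  finally show "(\<integral>\<^sup>+a. ennreal 1 * ennreal (exp (lam * (\<Sum>j\<in>w. (z a j)\<^sup>2))) \<partial>PP) \<le> ennreal A2" by simp
 qed (auto simp: k)
 also have "(\<integral>\<^sup>+a. ennreal 1 * indicator {a. B < E (G a, t a, y a)} a \<partial>PP) \<le> ennreal (Ce / B + eps) + ennreal (e1 C1)"
 proof -
  have "(\<integral>\<^sup>+a. indicator {a. B < E (G a, t a, y a)} a \<partial>PP)
   \<le> (\<integral>\<^sup>+a. ennreal (q a) * indicator {a. B < E (G a, t a, y a)} a \<partial>PP) + (\<integral>\<^sup>+a. ennreal \<bar>1 - q a\<bar> \<partial>PP)"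
   by (rule swap_q(2)) (auto split: split_indicator)
  also have "\<dots> \<le> ennreal (Ce / B + eps) + ennreal (e1 C1)"
   by (intro add_mono q_E_tail L1_close B C1)
  finally show ?thesis by simp
 qed
 also have "ennreal (k * A2) + ennreal (1 / k) * (ennreal (Ce / B + eps) + ennreal (e1 C1)) = ennreal (k * A2 + 1 / k * ((Ce / B + eps) + e1 C1))"
  using k B A2_pos param e1_nonneg[OF C1]
  by (simp add: ennreal_mult[symmetric] ennreal_plus[symmetric] del: ennreal_plus)
 also have "k * A2 + 1 / k * ((Ce / B + eps) + e1 C1) = k * A2 + (e1 C1 + (Ce / B + eps)) / k"
  by (simp add: add.commute)
 finally show ?thesis by (simp add: mult_left_mono)
qed

text \<open>The counterpart of \<open>psi / sg\<close> when \<open>q\<close> replaces 1 in the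
  smoothed transform (see \<open>b0_eq\<close>).\<close>

definition b0 :: ennreal where
 "b0 = (\<integral>\<^sup>+a. ennreal (q a) * kW (y a) \<partial>PP)"

text \<open>The Laplace transform of the window energy under the loop law, the quantity to be
  computed.\<close>

definition psi :: ennreal where
 "psi = (\<integral>\<^sup>+a. ennreal (r a) * ennreal (exp (- lam * Q a)) \<partial>PP)"

text \<open>The value of that transform for an exactly white \<open>y\<close>.\<close>

definition chi :: real where
 "chi = (1 / sqrt (1 - lam\<^sup>2 * (P / (1 + P)))) ^ card w"

lemma chi_eq: "ennreal chi = ennreal sg * (\<GG> u. kW (\<lambda>j. sqrt (1 + P) * u j))"
 unfolding kW_def chi_def sg_def using nn_integral_window_value[OF w, of lam P] param by simp

text \<open>The weight \<open>r\<close> is inserted for free under \<open>q\<close>. Exchanging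
  \<open>q\<close> for 1 costs \<open>eps\<close>, and comparing with white \<open>y\<close> costs
  another \<open>eps\<close>.\<close>

lemma b0_le: "b0 \<le> (\<GG> u. kW (\<lambda>j. sqrt (1 + P) * u j)) + ennreal (2 * eps)"
 and b0_ge: "(\<GG> u. kW (\<lambda>j. sqrt (1 + P) * u j)) \<le> b0 + ennreal (2 * eps)"
proof -
 have b0: "b0 = (\<integral>\<^sup>+a. ennreal (q a) * (ennreal (r a) * kW (y a)) \<partial>PP)"
  unfolding b0_def using q_indep_R[of "\<lambda>(g, v). kW v"] by simp
 have [simp]: "ennreal eps + ennreal eps = ennreal (2 * eps)"
  using param by (simp add: ennreal_plus[symmetric] del: ennreal_plus)
 have "b0 \<le> (\<integral>\<^sup>+a. ennreal (r a) * kW (y a) \<partial>PP) + ennreal eps"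
  unfolding b0 using swap_q(3)[of "\<lambda>a. kW (y a)"] kW_le close
  by (auto intro: order_trans add_left_mono)
 also have "\<dots> \<le> ((\<GG> u. kW (\<lambda>j. sqrt (1 + P) * u j)) + ennreal eps) + ennreal eps"
  by (intro add_mono white) auto
 finally show "b0 \<le> (\<GG> u. kW (\<lambda>j. sqrt (1 + P) * u j)) + ennreal (2 * eps)"
  by (simp add: add.assoc)
 have "(\<GG> u. kW (\<lambda>j. sqrt (1 + P) * u j)) \<le> (\<integral>\<^sup>+a. ennreal (r a) * kW (y a) \<partial>PP) + ennreal eps"
  by (rule white)
 also have "(\<integral>\<^sup>+a. ennreal (r a) * kW (y a) \<partial>PP) \<le> b0 + ennreal eps"
  unfolding b0 using swap_q(4)[of "\<lambda>a. kW (y a)"] kW_le close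
  by (auto intro: order_trans add_left_mono)
 finally show "(\<GG> u. kW (\<lambda>j. sqrt (1 + P) * u j)) \<le> b0 + ennreal (2 * eps)"
  by (simp add: add.assoc)
qed

lemma psi_eq: "psi = ennreal sg * (\<integral>\<^sup>+a. (\<GG> g. ennreal (R (G a, t a, sh g a) * Wt (G a, t a, sh g a))) \<partial>PP)"
proof -
 have "psi = (\<integral>\<^sup>+a. ennreal (R (G a, t a, y a) * Wt (G a, t a, y a)) * ennreal (exp (lam * (\<Sum>j\<in>w. (z a j)\<^sup>2) / 2)) \<partial>PP)"
  unfolding psi_def
 proof (rule nn_integral_cong)
  fix a
  have "- lam * Q a = - (lam / (2 * (1 + P))) * (\<Sum>j\<in>w. (y a j)\<^sup>2) + lam * (\<Sum>j\<in>w. (z a j)\<^sup>2) / 2"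
  proof -
   have "Q a = ((\<Sum>j\<in>w. (y a j)\<^sup>2) / (1 + P) - (\<Sum>j\<in>w. (z a j)\<^sup>2)) / 2"
    by (simp add: Q_def sum_subtractf sum_divide_distrib)
   then show ?thesis by (simp add: diff_divide_distrib right_diff_distrib)
  qed
  then have "exp (- lam * Q a) = Wt (G a, t a, y a) * exp (lam * (\<Sum>j\<in>w. (z a j)\<^sup>2) / 2)"
   by (simp only: Wt_def exp_add prod.case)
  then show "ennreal (r a) * ennreal (exp (- lam * Q a)) = ennreal (R (G a, t a, y a) * Wt (G a, t a, y a)) * ennreal (exp (lam * (\<Sum>j\<in>w. (z a j)\<^sup>2) / 2))"
   using R_pos[of "(G a, t a, y a)"] Wt_pos[of "(G a, t a, y a)"]
   by (simp add: r_def ennreal_mult less_imp_le mult.assoc)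
 qed
 also have "\<dots> = ennreal sg * (\<integral>\<^sup>+a. (\<GG> g. ennreal (R (G a, t a, sh g a) * Wt (G a, t a, sh g a))) \<partial>PP)"
  by (rule smooth_lam[symmetric, of "\<lambda>x. ennreal (R x * Wt x)"]) measurable
 finally show ?thesis .
qed

text \<open>The central cancellation. Under \<open>q\<close> the window of \<open>t\<close> is
  fresh, so \<open>R\<close> integrates to one over it even at the perturbed \<open>y\<close>; only
  \<open>Wt\<close> averaged over the perturbation survives.\<close>

lemma b0_eq: "b0 = (\<integral>\<^sup>+a. (\<GG> g. ennreal (q a) * ennreal (R (G a, t a, sh g a) * Wt (G a, t a, sh g a))) \<partial>PP)"
proof -
 define F :: "'g \<times> (nat \<Rightarrow> real) \<times> (nat \<Rightarrow> real) \<Rightarrow> ennreal" where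
  "F = (\<lambda>(g, u, v). (\<GG> h. ennreal (R (g, u, shiftw w (\<lambda>i. sqrt (lam / (1 - lam)) * h i) v) * Wt (g, u, shiftw w (\<lambda>i. sqrt (lam / (1 - lam)) * h i) v))))"
 have [measurable]: "F \<in> borel_measurable (N \<Otimes>\<^sub>M sq \<Otimes>\<^sub>M sq)" unfolding F_def by measurable
 have "(\<integral>\<^sup>+a. (\<GG> g. ennreal (q a) * ennreal (R (G a, t a, sh g a) * Wt (G a, t a, sh g a))) \<partial>PP)
   = (\<integral>\<^sup>+a. ennreal (q a) * F (G a, t a, y a) \<partial>PP)"
 proof (rule nn_integral_cong)
  fix a assume "a \<in> space PP"
  then have [simp]: "G a \<in> space N" using measurable_space[OF G] by simp
  show "(\<GG> g. ennreal (q a) * ennreal (R (G a, t a, sh g a) * Wt (G a, t a, sh g a))) = ennreal (q a) * F (G a, t a, y a)"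
   unfolding F_def prod.case by (rule nn_integral_cmult) measurable
 qed
 also have "\<dots> = (\<integral>\<^sup>+a. ennreal (q a) * (\<GG> u. F (G a, sub u (t a), y a)) \<partial>PP)"
  by (rule indep) measurable
 also have "\<dots> = b0"
  unfolding b0_def
 proof (rule nn_integral_cong)
  fix a assume "a \<in> space PP"
  then have [simp]: "G a \<in> space N" using measurable_space[OF G] by simp
  have "(\<GG> u. F (G a, sub u (t a), y a))
   = (\<GG> h. \<GG> u. ennreal (R (G a, sub u (t a), sh h a) * Wt (G a, sub u (t a), sh h a)))"
   unfolding F_def prod.case by (rule nn_integral_swap_gseq) measurable
  also have "\<dots> = (\<GG> h. \<GG> u. ennreal (R (G a, sub u (t a), sh h a)) * ennreal (Wt (G a, t a, sh h a)))"
   by (rule nn_integral_cong, rule nn_integral_cong, subst Wt_sub[of _ _ _ "G a" "t a"]) (auto simp: ennreal_mult R_pos Wt_pos less_imp_le)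
  also have "\<dots> = (\<GG> h. ennreal (Wt (G a, t a, sh h a)))"
   by (rule nn_integral_cong, subst nn_integral_multc) (measurable, simp add: int_R)
  also have "\<dots> = kW (y a)"
   unfolding kW_def Wt_def prod.case
   by (rule nn_integral_cong, intro arg_cong[where f=ennreal] arg_cong[where f=exp] arg_cong2[where f="(*)"] sum.cong refl)
    (auto simp: shiftw_def)
  finally show "ennreal (q a) * (\<GG> u. F (G a, sub u (t a), y a)) = ennreal (q a) * kW (y a)" by simp
 qed
 finally show ?thesis by simp
qed

section \<open>Two-sided comparison of the Laplace transforms\<close>

lemma gseq_const: "(\<GG> g. c) = (c :: ennreal)"
proof -
 interpret S: prob_space gseq by (rule prob_space_gseq)
 show ?thesis using S.emeasure_space_1 by simp
qed

lemma nn_integral_gseq_add3: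
 assumes [measurable]: "(\<lambda>(a, g). F a g) \<in> borel_measurable (PP \<Otimes>\<^sub>M sq)" "(\<lambda>(a, g). H a g) \<in> borel_measurable (PP \<Otimes>\<^sub>M sq)"
  "c \<in> borel_measurable PP"
 shows "(\<integral>\<^sup>+a. (\<GG> g. (F a g + c a) + H a g) \<partial>PP)
  = ((\<integral>\<^sup>+a. (\<GG> g. F a g) \<partial>PP) + (\<integral>\<^sup>+a. c a \<partial>PP)) + (\<integral>\<^sup>+a. (\<GG> g. H a g) \<partial>PP :: ennreal)"
proof -
 have "(\<integral>\<^sup>+a. (\<GG> g. (F a g + c a) + H a g) \<partial>PP)
   = (\<integral>\<^sup>+a. ((\<GG> g. F a g) + c a) + (\<GG> g. H a g) \<partial>PP)"
 proof (rule nn_integral_cong)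
  fix a assume a: "a \<in> space PP"
  have [measurable]: "F a \<in> borel_measurable sq" "H a \<in> borel_measurable sq"
   using measurable_compose[OF measurable_Pair1'[OF a] assms(1)] measurable_compose[OF measurable_Pair1'[OF a] assms(2)] by auto
  show "(\<GG> g. (F a g + c a) + H a g) = ((\<GG> g. F a g) + c a) + (\<GG> g. H a g)"
   by (simp add: nn_integral_add gseq_const cong: measurable_cong_sets)
 qed
 also have "\<dots> = ((\<integral>\<^sup>+a. (\<GG> g. F a g) \<partial>PP) + (\<integral>\<^sup>+a. c a \<partial>PP)) + (\<integral>\<^sup>+a. (\<GG> g. H a g) \<partial>PP)"
  by (subst nn_integral_add, measurable, subst nn_integral_add) auto
 finally show ?thesis .
qed

text \<open>\<open>psi\<close> and \<open>sg * b0\<close> integrate the same \<open>R * Wt\<close>,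
  against 1 and against \<open>q\<close>. Where \<open>R \<le> C\<close> they differ by at most
  \<open>C\<close> times the L1 distance; the rest is \<open>big_R_tail\<close>.\<close>

lemma psi_upper:
 assumes C: "1 < C" and C1: "1 < C1" and k: "0 < k"
 shows "psi \<le> ennreal (chi + sg * (2 * eps + C * e1 C1) + (k * A2 + (card w / 2 + Ce) / (k * ln C)))"
proof -
 let ?f = "\<lambda>a g. ennreal (R (G a, t a, sh g a) * Wt (G a, t a, sh g a))"
 have "(\<integral>\<^sup>+a. (\<GG> g. ?f a g) \<partial>PP)
  \<le> (\<integral>\<^sup>+a. (\<GG> g. (ennreal (q a) * ?f a g + ennreal C * ennreal \<bar>1 - q a\<bar>) + ?f a g * indicator {x. C < R x} (G a, t a, sh g a)) \<partial>PP)"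
 proof (rule nn_integral_mono, rule nn_integral_mono)
  fix a g
  define x where "x = R (G a, t a, sh g a) * Wt (G a, t a, sh g a)"
  have x: "0 \<le> x" "x \<le> R (G a, t a, sh g a)"
   using mult_left_mono[OF Wt_le less_imp_le[OF R_pos]] by (auto simp: x_def R_pos Wt_pos less_imp_le)
  show "?f a g \<le> (ennreal (q a) * ?f a g + ennreal C * ennreal \<bar>1 - q a\<bar>) + ?f a g * indicator {x. C < R x} (G a, t a, sh g a)"
  proof (cases "C < R (G a, t a, sh g a)")
   case False
   have "x \<le> q a * x + x * \<bar>1 - q a\<bar>"
    using x(1) mult_left_mono[of 1 "q a + \<bar>1 - q a\<bar>" x] by (simp add: algebra_simps)
   also have "\<dots> \<le> q a * x + C * \<bar>1 - q a\<bar>"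
    using x False by (intro add_left_mono mult_right_mono) auto
   finally have "ennreal x \<le> ennreal (q a) * ennreal x + ennreal C * ennreal \<bar>1 - q a\<bar>"
    using x(1) q_nonneg[of a] C by (simp add: ennreal_mult[symmetric] ennreal_plus[symmetric] ennreal_leI del: ennreal_plus)
   then show ?thesis using False by (simp add: x_def)
  qed simp
 qed
 also have "\<dots> = (b0 + ennreal C * (\<integral>\<^sup>+a. ennreal \<bar>1 - q a\<bar> \<partial>PP))
   + (\<integral>\<^sup>+a. (\<GG> g. ?f a g * indicator {x. C < R x} (G a, t a, sh g a)) \<partial>PP)"
  unfolding b0_eq
  by (subst nn_integral_gseq_add3) (auto simp: nn_integral_cmult)
 finally have "psi \<le> ennreal sg * (b0 + ennreal C * (\<integral>\<^sup>+a. ennreal \<bar>1 - q a\<bar> \<partial>PP))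
   + ennreal sg * (\<integral>\<^sup>+a. (\<GG> g. ?f a g * indicator {x. C < R x} (G a, t a, sh g a)) \<partial>PP)"
  unfolding psi_eq by (simp add: distrib_left[symmetric] mult_left_mono)
 also have "\<dots> \<le> ennreal sg * (((\<GG> u. kW (\<lambda>j. sqrt (1 + P) * u j)) + ennreal (2 * eps)) + ennreal C * ennreal (e1 C1))
   + ennreal (k * A2 + (card w / 2 + Ce) / (k * ln C))"
  by (intro add_mono mult_left_mono b0_le L1_close C1 big_R_tail C k) auto
 also have "\<dots> = ennreal chi + ennreal (sg * (2 * eps + C * e1 C1)) + ennreal (k * A2 + (card w / 2 + Ce) / (k * ln C))"
 proof -
  have "ennreal (sg * (2 * eps + C * e1 C1)) = ennreal sg * (ennreal (2 * eps) + ennreal C * ennreal (e1 C1))"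
   using sg_pos param C e1_nonneg[OF C1]
   by (simp add: ennreal_mult[symmetric] ennreal_plus[symmetric] del: ennreal_plus)
  then show ?thesis unfolding chi_eq by (simp add: distrib_left add.assoc)
 qed
 also have "\<dots> = ennreal (chi + sg * (2 * eps + C * e1 C1) + (k * A2 + (card w / 2 + Ce) / (k * ln C)))"
 proof -
  have "0 \<le> chi" unfolding chi_def
  proof -
   have "P / (1 + P) \<le> 1" "0 \<le> P / (1 + P)" using param by auto
   moreover have "lam\<^sup>2 \<le> 1" using param by (simp add: power_le_one)
   ultimately have "lam\<^sup>2 * (P / (1 + P)) \<le> 1" by (intro mult_le_one)
   then show "0 \<le> (1 / sqrt (1 - lam\<^sup>2 * (P / (1 + P)))) ^ card w" by simp
  qed
  moreover have "0 \<le> sg * (2 * eps + C * e1 C1)" using sg_pos param C e1_nonneg[OF C1] by auto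
  moreover have "0 \<le> (card w / 2 + Ce) / (k * ln C)" "0 \<le> k * A2" using A2_pos param C k by auto
  ultimately show ?thesis by (simp add: ennreal_plus[symmetric] del: ennreal_plus)
 qed
 finally show ?thesis .
qed

text \<open>The reverse comparison needs the \<open>q\<close>-mass of large \<open>R\<close>. There
  \<open>t\<close> is fresh, so the conditional second moment of \<open>R\<close> is
  \<open>exp E\<close>, and the mass above \<open>C\<close> is at most \<open>exp B / C\<close>
  unless the energy exceeds \<open>B\<close>; the latter is \<open>big_E_tail\<close>.\<close>

lemma psi_lower:
 assumes C: "1 < C" and C1: "1 < C1" and k: "0 < k" and B: "0 < B"
 shows "ennreal chi \<le> psi + ennreal (sg * (2 * eps + C * e1 C1 + exp B / C + e1 C1) + (k * A2 + (e1 C1 + (Ce / B + eps)) / k))"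
proof -
 let ?f = "\<lambda>a g. ennreal (R (G a, t a, sh g a) * Wt (G a, t a, sh g a))"
 let ?d = "\<integral>\<^sup>+a. ennreal \<bar>1 - q a\<bar> \<partial>PP"
 \<comment> \<open>The \<open>q\<close>-mass of large likelihoods, the only term that the upper
   bound does not have.\<close>
 define T where "T = (\<integral>\<^sup>+a. (\<GG> g. ennreal (q a) * (ennreal (R (G a, t a, sh g a)) * indicator {x. C < R x} (G a, t a, sh g a))) \<partial>PP)"
 define a0 where "a0 = (\<integral>\<^sup>+a. (\<GG> g. ?f a g) \<partial>PP)"
 have "b0 \<le> (\<integral>\<^sup>+a. (\<GG> g. (?f a g + ennreal C * ennreal \<bar>1 - q a\<bar>) + ennreal (q a) * (ennreal (R (G a, t a, sh g a)) * indicator {x. C < R x} (G a, t a, sh g a))) \<partial>PP)"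
  unfolding b0_eq
 proof (rule nn_integral_mono, rule nn_integral_mono)
  fix a g
  define x where "x = R (G a, t a, sh g a) * Wt (G a, t a, sh g a)"
  have x: "0 \<le> x" "x \<le> R (G a, t a, sh g a)"
   using mult_left_mono[OF Wt_le less_imp_le[OF R_pos]] by (auto simp: x_def R_pos Wt_pos less_imp_le)
  show "ennreal (q a) * ?f a g \<le> (?f a g + ennreal C * ennreal \<bar>1 - q a\<bar>) + ennreal (q a) * (ennreal (R (G a, t a, sh g a)) * indicator {x. C < R x} (G a, t a, sh g a))"
  proof (cases "C < R (G a, t a, sh g a)")
   case False
   have "q a * x \<le> x + x * \<bar>1 - q a\<bar>"
    using x(1) mult_left_mono[of "q a" "1 + \<bar>1 - q a\<bar>" x] by (simp add: algebra_simps)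
   also have "\<dots> \<le> x + C * \<bar>1 - q a\<bar>"
    using x False by (intro add_left_mono mult_right_mono) auto
   finally have "ennreal (q a) * ennreal x \<le> ennreal x + ennreal C * ennreal \<bar>1 - q a\<bar>"
    using x(1) q_nonneg[of a] C by (simp add: ennreal_mult[symmetric] ennreal_plus[symmetric] ennreal_leI del: ennreal_plus)
   then show ?thesis using False by (simp add: x_def)
  next
   case True
   have "ennreal (q a) * ennreal x \<le> ennreal (q a) * ennreal (R (G a, t a, sh g a))"
    using x by (intro mult_left_mono ennreal_leI) auto
   then show ?thesis using True by (auto simp: x_def intro: add_increasing)
  qed
 qed
 also have "\<dots> = (a0 + ennreal C * ?d) + T"
  unfolding a0_def T_def
  by (subst nn_integral_gseq_add3) (auto simp: nn_integral_cmult)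
 finally have b0: "b0 \<le> (a0 + ennreal C * ?d) + T" .
 define E'' where "E'' = (\<integral>\<^sup>+a. (\<GG> g. indicator {x. B < E x} (G a, t a, sh g a)) \<partial>PP)"
 have "T = (\<integral>\<^sup>+a. ennreal (q a) * (\<GG> g. ennreal (R (G a, t a, sh g a)) * indicator {x. C < R x} (G a, t a, sh g a)) \<partial>PP)"
  unfolding T_def
 proof (rule nn_integral_cong)
  fix a assume "a \<in> space PP"
  then have [simp]: "G a \<in> space N" using measurable_space[OF G] by simp
  show "(\<GG> g. ennreal (q a) * (ennreal (R (G a, t a, sh g a)) * indicator {x. C < R x} (G a, t a, sh g a)))
   = ennreal (q a) * (\<GG> g. ennreal (R (G a, t a, sh g a)) * indicator {x. C < R x} (G a, t a, sh g a))"
   by (rule nn_integral_cmult) measurable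
 qed
 also have "\<dots> = (\<integral>\<^sup>+a. ennreal (q a) * (\<GG> u. \<GG> g. ennreal (R (G a, sub u (t a), sh g a)) * indicator {x. C < R x} (G a, sub u (t a), sh g a)) \<partial>PP)"
  using indep[of "\<lambda>(g, u, v). (\<GG> h. ennreal (R (g, u, shiftw w (\<lambda>i. sqrt (lam / (1 - lam)) * h i) v)) * indicator {x. C < R x} (g, u, shiftw w (\<lambda>i. sqrt (lam / (1 - lam)) * h i) v))"]
  by simp
 also have "\<dots> \<le> (\<integral>\<^sup>+a. ennreal (q a) * (ennreal (exp B / C) + (\<GG> g. indicator {x. B < E x} (G a, t a, sh g a))) \<partial>PP)"
 proof (rule nn_integral_mono, rule mult_left_mono)
  fix a assume "a \<in> space PP"
  then have [simp]: "G a \<in> space N" using measurable_space[OF G] by simp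
  have "(\<GG> u. \<GG> g. ennreal (R (G a, sub u (t a), sh g a)) * indicator {x. C < R x} (G a, sub u (t a), sh g a))
   = (\<GG> g. \<GG> u. ennreal (R (G a, sub u (t a), sh g a)) * indicator {x. C < R x} (G a, sub u (t a), sh g a))"
   by (rule nn_integral_swap_gseq) measurable
  also have "\<dots> \<le> (\<GG> g. ennreal (exp B / C) + indicator {x. B < E x} (G a, t a, sh g a))"
  proof (rule nn_integral_mono)
   fix g
   show "(\<GG> u. ennreal (R (G a, sub u (t a), sh g a)) * indicator {x. C < R x} (G a, sub u (t a), sh g a))
    \<le> ennreal (exp B / C) + indicator {x. B < E x} (G a, t a, sh g a)"
   proof (cases "B < E (G a, t a, sh g a)")
    case True
    have "(\<GG> u. ennreal (R (G a, sub u (t a), sh g a)) * indicator {x. C < R x} (G a, sub u (t a), sh g a))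
     \<le> (\<GG> u. ennreal (R (G a, sub u (t a), sh g a)))"
     by (intro nn_integral_mono) (auto split: split_indicator)
    then show ?thesis using True by (simp add: int_R add_increasing)
   next
    case False
    have "(\<GG> u. ennreal (R (G a, sub u (t a), sh g a)) * indicator {x. C < R x} (G a, sub u (t a), sh g a))
     \<le> (\<GG> u. ennreal ((R (G a, sub u (t a), sh g a))\<^sup>2) * ennreal (1 / C))"
    proof (rule nn_integral_mono)
     fix u
     define x where "x = R (G a, sub u (t a), sh g a)"
     have "x \<le> x\<^sup>2 * (1 / C)" if "C < x"
      using that C by (simp add: power2_eq_square field_simps)
     then show "ennreal (R (G a, sub u (t a), sh g a)) * indicator {x. C < R x} (G a, sub u (t a), sh g a) \<le> ennreal ((R (G a, sub u (t a), sh g a))\<^sup>2) * ennreal (1 / C)"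
      using C by (auto simp: x_def ennreal_mult[symmetric] intro!: ennreal_leI split: split_indicator)
    qed
    also have "\<dots> = (\<GG> u. ennreal ((R (G a, sub u (t a), sh g a))\<^sup>2)) * ennreal (1 / C)"
     by (rule nn_integral_multc) measurable
    also have "\<dots> = ennreal (exp (E (G a, t a, sh g a)) / C)"
     using C by (simp add: int_R_sq ennreal_mult[symmetric])
    also have "\<dots> \<le> ennreal (exp B / C)"
     using False C by (intro ennreal_leI divide_right_mono) auto
    finally show ?thesis by (rule order_trans) simp
   qed
  qed
  also have "\<dots> = ennreal (exp B / C) + (\<GG> g. indicator {x. B < E x} (G a, t a, sh g a))"
   by (subst nn_integral_add) (auto simp: gseq_const cong: measurable_cong_sets)
  finally show "(\<GG> u. \<GG> g. ennreal (R (G a, sub u (t a), sh g a)) * indicator {x. C < R x} (G a, sub u (t a), sh g a))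
   \<le> ennreal (exp B / C) + (\<GG> g. indicator {x. B < E x} (G a, t a, sh g a))" .
 qed simp
 also have "\<dots> = ennreal (exp B / C) + (\<integral>\<^sup>+a. ennreal (q a) * (\<GG> g. indicator {x. B < E x} (G a, t a, sh g a)) \<partial>PP)"
  by (simp add: distrib_left nn_integral_add nn_integral_multc q_prob)
 also have "\<dots> \<le> ennreal (exp B / C) + (E'' + ?d)"
  unfolding E''_def
 proof (intro add_mono order_refl swap_q(1))
  fix a
  have "(\<GG> g. indicator {x. B < E x} (G a, t a, sh g a)) \<le> (\<GG> g. 1)"
   by (intro nn_integral_mono) (auto split: split_indicator)
  then show "(\<GG> g. indicator {x. B < E x} (G a, t a, sh g a)) \<le> (1::ennreal)" by (simp only: gseq_const)
 qed measurable
 finally have T: "T \<le> ennreal (exp B / C) + (E'' + ?d)" .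
 have "ennreal chi \<le> ennreal sg * (b0 + ennreal (2 * eps))"
  unfolding chi_eq by (intro mult_left_mono b0_ge) auto
 also have "\<dots> \<le> ennreal sg * (((a0 + ennreal C * ?d) + (ennreal (exp B / C) + (E'' + ?d))) + ennreal (2 * eps))"
  using b0 T by (intro mult_left_mono add_mono) (auto intro: order_trans add_left_mono)
 also have "\<dots> = (psi + ennreal sg * E'') + ennreal sg * (ennreal C * ?d + (ennreal (exp B / C) + (?d + ennreal (2 * eps))))"
  unfolding psi_eq a0_def by (simp add: distrib_left add_ac)
 also have "\<dots> \<le> (psi + ennreal (k * A2 + (e1 C1 + (Ce / B + eps)) / k)) + ennreal sg * (ennreal C * ennreal (e1 C1) + (ennreal (exp B / C) + (ennreal (e1 C1) + ennreal (2 * eps))))"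
  unfolding E''_def by (intro add_mono mult_left_mono big_E_tail C1 k B order_refl L1_close) auto
 also have "ennreal sg * (ennreal C * ennreal (e1 C1) + (ennreal (exp B / C) + (ennreal (e1 C1) + ennreal (2 * eps)))) = ennreal (sg * (2 * eps + C * e1 C1 + exp B / C + e1 C1))"
  using sg_pos param C e1_nonneg[OF C1]
  by (simp add: ennreal_mult[symmetric] ennreal_plus[symmetric] add_ac del: ennreal_plus)
 finally have fin: "ennreal chi \<le> (psi + ennreal (k * A2 + (e1 C1 + (Ce / B + eps)) / k)) + ennreal (sg * (2 * eps + C * e1 C1 + exp B / C + e1 C1))" .
 have "0 \<le> k * A2 + (e1 C1 + (Ce / B + eps)) / k" "0 \<le> sg * (2 * eps + C * e1 C1 + exp B / C + e1 C1)"
  using k B C A2_pos param e1_nonneg[OF C1] sg_pos by (auto intro!: add_nonneg_nonneg mult_nonneg_nonneg)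
 then have "ennreal (sg * (2 * eps + C * e1 C1 + exp B / C + e1 C1) + (k * A2 + (e1 C1 + (Ce / B + eps)) / k))
  = ennreal (k * A2 + (e1 C1 + (Ce / B + eps)) / k) + ennreal (sg * (2 * eps + C * e1 C1 + exp B / C + e1 C1))"
  by (subst add.commute) (rule ennreal_plus)
 then show ?thesis using fin by (simp only: add.assoc)
qed

end

section \<open>Feedback loops driven by white noise\<close>

text \<open>The strict inequality in \<open>e_causal\<close> makes the loop solvable: round
  \<open>n\<close> first produces \<open>t n\<close> from the \<open>y\<close> of earlier rounds,
  then \<open>y n\<close> from \<open>t\<close> up to and including \<open>n\<close>.\<close>

locale feedback = prob_space M0 for M0 :: "'s measure" +
 fixes e s :: "nat \<Rightarrow> 's \<Rightarrow> (nat \<Rightarrow> real) \<Rightarrow> real"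
 assumes e_meas: "\<And>n. (\<lambda>(a, y). e n a y) \<in> borel_measurable (M0 \<Otimes>\<^sub>M sq)"
  and s_meas: "\<And>n. (\<lambda>(a, t). s n a t) \<in> borel_measurable (M0 \<Otimes>\<^sub>M sq)"
  and e_causal: "\<And>n a y y'. (\<And>i. i < n \<Longrightarrow> y i = y' i) \<Longrightarrow> e n a y = e n a y'"
  and s_causal: "\<And>n a t t'. (\<And>i. i \<le> n \<Longrightarrow> t i = t' i) \<Longrightarrow> s n a t = s n a t'"
begin

lemma e_comp [measurable]:
 assumes [measurable]: "f \<in> measurable K M0" "h \<in> measurable K sq"
 shows "(\<lambda>x. e n (f x) (h x)) \<in> borel_measurable K"
 using measurable_compose[OF measurable_Pair[OF assms] e_meas[of n]] by simp

lemma s_comp [measurable]: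
 assumes [measurable]: "f \<in> measurable K M0" "h \<in> measurable K sq"
 shows "(\<lambda>x. s n (f x) (h x)) \<in> borel_measurable K"
 using measurable_compose[OF measurable_Pair[OF assms] s_meas[of n]] by simp

text \<open>With \<open>ls\<close>, the Girsanov factors of the loop: densities relative to white
  noise of the channel with output \<open>t\<close> and of the channel with output
  \<open>y\<close>.\<close>

definition re :: "nat set \<Rightarrow> 's \<Rightarrow> (nat \<Rightarrow> real) \<Rightarrow> (nat \<Rightarrow> real) \<Rightarrow> real" where
 "re w a t y = (\<Prod>j\<in>w. gl (e j a y) (t j))"

definition ls :: "nat set \<Rightarrow> 's \<Rightarrow> (nat \<Rightarrow> real) \<Rightarrow> (nat \<Rightarrow> real) \<Rightarrow> real" where
 "ls w a t y = (\<Prod>j\<in>w. gl (s j a t) (y j))"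

lemma re_pos: "0 < re w a t y" and ls_pos: "0 < ls w a t y"
 by (auto simp: re_def ls_def intro!: prod_pos gl_pos)

lemma re_m [measurable]:
 assumes [measurable]: "f \<in> measurable K M0" "g \<in> measurable K sq" "h \<in> measurable K sq"
 shows "(\<lambda>x. re w (f x) (g x) (h x)) \<in> borel_measurable K"
 unfolding re_def by measurable

lemma ls_m [measurable]:
 assumes [measurable]: "f \<in> measurable K M0" "g \<in> measurable K sq" "h \<in> measurable K sq"
 shows "(\<lambda>x. ls w (f x) (g x) (h x)) \<in> borel_measurable K"
 unfolding ls_def by measurable

lemma re_cong:
 assumes "\<And>i. i \<in> w \<Longrightarrow> t i = t' i" "\<And>i j. j \<in> w \<Longrightarrow> i < j \<Longrightarrow> y i = y' i"
 shows "re w a t y = re w a t' y'"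
 unfolding re_def
proof (intro prod.cong refl)
 fix j assume j: "j \<in> w"
 then have "e j a y = e j a y'" by (intro e_causal assms(2))
 then show "gl (e j a y) (t j) = gl (e j a y') (t' j)" using assms(1)[OF j] by simp
qed

lemma ls_cong:
 assumes "\<And>i. i \<in> w \<Longrightarrow> y i = y' i" "\<And>i j. j \<in> w \<Longrightarrow> i \<le> j \<Longrightarrow> t i = t' i"
 shows "ls w a t y = ls w a t' y'"
 unfolding ls_def
proof (intro prod.cong refl)
 fix j assume j: "j \<in> w"
 then have "s j a t = s j a t'" by (intro s_causal assms(2))
 then show "gl (s j a t) (y j) = gl (s j a t') (y' j)" using assms(1)[OF j] by simp
qed

lemma gseq_nn_m [measurable]:
 assumes [measurable]: "(\<lambda>(x, g). F x g) \<in> borel_measurable (K \<Otimes>\<^sub>M sq)"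
 shows "(\<lambda>x. (\<GG> g. F x g)) \<in> borel_measurable K"
 by (intro sigma_finite_measure.borel_measurable_nn_integral[OF sigma_finite_gseq]) (simp cong: measurable_cong_sets)

lemma re_int: "finite w \<Longrightarrow> (\<GG> t. ennreal (re w a t y)) = 1"
 unfolding re_def by (rule nn_integral_gseq_prod_gl)

lemma ls_int: "finite w \<Longrightarrow> (\<GG> y. ennreal (ls w a t y)) = 1"
 unfolding ls_def by (rule nn_integral_gseq_prod_gl)

text \<open>Solves the loop in place: after \<open>k\<close> rounds the entries below
  \<open>k\<close> are loop signals and the others are still raw noise.\<close>

primrec sol :: "nat \<Rightarrow> 's \<Rightarrow> (nat \<Rightarrow> real) \<Rightarrow> (nat \<Rightarrow> real) \<Rightarrow> (nat \<Rightarrow> real) \<times> (nat \<Rightarrow> real)" where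
 "sol 0 a v z = (v, z)"
| "sol (Suc k) a v z =
  (let t = (fst (sol k a v z))(k := fst (sol k a v z) k + e k a (snd (sol k a v z)))
   in (t, (snd (sol k a v z))(k := snd (sol k a v z) k + s k a t)))"

lemma sol_eq:
 assumes "\<And>n. T n = e n a Y + v n" "\<And>n. Y n = s n a T + z n"
 shows "fst (sol k a v z) = (\<lambda>j. if j < k then T j else v j) \<and> snd (sol k a v z) = (\<lambda>j. if j < k then Y j else z j)"
proof (induction k)
 case (Suc k)
 have e: "e k a (\<lambda>j. if j < k then Y j else z j) = e k a Y" by (rule e_causal) simp
 have t: "(\<lambda>j. if j < k then T j else v j)(k := v k + e k a Y) = (\<lambda>j. if j < Suc k then T j else v j)"
  using assms(1)[of k] by (auto simp: less_Suc_eq)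
 have s: "s k a (\<lambda>j. if j < Suc k then T j else v j) = s k a T" by (rule s_causal) simp
 show ?case using Suc e t s assms(2)[of k] by (auto simp: Let_def less_Suc_eq)
qed simp

text \<open>Each round shifts one coordinate of \<open>t\<close> and one of \<open>y\<close> by
  amounts not involving that coordinate, so each shift contributes exactly one factor
  \<open>gl\<close>.\<close>

lemma nn_integral_sol:
 assumes a: "a \<in> space M0" and "F \<in> borel_measurable (sq \<Otimes>\<^sub>M sq)"
 shows "(\<GG> v. \<GG> z. F (sol k a v z))
  = (\<GG> t. \<GG> y. F (t, y) * ennreal (re {..<k} a t y * ls {..<k} a t y))"
 using assms(2)
proof (induction k arbitrary: F)
 case 0
 then show ?case by (simp add: re_def ls_def)
next
 case (Suc k)
 note [measurable] = Suc.prems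
 have [measurable]: "(\<lambda>x. e n a (h x)) \<in> borel_measurable K" "(\<lambda>x. s n a (h x)) \<in> borel_measurable K"
  if [measurable]: "h \<in> measurable K sq" for h n and K :: "'k measure"
  using a by measurable
 have [measurable]: "(\<lambda>x. re w a (g x) (h x)) \<in> borel_measurable K" "(\<lambda>x. ls w a (g x) (h x)) \<in> borel_measurable K"
  if [measurable]: "h \<in> measurable K sq" "g \<in> measurable K sq" for h g w and K :: "'k measure"
  using a by measurable
 define tp where "tp t y = t(k := t k + e k a y)" for t y :: "nat \<Rightarrow> real"
 have [measurable]: "(\<lambda>x. tp (f x) (g x)) \<in> measurable K sq"
  if [measurable]: "f \<in> measurable K sq" "g \<in> measurable K sq" for f g and K :: "'k measure"
  unfolding tp_def by measurable
 have ind_e: "e k a (y(k := u)) = e k a y" for y u by (rule e_causal) simp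
 have ind_re: "re {..<k} a (t(k := u)) (y(k := x)) = re {..<k} a t y" for t u y x by (rule re_cong) auto
 have ind_ls: "ls {..<k} a (t(k := u)) (y(k := x)) = ls {..<k} a t y" for t u y x by (rule ls_cong) auto
 note ind_y = ind_re[of t "t k" for t, simplified] ind_ls[of t "t k" for t, simplified]
 note ind_t = ind_re[of _ _ y "y k" for y, simplified] ind_ls[of _ _ y "y k" for y, simplified]
 have [simp]: "{..<Suc k} = insert k {..<k}" by auto
 define L where "L t y = ennreal (re {..<k} a t y * ls {..<k} a t y)" for t y
 have [measurable]: "(\<lambda>x. L (f x) (g x)) \<in> borel_measurable K"
  if [measurable]: "f \<in> measurable K sq" "g \<in> measurable K sq" for f g and K :: "'k measure"
  unfolding L_def by measurable
 have "(\<GG> v. \<GG> z. F (sol (Suc k) a v z))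
  = (\<GG> v. \<GG> z. (\<lambda>(t, y). F (tp t y, y(k := y k + s k a (tp t y)))) (sol k a v z))"
  by (simp add: Let_def tp_def split_beta')
 also have "\<dots> = (\<GG> t. \<GG> y. F (tp t y, y(k := y k + s k a (tp t y))) * L t y)"
  unfolding L_def by (subst Suc.IH) auto
 \<comment> \<open>For fixed \<open>t\<close>, coordinate \<open>k\<close> of \<open>y\<close> is
   shifted: \<open>tp t y\<close> ignores \<open>y k\<close>, so the shift is admissible. Only
   afterwards is \<open>t k\<close> shifted, for fixed \<open>y\<close>.\<close>
 also have "\<dots> = (\<GG> t. \<GG> y. (F (tp t y, y) * L t y) * ennreal (gl (s k a (tp t y)) (y k)))"
 proof (rule nn_integral_cong)
  fix t :: "nat \<Rightarrow> real"
  have [simp]: "tp t (y(k := u)) = tp t y" for y u by (simp add: tp_def ind_e)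
  show "(\<GG> y. F (tp t y, y(k := y k + s k a (tp t y))) * L t y)
   = (\<GG> y. (F (tp t y, y) * L t y) * ennreal (gl (s k a (tp t y)) (y k)))"
   using nn_integral_gseq_shift1[of "\<lambda>y. F (tp t y, y) * L t y" "\<lambda>y. s k a (tp t y)" k]
   by (simp add: L_def ind_y)
 qed
 also have "\<dots> = (\<GG> y. \<GG> t. (F (tp t y, y) * L t y) * ennreal (gl (s k a (tp t y)) (y k)))"
  by (rule nn_integral_swap_gseq) measurable
 also have "\<dots> = (\<GG> y. \<GG> t. ((F (t, y) * L t y) * ennreal (gl (s k a t) (y k))) * ennreal (gl (e k a y) (t k)))"
 proof (rule nn_integral_cong)
  fix y :: "nat \<Rightarrow> real"
  show "(\<GG> t. (F (tp t y, y) * L t y) * ennreal (gl (s k a (tp t y)) (y k)))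
   = (\<GG> t. ((F (t, y) * L t y) * ennreal (gl (s k a t) (y k))) * ennreal (gl (e k a y) (t k)))"
   using nn_integral_gseq_shift1[of "\<lambda>t. (F (t, y) * L t y) * ennreal (gl (s k a t) (y k))" "\<lambda>_. e k a y" k]
   by (simp add: tp_def L_def ind_t)
 qed
 also have "\<dots> = (\<GG> t. \<GG> y. ((F (t, y) * L t y) * ennreal (gl (s k a t) (y k))) * ennreal (gl (e k a y) (t k)))"
  by (rule nn_integral_swap_gseq) measurable
 also have "\<dots> = (\<GG> t. \<GG> y. F (t, y) * ennreal (re {..<Suc k} a t y * ls {..<Suc k} a t y))"
 proof (rule nn_integral_cong, rule nn_integral_cong)
  fix t y :: "nat \<Rightarrow> real"
  have "ennreal (re {..<Suc k} a t y * ls {..<Suc k} a t y)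
   = L t y * (ennreal (gl (s k a t) (y k)) * ennreal (gl (e k a y) (t k)))"
   unfolding L_def re_def ls_def
   by (simp add: ennreal_mult[symmetric] prod_nonneg gl_pos less_imp_le mult_ac)
  then show "((F (t, y) * L t y) * ennreal (gl (s k a t) (y k))) * ennreal (gl (e k a y) (t k))
   = F (t, y) * ennreal (re {..<Suc k} a t y * ls {..<Suc k} a t y)"
   by (simp only: mult.assoc)
 qed
 finally show ?case .
qed

end

locale closed_loop = feedback M0 e s + W: prob_space M
 for M0 :: "'s measure" and e s and M :: "'w measure" +
 fixes A :: "'w \<Rightarrow> 's" and V Z T Y :: "'w \<Rightarrow> nat \<Rightarrow> real"
 assumes law: "distr M (M0 \<Otimes>\<^sub>M gseq \<Otimes>\<^sub>M gseq) (\<lambda>om. (A om, V om, Z om)) = M0 \<Otimes>\<^sub>M gseq \<Otimes>\<^sub>M gseq"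
  and A [measurable]: "A \<in> measurable M M0"
  and V [measurable]: "V \<in> measurable M sq" and Z [measurable]: "Z \<in> measurable M sq"
  and T_eq: "\<And>om n. om \<in> space M \<Longrightarrow> T om n = e n (A om) (Y om) + V om n"
  and Y_eq: "\<And>om n. om \<in> space M \<Longrightarrow> Y om n = s n (A om) (T om) + Z om n"
begin

definition L :: "nat \<Rightarrow> 's \<Rightarrow> (nat \<Rightarrow> real) \<Rightarrow> (nat \<Rightarrow> real) \<Rightarrow> real" where
 "L k a t y = re {..<k} a t y * ls {..<k} a t y"

lemma L_pos: "0 < L k a t y"
 by (simp add: L_def re_pos ls_pos)

lemma L_m [measurable]:
 assumes [measurable]: "f \<in> measurable K M0" "g \<in> measurable K sq" "h \<in> measurable K sq"
 shows "(\<lambda>x. L k (f x) (g x) (h x)) \<in> borel_measurable K"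
 unfolding L_def by measurable

lemma nn_integral_static:
 assumes [measurable]: "F \<in> borel_measurable (M0 \<Otimes>\<^sub>M sq \<Otimes>\<^sub>M sq)"
 shows "(\<integral>\<^sup>+om. F (A om, V om, Z om) \<partial>M) = (\<integral>\<^sup>+a. (\<GG> v. \<GG> z. F (a, v, z)) \<partial>M0)"
proof -
 interpret G: prob_space gseq by (rule prob_space_gseq)
 interpret GG: pair_prob_space gseq gseq by unfold_locales
 have "(\<integral>\<^sup>+om. F (A om, V om, Z om) \<partial>M) = (\<integral>\<^sup>+x. F x \<partial>(distr M (M0 \<Otimes>\<^sub>M gseq \<Otimes>\<^sub>M gseq) (\<lambda>om. (A om, V om, Z om))))"
  by (subst nn_integral_distr) (auto cong: measurable_cong_sets)
 also have "\<dots> = (\<integral>\<^sup>+a. \<integral>\<^sup>+x. F (a, x) \<partial>(gseq \<Otimes>\<^sub>M gseq) \<partial>M0)"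
  unfolding law by (subst GG.P.nn_integral_fst[symmetric]) (auto cong: measurable_cong_sets)
 also have "\<dots> = (\<integral>\<^sup>+a. (\<GG> v. \<GG> z. F (a, v, z)) \<partial>M0)"
  by (intro nn_integral_cong, subst G.nn_integral_fst[symmetric]) (auto cong: measurable_cong_sets)
 finally show ?thesis .
qed

lemma sol_m [measurable]:
 assumes [measurable]: "f \<in> measurable K M0" "g \<in> measurable K sq" "h \<in> measurable K sq"
 shows "(\<lambda>x. fst (sol k (f x) (g x) (h x))) \<in> measurable K sq"
  "(\<lambda>x. snd (sol k (f x) (g x) (h x))) \<in> measurable K sq"
proof (induction k)
 case (Suc k)
 note [measurable] = Suc
 { case 1 show ?case unfolding sol.simps Let_def fst_conv by measurable
 next
  case 2 show ?case unfolding sol.simps Let_def snd_conv by measurable }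
qed simp_all

lemma sol_TY:
 assumes "om \<in> space M" "j < k"
 shows "fst (sol k (A om) (V om) (Z om)) j = T om j" "snd (sol k (A om) (V om) (Z om)) j = Y om j"
 using sol_eq[of "T om" "A om" "Y om" "V om" "Z om" k] T_eq[OF assms(1)] Y_eq[OF assms(1)] assms(2) by simp_all

lemma T_m [measurable]: "T \<in> measurable M sq" and Y_m [measurable]: "Y \<in> measurable M sq"
proof -
 have "(\<lambda>om. T om j) \<in> borel_measurable M" "(\<lambda>om. Y om j) \<in> borel_measurable M" for j
 proof -
  have *: "(\<lambda>om. fst (sol (Suc j) (A om) (V om) (Z om)) j) \<in> borel_measurable M"
   "(\<lambda>om. snd (sol (Suc j) (A om) (V om) (Z om)) j) \<in> borel_measurable M"
   by measurable
  show "(\<lambda>om. T om j) \<in> borel_measurable M" "(\<lambda>om. Y om j) \<in> borel_measurable M"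
   using *[THEN measurable_cong[THEN iffD1, rotated]] sol_TY[of _ j "Suc j"] by (auto simp del: sol.simps)
 qed
 then show "T \<in> measurable M sq" "Y \<in> measurable M sq" by (auto intro!: measurable_sqI)
qed

text \<open>The likelihood \<open>L k\<close> turns the loop signals up to time \<open>k\<close> into white noise.\<close>

lemma nn_integral_loop:
 assumes [measurable]: "F \<in> borel_measurable (M0 \<Otimes>\<^sub>M sq \<Otimes>\<^sub>M sq)"
  and F: "\<And>a t y t' y'. (\<And>i. i < k \<Longrightarrow> t i = t' i) \<Longrightarrow> (\<And>i. i < k \<Longrightarrow> y i = y' i) \<Longrightarrow> F (a, t, y) = F (a, t', y')"
 shows "(\<integral>\<^sup>+om. F (A om, T om, Y om) \<partial>M) = (\<integral>\<^sup>+a. (\<GG> t. \<GG> y. F (a, t, y) * ennreal (L k a t y)) \<partial>M0)"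
proof -
 have "(\<integral>\<^sup>+om. F (A om, T om, Y om) \<partial>M)
  = (\<integral>\<^sup>+om. (\<lambda>(a, v, z). F (a, fst (sol k a v z), snd (sol k a v z))) (A om, V om, Z om) \<partial>M)"
  unfolding prod.case by (intro nn_integral_cong F) (auto simp: sol_TY)
 also have "\<dots> = (\<integral>\<^sup>+a. (\<GG> v. \<GG> z. F (a, sol k a v z)) \<partial>M0)"
 proof -
  have m: "(\<lambda>(a, v, z). F (a, fst (sol k a v z), snd (sol k a v z))) \<in> borel_measurable (M0 \<Otimes>\<^sub>M sq \<Otimes>\<^sub>M sq)"
   by measurable
  show ?thesis using nn_integral_static[OF m] by simp
 qed
 also have "\<dots> = (\<integral>\<^sup>+a. (\<GG> t. \<GG> y. F (a, t, y) * ennreal (L k a t y)) \<partial>M0)"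
  unfolding L_def by (rule nn_integral_cong, rule nn_integral_sol) auto
 finally show ?thesis .
qed

end

text \<open>Density of the centred Gaussian law of variance \<open>1 + P\<close> with respect to
  \<open>N01\<close>.\<close>

definition nd :: "real \<Rightarrow> real \<Rightarrow> real" where
 "nd P y = exp (P / (1 + P) * y\<^sup>2 / 2) / sqrt (1 + P)"

definition nh :: "real \<Rightarrow> nat set \<Rightarrow> (nat \<Rightarrow> real) \<Rightarrow> real" where
 "nh P w y = (\<Prod>j\<in>w. nd P (y j))"

lemma nd_pos: "0 \<le> P \<Longrightarrow> 0 < nd P y"
 by (simp add: nd_def)

lemma nh_pos: "0 \<le> P \<Longrightarrow> 0 < nh P w y"
 by (auto simp: nh_def intro!: prod_pos nd_pos)

lemma nh_m [measurable]:
 assumes [measurable]: "f \<in> measurable K sq"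
 shows "(\<lambda>x. nh P w (f x)) \<in> borel_measurable K"
 unfolding nh_def nd_def by measurable

lemma nn_integral_nd:
 assumes P: "0 \<le> P" and [measurable]: "f \<in> borel_measurable borel"
 shows "(\<integral>\<^sup>+x. f x * ennreal (nd P x) \<partial>N01) = (\<integral>\<^sup>+x. f (sqrt (1 + P) * x) \<partial>N01)"
proof -
 define u where "u = sqrt (1 + P)"
 have u: "0 < u" "u\<^sup>2 = 1 + P" using P by (auto simp: u_def)
 have eq: "u * (std_normal_density (u * x) * nd P (u * x)) = std_normal_density x" for x
 proof -
  have "- (u * x)\<^sup>2 / 2 + P / (1 + P) * (u * x)\<^sup>2 / 2 = - ((1 - P / (1 + P)) * u\<^sup>2) * x\<^sup>2 / 2"
   by (simp add: power_mult_distrib algebra_simps diff_divide_distrib)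
  also have "(1 - P / (1 + P)) * u\<^sup>2 = 1" unfolding u(2) using P by (simp add: field_simps)
  finally have "exp (- (u * x)\<^sup>2 / 2) * exp (P / (1 + P) * (u * x)\<^sup>2 / 2) = exp (- x\<^sup>2 / 2)"
   by (simp only: exp_add[symmetric]) simp
  then show ?thesis using u(1) by (simp add: std_normal_density_def nd_def u_def[symmetric])
 qed
 have "(\<integral>\<^sup>+x. f x * ennreal (nd P x) \<partial>N01) = (\<LL> x. ennreal (std_normal_density x) * (f x * ennreal (nd P x)))"
  by (simp add: nn_integral_density nd_def)
 also have "\<dots> = ennreal u * (\<LL> x. ennreal (std_normal_density (u * x)) * (f (u * x) * ennreal (nd P (u * x))))"
  using nn_integral_real_affine[of "\<lambda>x. ennreal (std_normal_density x) * (f x * ennreal (nd P x))" u 0] u(1)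
  by (simp add: nd_def)
 also have "\<dots> = (\<LL> x. ennreal (std_normal_density x) * f (u * x))"
 proof (subst nn_integral_cmult[symmetric])
  show "(\<lambda>x. ennreal (std_normal_density (u * x)) * (f (u * x) * ennreal (nd P (u * x)))) \<in> borel_measurable lborel"
   unfolding nd_def by measurable
  show "(\<LL> x. ennreal u * (ennreal (std_normal_density (u * x)) * (f (u * x) * ennreal (nd P (u * x)))))
   = (\<LL> x. ennreal (std_normal_density x) * f (u * x))"
  proof (rule nn_integral_cong)
   fix x
   have "ennreal u * (ennreal (std_normal_density (u * x)) * ennreal (nd P (u * x))) = ennreal (std_normal_density x)"
    using u(1) nd_pos[OF P, of "u * x"] by (simp add: ennreal_mult[symmetric] eq less_imp_le)
   moreover have "ennreal u * (ennreal (std_normal_density (u * x)) * (f (u * x) * ennreal (nd P (u * x))))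
     = (ennreal u * (ennreal (std_normal_density (u * x)) * ennreal (nd P (u * x)))) * f (u * x)"
    by (simp only: mult_ac)
   ultimately show "ennreal u * (ennreal (std_normal_density (u * x)) * (f (u * x) * ennreal (nd P (u * x)))) = ennreal (std_normal_density x) * f (u * x)"
    by (simp only:)
  qed
 qed
 finally show ?thesis by (simp add: nn_integral_density u_def)
qed

definition scalew :: "real \<Rightarrow> nat set \<Rightarrow> (nat \<Rightarrow> real) \<Rightarrow> nat \<Rightarrow> real" where
 "scalew c w u = (\<lambda>i. if i \<in> w then c * u i else u i)"

lemma scalew_m [measurable]:
 assumes [measurable]: "f \<in> measurable K sq"
 shows "(\<lambda>x. scalew c w (f x)) \<in> measurable K sq"
 unfolding scalew_def by measurable

lemma nn_integral_nh:
 assumes P: "0 \<le> P" and "finite w" "f \<in> borel_measurable sq"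
 shows "(\<GG> y. f y * ennreal (nh P w y)) = (\<GG> y. f (scalew (sqrt (1 + P)) w y))"
 using assms(2,3)
proof (induction w arbitrary: f rule: finite_induct)
 case empty then show ?case by (simp add: nh_def scalew_def)
next
 case (insert j w)
 note [measurable] = insert.prems
 let ?c = "sqrt (1 + P)"
 have m [measurable]: "(\<lambda>x. ennreal (nd P (g x))) \<in> borel_measurable K" if [measurable]: "g \<in> borel_measurable K" for g and K :: "'k measure"
  unfolding nd_def by measurable
 have nh: "nh P w (y(j := x)) = nh P w y" for y x
  using insert.hyps by (auto simp: nh_def intro!: prod.cong)
 have "(\<GG> y. f y * ennreal (nh P (insert j w) y)) = (\<GG> y. (f y * ennreal (nh P w y)) * ennreal (nd P (y j)))"
 proof (rule nn_integral_cong)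
  fix y
  have "nh P (insert j w) y = nh P w y * nd P (y j)" using insert.hyps by (simp add: nh_def)
  then show "f y * ennreal (nh P (insert j w) y) = (f y * ennreal (nh P w y)) * ennreal (nd P (y j))"
   using nd_pos[OF P, of "y j"] nh_pos[OF P, of w y] by (simp add: ennreal_mult less_imp_le mult.assoc)
 qed
 also have "\<dots> = (\<GG> y. \<integral>\<^sup>+x. (f (y(j := x)) * ennreal (nh P w y)) * ennreal (nd P x) \<partial>N01)"
  by (subst nn_integral_gseq_coord[of _ j, symmetric]) (auto simp: nh)
 also have "\<dots> = (\<GG> y. \<integral>\<^sup>+x. f (y(j := ?c * x)) * ennreal (nh P w y) \<partial>N01)"
  by (subst nn_integral_nd[OF P]) auto
 also have "\<dots> = (\<GG> y. f (y(j := ?c * y j)) * ennreal (nh P w y))"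
  by (subst (2) nn_integral_gseq_coord[of _ j, symmetric]) (auto simp: nh)
 also have "\<dots> = (\<GG> y. f ((scalew ?c w y)(j := ?c * (scalew ?c w y) j)))"
  by (rule insert.IH[of "\<lambda>y. f (y(j := ?c * y j))"]) measurable
 also have "(\<lambda>y. (scalew ?c w y)(j := ?c * (scalew ?c w y) j)) = scalew ?c (insert j w)"
  using insert.hyps by (auto simp: scalew_def fun_eq_iff)
 finally show ?case by (simp add: fun_eq_iff)
qed

lemma nn_integral_nh_1: "0 \<le> P \<Longrightarrow> finite w \<Longrightarrow> (\<GG> y. ennreal (nh P w y)) = 1"
 using nn_integral_nh[of P w "\<lambda>_. 1"] by simp

section \<open>Logarithmic inequalities and total variation\<close>

lemma nn_integral_N01_shift_sq: "(\<integral>\<^sup>+x. ennreal ((c + x)\<^sup>2) \<partial>N01) = ennreal (c\<^sup>2) + 1"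
proof -
 interpret N: prob_space N01 by (rule prob_space_N01)
 have i1: "integrable N01 (\<lambda>x. x)" "(\<integral>x. x \<partial>N01) = 0"
  using integrable_normal_moment_nz_1[of 1 0] normal_moment_nz_1[of 1 0]
  by (auto simp: integrable_density integral_density has_bochner_integral_iff)
 have i2: "integrable N01 (\<lambda>x. x\<^sup>2)" "(\<integral>x. x\<^sup>2 \<partial>N01) = 1"
  using std_normal_moment_even[of 1]
  by (auto simp: integrable_density integral_density has_bochner_integral_iff)
 have i3: "integrable N01 (\<lambda>x. (c + x)\<^sup>2)" "(\<integral>x. (c + x)\<^sup>2 \<partial>N01) = c\<^sup>2 + 1"
  using i1 i2 N.prob_space by (auto simp: power2_sum)
 show ?thesis
  using i3 by (subst nn_integral_eq_integral) (auto simp: ennreal_plus)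
qed

text \<open>Gibbs' inequality from \<open>ln u \<ge> 1 - 1 / u\<close>; any finite bound
  \<open>c\<close> on the mean of \<open>1 / f\<close> is usable, not only 1.\<close>

lemma (in prob_space) ln_lower:
 assumes [measurable]: "f \<in> borel_measurable M" and pos: "\<And>x. x \<in> space M \<Longrightarrow> 0 < f x"
  and c: "(\<integral>\<^sup>+x. ennreal (1 / f x) \<partial>M) \<le> ennreal c" "0 \<le> c" and i: "integrable M (\<lambda>x. ln (f x))"
 shows "1 - c \<le> expectation (\<lambda>x. ln (f x))"
proof -
 have b: "integrable M (\<lambda>x. 1 / f x)"
  using c pos by (intro integrableI_nn_integral_finite[where x="enn2real (\<integral>\<^sup>+x. ennreal (1 / f x) \<partial>M)"])
   (auto simp: less_top[symmetric] top_unique intro!: AE_I2 less_imp_le ennreal_enn2real[symmetric])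
 have "expectation (\<lambda>x. 1 / f x) \<le> c"
  using c pos enn2real_mono[of _ "ennreal c"] by (subst integral_eq_nn_integral) (auto intro!: AE_I2 less_imp_le)
 have "1 - c \<le> 1 - expectation (\<lambda>x. 1 / f x)" using \<open>expectation (\<lambda>x. 1 / f x) \<le> c\<close> by simp
 also have "\<dots> = expectation (\<lambda>x. 1 - 1 / f x)" using b prob_space by simp
 also have "\<dots> \<le> expectation (\<lambda>x. ln (f x))"
 proof (rule integral_mono)
  fix x assume "x \<in> space M"
  then show "1 - 1 / f x \<le> ln (f x)" using ln_add_one_self_le_self2[of "1 / f x - 1"] pos[of x]
   by (simp add: ln_div)
 qed (use b i in auto)
 finally show ?thesis .
qed

text \<open>The negative part of the logarithm is at most \<open>1 / f\<close>, the positive part is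
  bounded through \<open>g\<close>.\<close>

lemma (in prob_space) ln_integrable:
 assumes [measurable]: "f \<in> borel_measurable M" and pos: "\<And>x. x \<in> space M \<Longrightarrow> 0 < f x"
  and c: "(\<integral>\<^sup>+x. ennreal (1 / f x) \<partial>M) \<le> ennreal c"
  and g: "integrable M g" "\<And>x. x \<in> space M \<Longrightarrow> ln (f x) \<le> g x"
 shows "integrable M (\<lambda>x. ln (f x))"
proof -
 have b: "integrable M (\<lambda>x. 1 / f x)"
  using c pos by (intro integrableI_nn_integral_finite[where x="enn2real (\<integral>\<^sup>+x. ennreal (1 / f x) \<partial>M)"])
   (auto simp: less_top[symmetric] top_unique intro!: AE_I2 less_imp_le ennreal_enn2real[symmetric])
 show ?thesis
 proof (rule Bochner_Integration.integrable_bound)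
  show "integrable M (\<lambda>x. \<bar>g x\<bar> + 1 / f x)" using g b by auto
  show "AE x in M. norm (ln (f x)) \<le> norm (\<bar>g x\<bar> + 1 / f x)"
  proof (rule AE_I2)
   fix x assume x: "x \<in> space M"
   have "- ln (f x) = ln (1 / f x)" using pos[OF x] by (simp add: ln_div)
   also have "\<dots> \<le> 1 / f x" using pos[OF x] ln_le_minus_one[of "1 / f x"] by simp
   finally have "\<bar>ln (f x)\<bar> \<le> \<bar>g x\<bar> + 1 / f x"
    using g(2)[OF x] pos[OF x] divide_pos_pos[of 1 "f x"] by (intro abs_leI) linarith+
   then show "norm (ln (f x)) \<le> norm (\<bar>g x\<bar> + 1 / f x)" by simp
  qed
 qed measurable
qed

lemma ennreal_power2_le_imp_le:
 fixes a b :: ennreal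
 assumes "a\<^sup>2 \<le> b\<^sup>2" "b < top"
 shows "a \<le> b"
proof (rule ccontr)
 assume "\<not> a \<le> b"
 then have ab: "b < a" by simp
 have "b * b < a * a"
 proof (cases "b = 0")
  case True then show ?thesis using ab by (simp add: zero_less_iff_neq_zero)
 next
  case False
  then have "b * b < a * b" using ab assms(2) by (intro ennreal_mult_strict_right_mono) (auto simp: zero_less_iff_neq_zero)
  also have "\<dots> \<le> a * a" using ab by (intro mult_left_mono) auto
  finally show ?thesis .
 qed
 then show False using assms(1) by (simp add: power2_eq_square)
qed

text \<open>A Pinsker-type bound through the Hellinger distance. Write
  \<open>1 - f = (1 - sqrt f) * (1 + sqrt f)\<close> and apply Cauchy-Schwarz: the first factor has
  second moment \<open>2 - 2 * E (sqrt f) \<le> d\<close> because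
  \<open>ln (sqrt f) \<le> sqrt f - 1\<close>, the second has second moment at most 4.\<close>

lemma (in prob_space) ratio_L1_close:
 assumes [measurable]: "f \<in> borel_measurable M" and pos: "\<And>x. x \<in> space M \<Longrightarrow> 0 < f x"
  and c: "(\<integral>\<^sup>+x. ennreal (f x) \<partial>M) = 1"
  and i: "integrable M (\<lambda>x. ln (f x))" "expectation (\<lambda>x. - ln (f x)) \<le> d" "0 \<le> d"
 shows "(\<integral>\<^sup>+x. ennreal \<bar>1 - f x\<bar> \<partial>M) \<le> ennreal (2 * sqrt d)"
proof -
 have f: "integrable M f"
  using c pos by (intro integrableI_nn_integral_finite[where x=1]) (auto intro!: AE_I2 less_imp_le)
 have Ef: "expectation f = 1"
  using c pos by (subst integral_eq_nn_integral) (auto intro!: AE_I2 less_imp_le)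
 define h where "h x = sqrt (f x)" for x
 have h_m [measurable]: "h \<in> borel_measurable M" unfolding h_def by measurable
 have h2: "(h x)\<^sup>2 = f x" if "x \<in> space M" for x using pos[OF that] by (simp add: h_def)
 have hi: "integrable M h"
 proof (rule Bochner_Integration.integrable_bound[of M "\<lambda>x. 1 + f x"])
  show "AE x in M. norm (h x) \<le> norm (1 + f x)"
  proof (rule AE_I2)
   fix x assume x: "x \<in> space M"
   have "(h x - 1 / 2)\<^sup>2 = (h x)\<^sup>2 - h x + 1 / 4" by (simp add: power2_eq_square algebra_simps)
   then have "h x \<le> 1 + f x" using h2[OF x] zero_le_power2[of "h x - 1 / 2"] by linarith
   then show "norm (h x) \<le> norm (1 + f x)" using pos[OF x] by (simp add: h_def)
  qed
  show "integrable M (\<lambda>x. 1 + f x)" using f by simp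
 qed (rule h_m)
 have Eh: "1 - d / 2 \<le> expectation h"
 proof -
  have "1 - d / 2 \<le> expectation (\<lambda>x. 1 + ln (f x) / 2)" using i prob_space by simp
  also have "\<dots> \<le> expectation h"
  proof (rule integral_mono)
   fix x assume x: "x \<in> space M"
   have "ln (h x) \<le> h x - 1" using pos[OF x] by (intro ln_le_minus_one) (simp add: h_def)
   then show "1 + ln (f x) / 2 \<le> h x" using pos[OF x] by (simp add: h_def ln_sqrt)
  qed (use i hi in auto)
  finally show ?thesis .
 qed
 define u v where "u x = \<bar>1 - h x\<bar>" and "v x = 1 + h x" for x
 have [measurable]: "u \<in> borel_measurable M" "v \<in> borel_measurable M" unfolding u_def v_def by measurable
 have ui: "integrable M (\<lambda>x. (u x)\<^sup>2)" and Eu: "expectation (\<lambda>x. (u x)\<^sup>2) \<le> d"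
 proof -
  have eq: "(u x)\<^sup>2 = 1 - 2 * h x + f x" if "x \<in> space M" for x
   using h2[OF that] by (simp add: u_def power2_diff)
  show "integrable M (\<lambda>x. (u x)\<^sup>2)" by (subst Bochner_Integration.integrable_cong[OF refl eq]) (use hi f in auto)
  show "expectation (\<lambda>x. (u x)\<^sup>2) \<le> d"
   by (subst Bochner_Integration.integral_cong[OF refl eq]) (use hi f Ef Eh prob_space in auto)
 qed
 have vi: "integrable M (\<lambda>x. (v x)\<^sup>2)" and Ev: "expectation (\<lambda>x. (v x)\<^sup>2) \<le> 4"
 proof -
  have eq: "(v x)\<^sup>2 = 1 + 2 * h x + f x" if "x \<in> space M" for x
   using h2[OF that] by (simp add: v_def power2_sum)
  have "expectation h \<le> 1"
  proof -
   have "expectation h \<le> expectation (\<lambda>x. (1 + f x) / 2)"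
   proof (rule integral_mono)
    fix x assume x: "x \<in> space M"
    have "0 \<le> (h x - 1)\<^sup>2" by simp
    then show "h x \<le> (1 + f x) / 2" using h2[OF x] by (simp add: power2_diff)
   qed (use hi f in auto)
   also have "\<dots> = 1" using f Ef prob_space by simp
   finally show ?thesis .
  qed
  show "integrable M (\<lambda>x. (v x)\<^sup>2)" by (subst Bochner_Integration.integrable_cong[OF refl eq]) (use hi f in auto)
  show "expectation (\<lambda>x. (v x)\<^sup>2) \<le> 4"
   by (subst Bochner_Integration.integral_cong[OF refl eq]) (use hi f Ef \<open>expectation h \<le> 1\<close> prob_space in auto)
 qed
 have "(\<integral>\<^sup>+x. ennreal \<bar>1 - f x\<bar> \<partial>M) = (\<integral>\<^sup>+x. ennreal (u x) * ennreal (v x) \<partial>M)"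
 proof (rule nn_integral_cong)
  fix x assume x: "x \<in> space M"
  have "1 - f x = (1 - h x) * (1 + h x)" using h2[OF x] by (simp add: power2_eq_square algebra_simps)
  moreover have "0 \<le> 1 + h x" using pos[OF x] by (simp add: h_def)
  ultimately have "\<bar>1 - f x\<bar> = u x * v x" by (simp add: u_def v_def abs_mult)
  then show "ennreal \<bar>1 - f x\<bar> = ennreal (u x) * ennreal (v x)"
   using \<open>0 \<le> 1 + h x\<close> by (simp add: ennreal_mult u_def v_def)
 qed
 also have "\<dots> \<le> ennreal (2 * sqrt d)"
 proof -
  have "(\<integral>\<^sup>+x. ennreal (u x) * ennreal (v x) \<partial>M)\<^sup>2 \<le> (\<integral>\<^sup>+x. (ennreal (u x))\<^sup>2 \<partial>M) * (\<integral>\<^sup>+x. (ennreal (v x))\<^sup>2 \<partial>M)"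
   by (rule Cauchy_Schwarz_nn_integral) auto
  also have "(\<integral>\<^sup>+x. (ennreal (u x))\<^sup>2 \<partial>M) = ennreal (expectation (\<lambda>x. (u x)\<^sup>2))"
  proof -
   have "0 \<le> u x" for x by (simp add: u_def)
   then show ?thesis
    using ui by (subst nn_integral_eq_integral[symmetric]) (auto simp: ennreal_power intro!: nn_integral_cong)
  qed
  also have "(\<integral>\<^sup>+x. (ennreal (v x))\<^sup>2 \<partial>M) = ennreal (expectation (\<lambda>x. (v x)\<^sup>2))"
  proof -
   have "0 \<le> v x" if "x \<in> space M" for x using pos[OF that] by (simp add: v_def h_def)
   then show ?thesis
    using vi by (subst nn_integral_eq_integral[symmetric]) (auto simp: ennreal_power intro!: nn_integral_cong)
  qed
  also have "ennreal (expectation (\<lambda>x. (u x)\<^sup>2)) * ennreal (expectation (\<lambda>x. (v x)\<^sup>2)) \<le> ennreal d * ennreal 4"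
   by (intro mult_mono ennreal_leI Eu Ev) auto
  also have "\<dots> = ennreal (d * 4)" using i(3) by (rule ennreal_mult[symmetric]) simp
  also have "d * 4 = (2 * sqrt d)\<^sup>2" using i(3) by (simp add: power_mult_distrib)
  also have "ennreal ((2 * sqrt d)\<^sup>2) = (ennreal (2 * sqrt d))\<^sup>2" using i(3) by (subst ennreal_power) auto
  finally show ?thesis by (rule ennreal_power2_le_imp_le) simp
 qed
 finally show ?thesis .
qed

section \<open>The Gibbs inequality along the loop\<close>

text \<open>The static data is a pair of the initial state \<open>x\<close> and all other noise
  \<open>h\<close>. \<open>gk\<close> stands for a Gaussian factor of the state after
  \<open>k\<close> rounds: stability enters through \<open>gk_ln\<close>, the expansion rate
  \<open>al\<close> per round through \<open>gibbs\<close>. \<open>cap\<close> negates the bound to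
  be proved.\<close>

locale info_loop = closed_loop "density lborel (\<lambda>x. ennreal (p x)) \<Otimes>\<^sub>M H" e s M A V Z T Y
 for p :: "'x::euclidean_space \<Rightarrow> real" and H :: "'h measure" and e s and M :: "'w measure" and A V Z T Y +
 fixes P Ce c0 Kg al :: real
  and gk :: "nat \<Rightarrow> 'x \<times> 'h \<Rightarrow> (nat \<Rightarrow> real) \<Rightarrow> (nat \<Rightarrow> real) \<Rightarrow> real"
 assumes H: "prob_space H" and p_m [measurable]: "p \<in> borel_measurable borel"
  and p_nonneg: "\<And>x. 0 \<le> p x" and p_prob: "prob_space (density lborel (\<lambda>x. ennreal (p x)))"
  and p_ent: "integrable lborel (\<lambda>x. p x * ln (p x))"
  and param: "0 \<le> P" "0 \<le> Ce" "0 \<le> c0" "0 < al" "0 \<le> Kg"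
  and s_pow: "\<And>n. (\<integral>\<^sup>+om. ennreal ((s n (A om) (T om))\<^sup>2) \<partial>M) = ennreal P"
  and e_pow: "\<And>n. (\<integral>\<^sup>+om. ennreal ((e n (A om) (Y om))\<^sup>2) \<partial>M) \<le> ennreal Ce"
  and gk_meas: "\<And>k. (\<lambda>(a, t, y). gk k a t y) \<in> borel_measurable ((borel \<Otimes>\<^sub>M H) \<Otimes>\<^sub>M sq \<Otimes>\<^sub>M sq)"
  and gk_bounds: "\<And>k a t y. 0 < gk k a t y" "\<And>k a t y. gk k a t y \<le> 1"
  and gk_causal: "\<And>k a t y t' y'. (\<And>i. i < k \<Longrightarrow> t i = t' i) \<Longrightarrow> (\<And>i. i < k \<Longrightarrow> y i = y' i) \<Longrightarrow> gk k a t y = gk k a t' y'"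
  and gk_ln: "\<And>k. (\<integral>\<^sup>+om. ennreal (- ln (gk k (A om) (T om) (Y om))) \<partial>M) \<le> ennreal Kg"
  and gibbs: "\<And>k. (\<integral>\<^sup>+h. (\<GG> t. \<GG> y. \<LL> x. ennreal (gk k (x, h) t y * re {..<k} (x, h) t y * nh P {..<k} y)) \<partial>H)
   \<le> ennreal (c0 * exp (- (real k * al)))"
  and cap: "ln (1 + P) / 2 \<le> al"
begin

abbreviation M0 :: "('x \<times> 'h) measure" where
 "M0 \<equiv> density lborel (\<lambda>x. ennreal (p x)) \<Otimes>\<^sub>M H"

lemma sets_M0 [measurable_cong]: "sets M0 = sets (borel \<Otimes>\<^sub>M H)"
 by (intro sets_pair_measure_cong) auto

lemma gk_comp [measurable]:
 assumes [measurable]: "f \<in> measurable K M0" "g \<in> measurable K sq" "h \<in> measurable K sq"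
 shows "(\<lambda>x. gk k (f x) (g x) (h x)) \<in> borel_measurable K"
proof -
 have "f \<in> measurable K (borel \<Otimes>\<^sub>M H)" using assms(1) by (simp cong: measurable_cong_sets add: sets_M0)
 then show ?thesis
  using measurable_compose[OF measurable_Pair[OF _ measurable_Pair[OF assms(2,3)]] gk_meas[of k]] by simp
qed

lemma sf_H: "sigma_finite_measure H"
 using H by (rule prob_space_imp_sigma_finite)

lemma sf_p: "sigma_finite_measure (density lborel (\<lambda>x. ennreal (p x)))"
 using p_prob by (rule prob_space_imp_sigma_finite)

lemma nn_M0:
 assumes [measurable]: "F \<in> borel_measurable M0"
 shows "(\<integral>\<^sup>+a. F a \<partial>M0) = (\<integral>\<^sup>+h. (\<LL> x. ennreal (p x) * F (x, h)) \<partial>H)"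
proof -
 interpret pair_sigma_finite "density lborel (\<lambda>x. ennreal (p x))" H
  using sf_H sf_p by (simp add: pair_sigma_finite_def)
 have "(\<integral>\<^sup>+a. F a \<partial>M0) = (\<integral>\<^sup>+h. \<integral>\<^sup>+x. F (x, h) \<partial>density lborel (\<lambda>x. ennreal (p x)) \<partial>H)"
  by (subst nn_integral_snd[symmetric]) auto
 also have "\<dots> = (\<integral>\<^sup>+h. (\<LL> x. ennreal (p x) * F (x, h)) \<partial>H)"
 proof (rule nn_integral_cong)
  fix h assume [measurable]: "h \<in> space H"
  have "(\<lambda>x. F (x, h)) \<in> borel_measurable borel"
   by (rule measurable_compose[OF _ assms]) (simp cong: measurable_cong_sets add: sets_M0)
  then show "(\<integral>\<^sup>+x. F (x, h) \<partial>density lborel (\<lambda>x. ennreal (p x))) = (\<LL> x. ennreal (p x) * F (x, h))"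
   by (subst nn_integral_density) auto
 qed
 finally show ?thesis .
qed

lemma emeasure_H [simp]: "emeasure H (space H) = 1"
 using H by (rule prob_space.emeasure_space_1)

lemma Z_dist:
 assumes [measurable]: "f \<in> borel_measurable sq"
 shows "(\<integral>\<^sup>+om. f (Z om) \<partial>M) = (\<GG> z. f z)" "(\<integral>\<^sup>+om. f (V om) \<partial>M) = (\<GG> z. f z)"
 using nn_integral_static[of "\<lambda>(a, v, z). f z"] nn_integral_static[of "\<lambda>(a, v, z). f v"] by (simp_all add: emeasure_space_1)

section \<open>Moments of the loop signals\<close>

lemma x_int: "integrable M (\<lambda>om. ln (p (fst (A om))))"
proof -
 have fstA [measurable]: "(\<lambda>om. fst (A om)) \<in> borel_measurable M"
  using measurable_compose[OF A measurable_fst] by (simp cong: measurable_cong_sets)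
 have "(\<integral>\<^sup>+om. ennreal \<bar>ln (p (fst (A om)))\<bar> \<partial>M) = (\<integral>\<^sup>+a. ennreal \<bar>ln (p (fst a))\<bar> \<partial>M0)"
  using nn_integral_static[of "\<lambda>(a, v, z). ennreal \<bar>ln (p (fst a))\<bar>"] by simp
 also have "\<dots> = (\<integral>\<^sup>+h. (\<LL> x. ennreal (p x) * ennreal \<bar>ln (p x)\<bar>) \<partial>H)"
  by (subst nn_M0) auto
 also have "\<dots> = (\<LL> x. ennreal (norm (p x * ln (p x))))"
  by (simp add: abs_mult ennreal_mult p_nonneg)
 also have "\<dots> < \<infinity>" using p_ent by (simp add: integrable_iff_bounded)
 finally show ?thesis by (intro integrableI_bounded) auto
qed

lemma p_fstA: "AE om in M. 0 < p (fst (A om))"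
proof -
 have fstA [measurable]: "(\<lambda>om. fst (A om)) \<in> borel_measurable M"
  using measurable_compose[OF A measurable_fst] by (simp cong: measurable_cong_sets)
 have "(\<integral>\<^sup>+om. indicator {x. p x = 0} (fst (A om)) \<partial>M) = (\<integral>\<^sup>+a. indicator {x. p x = 0} (fst a) \<partial>M0)"
  using nn_integral_static[of "\<lambda>(a, v, z). indicator {x. p x = 0} (fst a)"] by simp
 also have "\<dots> = (\<integral>\<^sup>+h. (\<LL> x. ennreal (p x) * indicator {x. p x = 0} x) \<partial>H)"
  by (subst nn_M0) auto
 also have "\<dots> = (\<integral>\<^sup>+h. (\<LL> (x::'x). 0) \<partial>H)"
  by (intro nn_integral_cong) (auto split: split_indicator)
 finally have "(\<integral>\<^sup>+om. indicator {x. p x = 0} (fst (A om)) \<partial>M) = 0" by simp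
 then have "AE om in M. indicator {x. p x = 0} (fst (A om)) = (0::ennreal)"
  by (subst (asm) nn_integral_0_iff_AE) auto
 then show ?thesis
 proof eventually_elim
  fix om assume "indicator {x. p x = 0} (fst (A om)) = (0::ennreal)"
  then have "p (fst (A om)) \<noteq> 0" by (simp add: indicator_def split: if_splits)
  then show "0 < p (fst (A om))" using p_nonneg[of "fst (A om)"] by simp
 qed
qed

lemma fst_sol_upd:
 "k \<le> n \<Longrightarrow> sol k a v (z(n := u)) = (fst (sol k a v z), (snd (sol k a v z))(n := u))"
proof (induction k)
 case (Suc k)
 have "e k a ((snd (sol k a v z))(n := u)) = e k a (snd (sol k a v z))"
  using Suc.prems by (intro e_causal) auto
 note ee = this
 have kn: "k \<noteq> n" "n \<noteq> k" "k \<le> n" using Suc.prems by auto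
 show ?case
  unfolding sol.simps Suc.IH[OF kn(3)] Let_def fst_conv snd_conv ee fun_upd_other[OF kn(1)] fun_upd_twist[OF kn(2)] ..
qed simp

text \<open>The noise \<open>z n\<close> is independent of everything entering \<open>s n\<close>,
  so resampling this one coordinate adds signal power and noise power.\<close>

lemma Y_sq: "(\<integral>\<^sup>+om. ennreal ((Y om n)\<^sup>2) \<partial>M) = ennreal (P + 1)"
proof -
 define S where "S a v z = s n a (fst (sol (Suc n) a v z))" for a v z
 have S_m [measurable]: "(\<lambda>x. S (f x) (g x) (h x)) \<in> borel_measurable K"
  if [measurable]: "f \<in> measurable K M0" "g \<in> measurable K sq" "h \<in> measurable K sq" for f g h and K :: "'k measure"
  unfolding S_def by measurable
 have S_upd: "S a v (z(n := u)) = S a v z" for a v z u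
  using fst_sol_upd[of n n a v z u] e_causal[of n "(snd (sol n a v z))(n := u)" "snd (sol n a v z)" a]
  by (simp add: S_def Let_def)
 have S: "S (A om) (V om) (Z om) = s n (A om) (T om)" if "om \<in> space M" for om
  unfolding S_def using sol_TY(1)[OF that, of _ "Suc n"] by (intro s_causal) simp
 have "(\<integral>\<^sup>+om. ennreal ((Y om n)\<^sup>2) \<partial>M) = (\<integral>\<^sup>+om. (\<lambda>(a, v, z). ennreal ((S a v z + z n)\<^sup>2)) (A om, V om, Z om) \<partial>M)"
  using S Y_eq by (intro nn_integral_cong) simp
 also have "\<dots> = (\<integral>\<^sup>+a. (\<GG> v. \<GG> z. ennreal ((S a v z + z n)\<^sup>2)) \<partial>M0)"
  by (subst nn_integral_static) auto
 also have "\<dots> = (\<integral>\<^sup>+a. (\<GG> v. \<GG> z. ennreal ((S a v z)\<^sup>2) + 1) \<partial>M0)"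
 proof (rule nn_integral_cong, rule nn_integral_cong)
  fix a v assume [measurable]: "a \<in> space M0"
  have [measurable]: "v \<in> space sq" by simp
  have "(\<GG> z. ennreal ((S a v z + z n)\<^sup>2)) = (\<GG> z. \<integral>\<^sup>+u. ennreal ((S a v z + u)\<^sup>2) \<partial>N01)"
   by (subst nn_integral_gseq_coord[of _ n, symmetric]) (auto simp: S_upd)
  then show "(\<GG> z. ennreal ((S a v z + z n)\<^sup>2)) = (\<GG> z. ennreal ((S a v z)\<^sup>2) + 1)"
   by (simp add: nn_integral_N01_shift_sq)
 qed
 also have "\<dots> = (\<integral>\<^sup>+om. (\<lambda>(a, v, z). ennreal ((S a v z)\<^sup>2) + 1) (A om, V om, Z om) \<partial>M)"
  by (subst nn_integral_static) auto
 also have "\<dots> = (\<integral>\<^sup>+om. ennreal ((s n (A om) (T om))\<^sup>2) + 1 \<partial>M)"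
  using S by (intro nn_integral_cong) simp
 also have "\<dots> = ennreal P + 1"
  by (subst nn_integral_add) (auto simp: s_pow W.emeasure_space_1)
 finally show ?thesis using param by (simp add: ennreal_plus)
qed

lemma Y_int: "integrable M (\<lambda>om. (Y om n)\<^sup>2)" "W.expectation (\<lambda>om. (Y om n)\<^sup>2) = P + 1"
proof -
 show i: "integrable M (\<lambda>om. (Y om n)\<^sup>2)"
  using Y_sq by (intro integrableI_nn_integral_finite[of _ _ "P + 1"]) auto
 show "W.expectation (\<lambda>om. (Y om n)\<^sup>2) = P + 1"
  using Y_sq[of n] param by (subst integral_eq_nn_integral) auto
qed

lemma Z_int: "integrable M (\<lambda>om. (Z om n)\<^sup>2)" "W.expectation (\<lambda>om. (Z om n)\<^sup>2) = 1"
proof -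
 have Z2: "(\<integral>\<^sup>+om. ennreal ((Z om n)\<^sup>2) \<partial>M) = 1"
  using Z_dist(1)[of "\<lambda>z. ennreal ((z n)\<^sup>2)"] nn_integral_gseq_coord1[of "\<lambda>x. ennreal (x\<^sup>2)" n] nn_integral_N01_sq by simp
 show i: "integrable M (\<lambda>om. (Z om n)\<^sup>2)"
  using Z2 by (intro integrableI_nn_integral_finite[of _ _ 1]) auto
 show "W.expectation (\<lambda>om. (Z om n)\<^sup>2) = 1"
  using Z2 by (subst integral_eq_nn_integral) auto
qed

definition Qw :: "nat set \<Rightarrow> 'w \<Rightarrow> real" where
 "Qw w om = (\<Sum>j\<in>w. (Y om j)\<^sup>2 / (1 + P) - (Z om j)\<^sup>2) / 2"

text \<open>The mean vanishes because the output power is exactly \<open>1 + P\<close>; the drift of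
  \<open>LL k\<close> is then \<open>ln (1 + P) / 2 - al\<close> per round.\<close>

lemma Qw_int: "integrable M (Qw w)" and Qw_exp: "W.expectation (Qw w) = 0"
 using Y_int Z_int param by (auto simp: Qw_def[abs_def])

lemma Qw_m [measurable]: "Qw w \<in> borel_measurable M"
 using Qw_int by auto

lemma lng_int: "integrable M (\<lambda>om. ln (gk k (A om) (T om) (Y om)))"
 and lng_exp: "W.expectation (\<lambda>om. - ln (gk k (A om) (T om) (Y om))) \<le> Kg"
proof -
 have nonneg: "0 \<le> - ln (gk k (A om) (T om) (Y om))" for om
  using gk_bounds[of k] by (simp add: ln_le_zero_iff)
 have "integrable M (\<lambda>om. - ln (gk k (A om) (T om) (Y om)))"
  using gk_ln[of k] nonneg
  by (intro integrableI_bounded) (auto simp: less_top[symmetric] top_unique)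
 then show "integrable M (\<lambda>om. ln (gk k (A om) (T om) (Y om)))" by simp
 show "W.expectation (\<lambda>om. - ln (gk k (A om) (T om) (Y om))) \<le> Kg"
  using gk_ln[of k] nonneg param enn2real_mono[OF gk_ln[of k]]
  by (subst integral_eq_nn_integral) auto
qed

text \<open>Logarithm of the loop density \<open>p * re * ls\<close> over the comparison density
  \<open>exp (k * al) * gk * re * nh\<close>: the factor \<open>re\<close> cancels, and
  \<open>ls / nh\<close> is expressed by \<open>Qw\<close> (see \<open>ratio_eq\<close>).\<close>

definition LL :: "nat \<Rightarrow> 'w \<Rightarrow> real" where
 "LL k om = ln (p (fst (A om))) + Qw {..<k} om + real k * (ln (1 + P) / 2 - al) - ln (gk k (A om) (T om) (Y om))"

definition K1 :: real where "K1 = W.expectation (\<lambda>om. ln (p (fst (A om)))) + Kg"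

lemma LL_int: "integrable M (LL k)"
 unfolding LL_def[abs_def] using x_int Qw_int lng_int by auto

lemma LL_m [measurable]: "LL k \<in> borel_measurable M"
 using LL_int by auto

lemma LL_exp: "W.expectation (LL k) \<le> K1 + real k * (ln (1 + P) / 2 - al)"
proof -
 have "W.expectation (LL k) = W.expectation (\<lambda>om. ln (p (fst (A om)))) + W.expectation (Qw {..<k})
   + real k * (ln (1 + P) / 2 - al) - W.expectation (\<lambda>om. ln (gk k (A om) (T om) (Y om)))"
  unfolding LL_def[abs_def] using x_int Qw_int lng_int W.prob_space by simp
 then show ?thesis using lng_exp[of k] Qw_exp by (simp add: K1_def)
qed

text \<open>On the loop \<open>s = y - z\<close>, so
  \<open>gl s y = exp ((y\<^sup>2 - z\<^sup>2) / 2)\<close>; combined with \<open>nd\<close> this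
  leaves the normalised energy.\<close>

lemma ratio_eq:
 assumes om: "om \<in> space M" and w: "finite w"
 shows "nh P w (Y om) / ls w (A om) (T om) (Y om) = exp (- (Qw w om + real (card w) * (ln (1 + P) / 2)))"
proof -
 have "nd P (Y om j) / gl (s j (A om) (T om)) (Y om j) = exp (- (((Y om j)\<^sup>2 / (1 + P) - (Z om j)\<^sup>2) / 2 + ln (1 + P) / 2))" for j
 proof -
  have s: "s j (A om) (T om) = Y om j - Z om j" using Y_eq[OF om, of j] by simp
  have P1: "1 / sqrt (1 + P) = exp (- (ln (1 + P) / 2))"
   using param by (simp add: exp_minus ln_sqrt[symmetric] inverse_eq_divide)
  have P2: "P / (1 + P) = 1 - 1 / (1 + P)" using param by (simp add: field_simps)
  have "nd P (Y om j) / gl (s j (A om) (T om)) (Y om j)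
   = exp (P / (1 + P) * (Y om j)\<^sup>2 / 2) * (1 / sqrt (1 + P)) / exp ((Y om j - Z om j) * Y om j - (Y om j - Z om j)\<^sup>2 / 2)"
   by (simp add: nd_def gl_def s)
  also have "\<dots> = exp (P / (1 + P) * (Y om j)\<^sup>2 / 2 + - (ln (1 + P) / 2) - ((Y om j - Z om j) * Y om j - (Y om j - Z om j)\<^sup>2 / 2))"
   unfolding P1 by (simp only: exp_diff exp_add)
  also have "P / (1 + P) * (Y om j)\<^sup>2 / 2 + - (ln (1 + P) / 2) - ((Y om j - Z om j) * Y om j - (Y om j - Z om j)\<^sup>2 / 2)
   = - (((Y om j)\<^sup>2 / (1 + P) - (Z om j)\<^sup>2) / 2 + ln (1 + P) / 2)"
   unfolding P2 by (simp add: power2_eq_square algebra_simps diff_divide_distrib add_divide_distrib)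
  finally show ?thesis .
 qed
 then have "nh P w (Y om) / ls w (A om) (T om) (Y om) = exp (\<Sum>j\<in>w. - (((Y om j)\<^sup>2 / (1 + P) - (Z om j)\<^sup>2) / 2 + ln (1 + P) / 2))"
  using w by (simp add: nh_def ls_def prod_dividef[symmetric] exp_sum)
 also have "(\<Sum>j\<in>w. - (((Y om j)\<^sup>2 / (1 + P) - (Z om j)\<^sup>2) / 2 + ln (1 + P) / 2)) = - (Qw w om + real (card w) * (ln (1 + P) / 2))"
  by (simp only: Qw_def sum_negf sum.distrib sum_divide_distrib[symmetric] sum_constant)
 finally show ?thesis .
qed

text \<open>Change of measure from the loop to the comparison density. The extra factor
  \<open>F\<close> allows further likelihood ratios to be compared in the same way.\<close>

lemma nn_exp_LL:
 assumes [measurable]: "(\<lambda>(a, t, y). F a t y) \<in> borel_measurable (M0 \<Otimes>\<^sub>M sq \<Otimes>\<^sub>M sq)"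
  and F_causal: "\<And>a t y t' y'. (\<And>i. i < k \<Longrightarrow> t i = t' i) \<Longrightarrow> (\<And>i. i < k \<Longrightarrow> y i = y' i) \<Longrightarrow> F a t y = F a t' y'"
 shows "(\<integral>\<^sup>+om. ennreal (exp (- LL k om)) * F (A om) (T om) (Y om) \<partial>M)
  \<le> ennreal (exp (real k * al)) * (\<integral>\<^sup>+h. (\<GG> t. \<GG> y. \<LL> x. ennreal (gk k (x, h) t y * re {..<k} (x, h) t y * nh P {..<k} y) * F (x, h) t y) \<partial>H)"
proof -
 define G where "G = (\<lambda>(a, t, y). ennreal (gk k a t y * nh P {..<k} y / (p (fst a) * ls {..<k} a t y)) * F a t y)"
 have F_m [measurable]: "(\<lambda>x. F (f x) (g x) (h x)) \<in> borel_measurable K"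
  if "f \<in> measurable K M0" "g \<in> measurable K sq" "h \<in> measurable K sq" for f g h and K :: "'k measure"
  using measurable_compose[OF measurable_Pair[OF that(1) measurable_Pair[OF that(2,3)]] assms(1)] by simp
 have fst_m [measurable]: "(\<lambda>x. p (fst (f x))) \<in> borel_measurable K" if [measurable]: "f \<in> measurable K M0" for f and K :: "'k measure"
 proof -
  have "(\<lambda>x. fst (f x)) \<in> borel_measurable K"
   using measurable_compose[OF that measurable_fst] by (simp cong: measurable_cong_sets)
  then show ?thesis by measurable
 qed
 have G_m [measurable]: "G \<in> borel_measurable (M0 \<Otimes>\<^sub>M sq \<Otimes>\<^sub>M sq)" unfolding G_def by measurable
 have "(\<integral>\<^sup>+om. ennreal (exp (- LL k om)) * F (A om) (T om) (Y om) \<partial>M) = (\<integral>\<^sup>+om. ennreal (exp (real k * al)) * G (A om, T om, Y om) \<partial>M)"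
 proof (rule nn_integral_cong_AE)
  show "AE om in M. ennreal (exp (- LL k om)) * F (A om) (T om) (Y om) = ennreal (exp (real k * al)) * G (A om, T om, Y om)"
   using p_fstA AE_space
  proof eventually_elim
   fix om assume p: "0 < p (fst (A om))" and om: "om \<in> space M"
   have "exp (- LL k om) = exp (real k * al) * (gk k (A om) (T om) (Y om) * exp (- (Qw {..<k} om + real k * (ln (1 + P) / 2))) / p (fst (A om)))"
   proof -
    have "- LL k om = (real k * al + (ln (gk k (A om) (T om) (Y om)) + - (Qw {..<k} om + real k * (ln (1 + P) / 2)))) - ln (p (fst (A om)))"
     by (simp add: LL_def algebra_simps)
    then show ?thesis using p gk_bounds(1)[of k "A om"] by (simp only: exp_diff exp_add exp_ln) simp
   qed
   also have "exp (- (Qw {..<k} om + real k * (ln (1 + P) / 2))) = nh P {..<k} (Y om) / ls {..<k} (A om) (T om) (Y om)"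
    using ratio_eq[OF om, of "{..<k}"] by simp
   finally have eq: "exp (- LL k om) = exp (real k * al)
     * (gk k (A om) (T om) (Y om) * nh P {..<k} (Y om) / (p (fst (A om)) * ls {..<k} (A om) (T om) (Y om)))"
    by (simp add: mult.commute)
   have "0 \<le> gk k (A om) (T om) (Y om) * nh P {..<k} (Y om) / (p (fst (A om)) * ls {..<k} (A om) (T om) (Y om))"
    using p gk_bounds(1)[of k "A om"] nh_pos[OF param(1), of "{..<k}"] ls_pos[of "{..<k}" "A om"]
    by (intro divide_nonneg_nonneg mult_nonneg_nonneg) (auto simp: less_imp_le)
   then show "ennreal (exp (- LL k om)) * F (A om) (T om) (Y om) = ennreal (exp (real k * al)) * G (A om, T om, Y om)"
    unfolding eq G_def prod.case by (subst ennreal_mult) (auto simp: mult.assoc)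
  qed
 qed
 also have "\<dots> = ennreal (exp (real k * al)) * (\<integral>\<^sup>+om. G (A om, T om, Y om) \<partial>M)"
  by (rule nn_integral_cmult) measurable
 also have "(\<integral>\<^sup>+om. G (A om, T om, Y om) \<partial>M) = (\<integral>\<^sup>+a. (\<GG> t. \<GG> y. G (a, t, y) * ennreal (L k a t y)) \<partial>M0)"
 proof (rule nn_integral_loop[OF G_m])
  fix a t y t' y' assume *: "\<And>i. i < k \<Longrightarrow> t i = (t' i :: real)" "\<And>i. i < k \<Longrightarrow> y i = (y' i :: real)"
  have "nh P {..<k} y = nh P {..<k} y'" unfolding nh_def using * by simp
  moreover have "ls {..<k} a t y = ls {..<k} a t' y'" using * by (intro ls_cong) auto
  ultimately show "G (a, t, y) = G (a, t', y')"
   using F_causal[of t t' y y' a] gk_causal[of k t t' y y' a] * by (simp add: G_def)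
 qed
 also have "\<dots> = (\<integral>\<^sup>+h. (\<LL> x. ennreal (p x) * (\<GG> t. \<GG> y. G ((x, h), t, y) * ennreal (L k (x, h) t y))) \<partial>H)"
  by (subst nn_M0) auto
 also have "\<dots> \<le> (\<integral>\<^sup>+h. (\<LL> x. \<GG> t. \<GG> y. ennreal (gk k (x, h) t y * re {..<k} (x, h) t y * nh P {..<k} y) * F (x, h) t y) \<partial>H)"
 proof (rule nn_integral_mono, rule nn_integral_mono)
  fix h x assume h [measurable]: "h \<in> space H"
  then have [measurable]: "(x, h) \<in> space M0" by (simp add: space_pair_measure)
  have "ennreal (p x) * (\<GG> t. \<GG> y. G ((x, h), t, y) * ennreal (L k (x, h) t y))
   = (\<GG> t. \<GG> y. ennreal (p x) * (G ((x, h), t, y) * ennreal (L k (x, h) t y)))"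
   by (simp add: nn_integral_cmult cong: measurable_cong_sets)
  also have "\<dots> \<le> (\<GG> t. \<GG> y. ennreal (gk k (x, h) t y * re {..<k} (x, h) t y * nh P {..<k} y) * F (x, h) t y)"
  proof (rule nn_integral_mono, rule nn_integral_mono)
   fix t y
   show "ennreal (p x) * (G ((x, h), t, y) * ennreal (L k (x, h) t y)) \<le> ennreal (gk k (x, h) t y * re {..<k} (x, h) t y * nh P {..<k} y) * F (x, h) t y"
   \<comment> \<open>States of density zero carry mass on the comparison side only, hence the
     inequality.\<close>
   proof (cases "p x = 0")
    case False
    then have p: "0 < p x" using p_nonneg[of x] by simp
    let ?c = "gk k (x, h) t y * nh P {..<k} y / (p x * ls {..<k} (x, h) t y)"
    have c: "0 \<le> ?c" using p gk_bounds(1)[of k "(x, h)"] nh_pos[OF param(1)] ls_pos by (simp add: less_imp_le)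
    have "p x * (?c * L k (x, h) t y) = gk k (x, h) t y * re {..<k} (x, h) t y * nh P {..<k} y"
     using p ls_pos[of "{..<k}" "(x, h)" t y] by (simp add: L_def field_simps)
    then have "ennreal (p x) * (ennreal ?c * ennreal (L k (x, h) t y)) = ennreal (gk k (x, h) t y * re {..<k} (x, h) t y * nh P {..<k} y)"
     using p c L_pos[of k "(x, h)" t y] by (simp only: ennreal_mult[symmetric] less_imp_le mult_nonneg_nonneg)
    moreover have "ennreal (p x) * (G ((x, h), t, y) * ennreal (L k (x, h) t y)) = (ennreal (p x) * (ennreal ?c * ennreal (L k (x, h) t y))) * F (x, h) t y"
     by (simp add: G_def mult_ac)
    ultimately show ?thesis by simp
   qed simp
  qed
  finally show "ennreal (p x) * (\<GG> t. \<GG> y. G ((x, h), t, y) * ennreal (L k (x, h) t y))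
   \<le> (\<GG> t. \<GG> y. ennreal (gk k (x, h) t y * re {..<k} (x, h) t y * nh P {..<k} y) * F (x, h) t y)" .
 qed
 also have "\<dots> = (\<integral>\<^sup>+h. (\<GG> t. \<GG> y. \<LL> x. ennreal (gk k (x, h) t y * re {..<k} (x, h) t y * nh P {..<k} y) * F (x, h) t y) \<partial>H)"
 proof (rule nn_integral_cong)
  fix h assume h [measurable]: "h \<in> space H"
  have xh [measurable]: "(\<lambda>z. (f z, h)) \<in> measurable K M0" if [measurable]: "f \<in> borel_measurable K" for f and K :: "'k measure"
   by (simp cong: measurable_cong_sets add: sets_M0)
  let ?f = "\<lambda>x t y. ennreal (gk k (x, h) t y * re {..<k} (x, h) t y * nh P {..<k} y) * F (x, h) t y"
  have lb_m [measurable]: "(\<lambda>z. (\<LL> x. f z x)) \<in> borel_measurable K"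
   if [measurable]: "(\<lambda>(z, x). f z x) \<in> borel_measurable (K \<Otimes>\<^sub>M borel)" for f :: "'k \<Rightarrow> 'x \<Rightarrow> ennreal" and K
   by (intro sigma_finite_measure.borel_measurable_nn_integral[OF sigma_finite_lborel]) (simp cong: measurable_cong_sets)
  have "(\<LL> x. \<GG> t. \<GG> y. ?f x t y) = (\<GG> t. \<LL> x. \<GG> y. ?f x t y)"
   by (rule nn_integral_swap_lborel_gseq) measurable
  also have "\<dots> = (\<GG> t. \<GG> y. \<LL> x. ?f x t y)"
   by (rule nn_integral_cong, rule nn_integral_swap_lborel_gseq) measurable
  finally show "(\<LL> x. \<GG> t. \<GG> y. ?f x t y) = (\<GG> t. \<GG> y. \<LL> x. ?f x t y)" .
 qed
 finally show ?thesis by (simp add: mult_left_mono)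
qed

end

section \<open>The loop law with the feedback of a window removed\<close>

context info_loop
begin

abbreviation R0 :: "(('x \<times> 'h) \<times> (nat \<Rightarrow> real) \<times> (nat \<Rightarrow> real)) measure" where
 "R0 \<equiv> M0 \<Otimes>\<^sub>M gseq \<Otimes>\<^sub>M gseq"

lemma nn_R0:
 assumes [measurable]: "F \<in> borel_measurable (M0 \<Otimes>\<^sub>M sq \<Otimes>\<^sub>M sq)"
 shows "(\<integral>\<^sup>+x. F x \<partial>R0) = (\<integral>\<^sup>+a. (\<GG> t. \<GG> y. F (a, t, y)) \<partial>M0)"
proof -
 interpret S: prob_space gseq by (rule prob_space_gseq)
 interpret SS: pair_prob_space gseq gseq by unfold_locales
 have "(\<integral>\<^sup>+x. F x \<partial>R0) = (\<integral>\<^sup>+a. \<integral>\<^sup>+x. F (a, x) \<partial>(gseq \<Otimes>\<^sub>M gseq) \<partial>M0)"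
  by (subst SS.P.nn_integral_fst[symmetric]) (auto cong: measurable_cong_sets)
 also have "\<dots> = (\<integral>\<^sup>+a. (\<GG> t. \<GG> y. F (a, t, y)) \<partial>M0)"
  by (intro nn_integral_cong, subst S.nn_integral_fst[symmetric]) (auto cong: measurable_cong_sets)
 finally show ?thesis .
qed

text \<open>The loop density without the factors of \<open>t\<close> from \<open>J\<close> on: from
  then on \<open>t\<close> is free noise, while \<open>y\<close> still follows \<open>t\<close> up
  to \<open>k\<close>.\<close>

definition PP :: "nat \<Rightarrow> nat \<Rightarrow> (('x \<times> 'h) \<times> (nat \<Rightarrow> real) \<times> (nat \<Rightarrow> real)) measure" where
 "PP J k = density R0 (\<lambda>(a, t, y). ennreal (re {..<J} a t y * ls {..<k} a t y))"

lemma sets_PP [measurable_cong, simp]: "sets (PP J k) = sets (M0 \<Otimes>\<^sub>M sq \<Otimes>\<^sub>M sq)"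
 unfolding PP_def sets_density by (intro sets_pair_measure_cong) auto

lemma nn_PP:
 assumes [measurable]: "F \<in> borel_measurable (M0 \<Otimes>\<^sub>M sq \<Otimes>\<^sub>M sq)"
 shows "(\<integral>\<^sup>+x. F x \<partial>PP J k)
  = (\<integral>\<^sup>+a. (\<GG> t. \<GG> y. F (a, t, y) * ennreal (re {..<J} a t y * ls {..<k} a t y)) \<partial>M0)"
proof -
 have "(\<integral>\<^sup>+x. F x \<partial>PP J k) = (\<integral>\<^sup>+x. (\<lambda>(a, t, y). ennreal (re {..<J} a t y * ls {..<k} a t y)) x * F x \<partial>R0)"
  unfolding PP_def by (subst nn_integral_density) (auto cong: measurable_cong_sets)
 also have "\<dots> = (\<integral>\<^sup>+x. (\<lambda>(a, t, y). F (a, t, y) * ennreal (re {..<J} a t y * ls {..<k} a t y)) x \<partial>R0)"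
  by (intro nn_integral_cong) (auto simp: mult.commute)
 also have "\<dots> = (\<integral>\<^sup>+a. (\<GG> t. \<GG> y. F (a, t, y) * ennreal (re {..<J} a t y * ls {..<k} a t y)) \<partial>M0)"
  by (subst nn_R0) auto
 finally show ?thesis .
qed

lemma re_split: "re {..<J + m} a t y = re {..<J} a t y * re {J..<J + m} a t y"
 and ls_split: "ls {..<J + m} a t y = ls {..<J} a t y * ls {J..<J + m} a t y"
proof -
 have "prod f {..<J + m} = prod f {..<J} * prod f {J..<J + m}" for f :: "nat \<Rightarrow> real"
  by (subst prod.union_disjoint[symmetric]) (auto simp: ivl_disj_un_one)
 then show "re {..<J + m} a t y = re {..<J} a t y * re {J..<J + m} a t y"
  "ls {..<J + m} a t y = ls {..<J} a t y * ls {J..<J + m} a t y"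
  unfolding re_def ls_def by blast+
qed

text \<open>Putting the omitted factor back restores the likelihood \<open>L (J + m)\<close> of the
  loop.\<close>

lemma nn_PP_loop:
 assumes [measurable]: "(\<lambda>(a, t, y). F a t y) \<in> borel_measurable (M0 \<Otimes>\<^sub>M sq \<Otimes>\<^sub>M sq)"
  and F: "\<And>a t y t' y'. (\<And>i. i < J + m \<Longrightarrow> t i = t' i) \<Longrightarrow> (\<And>i. i < J + m \<Longrightarrow> y i = y' i) \<Longrightarrow> F a t y = F a t' y'"
 shows "(\<integral>\<^sup>+x. (\<lambda>(a, t, y). ennreal (re {J..<J + m} a t y) * F a t y) x \<partial>PP J (J + m)) = (\<integral>\<^sup>+om. F (A om) (T om) (Y om) \<partial>M)"
proof -
 have F_m [measurable]: "(\<lambda>x. F (f x) (g x) (h x)) \<in> borel_measurable K"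
  if "f \<in> measurable K M0" "g \<in> measurable K sq" "h \<in> measurable K sq" for f g h and K :: "'k measure"
  using measurable_compose[OF measurable_Pair[OF that(1) measurable_Pair[OF that(2,3)]] assms(1)] by simp
 have "(\<integral>\<^sup>+x. (\<lambda>(a, t, y). ennreal (re {J..<J + m} a t y) * F a t y) x \<partial>PP J (J + m))
  = (\<integral>\<^sup>+a. (\<GG> t. \<GG> y. F a t y * ennreal (L (J + m) a t y)) \<partial>M0)"
 proof (subst nn_PP, measurable, unfold prod.case, rule nn_integral_cong, rule nn_integral_cong, rule nn_integral_cong)
  fix a t y
  have "ennreal (L (J + m) a t y) = ennreal (re {J..<J + m} a t y) * ennreal (re {..<J} a t y * ls {..<J + m} a t y)"
   by (subst ennreal_mult[symmetric]) (auto simp: L_def re_split re_pos ls_pos less_imp_le mult_ac)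
  then show "ennreal (re {J..<J + m} a t y) * F a t y * ennreal (re {..<J} a t y * ls {..<J + m} a t y) = F a t y * ennreal (L (J + m) a t y)"
   by (simp add: mult_ac)
 qed
 also have "\<dots> = (\<integral>\<^sup>+om. (\<lambda>(a, t, y). F a t y) (A om, T om, Y om) \<partial>M)"
  by (subst nn_integral_loop[of "\<lambda>(a, t, y). F a t y" "J + m"]) (auto intro: F)
 finally show ?thesis by simp
qed

lemma int_out_ls:
 assumes a: "a \<in> space M0" and [measurable]: "f \<in> borel_measurable sq"
  and w: "finite w" and f: "\<And>u y. f (\<lambda>i. if i \<in> w then u i else y i) = f y"
 shows "(\<GG> y. f y * ennreal (ls w a t y)) = (\<GG> y. f y)"
proof -
 have [measurable]: "a \<in> space M0" "t \<in> space sq" using a by auto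
 have ls: "ls w a t (\<lambda>i. if i \<in> w then u i else y i) = ls w a t u" for u y by (rule ls_cong) auto
 have "(\<GG> y. f y * ennreal (ls w a t y)) = (\<GG> y. \<GG> u. f y * ennreal (ls w a t u))"
  by (subst nn_integral_gseq_override[of _ w, symmetric]) (auto simp: f ls)
 also have "\<dots> = (\<GG> y. f y)"
  by (rule nn_integral_cong, subst nn_integral_cmult) (auto simp: ls_int[OF w] cong: measurable_cong_sets)
 finally show ?thesis .
qed

text \<open>The window of \<open>y\<close> enters only through \<open>ls {J..<J + m}\<close>, which
  integrates to one; the loop density up to \<open>J\<close> remains.\<close>

lemma prob_PP: "prob_space (PP J (J + m))"
proof
 have "emeasure (PP J (J + m)) (space (PP J (J + m))) = (\<integral>\<^sup>+x. 1 \<partial>PP J (J + m))" by simp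
 also have "\<dots> = (\<integral>\<^sup>+a. (\<GG> t. \<GG> y. 1 * ennreal (re {..<J} a t y * ls {..<J + m} a t y)) \<partial>M0)"
  by (subst nn_PP) auto
 also have "\<dots> = (\<integral>\<^sup>+a. (\<GG> t. \<GG> y. 1 * ennreal (L J a t y)) \<partial>M0)"
 proof (rule nn_integral_cong, rule nn_integral_cong)
  fix a t assume a [measurable]: "a \<in> space M0"
  have [measurable]: "t \<in> space sq" by simp
  have "(\<GG> y. 1 * ennreal (re {..<J} a t y * ls {..<J + m} a t y))
   = (\<GG> y. ennreal (L J a t y) * ennreal (ls {J..<J + m} a t y))"
   by (intro nn_integral_cong) (simp add: L_def ls_split ennreal_mult re_pos ls_pos less_imp_le mult_ac)
  also have "\<dots> = (\<GG> y. ennreal (L J a t y))"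
  proof (rule int_out_ls[OF a])
   fix u y
   have "re {..<J} a t (\<lambda>i. if i \<in> {J..<J + m} then u i else y i) = re {..<J} a t y" by (rule re_cong) auto
   moreover have "ls {..<J} a t (\<lambda>i. if i \<in> {J..<J + m} then u i else y i) = ls {..<J} a t y" by (rule ls_cong) auto
   ultimately show "ennreal (L J a t (\<lambda>i. if i \<in> {J..<J + m} then u i else y i)) = ennreal (L J a t y)"
    by (simp add: L_def)
  qed auto
  finally show "(\<GG> y. 1 * ennreal (re {..<J} a t y * ls {..<J + m} a t y)) = (\<GG> y. 1 * ennreal (L J a t y))" by simp
 qed
 also have "\<dots> = (\<integral>\<^sup>+om. (\<lambda>_. 1) (A om, T om, Y om) \<partial>M)"
  by (subst nn_integral_loop[of "\<lambda>_. 1" J]) auto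
 finally show "emeasure (PP J (J + m)) (space (PP J (J + m))) = 1" by (simp add: W.emeasure_space_1)
qed

text \<open>Given \<open>t\<close>, the window of \<open>y\<close> under \<open>PP\<close> is
  \<open>s + z\<close> with \<open>s\<close> fixed and \<open>z\<close> fresh: the factors through
  which later \<open>t\<close> would react to \<open>y\<close> are omitted. So shift by
  \<open>s\<close>, smooth the noise, and shift back.\<close>

lemma smooth_PP:
 fixes J m :: nat
 assumes [measurable]: "F \<in> borel_measurable (M0 \<Otimes>\<^sub>M sq \<Otimes>\<^sub>M sq)" and l: "0 < l" "l < 1"
 defines "w \<equiv> {J..<J + m}"
 shows "(\<integral>\<^sup>+x. (\<lambda>(a, t, y). F (a, t, y) * ennreal (exp (l * (\<Sum>j\<in>w. (y j - s j a t)\<^sup>2) / 2))) x \<partial>PP J (J + m))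
  = ennreal ((1 / sqrt (1 - l)) ^ card w)
   * (\<integral>\<^sup>+x. (\<lambda>(a, t, y). (\<GG> g. F (a, t, shiftw w (\<lambda>i. sqrt (l / (1 - l)) * g i) y))) x \<partial>PP J (J + m))"
proof -
 have w: "finite w" by (simp add: w_def)
 let ?sg = "ennreal ((1 / sqrt (1 - l)) ^ card w)" and ?sh = "\<lambda>g. shiftw w (\<lambda>i. sqrt (l / (1 - l)) * g i)"
 have "(\<integral>\<^sup>+x. (\<lambda>(a, t, y). F (a, t, y) * ennreal (exp (l * (\<Sum>j\<in>w. (y j - s j a t)\<^sup>2) / 2))) x \<partial>PP J (J + m))
  = (\<integral>\<^sup>+a. (\<GG> t. \<GG> y. F (a, t, y) * ennreal (exp (l * (\<Sum>j\<in>w. (y j - s j a t)\<^sup>2) / 2)) * ennreal (re {..<J} a t y * ls {..<J + m} a t y)) \<partial>M0)"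
  by (subst nn_PP) auto
 also have "\<dots> = (\<integral>\<^sup>+a. (\<GG> t. ?sg * (\<GG> y. (\<GG> g. F (a, t, ?sh g y)) * ennreal (re {..<J} a t y * ls {..<J + m} a t y))) \<partial>M0)"
 proof (rule nn_integral_cong, rule nn_integral_cong)
  fix a t assume a [measurable]: "a \<in> space M0"
  have [measurable]: "t \<in> space sq" by simp
  define S where "S j = s j a t" for j
  define h where "h y = F (a, t, y) * ennreal (L J a t y)" for y
  have [measurable]: "h \<in> borel_measurable sq" unfolding h_def by measurable
  have L_inv: "L J a t (shiftw w v y) = L J a t y" for v y
  proof -
   have "re {..<J} a t (shiftw w v y) = re {..<J} a t y" by (rule re_cong) (auto simp: shiftw_def w_def)
   moreover have "ls {..<J} a t (shiftw w v y) = ls {..<J} a t y" by (rule ls_cong) (auto simp: shiftw_def w_def)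
   ultimately show ?thesis by (simp add: L_def)
  qed
  have LL: "ennreal (re {..<J} a t y * ls {..<J + m} a t y) = ennreal (L J a t y) * ennreal (\<Prod>j\<in>w. gl (S j) (y j))" for y
  proof -
   have "(\<Prod>j\<in>w. gl (S j) (y j)) = ls {J..<J + m} a t y" by (simp add: S_def ls_def w_def)
   then show ?thesis
    by (simp add: L_def ls_split ennreal_mult[symmetric] re_pos ls_pos less_imp_le mult.assoc)
  qed
  have "(\<GG> y. F (a, t, y) * ennreal (exp (l * (\<Sum>j\<in>w. (y j - s j a t)\<^sup>2) / 2)) * ennreal (re {..<J} a t y * ls {..<J + m} a t y))
   = (\<GG> y. (h y * ennreal (exp (l * (\<Sum>j\<in>w. (y j - S j)\<^sup>2) / 2))) * ennreal (\<Prod>j\<in>w. gl (S j) (y j)))"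
   by (intro nn_integral_cong) (simp add: h_def LL S_def mult_ac)
  also have "\<dots> = (\<GG> y. h (shiftw w S y) * ennreal (exp (l * (\<Sum>j\<in>w. (shiftw w S y j - S j)\<^sup>2) / 2)))"
   by (rule nn_integral_gseq_shift[OF w, symmetric]) measurable
  also have "\<dots> = (\<GG> y. h (shiftw w S y) * ennreal (exp (l * (\<Sum>j\<in>w. (y j)\<^sup>2) / 2)))"
   by (intro nn_integral_cong) (simp add: shiftw_def)
  also have "\<dots> = ?sg * (\<GG> y. \<GG> g. h (shiftw w S (?sh g y)))"
   by (rule nn_integral_gseq_smooth[OF w _ l]) measurable
  also have "(\<GG> y. \<GG> g. h (shiftw w S (?sh g y))) = (\<GG> y. (\<lambda>y. (\<GG> g. h (?sh g y))) (shiftw w S y))"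
  proof -
   have "shiftw w S (?sh g y) = ?sh g (shiftw w S y)" for g y by (auto simp: shiftw_def)
   then show ?thesis by simp
  qed
  also have "\<dots> = (\<GG> y. (\<GG> g. h (?sh g y)) * ennreal (\<Prod>j\<in>w. gl (S j) (y j)))"
   by (rule nn_integral_gseq_shift[OF w]) measurable
  also have "\<dots> = (\<GG> y. (\<GG> g. F (a, t, ?sh g y)) * ennreal (re {..<J} a t y * ls {..<J + m} a t y))"
  proof (rule nn_integral_cong)
   fix y :: "nat \<Rightarrow> real"
   have [measurable]: "y \<in> space sq" by simp
   have "(\<GG> g. h (?sh g y)) = (\<GG> g. F (a, t, ?sh g y)) * ennreal (L J a t y)"
    unfolding h_def L_inv by (rule nn_integral_multc) measurable
   then show "(\<GG> g. h (?sh g y)) * ennreal (\<Prod>j\<in>w. gl (S j) (y j)) = (\<GG> g. F (a, t, ?sh g y)) * ennreal (re {..<J} a t y * ls {..<J + m} a t y)"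
    by (simp add: LL mult.assoc)
  qed
  finally show "(\<GG> y. F (a, t, y) * ennreal (exp (l * (\<Sum>j\<in>w. (y j - s j a t)\<^sup>2) / 2)) * ennreal (re {..<J} a t y * ls {..<J + m} a t y))
   = ?sg * (\<GG> y. (\<GG> g. F (a, t, ?sh g y)) * ennreal (re {..<J} a t y * ls {..<J + m} a t y))" .
 qed
 also have "\<dots> = ?sg * (\<integral>\<^sup>+a. (\<GG> t. \<GG> y. (\<GG> g. F (a, t, ?sh g y)) * ennreal (re {..<J} a t y * ls {..<J + m} a t y)) \<partial>M0)"
 proof -
  have "(\<GG> t. ?sg * (\<GG> y. (\<GG> g. F (a, t, ?sh g y)) * ennreal (re {..<J} a t y * ls {..<J + m} a t y)))
   = ?sg * (\<GG> t. \<GG> y. (\<GG> g. F (a, t, ?sh g y)) * ennreal (re {..<J} a t y * ls {..<J + m} a t y))"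
   if [measurable]: "a \<in> space M0" for a
   by (rule nn_integral_cmult) measurable
  then have "(\<integral>\<^sup>+a. (\<GG> t. ?sg * (\<GG> y. (\<GG> g. F (a, t, ?sh g y)) * ennreal (re {..<J} a t y * ls {..<J + m} a t y))) \<partial>M0)
   = (\<integral>\<^sup>+a. ?sg * (\<GG> t. \<GG> y. (\<GG> g. F (a, t, ?sh g y)) * ennreal (re {..<J} a t y * ls {..<J + m} a t y)) \<partial>M0)"
   by (intro nn_integral_cong) auto
  also have "\<dots> = ?sg * (\<integral>\<^sup>+a. (\<GG> t. \<GG> y. (\<GG> g. F (a, t, ?sh g y)) * ennreal (re {..<J} a t y * ls {..<J + m} a t y)) \<partial>M0)"
   by (rule nn_integral_cmult) measurable
  finally show ?thesis .
 qed
 also have "(\<integral>\<^sup>+a. (\<GG> t. \<GG> y. (\<GG> g. F (a, t, ?sh g y)) * ennreal (re {..<J} a t y * ls {..<J + m} a t y)) \<partial>M0)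
  = (\<integral>\<^sup>+x. (\<lambda>(a, t, y). (\<GG> g. F (a, t, ?sh g y))) x \<partial>PP J (J + m))"
  by (subst nn_PP) auto
 finally show ?thesis .
qed

section \<open>The case of equality\<close>

lemma expLL: "(\<integral>\<^sup>+om. ennreal (exp (- LL k om)) \<partial>M) \<le> ennreal c0"
proof -
 have "(\<integral>\<^sup>+om. ennreal (exp (- LL k om)) \<partial>M) \<le> ennreal (exp (real k * al)) * (\<integral>\<^sup>+h. (\<GG> t. \<GG> y. \<LL> x. ennreal (gk k (x, h) t y * re {..<k} (x, h) t y * nh P {..<k} y)) \<partial>H)"
  using nn_exp_LL[of "\<lambda>_ _ _. 1" k] by simp
 also have "\<dots> \<le> ennreal (exp (real k * al)) * ennreal (c0 * exp (- (real k * al)))"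
  by (intro mult_left_mono gibbs) auto
 also have "\<dots> = ennreal c0"
  using param by (simp add: ennreal_mult[symmetric] exp_minus)
 finally show ?thesis .
qed

lemma LL_exp_lower: "1 - c0 \<le> W.expectation (LL k)"
 using W.ln_lower[of "\<lambda>om. exp (LL k om)" c0] expLL[of k] param LL_int by (simp add: exp_minus inverse_eq_divide)

text \<open>The mean of \<open>LL k\<close> is at least \<open>1 - c0\<close> for every
  \<open>k\<close>, but would decrease linearly if \<open>al\<close> exceeded
  \<open>ln (1 + P) / 2\<close>.\<close>

lemma al_eq: "al = ln (1 + P) / 2"
proof (rule ccontr)
 assume "al \<noteq> ln (1 + P) / 2"
 then have d: "0 < al - ln (1 + P) / 2" using cap by simp
 obtain k :: nat where "K1 - (1 - c0) < real k * (al - ln (1 + P) / 2)"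
  using reals_Archimedean3[OF d] by blast
 then show False using LL_exp[of k] LL_exp_lower[of k] by (simp add: algebra_simps)
qed

lemma gap_0: "ln (1 + P) / 2 - al = 0"
 using al_eq by simp

lemma P_pos: "0 < P"
 using al_eq param by (cases "P = 0") auto

definition K2 :: real where
 "K2 = (K1 + 2 * c0) + W.expectation (\<lambda>om. \<bar>ln (p (fst (A om)))\<bar>) + Kg"

text \<open>The mean of \<open>exp (- LL k)\<close> controls the negative part:
  \<open>\<bar>u\<bar> \<le> u + 2 * exp (- u)\<close>. With zero drift the bound is uniform in
  \<open>k\<close>.\<close>

lemma abs_LL: "W.expectation (\<lambda>om. \<bar>LL k om\<bar>) \<le> K1 + 2 * c0"
proof -
 have i: "integrable M (\<lambda>om. exp (- LL k om))"
  using expLL[of k] by (intro integrableI_bounded) (auto simp: less_top[symmetric] top_unique)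
 have "W.expectation (\<lambda>om. exp (- LL k om)) \<le> c0"
  using expLL[of k] enn2real_mono[OF expLL[of k]] param by (subst integral_eq_nn_integral) auto
 moreover have "W.expectation (\<lambda>om. \<bar>LL k om\<bar>) \<le> W.expectation (\<lambda>om. LL k om + 2 * exp (- LL k om))"
 proof (rule integral_mono)
  fix om
  have "- LL k om \<le> exp (- LL k om)" using exp_ge_add_one_self[of "- LL k om"] by linarith
  then show "\<bar>LL k om\<bar> \<le> LL k om + 2 * exp (- LL k om)" using exp_gt_zero[of "- LL k om"] by (cases "0 \<le> LL k om") auto
 qed (use LL_int i in auto)
 moreover have "W.expectation (LL k) \<le> K1"
  using LL_exp[of k] unfolding gap_0 by simp
 ultimately show ?thesis using LL_int i by simp
qed

text \<open>Without drift, \<open>Qw\<close> differs from \<open>LL k\<close> only by the entropy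
  term of \<open>x\<close> and by \<open>ln gk\<close>, both bounded in absolute mean.\<close>

lemma abs_Q: "W.expectation (\<lambda>om. \<bar>Qw {..<k} om\<bar>) \<le> K2"
proof -
 have "W.expectation (\<lambda>om. \<bar>Qw {..<k} om\<bar>)
  \<le> W.expectation (\<lambda>om. \<bar>LL k om\<bar> + \<bar>ln (p (fst (A om)))\<bar> + (- ln (gk k (A om) (T om) (Y om))))"
 proof (rule integral_mono)
  fix om
  have "ln (gk k (A om) (T om) (Y om)) \<le> 0" using gk_bounds[of k] by (simp add: ln_le_zero_iff)
  then show "\<bar>Qw {..<k} om\<bar> \<le> \<bar>LL k om\<bar> + \<bar>ln (p (fst (A om)))\<bar> + (- ln (gk k (A om) (T om) (Y om)))"
   unfolding LL_def gap_0 by simp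
 qed (use Qw_int LL_int x_int lng_int in auto)
 also have "\<dots> = W.expectation (\<lambda>om. \<bar>LL k om\<bar>) + W.expectation (\<lambda>om. \<bar>ln (p (fst (A om)))\<bar>) + W.expectation (\<lambda>om. - ln (gk k (A om) (T om) (Y om)))"
  using LL_int x_int lng_int by simp
 also have "\<dots> \<le> K2" unfolding K2_def by (intro add_mono abs_LL lng_exp order_refl)
 finally show ?thesis .
qed

text \<open>A window is the difference of two initial segments. The bound depends neither on the
  position nor, which is decisive, on the length of the window.\<close>

lemma abs_Q_window: "W.expectation (\<lambda>om. \<bar>Qw {J..<J + m} om\<bar>) \<le> 2 * K2"
proof -
 have eq: "Qw {J..<J + m} om = Qw {..<J + m} om - Qw {..<J} om" for om
 proof -
  have "{..<J + m} = {..<J} \<union> {J..<J + m}" "{..<J} \<inter> {J..<J + m} = {}" by auto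
  then show ?thesis by (simp add: Qw_def sum.union_disjoint add_divide_distrib)
 qed
 have "W.expectation (\<lambda>om. \<bar>Qw {J..<J + m} om\<bar>) \<le> W.expectation (\<lambda>om. \<bar>Qw {..<J + m} om\<bar> + \<bar>Qw {..<J} om\<bar>)"
  by (rule integral_mono) (use Qw_int eq in auto)
 also have "\<dots> \<le> K2 + K2" using Qw_int add_mono[OF abs_Q[of "J + m"] abs_Q[of J]] by simp
 finally show ?thesis by simp
qed

end

section \<open>White windows\<close>

text \<open>The error \<open>e1\<close> as a function of bare parameters, so that they can be fixed
  before a window is given.\<close>

definition e1_bound :: "nat \<Rightarrow> real \<Rightarrow> real \<Rightarrow> real \<Rightarrow> real" where
 "e1_bound m Ce eps C1 = 2 * C1 * eps + 2 * (m / ln C1 + (2 * Ce / ln C1 + eps))"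

text \<open>The parameters are chosen in the order \<open>k\<close>, \<open>B\<close>,
  \<open>C\<close>, \<open>C1\<close>, \<open>eps\<close>, each after the ones it has to beat:
  \<open>k\<close> against \<open>A2\<close>; \<open>B\<close> against \<open>Ce / k\<close>;
  \<open>C\<close> against \<open>exp B\<close> and, logarithmically, against \<open>1 / k\<close>;
  \<open>C1\<close> so that the logarithmic part of \<open>e1_bound\<close> is small even after
  multiplication by \<open>C\<close>; \<open>eps\<close> against \<open>C1\<close>.\<close>

lemma small_error_parameters:
 fixes m :: nat and Ce sg A2 d :: real
 assumes Ce: "0 \<le> Ce" and sg: "0 < sg" and A2: "0 < A2" and d: "0 < d"
 obtains C C1 k B eps :: real where "1 < C" "1 < C1" "0 < k" "0 < B" "0 < eps"
  "sg * (2 * eps + C * e1_bound m Ce eps C1) + (k * A2 + (m / 2 + Ce) / (k * ln C)) \<le> d"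
  "sg * (2 * eps + C * e1_bound m Ce eps C1 + exp B / C + e1_bound m Ce eps C1) + (k * A2 + (e1_bound m Ce eps C1 + (Ce / B + eps)) / k) \<le> d"
proof -
 define k where "k = d / (8 * A2)"
 have k: "0 < k" "k * A2 = d / 8" using d A2 by (auto simp: k_def)
 define B where "B = 8 * (Ce + 1) / (k * d)"
 have B: "0 < B" using Ce k d by (simp add: B_def)
 have B2: "Ce / B / k \<le> d / 8"
 proof -
  have "B * k = 8 * (Ce + 1) / d" using k by (simp add: B_def)
  then have "Ce / B / k = Ce / (8 * (Ce + 1) / d)" by (simp only: divide_divide_eq_left)
  also have "\<dots> = (Ce / (Ce + 1)) * (d / 8)" by simp
  also have "\<dots> \<le> 1 * (d / 8)" using Ce d by (intro mult_right_mono) auto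
  finally show ?thesis by simp
 qed
 define l where "l = 8 * (m / 2 + Ce) / (k * d) + B + 8 * sg / d + 1"
 \<comment> \<open>One factor \<open>exp l\<close> absorbs \<open>exp B\<close>; the other leaves
   \<open>1 / exp l \<le> 1 / l\<close>.\<close>
 define C where "C = exp l * exp l"
 have l: "0 < l" "1 < l" "B \<le> l" "8 * (m / 2 + Ce) / (k * d) \<le> l" "8 * sg / d \<le> l"
 proof -
  have "0 \<le> 8 * (m / 2 + Ce) / (k * d)" "0 < 8 * sg / d" using Ce k(1) d sg by auto
  then show "0 < l" "1 < l" "B \<le> l" "8 * (m / 2 + Ce) / (k * d) \<le> l" "8 * sg / d \<le> l"
   using B unfolding l_def by linarith+
 qed
 have C: "1 < C" "ln C = 2 * l" using l by (auto simp: C_def exp_add[symmetric])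
 have C2: "(m / 2 + Ce) / (k * ln C) \<le> d / 8"
 proof -
  have "8 * (m / 2 + Ce) \<le> l * (k * d)" using l(4) k d by (simp add: field_simps)
  also have "\<dots> \<le> 2 * l * (k * d)" using l k d by simp
  finally show ?thesis using l k d by (simp add: C(2) field_simps)
 qed
 have C3: "sg * (exp B / C) \<le> d / 8"
 proof -
  have "exp B / C \<le> exp l / C" using l C by (intro divide_right_mono) auto
  also have "\<dots> = 1 / exp l" by (simp add: C_def)
  also have "\<dots> \<le> 1 / l" proof -
   have "l \<le> exp l" using exp_ge_add_one_self[of l] by linarith
   then show ?thesis using l(1) by (intro divide_left_mono) auto
  qed
  also have "\<dots> \<le> d / (8 * sg)" using l(5) l(1) sg d by (simp add: field_simps)
  finally have "sg * (exp B / C) \<le> sg * (d / (8 * sg))" using sg by (intro mult_left_mono) auto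
  then show ?thesis using sg by simp
 qed
 \<comment> \<open>Common target for \<open>e1_bound\<close> and \<open>eps\<close>: all terms
   carrying \<open>sg\<close>, \<open>C\<close> or \<open>1 / k\<close> then add up to at most
   \<open>d / 4\<close>.\<close>
 define n where "n = d / (4 * (sg * (C + 3) + 2 / k))"
 have den: "0 < sg * (C + 3) + 2 / k" using sg C k by (intro add_pos_pos mult_pos_pos) auto
 have n: "0 < n" "n * (sg * (C + 3) + 2 / k) = d / 4"   proof -
  define D where "D = sg * (C + 3) + 2 / k"
  show "0 < n" "n * (sg * (C + 3) + 2 / k) = d / 4"
   using den d unfolding n_def D_def[symmetric] by auto
 qed
 define l1 where "l1 = 4 * (m + 2 * Ce) / n + 1"
 have l1: "0 < l1" "4 * (m + 2 * Ce) / n \<le> l1" using Ce n by (auto simp: l1_def intro!: add_nonneg_pos)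
 define C1 where "C1 = exp l1"
 have C1: "1 < C1" "ln C1 = l1" using l1 by (auto simp: C1_def)
 define eps where "eps = n / (4 * (C1 + 1))"
 have eps: "0 < eps" "eps * (4 * (C1 + 1)) = n" using n C1 by (auto simp: eps_def)
 have eps_n: "eps \<le> n"
 proof -
  have "1 \<le> 4 * (C1 + 1)" using C1 by simp
  then have "eps * 1 \<le> eps * (4 * (C1 + 1))" using eps(1) by (intro mult_left_mono) auto
  then show ?thesis unfolding eps(2) by simp
 qed
 define e1 where "e1 = e1_bound m Ce eps C1"
 have e1: "0 \<le> e1" "e1 \<le> n"
 proof -
  show "0 \<le> e1" using Ce eps(1) C1(1) l1(1) unfolding e1_def e1_bound_def C1(2)
   by (intro add_nonneg_nonneg mult_nonneg_nonneg divide_nonneg_nonneg) auto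
  have "(m + 2 * Ce) / l1 \<le> n / 4" using l1 n by (simp add: field_simps)
  moreover have "e1 = 2 * eps * (C1 + 1) + 2 * ((m + 2 * Ce) / l1)"
   by (simp add: e1_def e1_bound_def C1(2) algebra_simps add_divide_distrib)
  moreover have "2 * eps * (C1 + 1) = n / 2" using eps(2) by (simp add: algebra_simps)
  ultimately show "e1 \<le> n" by linarith
 qed
 have small: "sg * (2 * eps + C * e1 + e1) + (e1 + eps) / k \<le> d / 4"
 proof -
  have "sg * (2 * eps + C * e1 + e1) + (e1 + eps) / k \<le> sg * (2 * n + C * n + n) + (n + n) / k"
   using sg C k e1 eps eps_n by (intro add_mono mult_left_mono divide_right_mono) auto
  also have "\<dots> = n * (sg * (C + 3) + 2 / k)" by (simp add: algebra_simps add_divide_distrib)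
  finally show ?thesis using n by simp
 qed
 have nn: "0 \<le> sg * e1" "0 \<le> (e1 + eps) / k" "0 \<le> sg * (2 * eps + C * e1)" using sg e1 eps k C by auto
 have s1: "sg * (2 * eps + C * e1 + e1) = sg * (2 * eps + C * e1) + sg * e1"
  "sg * (2 * eps + C * e1 + exp B / C + e1) = sg * (2 * eps + C * e1) + sg * (exp B / C) + sg * e1"
  by (simp_all add: distrib_left)
 show ?thesis
 proof (rule that[OF C(1) C1(1) k(1) B eps(1)])
  show "sg * (2 * eps + C * e1_bound m Ce eps C1) + (k * A2 + (m / 2 + Ce) / (k * ln C)) \<le> d"
   unfolding e1_def[symmetric] k(2) using small[unfolded s1] C2 nn d by linarith
  have "(e1 + (Ce / B + eps)) / k = (e1 + eps) / k + Ce / B / k" by (simp add: add_divide_distrib)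
  then show "sg * (2 * eps + C * e1_bound m Ce eps C1 + exp B / C + e1_bound m Ce eps C1) + (k * A2 + (e1_bound m Ce eps C1 + (Ce / B + eps)) / k) \<le> d"
   unfolding e1_def[symmetric] k(2) s1 using small[unfolded s1] B2 C3 nn d by linarith
 qed
qed

text \<open>\<open>G\<close> is the part of the static data through which the feedback acts.
  Independence of \<open>t\<close> is required relative to \<open>G a\<close> only, so that
  \<open>x\<close> may be averaged out when the feedback does not see it.\<close>

locale white_windows = info_loop p H e s M A V Z T Y P Ce c0 Kg al gk
 for p :: "'x::euclidean_space \<Rightarrow> real" and H :: "'h measure" and e s and M :: "'w measure"
  and A V Z T Y P Ce c0 Kg al gk +
 fixes N :: "'g measure" and G :: "'x \<times> 'h \<Rightarrow> 'g" and eb :: "nat \<Rightarrow> 'g \<Rightarrow> (nat \<Rightarrow> real) \<Rightarrow> real"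
 assumes G_m [measurable]: "G \<in> measurable M0 N"
  and eb_m: "\<And>n. (\<lambda>(g, y). eb n g y) \<in> borel_measurable (N \<Otimes>\<^sub>M sq)"
  and e_eb: "\<And>n a y. e n a y = eb n (G a) y"
begin

text \<open>Certificate for a window: under \<open>q\<close> the window of \<open>t\<close> is fresh
  given \<open>G a\<close>, the rest of \<open>t\<close>, and \<open>y\<close>, while
  \<open>q\<close> stays close to 1 on the loop. Whiteness is tested on functions of
  \<open>y\<close> alone, so it may be proved with another density than \<open>q\<close>.\<close>

definition white_window :: "nat \<Rightarrow> real \<Rightarrow> nat \<Rightarrow> (('x \<times> 'h) \<times> (nat \<Rightarrow> real) \<times> (nat \<Rightarrow> real) \<Rightarrow> real) \<Rightarrow> bool" where
 "white_window m d J q \<longleftrightarrow>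
  q \<in> borel_measurable (M0 \<Otimes>\<^sub>M sq \<Otimes>\<^sub>M sq) \<and> (\<forall>x. 0 \<le> q x) \<and>
  (\<integral>\<^sup>+x. ennreal (q x) \<partial>PP J (J + m)) = 1 \<and>
  (\<forall>F\<in>borel_measurable (N \<Otimes>\<^sub>M sq \<Otimes>\<^sub>M sq).
   (\<integral>\<^sup>+x. (\<lambda>(a, t, y). ennreal (q (a, t, y)) * F (G a, t, y)) x \<partial>PP J (J + m))
   = (\<integral>\<^sup>+x. (\<lambda>(a, t, y). ennreal (q (a, t, y)) * (\<GG> u. F (G a, (\<lambda>i. if i \<in> {J..<J + m} then u i else t i), y))) x \<partial>PP J (J + m))) \<and>
  (\<forall>a t y t' y'. (\<forall>i<J + m. t i = t' i) \<longrightarrow> (\<forall>i<J + m. y i = y' i) \<longrightarrow> q (a, t, y) = q (a, t', y')) \<and>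
  (\<integral>\<^sup>+om. ennreal \<bar>1 - q (A om, T om, Y om)\<bar> \<partial>M) \<le> ennreal d \<and>
  (\<forall>k\<in>borel_measurable sq. (\<forall>y. k y \<le> 1) \<longrightarrow> (\<forall>y y'. (\<forall>i\<in>{J..<J + m}. y i = y' i) \<longrightarrow> k y = k y') \<longrightarrow>
   (\<integral>\<^sup>+om. k (Y om) \<partial>M) \<le> (\<GG> u. k (\<lambda>j. sqrt (1 + P) * u j)) + ennreal d \<and>
   (\<GG> u. k (\<lambda>j. sqrt (1 + P) * u j)) \<le> (\<integral>\<^sup>+om. k (Y om) \<partial>M) + ennreal d)"

abbreviation (input) win :: "nat \<Rightarrow> nat \<Rightarrow> nat set" where "win J m \<equiv> {J..<J + m}"

text \<open>Weighted by the omitted likelihood, integrals under \<open>PP\<close> are loop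
  expectations (\<open>PP_loop\<close>), so the weighted hypotheses of \<open>tight_window\<close>
  become moments of the loop signals.\<close>

lemma window_PP:
 assumes q: "white_window m d J q" and d: "d \<le> eps" "0 < eps" and lam: "0 < lam" "2 * lam < 1"
 shows "tight_window (PP J (J + m)) N (win J m) (\<lambda>(a, t, y). G a) (\<lambda>(a, t, y). t) (\<lambda>(a, t, y). y)
  (\<lambda>(a, t, y) j. y j - s j a t) (\<lambda>g y j. eb j g y) q P (real m * Ce) eps lam"
proof -
 note q1' = q[unfolded white_window_def, THEN conjunct2]
 note q2' = q1'[THEN conjunct2]
 note q3' = q2'[THEN conjunct2]
 note q4' = q3'[THEN conjunct2]
 note q5' = q4'[THEN conjunct2]
 note q_indep = q3'[THEN conjunct1] and q_causal = q4'[THEN conjunct1] and q_close = q5'[THEN conjunct1]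
  and q_white = q5'[THEN conjunct2]
 let ?PP = "PP J (J + m)" and ?w = "win J m"
 let ?G = "\<lambda>(a, t, y). G a" and ?t = "\<lambda>(a, t, y). t :: nat \<Rightarrow> real" and ?y = "\<lambda>(a, t, y). y :: nat \<Rightarrow> real"
 let ?z = "\<lambda>(a, t, y) j. y j - s j a t :: real" and ?e = "\<lambda>g y j. eb j g y"
 have q_m [measurable]: "q \<in> borel_measurable (M0 \<Otimes>\<^sub>M sq \<Otimes>\<^sub>M sq)"
  by (rule q[unfolded white_window_def, THEN conjunct1])
 have q_comp [measurable]: "(\<lambda>x. q (f x, g x, h x)) \<in> borel_measurable K"
  if [measurable]: "f \<in> measurable K M0" "g \<in> measurable K sq" "h \<in> measurable K sq" for f g h and K :: "'k measure"
  by measurable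
 have q0: "\<And>a. 0 \<le> q a" and q1: "(\<integral>\<^sup>+x. ennreal (q x) \<partial>?PP) = 1"
  using q1'[THEN conjunct1] q2'[THEN conjunct1] by auto
 interpret wn: window ?PP N ?w ?G ?t ?y ?z ?e q P "real m * Ce" eps lam
 proof (intro window.intro window_axioms.intro prob_PP)
  show "(\<lambda>(g, y). ?e g y) \<in> measurable (N \<Otimes>\<^sub>M sq) sq"
   unfolding split_beta' by (rule measurable_sqI) (use eb_m in \<open>simp add: split_beta'\<close>)
  fix F :: "'g \<times> (nat \<Rightarrow> real) \<times> (nat \<Rightarrow> real) \<Rightarrow> ennreal" assume F [measurable]: "F \<in> borel_measurable (N \<Otimes>\<^sub>M sq \<Otimes>\<^sub>M sq)"
  show "(\<integral>\<^sup>+a. ennreal (q a) * F (?G a, ?t a, ?y a) \<partial>?PP)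
   = (\<integral>\<^sup>+a. ennreal (q a) * (\<GG> u. F (?G a, (\<lambda>i. if i \<in> ?w then u i else ?t a i), ?y a)) \<partial>?PP)"
  proof -
   have "(\<integral>\<^sup>+x. (\<lambda>(a, t, y). ennreal (q (a, t, y)) * F (G a, t, y)) x \<partial>?PP)
    = (\<integral>\<^sup>+x. (\<lambda>(a, t, y). ennreal (q (a, t, y)) * (\<GG> u. F (G a, (\<lambda>i. if i \<in> ?w then u i else t i), y))) x \<partial>?PP)"
    using q_indep F by (rule bspec)
   moreover have "(\<integral>\<^sup>+a. ennreal (q a) * F (?G a, ?t a, ?y a) \<partial>?PP) = (\<integral>\<^sup>+x. (\<lambda>(a, t, y). ennreal (q (a, t, y)) * F (G a, t, y)) x \<partial>?PP)"
    by (rule nn_integral_cong) auto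
   moreover have "(\<integral>\<^sup>+a. ennreal (q a) * (\<GG> u. F (?G a, (\<lambda>i. if i \<in> ?w then u i else ?t a i), ?y a)) \<partial>?PP)
    = (\<integral>\<^sup>+x. (\<lambda>(a, t, y). ennreal (q (a, t, y)) * (\<GG> u. F (G a, (\<lambda>i. if i \<in> ?w then u i else t i), y))) x \<partial>?PP)"
    by (rule nn_integral_cong) auto
   ultimately show ?thesis by simp
  qed
  fix l :: real assume "0 < l" "l < 1"
  then show "(\<integral>\<^sup>+a. F (?G a, ?t a, ?y a) * ennreal (exp (l * (\<Sum>j\<in>?w. (?z a j)\<^sup>2) / 2)) \<partial>?PP)
   = ennreal ((1 / sqrt (1 - l)) ^ card ?w)
    * (\<integral>\<^sup>+a. (\<GG> g. F (?G a, ?t a, shiftw ?w (\<lambda>i. sqrt (l / (1 - l)) * g i) (?y a))) \<partial>?PP)"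
   using smooth_PP[of "\<lambda>(a, t, y). F (G a, t, y)" l J m] by (simp add: split_beta')
 next
  show "?G \<in> measurable ?PP N" "?t \<in> measurable ?PP sq" "?y \<in> measurable ?PP sq" "?z \<in> measurable ?PP sq" "q \<in> borel_measurable ?PP"
   by measurable
  show "0 \<le> real m * Ce" using param by simp
 qed (use q0 q1 param lam d in simp_all)
 have r: "wn.r (a, t, y) = re ?w a t y" for a t y
  by (simp add: wn.r_def wn.R_def re_def e_eb)
 have PP_loop: "(\<integral>\<^sup>+x. ennreal (wn.r x) * F x \<partial>?PP) = (\<integral>\<^sup>+om. F (A om, T om, Y om) \<partial>M)"
  if [measurable]: "F \<in> borel_measurable (M0 \<Otimes>\<^sub>M sq \<Otimes>\<^sub>M sq)"
   and "\<And>a t y t' y'. (\<And>i. i < J + m \<Longrightarrow> t i = t' i) \<Longrightarrow> (\<And>i. i < J + m \<Longrightarrow> y i = y' i) \<Longrightarrow> F (a, t, y) = F (a, t', y')" for F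
 proof -
  have "(\<integral>\<^sup>+x. ennreal (wn.r x) * F x \<partial>?PP) = (\<integral>\<^sup>+x. (\<lambda>(a, t, y). ennreal (re ?w a t y) * F (a, t, y)) x \<partial>?PP)"
   by (intro nn_integral_cong) (auto simp: r)
  also have "\<dots> = (\<integral>\<^sup>+om. F (A om, T om, Y om) \<partial>M)"
   by (rule nn_PP_loop[of "\<lambda>a t y. F (a, t, y)" J m]) (use that(1) in simp, rule that(2))
  finally show ?thesis .
 qed
 have qM: "(\<integral>\<^sup>+om. ennreal \<bar>1 - q (A om, T om, Y om)\<bar> \<partial>M) \<le> ennreal d" by (rule q_close)
 have dd: "ennreal d \<le> ennreal eps" using d by (intro ennreal_leI)
 have kW_ind: "wn.kW y = wn.kW y'" if "\<forall>i\<in>?w. y i = y' i" for y y'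
  unfolding wn.kW_def using that by simp
 have white: "(\<integral>\<^sup>+om. wn.kW (Y om) \<partial>M) \<le> (\<GG> u. wn.kW (\<lambda>j. sqrt (1 + P) * u j)) + ennreal d"
  "(\<GG> u. wn.kW (\<lambda>j. sqrt (1 + P) * u j)) \<le> (\<integral>\<^sup>+om. wn.kW (Y om) \<partial>M) + ennreal d"
  using q_white[THEN bspec, OF wn.kW_m] wn.kW_le kW_ind by blast+
 have kW_PP: "(\<integral>\<^sup>+x. ennreal (wn.r x) * wn.kW (?y x) \<partial>?PP) = (\<integral>\<^sup>+om. wn.kW (Y om) \<partial>M)"
  using PP_loop[of "\<lambda>x. wn.kW (?y x)"] kW_ind by (simp add: split_beta')
 have E_sum: "(\<integral>\<^sup>+om. ennreal (\<Sum>j\<in>?w. (f om j)\<^sup>2) \<partial>M) \<le> ennreal (real m * c)"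
  if [measurable]: "\<And>j. (\<lambda>om. f om j) \<in> borel_measurable M" and "\<And>j. (\<integral>\<^sup>+om. ennreal ((f om j)\<^sup>2) \<partial>M) \<le> ennreal c" and c: "0 \<le> c"
  for f :: "'w \<Rightarrow> nat \<Rightarrow> real" and c
 proof -
  have "(\<integral>\<^sup>+om. ennreal (\<Sum>j\<in>?w. (f om j)\<^sup>2) \<partial>M) = (\<integral>\<^sup>+om. (\<Sum>j\<in>?w. ennreal ((f om j)\<^sup>2)) \<partial>M)" by simp
  also have "\<dots> = (\<Sum>j\<in>?w. \<integral>\<^sup>+om. ennreal ((f om j)\<^sup>2) \<partial>M)" by (rule nn_integral_sum) measurable
  also have "\<dots> \<le> (\<Sum>j\<in>?w. ennreal c)" by (intro sum_mono that)
  also have "\<dots> = ennreal (real m * c)" using c by (simp add: ennreal_mult ennreal_of_nat_eq_real_of_nat)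
  finally show ?thesis .
 qed
 show ?thesis
 proof unfold_locales
  show "(\<integral>\<^sup>+a. ennreal (wn.r a) \<partial>?PP) = 1"
   using PP_loop[of "\<lambda>_. 1"] by (simp add: W.emeasure_space_1)
  show "(\<integral>\<^sup>+a. ennreal (wn.r a) * ennreal \<bar>1 - q a\<bar> \<partial>?PP) \<le> ennreal eps"
  proof (subst PP_loop)
   fix a t y t' y' assume "\<And>i. i < J + m \<Longrightarrow> t i = (t' i :: real)" "\<And>i. i < J + m \<Longrightarrow> y i = (y' i :: real)"
   then have "q (a, t, y) = q (a, t', y')" using q_causal by blast
   then show "ennreal \<bar>1 - q (a, t, y)\<bar> = ennreal \<bar>1 - q (a, t', y')\<bar>" by simp
  qed (use qM dd in \<open>auto intro: order_trans\<close>)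
  show "(\<integral>\<^sup>+a. ennreal (wn.r a) * wn.kW (?y a) \<partial>?PP) \<le> (\<GG> u. wn.kW (\<lambda>j. sqrt (1 + P) * u j)) + ennreal eps"
   unfolding kW_PP using white(1) dd by (meson add_left_mono order_trans)
  show "(\<GG> u. wn.kW (\<lambda>j. sqrt (1 + P) * u j)) \<le> (\<integral>\<^sup>+a. ennreal (wn.r a) * wn.kW (?y a) \<partial>?PP) + ennreal eps"
   unfolding kW_PP using white(2) dd by (meson add_left_mono order_trans)
  have E_eq: "wn.E (?G x, ?t x, ?y x) = (\<lambda>(a, t, y). \<Sum>j\<in>?w. (e j a y)\<^sup>2) x" for x
   by (cases x) (simp add: wn.E_def e_eb)
  have "(\<integral>\<^sup>+a. ennreal (wn.r a) * ennreal (wn.E (?G a, ?t a, ?y a)) \<partial>?PP)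
   = (\<integral>\<^sup>+om. ennreal (\<Sum>j\<in>?w. (e j (A om) (Y om))\<^sup>2) \<partial>M)"
   unfolding E_eq
  proof (subst PP_loop)
   fix a t y t' y' assume *: "\<And>i. i < J + m \<Longrightarrow> t i = (t' i :: real)" "\<And>i. i < J + m \<Longrightarrow> y i = (y' i :: real)"
   have "e j a y = e j a y'" if "j \<in> ?w" for j using that * by (intro e_causal) auto
   then show "ennreal ((\<lambda>(a, t, y). \<Sum>j\<in>?w. (e j a y)\<^sup>2) (a, t, y)) = ennreal ((\<lambda>(a, t, y). \<Sum>j\<in>?w. (e j a y)\<^sup>2) (a, t', y'))"
    by simp
  qed (auto simp: split_beta')
  also have "\<dots> \<le> ennreal (real m * Ce)" by (rule E_sum) (auto simp: e_pow param)
  finally show "(\<integral>\<^sup>+a. ennreal (wn.r a) * ennreal (wn.E (?G a, ?t a, ?y a)) \<partial>?PP) \<le> ennreal (real m * Ce)" .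
  have "(\<integral>\<^sup>+a. ennreal (wn.r a) * ennreal (exp (lam * (\<Sum>j\<in>?w. (?z a j)\<^sup>2))) \<partial>?PP)
   = (\<integral>\<^sup>+om. ennreal (exp (lam * (\<Sum>j\<in>?w. (Y om j - s j (A om) (T om))\<^sup>2))) \<partial>M)"
  proof (subst PP_loop)
   fix a t y t' y' assume *: "\<And>i. i < J + m \<Longrightarrow> t i = (t' i :: real)" "\<And>i. i < J + m \<Longrightarrow> y i = (y' i :: real)"
   have "s j a t = s j a t'" if "j \<in> ?w" for j using that * by (intro s_causal) auto
   then show "ennreal (exp (lam * (\<Sum>j\<in>?w. (?z (a, t, y) j)\<^sup>2))) = ennreal (exp (lam * (\<Sum>j\<in>?w. (?z (a, t', y') j)\<^sup>2)))"
    using * by simp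
  qed (auto simp: split_beta')
  also have "\<dots> = (\<integral>\<^sup>+om. ennreal (exp (lam * (\<Sum>j\<in>?w. (Z om j)\<^sup>2))) \<partial>M)"
   using Y_eq by (intro nn_integral_cong) simp
  also have "\<dots> = (\<GG> z. ennreal (exp (lam * (\<Sum>j\<in>?w. (z j)\<^sup>2))))"
   by (rule Z_dist(1)[of "\<lambda>z. ennreal (exp (lam * (\<Sum>j\<in>?w. (z j)\<^sup>2)))"]) measurable
  also have "\<dots> = (\<GG> z. 1 * ennreal (exp ((2 * lam) * (\<Sum>j\<in>?w. (z j)\<^sup>2) / 2)))" by simp
  also have "\<dots> = ennreal wn.A2"
   using lam by (subst nn_integral_gseq_smooth) (auto simp: wn.A2_def)
  finally show "(\<integral>\<^sup>+a. ennreal (wn.r a) * ennreal (exp (lam * (\<Sum>j\<in>?w. (?z a j)\<^sup>2))) \<partial>?PP) \<le> ennreal wn.A2" by simp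
  have "(\<integral>\<^sup>+a. ennreal (wn.r a) * ennreal (\<Sum>j\<in>?w. (?t a j - eb j (?G a) (?y a))\<^sup>2) \<partial>?PP)
   = (\<integral>\<^sup>+om. ennreal (\<Sum>j\<in>?w. (T om j - e j (A om) (Y om))\<^sup>2) \<partial>M)"
  proof -
   have "(\<integral>\<^sup>+a. ennreal (wn.r a) * ennreal (\<Sum>j\<in>?w. (?t a j - eb j (?G a) (?y a))\<^sup>2) \<partial>?PP)
    = (\<integral>\<^sup>+a. ennreal (wn.r a) * (\<lambda>(a, t, y). ennreal (\<Sum>j\<in>?w. (t j - e j a y)\<^sup>2)) a \<partial>?PP)"
    by (intro nn_integral_cong) (auto simp: e_eb)
   also have "\<dots> = (\<integral>\<^sup>+om. (\<lambda>(a, t, y). ennreal (\<Sum>j\<in>?w. (t j - e j a y)\<^sup>2)) (A om, T om, Y om) \<partial>M)"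
   proof (rule PP_loop)
    fix a t y t' y' assume *: "\<And>i. i < J + m \<Longrightarrow> t i = (t' i :: real)" "\<And>i. i < J + m \<Longrightarrow> y i = (y' i :: real)"
    have "e j a y = e j a y'" if "j \<in> ?w" for j using that * by (intro e_causal) auto
    then show "(\<lambda>(a, t, y). ennreal (\<Sum>j\<in>?w. (t j - e j a y)\<^sup>2)) (a, t, y) = (\<lambda>(a, t, y). ennreal (\<Sum>j\<in>?w. (t j - e j a y)\<^sup>2)) (a, t', y')"
     using * by simp
   qed measurable
   finally show ?thesis by simp
  qed
  also have "\<dots> = (\<integral>\<^sup>+om. ennreal (\<Sum>j\<in>?w. (V om j)\<^sup>2) \<partial>M)"
   using T_eq by (intro nn_integral_cong) simp
  also have "\<dots> = (\<GG> z. ennreal (\<Sum>j\<in>?w. (z j)\<^sup>2))"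
   by (rule Z_dist(2)[of "\<lambda>z. ennreal (\<Sum>j\<in>?w. (z j)\<^sup>2)"]) measurable
  finally show "(\<integral>\<^sup>+a. ennreal (wn.r a) * ennreal (\<Sum>j\<in>?w. (?t a j - eb j (?G a) (?y a))\<^sup>2) \<partial>?PP) \<le> ennreal (real (card ?w))"
   by (simp add: nn_integral_gseq_sum_sq)
 qed
qed

definition chi_val :: "nat \<Rightarrow> real \<Rightarrow> real" where
 "chi_val m lam = (1 / sqrt (1 - lam\<^sup>2 * (P / (1 + P)))) ^ m"

text \<open>The order of quantifiers matters: the tolerance \<open>d\<close> depends on
  \<open>m\<close>, \<open>lam\<close> and \<open>dl\<close> only, so the window can be sought
  afterwards.\<close>

lemma window_laplace:
 assumes lam: "0 < lam" "2 * lam < 1" and dl: "0 < dl"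
 shows "\<exists>d>0. \<forall>J q d'. d' \<le> d \<longrightarrow> white_window m d' J q \<longrightarrow>
  (\<integral>\<^sup>+om. ennreal (exp (- lam * Qw {J..<J + m} om)) \<partial>M) \<le> ennreal (chi_val m lam + dl) \<and>
  ennreal (chi_val m lam) \<le> (\<integral>\<^sup>+om. ennreal (exp (- lam * Qw {J..<J + m} om)) \<partial>M) + ennreal dl"
proof -
 define sg where "sg = (1 / sqrt (1 - lam)) ^ m"
 define A2 where "A2 = (1 / sqrt (1 - 2 * lam)) ^ m"
 have "0 < sg" "0 < A2" "0 \<le> real m * Ce" using lam param by (auto simp: sg_def A2_def)
 from small_error_parameters[OF this(3,1,2) dl, of m]
 obtain C C1 k B eps where par: "1 < C" "1 < C1" "0 < k" "0 < B" "0 < eps"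
  "sg * (2 * eps + C * e1_bound m (real m * Ce) eps C1) + (k * A2 + (m / 2 + real m * Ce) / (k * ln C)) \<le> dl"
  "sg * (2 * eps + C * e1_bound m (real m * Ce) eps C1 + exp B / C + e1_bound m (real m * Ce) eps C1) + (k * A2 + (e1_bound m (real m * Ce) eps C1 + (real m * Ce / B + eps)) / k) \<le> dl"
  by metis
 show ?thesis
 proof (intro exI conjI allI impI)
  show "0 < eps" by (rule par)
  fix J q d' assume d': "d' \<le> eps" and q: "white_window m d' J q"
  interpret w: tight_window "PP J (J + m)" N "{J..<J + m}" "\<lambda>(a, t, y). G a" "\<lambda>(a, t, y). t" "\<lambda>(a, t, y). y"
   "\<lambda>(a, t, y) j. y j - s j a t" "\<lambda>g y j. eb j g y" q P "real m * Ce" eps lam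
   by (rule window_PP[OF q d' par(5) lam])
  have r: "w.r (a, t, y) = re {J..<J + m} a t y" for a t y
   by (simp add: w.r_def w.R_def re_def e_eb)
  have psi: "w.psi = (\<integral>\<^sup>+om. ennreal (exp (- lam * Qw {J..<J + m} om)) \<partial>M)"
  proof -
   let ?F = "\<lambda>a t y. ennreal (exp (- lam * ((\<Sum>j\<in>{J..<J + m}. (y j)\<^sup>2 / (1 + P) - (y j - s j a t)\<^sup>2) / 2)))"
   have "w.psi = (\<integral>\<^sup>+x. (\<lambda>(a, t, y). ennreal (re {J..<J + m} a t y) * ?F a t y) x \<partial>PP J (J + m))"
    unfolding w.psi_def by (intro nn_integral_cong) (auto simp: r w.Q_def)
   also have "\<dots> = (\<integral>\<^sup>+om. ?F (A om) (T om) (Y om) \<partial>M)"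
   proof (rule nn_PP_loop)
    fix a t y t' y' assume *: "\<And>i. i < J + m \<Longrightarrow> t i = (t' i :: real)" "\<And>i. i < J + m \<Longrightarrow> y i = (y' i :: real)"
    have "s j a t = s j a t'" if "j \<in> {J..<J + m}" for j using that * by (intro s_causal) auto
    then show "?F a t y = ?F a t' y'" using * by simp
   qed measurable
   also have "\<dots> = (\<integral>\<^sup>+om. ennreal (exp (- lam * Qw {J..<J + m} om)) \<partial>M)"
    unfolding Qw_def using Y_eq by (intro nn_integral_cong) simp
   finally show ?thesis .
  qed
  have e1: "w.e1 C1 = e1_bound m (real m * Ce) eps C1" by (simp add: w.e1_def e1_bound_def)
  have sgA: "w.sg = sg" "w.A2 = A2" "w.chi = chi_val m lam"
   by (simp_all add: w.sg_def w.A2_def w.chi_def sg_def A2_def chi_val_def)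
  show "(\<integral>\<^sup>+om. ennreal (exp (- lam * Qw {J..<J + m} om)) \<partial>M) \<le> ennreal (chi_val m lam + dl)"
   using w.psi_upper[OF par(1-3)] par(6) unfolding psi e1 sgA
   by (elim order_trans) (auto intro!: ennreal_leI)
  show "ennreal (chi_val m lam) \<le> (\<integral>\<^sup>+om. ennreal (exp (- lam * Qw {J..<J + m} om)) \<partial>M) + ennreal dl"
   using w.psi_lower[OF par(1-4)] par(7) unfolding psi e1 sgA
   by (elim order_trans) (auto intro!: add_left_mono ennreal_leI)
 qed
qed

end

context white_windows
begin

text \<open>
 If windows of every length are almost white, then \<open>exp (- lam * Qw)\<close> with \<open>lam = c / sqrt m\<close> has
 first and second moments as for a sum of \<open>m\<close> independent terms, so \<open>Qw\<close> fluctuates on the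
 scale \<open>sqrt m\<close>, contradicting the uniform bound on its first absolute moment.
\<close>

lemma windows_contradiction:
 assumes windows: "\<And>m d. 0 < d \<Longrightarrow> \<exists>J q. white_window m d J q"
 shows False
proof -
 \<comment> \<open>The variance per step of the ideal energy.\<close>
 define b where "b = P / (1 + P)"
 have b: "0 < b" "b < 1" using P_pos by (auto simp: b_def)
 \<comment> \<open>Then \<open>exp (b * c\<^sup>2 / 2) = 7\<close>, a lower bound for the ideal
   transform at \<open>lam = c / sqrt m\<close>; 7 exceeds the bound \<open>exp 1 + 3\<close>
   obtained at the end.\<close>
 define c where "c = sqrt (2 * ln 7 / b)"
 have c: "0 < c" "b * c\<^sup>2 = 2 * ln 7" using b by (auto simp: c_def)
 \<comment> \<open>Bounds the transform at \<open>2 * lam\<close>, including the approximation error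
   1, independently of \<open>m\<close>.\<close>
 define S where "S = exp (4 * (b * c\<^sup>2)) + 1"
 have S: "0 < S" by (simp add: S_def add_pos_pos)
 have K2: "0 \<le> K2" using abs_Q[of 0] by (simp add: Qw_def)
 \<comment> \<open>The first condition keeps \<open>2 * (2 * lam) < 1\<close> and the quadratic
   argument of the ideal transform small; the second makes \<open>S\<close> times the tail
   probability at most 1.\<close>
 obtain m :: nat where m: "16 * c\<^sup>2 * (1 + b) + 1 \<le> real m" "(2 * K2 * c * S * 1)\<^sup>2 \<le> real m" "1 \<le> m"
 proof -
  obtain m :: nat where "16 * c\<^sup>2 * (1 + b) + 1 + (2 * K2 * c * S * 1)\<^sup>2 + 1 \<le> real m"
   using real_arch_simple by blast
  moreover have "0 \<le> 16 * c\<^sup>2 * (1 + b)" "0 \<le> (2 * K2 * c * S * 1)\<^sup>2" using b by auto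
  ultimately have "16 * c\<^sup>2 * (1 + b) + 1 \<le> real m" "(2 * K2 * c * S * 1)\<^sup>2 \<le> real m" "1 \<le> real m" by linarith+
  then show ?thesis by (intro that) auto
 qed
 define lam where "lam = c / sqrt m"
 have sm: "0 < sqrt m" using m by simp
 have lam2: "lam\<^sup>2 = c\<^sup>2 / m" by (simp add: lam_def power_divide)
 have lam: "0 < lam" "2 * (2 * lam) < 1"
 proof -
  show "0 < lam" using c sm by (simp add: lam_def)
  have "16 * c\<^sup>2 < real m"
  proof -
   have "16 * c\<^sup>2 * 1 \<le> 16 * c\<^sup>2 * (1 + b)" using b by (intro mult_left_mono) auto
   then show ?thesis using m(1) by simp
  qed
  then have "(4 * c)\<^sup>2 < (sqrt m)\<^sup>2" by (simp add: power_mult_distrib)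
  then have "4 * c < sqrt m" using sm power_less_imp_less_base[of "4 * c" 2 "sqrt m"] by simp
  then show "2 * (2 * lam) < 1" using sm by (simp add: lam_def field_simps)
 qed
 have chi1: "7 \<le> chi_val m lam"
 proof -
  define u where "u = lam\<^sup>2 * b"
  have u: "0 < u" "u < 1"
  proof -
   have "lam\<^sup>2 < 1" using lam by (simp add: power_less_one_iff abs_square_less_1)
   then show "0 < u" "u < 1" using b lam mult_strict_mono[of "lam\<^sup>2" 1 b 1] by (auto simp: u_def)
  qed
  have "exp (u / 2) \<le> 1 / sqrt (1 - u)"
  proof -
   have "1 - u \<le> exp (- u)" using exp_ge_add_one_self[of "- u"] by simp
   then have "sqrt (1 - u) \<le> sqrt (exp (- u))" by simp
   also have "sqrt (exp (- u)) = exp (- (u / 2))"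
    by (rule real_sqrt_unique) (simp_all add: power2_eq_square exp_add[symmetric])
   finally have "sqrt (1 - u) \<le> 1 / exp (u / 2)" by (simp add: exp_minus inverse_eq_divide)
   then show ?thesis using u by (simp add: field_simps)
  qed
  then have "exp (u / 2) ^ m \<le> (1 / sqrt (1 - u)) ^ m" by (rule power_mono) simp
  also have "exp (u / 2) ^ m = exp (real m * (u / 2))" by (rule exp_of_nat_mult[symmetric])
  also have "real m * (u / 2) = b * c\<^sup>2 / 2" using m by (simp add: u_def lam2)
  also have "exp (b * c\<^sup>2 / 2) = 7" by (simp add: c)
  finally show ?thesis by (simp add: chi_val_def u_def b_def)
 qed
 have chi2: "chi_val m (2 * lam) \<le> exp (4 * (b * c\<^sup>2))"
 proof -
  define u where "u = (2 * lam)\<^sup>2 * b"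
  have u: "0 < u" "u \<le> 1 / 2"
  proof -
   show "0 < u" using lam b by (simp add: u_def)
   have "16 * c\<^sup>2 * b \<le> 16 * c\<^sup>2 * (1 + b)" by (intro mult_left_mono) auto
   then have "16 * c\<^sup>2 * b \<le> m" using m(1) by linarith
   moreover have "u = 4 * c\<^sup>2 * b / m" by (simp add: u_def power_mult_distrib lam2)
   ultimately have "u \<le> (real m / 4) / m" by (simp add: divide_right_mono)
   also have "\<dots> = 1 / 4" using m(3) by simp
   finally show "u \<le> 1 / 2" by simp
  qed
  have "1 / sqrt (1 - u) \<le> exp u"
  proof -
   have "(exp (- u))\<^sup>2 \<le> 1 - u"
   proof -
    have "(exp (- u))\<^sup>2 = exp (- (2 * u))" by (simp add: power2_eq_square exp_add[symmetric])
    also have "\<dots> = 1 / exp (2 * u)" by (simp add: exp_minus inverse_eq_divide)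
    also have "\<dots> \<le> 1 / (1 + 2 * u)" using u exp_ge_add_one_self[of "2 * u"] by (intro divide_left_mono) (auto intro: add_pos_pos)
    also have "\<dots> \<le> 1 - u"
    proof -
     have "(1 - u) * (1 + 2 * u) = 1 + u * (1 - 2 * u)" by (simp add: algebra_simps)
     moreover have "0 \<le> u * (1 - 2 * u)" using u by simp
     ultimately have "1 \<le> (1 - u) * (1 + 2 * u)" by simp
     then show ?thesis using u by (simp add: pos_divide_le_eq)
    qed
    finally show ?thesis .
   qed
   then have "exp (- u) \<le> sqrt (1 - u)" by (rule real_le_rsqrt)
   then have "1 / sqrt (1 - u) \<le> 1 / exp (- u)" using u by (intro divide_left_mono) auto
   then show ?thesis by (simp add: exp_minus inverse_eq_divide)
  qed
  then have "(1 / sqrt (1 - u)) ^ m \<le> exp u ^ m" using u by (intro power_mono) auto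
  also have "exp u ^ m = exp (real m * u)" by (rule exp_of_nat_mult[symmetric])
  also have "real m * u = 4 * (b * c\<^sup>2)" using m by (simp add: u_def power_mult_distrib lam2)
  finally show ?thesis by (simp add: chi_val_def u_def b_def)
 qed
 obtain d1 where d1: "0 < d1" "\<And>J q d'. d' \<le> d1 \<Longrightarrow> white_window m d' J q \<Longrightarrow>
   ennreal (chi_val m lam) \<le> (\<integral>\<^sup>+om. ennreal (exp (- lam * Qw {J..<J + m} om)) \<partial>M) + ennreal 1"
  using window_laplace[of lam 1 m] lam by auto
 obtain d2 where d2: "0 < d2" "\<And>J q d'. d' \<le> d2 \<Longrightarrow> white_window m d' J q \<Longrightarrow>
   (\<integral>\<^sup>+om. ennreal (exp (- (2 * lam) * Qw {J..<J + m} om)) \<partial>M) \<le> ennreal (chi_val m (2 * lam) + 1)"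
  using window_laplace[of "2 * lam" 1 m] lam by auto
 obtain J q where q: "white_window m (min d1 d2) J q" using windows[of "min d1 d2" m] d1 d2 by auto
 define Q where "Q = Qw {J..<J + m}"
 have Q_m [measurable]: "Q \<in> borel_measurable M" by (simp add: Q_def)
 have one: "ennreal (chi_val m lam) \<le> (\<integral>\<^sup>+om. ennreal (exp (- lam * Q om)) \<partial>M) + 1"
  using d1(2)[OF _ q] by (simp add: Q_def)
 have two: "(\<integral>\<^sup>+om. ennreal (exp (- (2 * lam) * Q om)) \<partial>M) \<le> ennreal S"
 proof -
  have "(\<integral>\<^sup>+om. ennreal (exp (- (2 * lam) * Q om)) \<partial>M) \<le> ennreal (chi_val m (2 * lam) + 1)"
   using d2(2)[OF _ q] by (simp add: Q_def)
  also have "\<dots> \<le> ennreal S" using chi2 by (intro ennreal_leI) (simp add: S_def)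
  finally show ?thesis .
 qed
 \<comment> \<open>Off this tail \<open>- lam * Q \<le> 1\<close>, because
   \<open>lam * (sqrt m / c) = 1\<close>. The probability comes from the bound on the absolute mean,
   which does not grow with \<open>m\<close>.\<close>
 have tail: "(\<integral>\<^sup>+om. indicator {om. Q om < - (sqrt m / c)} om \<partial>M) \<le> ennreal (2 * K2 * c / sqrt m)"
 proof -
  have "(\<integral>\<^sup>+om. indicator {om. Q om < - (sqrt m / c)} om \<partial>M) \<le> (\<integral>\<^sup>+om. ennreal (c / sqrt m) * ennreal \<bar>Q om\<bar> \<partial>M)"
  proof (rule nn_integral_mono)
   fix om
   have "1 \<le> c / sqrt m * \<bar>Q om\<bar>" if "Q om < - (sqrt m / c)"
   proof -
    have "sqrt m / c \<le> \<bar>Q om\<bar>" using that by linarith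
    then show ?thesis using c sm by (simp add: field_simps)
   qed
   then show "indicator {om. Q om < - (sqrt m / c)} om \<le> ennreal (c / sqrt m) * ennreal \<bar>Q om\<bar>"
    using c sm by (auto simp: ennreal_mult[symmetric] ennreal_ge_1 split: split_indicator)
  qed
  also have "\<dots> = ennreal (c / sqrt m) * ennreal (W.expectation (\<lambda>om. \<bar>Q om\<bar>))"
   using Qw_int by (subst nn_integral_cmult) (auto simp: Q_def nn_integral_eq_integral)
  also have "\<dots> \<le> ennreal (c / sqrt m) * ennreal (2 * K2)"
   using abs_Q_window[of J m] by (intro mult_left_mono ennreal_leI) (auto simp: Q_def)
  also have "\<dots> = ennreal (2 * K2 * c / sqrt m)"
   using c sm K2 by (simp add: ennreal_mult[symmetric] mult_ac)
  finally show ?thesis .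
 qed
 \<comment> \<open>On the tail \<open>x \<le> kk * x\<^sup>2 + S\<close> for
   \<open>x = exp (- lam * Q)\<close>: the square contributes at most \<open>kk * S = 1\<close>, the
   constant is multiplied by the tail probability.\<close>
 define kk where "kk = 1 / S"
 have kk: "0 < kk" "kk * S = 1" using S by (auto simp: kk_def)
 have "(\<integral>\<^sup>+om. ennreal (exp (- lam * Q om)) \<partial>M)
  \<le> (\<integral>\<^sup>+om. (ennreal (exp 1) + ennreal kk * ennreal (exp (- (2 * lam) * Q om))) + ennreal S * indicator {om. Q om < - (sqrt m / c)} om \<partial>M)"
 proof (rule nn_integral_mono)
  fix om
  show "ennreal (exp (- lam * Q om)) \<le> (ennreal (exp 1) + ennreal kk * ennreal (exp (- (2 * lam) * Q om))) + ennreal S * indicator {om. Q om < - (sqrt m / c)} om"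
  proof (cases "Q om < - (sqrt m / c)")
   case True
   define x where "x = exp (- lam * Q om)"
   have x: "0 < x" "x\<^sup>2 = exp (- (2 * lam) * Q om)" by (simp_all add: x_def power2_eq_square exp_add[symmetric])
   have "x \<le> kk * x\<^sup>2 + S"
   proof (cases "x \<le> S")
    case False
    then have "1 * x \<le> (kk * x) * x" using kk x S by (intro mult_right_mono) (auto simp: kk_def field_simps)
    then show ?thesis using S by (simp add: power2_eq_square mult.assoc)
   qed (use kk x in \<open>simp add: add_increasing\<close>)
   then have "ennreal x \<le> ennreal kk * ennreal (x\<^sup>2) + ennreal S"
    using kk S x by (simp add: ennreal_mult[symmetric] ennreal_plus[symmetric] ennreal_leI del: ennreal_plus)
   also have "\<dots> \<le> (ennreal (exp 1) + ennreal kk * ennreal (x\<^sup>2)) + ennreal S"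
    by (intro add_mono) (auto intro: add_increasing)
   finally have "ennreal x \<le> (ennreal (exp 1) + ennreal kk * ennreal (x\<^sup>2)) + ennreal S" .
   then show ?thesis using True unfolding x(2) unfolding x_def by simp
  next
   case False
   then have "- lam * Q om \<le> lam * (sqrt m / c)" using lam mult_left_mono[of "- Q om" "sqrt m / c" lam] by simp
   also have "\<dots> = 1" using c sm by (simp add: lam_def)
   finally have "ennreal (exp (- lam * Q om)) \<le> ennreal (exp 1)" by (intro ennreal_leI) simp
   then show ?thesis by (simp add: add_increasing2 add.assoc)
  qed
 qed
 also have "\<dots> = (ennreal (exp 1) + ennreal kk * (\<integral>\<^sup>+om. ennreal (exp (- (2 * lam) * Q om)) \<partial>M)) + ennreal S * (\<integral>\<^sup>+om. indicator {om. Q om < - (sqrt m / c)} om \<partial>M)"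
  by (simp add: nn_integral_add nn_integral_cmult W.emeasure_space_1 del: nn_integral_indicator)
 also have "\<dots> \<le> (ennreal (exp 1) + ennreal kk * ennreal S) + ennreal S * ennreal (2 * K2 * c / sqrt m)"
  by (intro add_mono mult_left_mono two tail order_refl) auto
 also have "\<dots> = ennreal (exp 1 + 1 + S * (2 * K2 * c / sqrt m))"
 proof -
  define zz where "zz = 2 * K2 * c / sqrt m"
  have zz: "0 \<le> zz" "0 \<le> S * zz" using S K2 c sm by (auto simp: zz_def)
  have "ennreal kk * ennreal S = ennreal 1" using kk S by (simp add: ennreal_mult[symmetric])
  moreover have "ennreal S * ennreal zz = ennreal (S * zz)" using zz S by (simp add: ennreal_mult)
  ultimately show ?thesis
   unfolding zz_def[symmetric] using zz by (simp add: ennreal_plus[symmetric] del: ennreal_plus ennreal_1)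
 qed
 also have "\<dots> \<le> ennreal (exp 1 + 1 + 1)"
 proof (rule ennreal_leI)
  have "2 * K2 * c * S * 1 \<le> sqrt m"
   using m(2) K2 c S by (intro real_le_rsqrt) auto
  then have "S * (2 * K2 * c / sqrt m) \<le> 1" using sm by (simp add: field_simps)
  then show "exp 1 + 1 + S * (2 * K2 * c / sqrt m) \<le> exp 1 + 1 + (1::real)" by simp
 qed
 finally have "ennreal (chi_val m lam) \<le> ennreal (exp 1 + 1 + 1) + 1"
  using one by (meson add_right_mono order_trans)
 also have "\<dots> = ennreal (exp 1 + 3)" by (simp add: ennreal_plus[symmetric] flip: ennreal_1 del: ennreal_plus ennreal_1)
 finally have "chi_val m lam \<le> exp 1 + 3" by (subst (asm) ennreal_le_iff) (auto intro: add_nonneg_nonneg)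
 then show False using chi1 exp_le by simp
qed

end

section \<open>Noise entering the controller\<close>

text \<open>Otherwise \<open>D\<close> would gain more than \<open>d\<close> between any two
  consecutive multiples of \<open>m\<close> and exceed \<open>K\<close>.\<close>

lemma small_increment:
 fixes D :: "nat \<Rightarrow> real"
 assumes "\<And>k. D k \<le> K" "0 < d"
 shows "\<exists>J. D (J + m) - D J \<le> d"
proof (rule ccontr)
 assume "\<nexists>J. D (J + m) - D J \<le> d"
 then have *: "d < D (J + m) - D J" for J by (meson not_le)
 have "D 0 + real i * d \<le> D (i * m)" for i
 proof (induction i)
  case (Suc i)
  then show ?case using *[of "i * m"] by (simp add: algebra_simps)
 qed simp
 moreover obtain i :: nat where "K - D 0 < real i * d" using reals_Archimedean3[OF assms(2)] by blast
 ultimately show False using assms(1) by (metis add.commute diff_less_eq leD order_trans)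
qed

lemma nn_integral_gseq_split:
 assumes [measurable]: "g \<in> borel_measurable sq" "h \<in> borel_measurable sq"
  and g: "\<And>u y. g (\<lambda>i. if i \<in> w then u i else y i) = g y"
  and h: "\<And>u y. h (\<lambda>i. if i \<in> w then u i else y i) = h u"
 shows "(\<GG> y. g y * h y) = (\<GG> y. g y) * (\<GG> y. h y)"
proof -
 have "(\<GG> y. g y * h y) = (\<GG> y. \<GG> u. g y * h u)"
  by (subst nn_integral_gseq_override[of _ w, symmetric]) (auto simp: g h)
 also have "\<dots> = (\<GG> y. g y * (\<GG> u. h u))"
  by (rule nn_integral_cong, rule nn_integral_cmult) measurable
 also have "\<dots> = (\<GG> y. g y) * (\<GG> u. h u)"
  by (rule nn_integral_multc) measurable
 finally show ?thesis .
qed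

text \<open>Uniform in the shift \<open>a\<close>; so averages of likelihoods over unknown shifts
  stay finite and their logarithms are bounded above by output energy.\<close>

lemma gl_le: "gl a b \<le> exp (b\<^sup>2 / 2)"
proof -
 have "0 \<le> (a - b)\<^sup>2" by simp
 then show ?thesis by (simp add: gl_def power2_diff field_simps power2_eq_square)
qed

lemma nn_integral_window_scale:
 assumes P: "0 \<le> P" and w: "finite w" and [measurable]: "k \<in> borel_measurable sq"
  and k: "\<And>y y'. (\<And>i. i \<in> w \<Longrightarrow> y i = y' i) \<Longrightarrow> k y = k y'"
 shows "(\<GG> y. k y * ennreal (nh P w y)) = (\<GG> u. k (\<lambda>j. sqrt (1 + P) * u j))"
 unfolding nn_integral_nh[OF P w assms(3)]
 by (intro nn_integral_cong k) (simp add: scalew_def)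

section \<open>Bounds for averaged likelihoods\<close>

context info_loop
begin

lemma ls_le: "finite w \<Longrightarrow> ls w a t y \<le> exp (\<Sum>j\<in>w. (y j)\<^sup>2 / 2)"
 unfolding ls_def by (auto simp: exp_sum intro!: prod_mono gl_le less_imp_le[OF gl_pos])

lemma ln_nh: "finite w \<Longrightarrow> ln (nh P w y) = (\<Sum>j\<in>w. P / (1 + P) * (y j)\<^sup>2 / 2 - ln (sqrt (1 + P)))"
proof -
 assume w: "finite w"
 have "nh P w y = exp (\<Sum>j\<in>w. P / (1 + P) * (y j)\<^sup>2 / 2 - ln (sqrt (1 + P)))"
  using w param by (simp add: nh_def nd_def exp_sum exp_diff)
 then show ?thesis by simp
qed

lemma ln_nh_int: "finite w \<Longrightarrow> integrable M (\<lambda>om. ln (nh P w (Y om)))"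
 using Y_int by (simp add: ln_nh)

lemma ln_ls: "om \<in> space M \<Longrightarrow> finite w \<Longrightarrow> ln (ls w (A om) (T om) (Y om)) = (\<Sum>j\<in>w. ((Y om j)\<^sup>2 - (Z om j)\<^sup>2) / 2)"
proof -
 assume om: "om \<in> space M" and w: "finite w"
 have "gl (s j (A om) (T om)) (Y om j) = exp (((Y om j)\<^sup>2 - (Z om j)\<^sup>2) / 2)" for j
 proof -
  have s: "s j (A om) (T om) = Y om j - Z om j" using Y_eq[OF om, of j] by simp
  show ?thesis unfolding gl_def s by (simp add: power2_eq_square algebra_simps diff_divide_distrib add_divide_distrib)
 qed
 then have "ls w (A om) (T om) (Y om) = exp (\<Sum>j\<in>w. ((Y om j)\<^sup>2 - (Z om j)\<^sup>2) / 2)"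
  using w by (simp add: ls_def exp_sum)
 then show ?thesis by simp
qed

lemma Y_sq_sum_int: "integrable M (\<lambda>om. \<Sum>j\<in>w. (Y om j)\<^sup>2 / 2)"
 using Y_int by simp

lemma lborel_nn_m [measurable]:
 assumes [measurable]: "(\<lambda>(z, x). f z x) \<in> borel_measurable (K \<Otimes>\<^sub>M borel)"
 shows "(\<lambda>z. (\<LL> x. f z (x :: 'x))) \<in> borel_measurable K"
 by (intro sigma_finite_measure.borel_measurable_nn_integral[OF sigma_finite_lborel]) (simp cong: measurable_cong_sets)

lemma Pair_M0:
 assumes [measurable]: "f \<in> borel_measurable K" "g \<in> measurable K H"
 shows "(\<lambda>z. (f z, g z)) \<in> measurable K M0"
 by (simp cong: measurable_cong_sets add: sets_M0)

lemma snd_M0: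
 assumes [measurable]: "f \<in> measurable K M0"
 shows "(\<lambda>z. snd (f z)) \<in> measurable K H"
 by (rule measurable_compose[OF assms measurable_snd])

lemma p_mass: "(\<LL> x. ennreal (p x)) = 1"
 using prob_space.emeasure_space_1[OF p_prob] by (simp add: emeasure_density)

lemma close_transfer:
 assumes [measurable]: "f \<in> borel_measurable M" "k \<in> borel_measurable M" and f: "\<And>om. om \<in> space M \<Longrightarrow> 0 \<le> f om" and k: "\<And>om. k om \<le> 1"
  and d: "(\<integral>\<^sup>+om. ennreal \<bar>1 - f om\<bar> \<partial>M) \<le> ennreal d"
 shows "(\<integral>\<^sup>+om. k om \<partial>M) \<le> (\<integral>\<^sup>+om. k om * ennreal (f om) \<partial>M) + ennreal d"
  and "(\<integral>\<^sup>+om. k om * ennreal (f om) \<partial>M) \<le> (\<integral>\<^sup>+om. k om \<partial>M) + ennreal d"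
proof -
 have pw: "ennreal (f om) \<le> 1 + ennreal \<bar>1 - f om\<bar>" "1 \<le> ennreal (f om) + ennreal \<bar>1 - f om\<bar>" if "om \<in> space M" for om
  using f[OF that]
  by (auto simp flip: ennreal_1 ennreal_plus simp del: ennreal_1 ennreal_plus intro!: ennreal_leI)
 have "(\<integral>\<^sup>+om. k om \<partial>M) \<le> (\<integral>\<^sup>+om. k om * ennreal (f om) + ennreal \<bar>1 - f om\<bar> \<partial>M)"
 proof (rule nn_integral_mono)
  fix om assume "om \<in> space M"
  then have "k om * 1 \<le> k om * (ennreal (f om) + ennreal \<bar>1 - f om\<bar>)" by (intro mult_left_mono pw) auto
  also have "\<dots> \<le> k om * ennreal (f om) + 1 * ennreal \<bar>1 - f om\<bar>"
   unfolding distrib_left by (intro add_mono mult_right_mono k) auto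
  finally show "k om \<le> k om * ennreal (f om) + ennreal \<bar>1 - f om\<bar>" by simp
 qed
 also have "\<dots> \<le> (\<integral>\<^sup>+om. k om * ennreal (f om) \<partial>M) + ennreal d"
  by (subst nn_integral_add) (auto intro: add_left_mono d)
 finally show "(\<integral>\<^sup>+om. k om \<partial>M) \<le> (\<integral>\<^sup>+om. k om * ennreal (f om) \<partial>M) + ennreal d" .
 have "(\<integral>\<^sup>+om. k om * ennreal (f om) \<partial>M) \<le> (\<integral>\<^sup>+om. k om + ennreal \<bar>1 - f om\<bar> \<partial>M)"
 proof (rule nn_integral_mono)
  fix om assume "om \<in> space M"
  then have "k om * ennreal (f om) \<le> k om * (1 + ennreal \<bar>1 - f om\<bar>)" by (intro mult_left_mono pw) auto
  also have "\<dots> \<le> k om + 1 * ennreal \<bar>1 - f om\<bar>"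
   unfolding distrib_left mult_1_right by (intro add_mono mult_right_mono k) auto
  finally show "k om * ennreal (f om) \<le> k om + ennreal \<bar>1 - f om\<bar>" by simp
 qed
 also have "\<dots> \<le> (\<integral>\<^sup>+om. k om \<partial>M) + ennreal d"
  by (subst nn_integral_add) (auto intro: add_left_mono d)
 finally show "(\<integral>\<^sup>+om. k om * ennreal (f om) \<partial>M) \<le> (\<integral>\<^sup>+om. k om \<partial>M) + ennreal d" .
qed

end

text \<open>The feedback does not see \<open>x\<close>, so \<open>x\<close> can be integrated out of
  the likelihood of \<open>y\<close> without touching \<open>re\<close>; \<open>G\<close> becomes
  the projection to \<open>h\<close>.\<close>

locale downstream_loop = info_loop p H e s M A V Z T Y P Ce c0 Kg al gk
 for p :: "'x::euclidean_space \<Rightarrow> real" and H :: "'h measure" and e s and M :: "'w measure"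
  and A V Z T Y P Ce c0 Kg al gk +
 fixes eb :: "nat \<Rightarrow> 'h \<Rightarrow> (nat \<Rightarrow> real) \<Rightarrow> real"
 assumes eb_m: "\<And>n. (\<lambda>(h, y). eb n h y) \<in> borel_measurable (H \<Otimes>\<^sub>M sq)"
  and e_eb: "\<And>n a y. e n a y = eb n (snd a) y"
  and gk_int: "\<And>k h t y. h \<in> space H \<Longrightarrow> (\<LL> x. ennreal (gk k (x, h) t y)) \<le> ennreal (c0 * exp (- (real k * al)))"
begin

sublocale white_windows p H e s M A V Z T Y P Ce c0 Kg al gk H snd eb
 by unfold_locales (auto simp: eb_m e_eb)

lemma re_snd: "re w (x, h) t y = re w (x', h) t y"
 by (simp add: re_def e_eb)

text \<open>Likelihood of \<open>y\<close> given \<open>h\<close> and \<open>t\<close>, with the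
  initial state averaged out.\<close>

definition U :: "nat \<Rightarrow> 'h \<Rightarrow> (nat \<Rightarrow> real) \<Rightarrow> (nat \<Rightarrow> real) \<Rightarrow> ennreal" where
 "U k h t y = (\<LL> x. ennreal (p x) * ennreal (ls {..<k} (x, h) t y))"

definition Ur :: "nat \<Rightarrow> 'h \<Rightarrow> (nat \<Rightarrow> real) \<Rightarrow> (nat \<Rightarrow> real) \<Rightarrow> real" where
 "Ur k h t y = enn2real (U k h t y)"

lemma U_m [measurable]:
 assumes [measurable]: "f \<in> measurable K H" "g \<in> measurable K sq" "h \<in> measurable K sq"
 shows "(\<lambda>z. U k (f z) (g z) (h z)) \<in> borel_measurable K"
proof -
 have "(\<lambda>(z, x). (x, f z)) \<in> measurable (K \<Otimes>\<^sub>M borel) M0"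
  unfolding split_beta' by (rule Pair_M0) measurable
 then have [measurable]: "(\<lambda>z. (snd z, f (fst z))) \<in> measurable (K \<Otimes>\<^sub>M borel) M0" by (simp add: split_beta')
 show ?thesis unfolding U_def by (rule lborel_nn_m) (unfold split_beta', measurable)
qed

lemma Ur_m [measurable]:
 assumes [measurable]: "f \<in> measurable K H" "g \<in> measurable K sq" "h \<in> measurable K sq"
 shows "(\<lambda>z. Ur k (f z) (g z) (h z)) \<in> borel_measurable K"
 unfolding Ur_def by measurable

lemma U_le: "U k h t y \<le> ennreal (exp (\<Sum>j<k. (y j)\<^sup>2 / 2))"
proof -
 have "U k h t y \<le> (\<LL> x. ennreal (p x) * ennreal (exp (\<Sum>j<k. (y j)\<^sup>2 / 2)))"
  unfolding U_def by (intro nn_integral_mono mult_left_mono ennreal_leI ls_le) auto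
 then show ?thesis by (simp add: nn_integral_multc p_mass)
qed

lemma U_pos: "h \<in> space H \<Longrightarrow> U k h t y \<noteq> 0"
proof
 assume h [measurable]: "h \<in> space H" and "U k h t y = 0"
 have [measurable]: "t \<in> space sq" "y \<in> space sq" by auto
 have "AE x in lborel. ennreal (p x) * ennreal (ls {..<k} (x, h) t y) = 0"
  using \<open>U k h t y = 0\<close> unfolding U_def by (subst (asm) nn_integral_0_iff_AE) auto
 then have "AE x in lborel. ennreal (p x) = 0"
 proof eventually_elim
  fix x assume "ennreal (p x) * ennreal (ls {..<k} (x, h) t y) = 0"
  moreover have "ennreal (ls {..<k} (x, h) t y) \<noteq> 0" using ls_pos[of "{..<k}" "(x, h)" t y] by (simp add: ennreal_eq_0_iff not_le)
  ultimately show "ennreal (p x) = 0" by simp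
 qed
 then have "(\<LL> x. ennreal (p x)) = 0" by (subst nn_integral_0_iff_AE) auto
 then show False by (simp add: p_mass)
qed

lemma Ur_pos: "h \<in> space H \<Longrightarrow> 0 < Ur k h t y"
 and Ur_eq: "ennreal (Ur k h t y) = U k h t y"
 and Ur_le: "Ur k h t y \<le> exp (\<Sum>j<k. (y j)\<^sup>2 / 2)"
proof -
 have fin: "U k h t y < top" using U_le[of k h t y] by (simp add: order_le_less_trans)
 then show eq: "ennreal (Ur k h t y) = U k h t y" by (simp add: Ur_def)
 show "0 < Ur k h t y" if "h \<in> space H"
  using fin U_pos[OF that, of k t y] by (simp add: Ur_def enn2real_positive_iff zero_less_iff_neq_zero)
 show "Ur k h t y \<le> exp (\<Sum>j<k. (y j)\<^sup>2 / 2)"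
  using enn2real_mono[OF U_le[of k h t y]] by (simp add: Ur_def)
qed

lemma Ur_nonneg: "0 \<le> Ur k h t y"
 by (simp add: Ur_def)

lemma U_cong:
 assumes "\<And>i. i < k \<Longrightarrow> t i = t' i" "\<And>i. i < k \<Longrightarrow> y i = y' i"
 shows "U k h t y = U k h t' y'"
proof -
 have "ls {..<k} (x, h) t y = ls {..<k} (x, h) t' y'" for x using assms by (intro ls_cong) auto
 then show ?thesis by (simp add: U_def)
qed

lemma nn_PP_U:
 assumes [measurable]: "(\<lambda>(h, t, y). F h t y) \<in> borel_measurable (H \<Otimes>\<^sub>M sq \<Otimes>\<^sub>M sq)"
 shows "(\<integral>\<^sup>+x. (\<lambda>(a, t, y). F (snd a) t y) x \<partial>PP J k)
  = (\<integral>\<^sup>+h. (\<GG> t. \<GG> y. F h t y * ennreal (re {..<J} (0, h) t y) * U k h t y) \<partial>H)"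
proof -
 have F_m [measurable]: "(\<lambda>x. F (f x) (g x) (h x)) \<in> borel_measurable K"
  if "f \<in> measurable K H" "g \<in> measurable K sq" "h \<in> measurable K sq" for f g h and K :: "'k measure"
  using measurable_compose[OF measurable_Pair[OF that(1) measurable_Pair[OF that(2,3)]] assms(1)] by simp
 have "(\<integral>\<^sup>+x. (\<lambda>(a, t, y). F (snd a) t y) x \<partial>PP J k)
  = (\<integral>\<^sup>+h. (\<LL> x. ennreal (p x) * (\<GG> t. \<GG> y. F h t y * ennreal (re {..<J} (x, h) t y * ls {..<k} (x, h) t y))) \<partial>H)"
  by (subst nn_PP, measurable, subst nn_M0) auto
 also have "\<dots> = (\<integral>\<^sup>+h. (\<GG> t. \<GG> y. F h t y * ennreal (re {..<J} (0, h) t y) * U k h t y) \<partial>H)"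
 proof (rule nn_integral_cong)
  fix h assume h [measurable]: "h \<in> space H"
  let ?f = "\<lambda>x t y. (F h t y * ennreal (re {..<J} (0, h) t y)) * (ennreal (p x) * ennreal (ls {..<k} (x, h) t y))"
  have "(\<LL> x. ennreal (p x) * (\<GG> t. \<GG> y. F h t y * ennreal (re {..<J} (x, h) t y * ls {..<k} (x, h) t y)))
   = (\<LL> x. \<GG> t. \<GG> y. ?f x t y)"
  proof (rule nn_integral_cong)
   fix x
   have [measurable]: "(x, h) \<in> space M0" using h by (simp add: space_pair_measure)
   have "ennreal (p x) * (\<GG> t. \<GG> y. F h t y * ennreal (re {..<J} (x, h) t y * ls {..<k} (x, h) t y))
    = (\<GG> t. \<GG> y. ennreal (p x) * (F h t y * ennreal (re {..<J} (x, h) t y * ls {..<k} (x, h) t y)))"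
    by (simp add: nn_integral_cmult cong: measurable_cong_sets)
   also have "\<dots> = (\<GG> t. \<GG> y. ?f x t y)"
   proof (rule nn_integral_cong, rule nn_integral_cong)
    fix t y
    have "ennreal (re {..<J} (x, h) t y * ls {..<k} (x, h) t y) = ennreal (re {..<J} (0, h) t y) * ennreal (ls {..<k} (x, h) t y)"
     unfolding re_snd[of "{..<J}" x h t y 0] by (intro ennreal_mult less_imp_le re_pos ls_pos)
    then show "ennreal (p x) * (F h t y * ennreal (re {..<J} (x, h) t y * ls {..<k} (x, h) t y)) = ?f x t y"
     by (simp only: mult_ac)
   qed
   finally show "ennreal (p x) * (\<GG> t. \<GG> y. F h t y * ennreal (re {..<J} (x, h) t y * ls {..<k} (x, h) t y))
    = (\<GG> t. \<GG> y. ?f x t y)" .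
  qed
  also have "\<dots> = (\<GG> t. \<LL> x. \<GG> y. ?f x t y)"
   by (rule nn_integral_swap_lborel_gseq) measurable
  also have "\<dots> = (\<GG> t. \<GG> y. \<LL> x. ?f x t y)"
   by (rule nn_integral_cong, rule nn_integral_swap_lborel_gseq) measurable
  also have "\<dots> = (\<GG> t. \<GG> y. F h t y * ennreal (re {..<J} (0, h) t y) * U k h t y)"
  proof (rule nn_integral_cong, rule nn_integral_cong)
   fix t y :: "nat \<Rightarrow> real"
   have [measurable]: "t \<in> space sq" "y \<in> space sq" by auto
   show "(\<LL> x. ?f x t y) = F h t y * ennreal (re {..<J} (0, h) t y) * U k h t y"
    unfolding U_def by (rule nn_integral_cmult) measurable
  qed
  finally show "(\<LL> x. ennreal (p x) * (\<GG> t. \<GG> y. F h t y * ennreal (re {..<J} (x, h) t y * ls {..<k} (x, h) t y)))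
   = (\<GG> t. \<GG> y. F h t y * ennreal (re {..<J} (0, h) t y) * U k h t y)" .
 qed
 finally show ?thesis .
qed

lemma nn_loop_U:
 assumes [measurable]: "(\<lambda>(h, t, y). F h t y) \<in> borel_measurable (H \<Otimes>\<^sub>M sq \<Otimes>\<^sub>M sq)"
  and F: "\<And>h t y t' y'. (\<And>i. i < k \<Longrightarrow> t i = t' i) \<Longrightarrow> (\<And>i. i < k \<Longrightarrow> y i = y' i) \<Longrightarrow> F h t y = F h t' y'"
 shows "(\<integral>\<^sup>+om. F (snd (A om)) (T om) (Y om) \<partial>M)
  = (\<integral>\<^sup>+h. (\<GG> t. \<GG> y. F h t y * ennreal (re {..<k} (0, h) t y) * U k h t y) \<partial>H)"
proof -
 have F_m [measurable]: "(\<lambda>x. F (f x) (g x) (h x)) \<in> borel_measurable K"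
  if "f \<in> measurable K H" "g \<in> measurable K sq" "h \<in> measurable K sq" for f g h and K :: "'k measure"
  using measurable_compose[OF measurable_Pair[OF that(1) measurable_Pair[OF that(2,3)]] assms(1)] by simp
 \<comment> \<open>The loop law is the window law with an empty window.\<close>
 have "(\<integral>\<^sup>+om. F (snd (A om)) (T om) (Y om) \<partial>M)
  = (\<integral>\<^sup>+x. (\<lambda>(a, t, y). ennreal (re {k..<k + 0} a t y) * F (snd a) t y) x \<partial>PP k (k + 0))"
  by (rule nn_PP_loop[symmetric]) (measurable, rule F, auto)
 also have "\<dots> = (\<integral>\<^sup>+x. (\<lambda>(a, t, y). F (snd a) t y) x \<partial>PP k k)"
  by (simp add: re_def)
 also have "\<dots> = (\<integral>\<^sup>+h. (\<GG> t. \<GG> y. F h t y * ennreal (re {..<k} (0, h) t y) * U k h t y) \<partial>H)"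
  by (rule nn_PP_U) measurable
 finally show ?thesis .
qed

end

section \<open>Exchanging the output law on a window\<close>

context downstream_loop
begin

text \<open>Exchanges the predictive density \<open>U (J + m) / U J\<close> of \<open>y\<close> on
  the window for the white one. After the exchange no remaining factor of the window law involves
  \<open>t\<close> on the window.\<close>

definition qd :: "nat \<Rightarrow> nat \<Rightarrow> ('x \<times> 'h) \<times> (nat \<Rightarrow> real) \<times> (nat \<Rightarrow> real) \<Rightarrow> real" where
 "qd J m = (\<lambda>(a, t, y). Ur J (snd a) t y * nh P {J..<J + m} y / Ur (J + m) (snd a) t y)"

lemma Ur_snd_m [measurable]:
 "(\<lambda>x. Ur k (snd (fst x)) (fst (snd x)) (snd (snd x))) \<in> borel_measurable (M0 \<Otimes>\<^sub>M sq \<Otimes>\<^sub>M sq)"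
 by (rule Ur_m) (rule snd_M0, measurable)

lemma qd_m [measurable]: "qd J m \<in> borel_measurable (M0 \<Otimes>\<^sub>M sq \<Otimes>\<^sub>M sq)"
 unfolding qd_def split_beta' by measurable

lemma qd_nonneg: "0 \<le> qd J m x"
 using nh_pos[OF param(1)] by (cases x) (simp add: qd_def Ur_nonneg less_imp_le)

lemma qd_U:
 assumes h: "h \<in> space H"
 shows "ennreal (qd J m ((x, h), t, y)) * U (J + m) h t y = U J h t y * ennreal (nh P {J..<J + m} y)"
proof -
 have "ennreal (qd J m ((x, h), t, y)) * U (J + m) h t y = ennreal (qd J m ((x, h), t, y) * Ur (J + m) h t y)"
  unfolding Ur_eq[symmetric] by (intro ennreal_mult[symmetric] qd_nonneg Ur_nonneg)
 also have "qd J m ((x, h), t, y) * Ur (J + m) h t y = Ur J h t y * nh P {J..<J + m} y"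
  using Ur_pos[OF h, of "J + m" t y] by (simp add: qd_def)
 also have "ennreal \<dots> = U J h t y * ennreal (nh P {J..<J + m} y)"
  unfolding Ur_eq[symmetric] by (intro ennreal_mult Ur_nonneg less_imp_le nh_pos param)
 finally show ?thesis .
qed

lemma qd_causal:
 assumes "\<And>i. i < J + m \<Longrightarrow> t i = t' i" "\<And>i. i < J + m \<Longrightarrow> y i = y' i"
 shows "qd J m (a, t, y) = qd J m (a, t', y')"
proof -
 have "U J (snd a) t y = U J (snd a) t' y'" "U (J + m) (snd a) t y = U (J + m) (snd a) t' y'"
  using assms by (auto intro!: U_cong)
 moreover have "nh P {J..<J + m} y = nh P {J..<J + m} y'" unfolding nh_def using assms by simp
 ultimately show ?thesis by (simp add: qd_def Ur_def)
qed

lemma re_U_mass: "(\<integral>\<^sup>+h. (\<GG> t. \<GG> y. ennreal (re {..<J} (0, h) t y) * U J h t y) \<partial>H) = 1"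
 using nn_loop_U[of "\<lambda>_ _ _. 1" J] by (simp add: W.emeasure_space_1)

lemma override_J:
 "re {..<J} a t (\<lambda>i. if i \<in> {J..<J + m} then u i else y i) = re {..<J} a t y"
 "re {..<J} a (\<lambda>i. if i \<in> {J..<J + m} then u i else t i) y = re {..<J} a t y"
 "U J h t (\<lambda>i. if i \<in> {J..<J + m} then u i else y i) = U J h t y"
 "U J h (\<lambda>i. if i \<in> {J..<J + m} then u i else t i) y = U J h t y"
 by (auto intro!: re_cong U_cong)

lemma F_meas3:
 assumes "(\<lambda>(h, t, y). F h t y) \<in> borel_measurable (H \<Otimes>\<^sub>M sq \<Otimes>\<^sub>M sq)"
  "f \<in> measurable K H" "g \<in> measurable K sq" "h \<in> measurable K sq"
 shows "(\<lambda>x. F (f x) (g x) (h x)) \<in> borel_measurable K"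
 using measurable_compose[OF measurable_Pair[OF assms(2) measurable_Pair[OF assms(3,4)]] assms(1)] by simp

lemma qd_H_m: "(\<lambda>(h, t, y). qd J m ((0, h), t, y)) \<in> borel_measurable (H \<Otimes>\<^sub>M sq \<Otimes>\<^sub>M sq)"
 unfolding qd_def split_beta' by simp

lemma nn_PP_qd:
 assumes F: "(\<lambda>(h, t, y). F h t y) \<in> borel_measurable (H \<Otimes>\<^sub>M sq \<Otimes>\<^sub>M sq)"
 shows "(\<integral>\<^sup>+x. (\<lambda>(a, t, y). ennreal (qd J m (a, t, y)) * F (snd a) t y) x \<partial>PP J (J + m))
  = (\<integral>\<^sup>+h. (\<GG> t. \<GG> y. F h t y * (ennreal (re {..<J} (0, h) t y) * U J h t y * ennreal (nh P {J..<J + m} y))) \<partial>H)"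
proof -
 note [measurable] = F_meas3[OF F] F_meas3[OF qd_H_m]
 have "(\<integral>\<^sup>+x. (\<lambda>(a, t, y). ennreal (qd J m (a, t, y)) * F (snd a) t y) x \<partial>PP J (J + m))
  = (\<integral>\<^sup>+x. (\<lambda>(a, t, y). ennreal (qd J m ((0, snd a), t, y)) * F (snd a) t y) x \<partial>PP J (J + m))"
  by (rule nn_integral_cong) (auto simp: qd_def)
 also have "\<dots> = (\<integral>\<^sup>+h. (\<GG> t. \<GG> y. (ennreal (qd J m ((0, h), t, y)) * F h t y) * ennreal (re {..<J} (0, h) t y) * U (J + m) h t y) \<partial>H)"
  by (rule nn_PP_U) measurable
 also have "\<dots> = (\<integral>\<^sup>+h. (\<GG> t. \<GG> y. F h t y * (ennreal (re {..<J} (0, h) t y) * U J h t y * ennreal (nh P {J..<J + m} y))) \<partial>H)"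
 proof (rule nn_integral_cong, rule nn_integral_cong, rule nn_integral_cong)
  fix h t y assume h: "h \<in> space H"
  have "(ennreal (qd J m ((0, h), t, y)) * F h t y) * ennreal (re {..<J} (0, h) t y) * U (J + m) h t y
   = (ennreal (qd J m ((0, h), t, y)) * U (J + m) h t y) * (F h t y * ennreal (re {..<J} (0, h) t y))" by (simp only: mult_ac)
  also have "\<dots> = F h t y * (ennreal (re {..<J} (0, h) t y) * U J h t y * ennreal (nh P {J..<J + m} y))"
   unfolding qd_U[OF h] by (simp only: mult_ac)
  finally show "(ennreal (qd J m ((0, h), t, y)) * F h t y) * ennreal (re {..<J} (0, h) t y) * U (J + m) h t y
   = F h t y * (ennreal (re {..<J} (0, h) t y) * U J h t y * ennreal (nh P {J..<J + m} y))" .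
 qed
 finally show ?thesis .
qed

text \<open>After the exchange the window factor \<open>re\<close> is integrated first, over the
  window of \<open>t\<close> for fixed \<open>y\<close>, and gives one; the window of
  \<open>y\<close> then carries only \<open>nh\<close> and separates from the past.\<close>

lemma nn_loop_qd:
 fixes J m :: nat
 defines "w \<equiv> {J..<J + m}"
 assumes k: "k \<in> borel_measurable sq" and kw: "\<And>y y'. (\<And>i. i \<in> w \<Longrightarrow> y i = y' i) \<Longrightarrow> k y = k y'"
 shows "(\<integral>\<^sup>+om. k (Y om) * ennreal (qd J m (A om, T om, Y om)) \<partial>M) = (\<GG> y. k y * ennreal (nh P w y))"
proof -
 have k_m [measurable]: "(\<lambda>x. k (f x)) \<in> borel_measurable K" if "f \<in> measurable K sq" for f and K :: "'k measure"
  using measurable_compose[OF that k] by simp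
 note [measurable] = F_meas3[OF qd_H_m]
 have w: "finite w" by (simp add: w_def)
 let ?n = "\<lambda>y. k y * ennreal (nh P w y)"
 let ?R = "\<lambda>h t y. ennreal (re {..<J} (0, h) t y) * U J h t y"
 have n_w: "?n (\<lambda>i. if i \<in> w then u i else y i) = ?n u" for u y
 proof -
  have "k (\<lambda>i. if i \<in> w then u i else y i) = k u" by (rule kw) simp
  moreover have "nh P w (\<lambda>i. if i \<in> w then u i else y i) = nh P w u" by (simp add: nh_def)
  ultimately show ?thesis by simp
 qed
 have R_w: "?R h t (\<lambda>i. if i \<in> w then u i else y i) = ?R h t y" "?R h (\<lambda>i. if i \<in> w then u i else t i) y = ?R h t y" for h t u y
  unfolding w_def by (simp_all only: override_J)
 have "(\<integral>\<^sup>+om. k (Y om) * ennreal (qd J m (A om, T om, Y om)) \<partial>M)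
  = (\<integral>\<^sup>+om. k (Y om) * ennreal (qd J m ((0, snd (A om)), T om, Y om)) \<partial>M)"
  by (simp add: qd_def)
 also have "\<dots> = (\<integral>\<^sup>+h. (\<GG> t. \<GG> y. (k y * ennreal (qd J m ((0, h), t, y))) * ennreal (re {..<J + m} (0, h) t y) * U (J + m) h t y) \<partial>H)"
 proof (rule nn_loop_U)
  fix h t y t' y' assume *: "\<And>i. i < J + m \<Longrightarrow> t i = (t' i :: real)" "\<And>i. i < J + m \<Longrightarrow> y i = (y' i :: real)"
  then have "k y = k y'" by (intro kw) (auto simp: w_def)
  with qd_causal[of J m t t' y y' "(0, h)"] * show "k y * ennreal (qd J m ((0, h), t, y)) = k y' * ennreal (qd J m ((0, h), t', y'))"
   by simp
 qed measurable
 also have "\<dots> = (\<integral>\<^sup>+h. (\<GG> t. \<GG> y. ?R h t y) * (\<GG> y. ?n y) \<partial>H)"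
 proof (rule nn_integral_cong)
  fix h assume h [measurable]: "h \<in> space H"
  then have [measurable]: "(0, h) \<in> space M0" by (simp add: space_pair_measure)
  have "(\<GG> t. \<GG> y. (k y * ennreal (qd J m ((0, h), t, y))) * ennreal (re {..<J + m} (0, h) t y) * U (J + m) h t y)
   = (\<GG> t. \<GG> y. ?n y * ?R h t y * ennreal (re w (0, h) t y))"
  proof (rule nn_integral_cong, rule nn_integral_cong)
   fix t y
   have r: "ennreal (re {..<J + m} (0, h) t y) = ennreal (re {..<J} (0, h) t y) * ennreal (re w (0, h) t y)"
    unfolding w_def re_split by (intro ennreal_mult less_imp_le re_pos)
   have "(k y * ennreal (qd J m ((0, h), t, y))) * ennreal (re {..<J + m} (0, h) t y) * U (J + m) h t y
    = (ennreal (qd J m ((0, h), t, y)) * U (J + m) h t y) * (k y * (ennreal (re {..<J} (0, h) t y) * ennreal (re w (0, h) t y)))"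
    unfolding r by (simp only: mult_ac)
   also have "\<dots> = ?n y * ?R h t y * ennreal (re w (0, h) t y)"
    unfolding qd_U[OF h] w_def by (simp only: mult_ac)
   finally show "(k y * ennreal (qd J m ((0, h), t, y))) * ennreal (re {..<J + m} (0, h) t y) * U (J + m) h t y
    = ?n y * ?R h t y * ennreal (re w (0, h) t y)" .
  qed
  also have "\<dots> = (\<GG> y. \<GG> t. ?n y * ?R h t y * ennreal (re w (0, h) t y))"
   by (rule nn_integral_swap_gseq) measurable
  also have "\<dots> = (\<GG> y. \<GG> t. ?n y * ?R h t y)"
  proof (rule nn_integral_cong)
   fix y :: "nat \<Rightarrow> real"
   have [measurable]: "y \<in> space sq" by simp
   have "(\<GG> t. (?n y * ?R h t y) * ennreal (re w (0, h) t y))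
    = (\<GG> t. ?n y * ?R h t y) * (\<GG> t. ennreal (re w (0, h) t y))"
   proof (rule nn_integral_gseq_split[where w=w])
    fix u t
    show "?n y * ?R h (\<lambda>i. if i \<in> w then u i else t i) y = ?n y * ?R h t y" by (simp only: R_w)
    have "re w (0, h) (\<lambda>i. if i \<in> w then u i else t i) y = re w (0, h) u y" by (rule re_cong) auto
    then show "ennreal (re w (0, h) (\<lambda>i. if i \<in> w then u i else t i) y) = ennreal (re w (0, h) u y)" by simp
   qed measurable
   then show "(\<GG> t. ?n y * ?R h t y * ennreal (re w (0, h) t y)) = (\<GG> t. ?n y * ?R h t y)"
    using w by (simp only: re_int mult_1_right)
  qed
  also have "\<dots> = (\<GG> t. \<GG> y. ?n y * ?R h t y)"
   by (rule nn_integral_swap_gseq) measurable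
  also have "\<dots> = (\<GG> t. (\<GG> y. ?R h t y) * (\<GG> y. ?n y))"
  proof (rule nn_integral_cong)
   fix t :: "nat \<Rightarrow> real"
   have [measurable]: "t \<in> space sq" by simp
   have "(\<GG> y. ?R h t y * ?n y) = (\<GG> y. ?R h t y) * (\<GG> y. ?n y)"
    by (rule nn_integral_gseq_split[where w=w]) (measurable, rule R_w, rule n_w)
   then show "(\<GG> y. ?n y * ?R h t y) = (\<GG> y. ?R h t y) * (\<GG> y. ?n y)"
    by (simp only: mult.commute)
  qed
  also have "\<dots> = (\<GG> t. \<GG> y. ?R h t y) * (\<GG> y. ?n y)"
   by (rule nn_integral_multc) measurable
  finally show "(\<GG> t. \<GG> y. (k y * ennreal (qd J m ((0, h), t, y))) * ennreal (re {..<J + m} (0, h) t y) * U (J + m) h t y)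
   = (\<GG> t. \<GG> y. ?R h t y) * (\<GG> y. ?n y)" .
 qed
 also have "\<dots> = (\<integral>\<^sup>+h. (\<GG> t. \<GG> y. ?R h t y) \<partial>H) * (\<GG> y. ?n y)"
 proof (rule nn_integral_multc)
  have [measurable]: "(\<lambda>x. re w (0, f x) (g x) (h x)) \<in> borel_measurable K"
   if "f \<in> measurable K H" "g \<in> measurable K sq" "h \<in> measurable K sq" for f g h w and K :: "'k measure"
   by (rule re_m[OF Pair_M0[OF _ that(1)] that(2,3)]) simp
  show "(\<lambda>h. (\<GG> t. \<GG> y. ?R h t y)) \<in> borel_measurable H" by measurable
 qed
 finally show ?thesis by (simp only: re_U_mass mult_1_left)
qed

end

section \<open>Divergence of the output from white noise\<close>

context downstream_loop
begin

text \<open>Its mean is the divergence of the loop law of \<open>(h, t, y)\<close> from the law with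
  the same feedback in which \<open>y\<close> is white of variance \<open>1 + P\<close>.\<close>

definition lnM :: "nat \<Rightarrow> 'w \<Rightarrow> real" where
 "lnM k om = ln (Ur k (snd (A om)) (T om) (Y om) / nh P {..<k} (Y om))"

lemma snd_A [measurable]: "(\<lambda>om. snd (A om)) \<in> measurable M H"
 by (rule snd_M0) measurable

lemma snd_A_space: "om \<in> space M \<Longrightarrow> snd (A om) \<in> space H"
 using measurable_space[OF snd_A] by simp

lemma Ur_0: "Ur 0 h t y = 1"
 by (simp add: Ur_def U_def ls_def p_mass)

text \<open>The exchange on the window starting at 0 shows that \<open>nh / Ur\<close> has mean one,
  which controls the negative part; the positive part is controlled by \<open>Ur_le\<close>.\<close>

lemma lnM_int: "integrable M (lnM k)"
 unfolding lnM_def[abs_def]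
proof (rule W.ln_integrable[where c=1])
 show "(\<integral>\<^sup>+om. ennreal (1 / (Ur k (snd (A om)) (T om) (Y om) / nh P {..<k} (Y om))) \<partial>M) \<le> ennreal 1"
  using nn_loop_qd[of "\<lambda>_. 1" 0 k] nn_integral_nh_1[OF param(1), of "{0..<k}"]
  by (simp add: qd_def Ur_0 lessThan_atLeast0)
 show "integrable M (\<lambda>om. (\<Sum>j<k. (Y om j)\<^sup>2 / 2) - ln (nh P {..<k} (Y om)))"
  using Y_sq_sum_int[of "{..<k}"] ln_nh_int[of "{..<k}"] by simp
 fix om assume om: "om \<in> space M"
 note U = Ur_pos[OF snd_A_space[OF om], of k "T om" "Y om"] and n = nh_pos[OF param(1), of "{..<k}" "Y om"]
 show "0 < Ur k (snd (A om)) (T om) (Y om) / nh P {..<k} (Y om)" using U n by simp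
 have "ln (Ur k (snd (A om)) (T om) (Y om)) \<le> (\<Sum>j<k. (Y om j)\<^sup>2 / 2)"
  using Ur_le[of k "snd (A om)" "T om" "Y om"] U by (metis exp_gt_zero ln_exp ln_le_cancel_iff)
 then show "ln (Ur k (snd (A om)) (T om) (Y om) / nh P {..<k} (Y om)) \<le> (\<Sum>j<k. (Y om j)\<^sup>2 / 2) - ln (nh P {..<k} (Y om))"
  using U n by (simp add: ln_div)
qed measurable

text \<open>A second Gibbs estimate. With the extra factor \<open>Ur / nh\<close> the comparison
  density still has mass at most \<open>c0\<close>, since \<open>gk\<close> integrates over
  \<open>x\<close> to the same bound for every \<open>(h, t, y)\<close>. So the divergence is at
  most the mean of \<open>LL k\<close> plus a constant, and \<open>LL k\<close> has no
  drift.\<close>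

lemma lnM_bound: "W.expectation (lnM k) \<le> K1 - 1 + c0"
proof -
 let ?M = "\<lambda>h t y. Ur k h t y / nh P {..<k} y"
 note n = nh_pos[OF param(1), of "{..<k}"]
 have [measurable]: "(\<lambda>x. ?M (snd (fst x)) (fst (snd x)) (snd (snd x))) \<in> borel_measurable (M0 \<Otimes>\<^sub>M sq \<Otimes>\<^sub>M sq)"
  by measurable
 have "(\<integral>\<^sup>+om. ennreal (1 / (exp (LL k om) / ?M (snd (A om)) (T om) (Y om))) \<partial>M)
  = (\<integral>\<^sup>+om. ennreal (exp (- LL k om)) * (\<lambda>a t y. ennreal (?M (snd a) t y)) (A om) (T om) (Y om) \<partial>M)"
  using n Ur_nonneg by (intro nn_integral_cong) (simp add: ennreal_mult[symmetric] exp_minus field_simps less_imp_le)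
 also have "\<dots> \<le> ennreal (exp (real k * al)) * (\<integral>\<^sup>+h. (\<GG> t. \<GG> y. \<LL> x. ennreal (gk k (x, h) t y * re {..<k} (x, h) t y * nh P {..<k} y)
   * (\<lambda>a t y. ennreal (?M (snd a) t y)) (x, h) t y) \<partial>H)"
 proof (rule nn_exp_LL)
  fix a :: "'x \<times> 'h" and t y t' y' assume *: "\<And>i. i < k \<Longrightarrow> t i = (t' i :: real)" "\<And>i. i < k \<Longrightarrow> y i = (y' i :: real)"
  have "Ur k (snd a) t y = Ur k (snd a) t' y'" unfolding Ur_def using * by (subst U_cong) auto
  moreover have "nh P {..<k} y = nh P {..<k} y'" unfolding nh_def using * by simp
  ultimately show "ennreal (?M (snd a) t y) = ennreal (?M (snd a) t' y')" by simp
 qed (unfold split_beta', measurable)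
 also have "\<dots> \<le> ennreal (exp (real k * al)) * (\<integral>\<^sup>+h. (\<GG> t. \<GG> y. ennreal (c0 * exp (- (real k * al))) * (ennreal (re {..<k} (0, h) t y) * U k h t y)) \<partial>H)"
 proof (intro mult_left_mono, rule nn_integral_mono, rule nn_integral_mono, rule nn_integral_mono)
  fix h t y assume h: "h \<in> space H"
  have m: "(\<lambda>x. gk k (x, h) t y) \<in> borel_measurable lborel"
  proof -
   have "t \<in> space sq" "y \<in> space sq" by auto
   then show ?thesis using h by (intro gk_comp Pair_M0) auto
  qed
  have "(\<LL> x. ennreal (gk k (x, h) t y * re {..<k} (x, h) t y * nh P {..<k} y) * (\<lambda>a t y. ennreal (?M (snd a) t y)) (x, h) t y)
   = (\<LL> x. ennreal (gk k (x, h) t y) * (ennreal (re {..<k} (0, h) t y) * U k h t y))"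
  proof (rule nn_integral_cong)
   fix x
   have "gk k (x, h) t y * re {..<k} (x, h) t y * nh P {..<k} y * ?M h t y = gk k (x, h) t y * (re {..<k} (0, h) t y * Ur k h t y)"
    using n[of y] re_snd[of "{..<k}" x h t y 0] by simp
   then show "ennreal (gk k (x, h) t y * re {..<k} (x, h) t y * nh P {..<k} y) * (\<lambda>a t y. ennreal (?M (snd a) t y)) (x, h) t y
    = ennreal (gk k (x, h) t y) * (ennreal (re {..<k} (0, h) t y) * U k h t y)"
    unfolding Ur_eq[symmetric] using gk_bounds(1)[of k "(x, h)" t y] n[of y]
    by (simp add: ennreal_mult[symmetric] re_pos less_imp_le Ur_nonneg)
  qed
  also have "\<dots> = (\<LL> x. ennreal (gk k (x, h) t y)) * (ennreal (re {..<k} (0, h) t y) * U k h t y)"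
   by (rule nn_integral_multc, rule measurable_compose[OF m measurable_ennreal])
  also have "\<dots> \<le> ennreal (c0 * exp (- (real k * al))) * (ennreal (re {..<k} (0, h) t y) * U k h t y)"
   by (intro mult_right_mono gk_int h) auto
  finally show "(\<LL> x. ennreal (gk k (x, h) t y * re {..<k} (x, h) t y * nh P {..<k} y) * (\<lambda>a t y. ennreal (?M (snd a) t y)) (x, h) t y)
   \<le> ennreal (c0 * exp (- (real k * al))) * (ennreal (re {..<k} (0, h) t y) * U k h t y)" .
 qed simp
 also have "\<dots> = ennreal (exp (real k * al)) * (\<integral>\<^sup>+om. ennreal (c0 * exp (- (real k * al))) \<partial>M)"
  using nn_loop_U[of "\<lambda>_ _ _. ennreal (c0 * exp (- (real k * al)))" k] by (simp add: mult.assoc)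
 also have "\<dots> = ennreal c0"
  using param by (simp add: ennreal_mult[symmetric] exp_minus W.emeasure_space_1)
 finally have le: "(\<integral>\<^sup>+om. ennreal (1 / (exp (LL k om) / ?M (snd (A om)) (T om) (Y om))) \<partial>M) \<le> ennreal c0" .
 have M_pos: "0 < ?M (snd (A om)) (T om) (Y om)" if "om \<in> space M" for om
  using Ur_pos[OF snd_A_space[OF that]] n by simp
 have ln: "ln (exp (LL k om) / ?M (snd (A om)) (T om) (Y om)) = LL k om - lnM k om" if "om \<in> space M" for om
  unfolding ln_divide_pos[OF exp_gt_zero M_pos[OF that]] by (simp add: lnM_def)
 have i: "integrable M (\<lambda>om. ln (exp (LL k om) / ?M (snd (A om)) (T om) (Y om)))"
  by (subst Bochner_Integration.integrable_cong[OF refl ln]) (use LL_int lnM_int in auto)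
 have "1 - c0 \<le> W.expectation (\<lambda>om. ln (exp (LL k om) / ?M (snd (A om)) (T om) (Y om)))"
 proof (rule W.ln_lower[OF _ _ le _ i])
  fix om assume om: "om \<in> space M"
  show "0 < exp (LL k om) / ?M (snd (A om)) (T om) (Y om)"
   by (rule divide_pos_pos[OF exp_gt_zero M_pos[OF om]])
 qed (measurable, simp add: param)
 also have "\<dots> = W.expectation (\<lambda>om. LL k om - lnM k om)"
  by (rule Bochner_Integration.integral_cong[OF refl ln])
 also have "\<dots> = W.expectation (LL k) - W.expectation (lnM k)" using LL_int lnM_int by simp
 finally have "1 - c0 \<le> W.expectation (LL k) - W.expectation (lnM k)" .
 then show ?thesis using LL_exp[of k] unfolding gap_0 by simp
qed

text \<open>Chain rule of divergence: the exchange density of a window is the increment of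
  \<open>lnM\<close>.\<close>

lemma qd_lnM:
 assumes om: "om \<in> space M"
 shows "0 < qd J m (A om, T om, Y om)" "ln (qd J m (A om, T om, Y om)) = lnM J om - lnM (J + m) om"
proof -
 note U = Ur_pos[OF snd_A_space[OF om], of _ "T om" "Y om"] and n = nh_pos[OF param(1), of _ "Y om"]
 have nh: "nh P {..<J + m} (Y om) = nh P {..<J} (Y om) * nh P {J..<J + m} (Y om)"
  unfolding nh_def by (subst prod.union_disjoint[symmetric]) (auto simp: ivl_disj_un_one)
 show "0 < qd J m (A om, T om, Y om)" using U n by (simp add: qd_def)
 have "qd J m (A om, T om, Y om)
  = Ur J (snd (A om)) (T om) (Y om) * nh P {J..<J + m} (Y om) / Ur (J + m) (snd (A om)) (T om) (Y om)"
  by (simp add: qd_def)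
 then show "ln (qd J m (A om, T om, Y om)) = lnM J om - lnM (J + m) om"
  using U[of J] U[of "J + m"] n[of "{..<J}"] n[of "{J..<J + m}"] by (simp add: lnM_def ln_div ln_mult nh)
qed

lemma re_H_m: "f \<in> measurable K H \<Longrightarrow> g \<in> measurable K sq \<Longrightarrow> h \<in> measurable K sq \<Longrightarrow>
  (\<lambda>x. re w (0, f x) (g x) (h x)) \<in> borel_measurable K"
 by (rule re_m[OF Pair_M0]) simp_all

lemma PP_qd: "(\<integral>\<^sup>+x. ennreal (qd J m x) \<partial>PP J (J + m)) = 1"
proof -
 let ?w = "{J..<J + m}"
 have "(\<integral>\<^sup>+x. ennreal (qd J m x) \<partial>PP J (J + m)) = (\<integral>\<^sup>+x. (\<lambda>(a, t, y). ennreal (qd J m (a, t, y)) * (\<lambda>_ _ _. 1) (snd a) t y) x \<partial>PP J (J + m))"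
  by (rule nn_integral_cong) auto
 also have "\<dots> = (\<integral>\<^sup>+h. (\<GG> t. \<GG> y. 1 * (ennreal (re {..<J} (0, h) t y) * U J h t y * ennreal (nh P ?w y))) \<partial>H)"
  by (rule nn_PP_qd) simp
 also have "\<dots> = (\<integral>\<^sup>+h. (\<GG> t. \<GG> y. ennreal (re {..<J} (0, h) t y) * U J h t y) \<partial>H)"
 proof (rule nn_integral_cong, rule nn_integral_cong)
  fix h and t :: "nat \<Rightarrow> real" assume h [measurable]: "h \<in> space H"
  have [measurable]: "(0, h) \<in> space M0" "t \<in> space sq" using h by (simp_all add: space_pair_measure)
  have "(\<GG> y. (ennreal (re {..<J} (0, h) t y) * U J h t y) * ennreal (nh P ?w y))
   = (\<GG> y. ennreal (re {..<J} (0, h) t y) * U J h t y) * (\<GG> y. ennreal (nh P ?w y))"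
  proof (rule nn_integral_gseq_split[where w="?w"])
   fix u y
   show "ennreal (re {..<J} (0, h) t (\<lambda>i. if i \<in> ?w then u i else y i)) * U J h t (\<lambda>i. if i \<in> ?w then u i else y i)
    = ennreal (re {..<J} (0, h) t y) * U J h t y"
    by (simp only: override_J)
  qed (measurable, simp add: nh_def)
  then show "(\<GG> y. 1 * (ennreal (re {..<J} (0, h) t y) * U J h t y * ennreal (nh P ?w y)))
   = (\<GG> y. ennreal (re {..<J} (0, h) t y) * U J h t y)"
   by (simp only: mult_1_left mult_1_right nn_integral_nh_1[OF param(1) finite_atLeastLessThan])
 qed
 finally show ?thesis by (simp only: re_U_mass)
qed

text \<open>The weights \<open>re {..<J}\<close>, \<open>U J\<close> and \<open>nh\<close> ignore
  \<open>t\<close> on the window, so resampling it is free.\<close>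

lemma PP_qd_indep:
 assumes F [measurable]: "F \<in> borel_measurable (H \<Otimes>\<^sub>M sq \<Otimes>\<^sub>M sq)"
 shows "(\<integral>\<^sup>+x. (\<lambda>(a, t, y). ennreal (qd J m (a, t, y)) * F (snd a, t, y)) x \<partial>PP J (J + m))
  = (\<integral>\<^sup>+x. (\<lambda>(a, t, y). ennreal (qd J m (a, t, y)) * (\<GG> u. F (snd a, (\<lambda>i. if i \<in> {J..<J + m} then u i else t i), y))) x \<partial>PP J (J + m))"
proof -
 let ?ov = "\<lambda>u t i. if i \<in> {J..<J + m} then u i else t i :: real"
 let ?R = "\<lambda>h t y. ennreal (re {..<J} (0, h) t y) * U J h t y * ennreal (nh P {J..<J + m} y)"
 have [measurable]: "(\<lambda>x. ?ov (f x) (g x)) \<in> measurable K sq"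
  if [measurable]: "f \<in> measurable K sq" "g \<in> measurable K sq" for f g and K :: "'k measure"
  by measurable
 note [measurable] = re_H_m
 have "(\<integral>\<^sup>+x. (\<lambda>(a, t, y). ennreal (qd J m (a, t, y)) * F (snd a, t, y)) x \<partial>PP J (J + m))
  = (\<integral>\<^sup>+h. (\<GG> t. \<GG> y. F (h, t, y) * ?R h t y) \<partial>H)"
  by (rule nn_PP_qd[of "\<lambda>h t y. F (h, t, y)"]) simp
 also have "\<dots> = (\<integral>\<^sup>+h. (\<GG> t. \<GG> y. (\<GG> u. F (h, ?ov u t, y)) * ?R h t y) \<partial>H)"
 proof (rule nn_integral_cong)
  fix h assume h [measurable]: "h \<in> space H"
  have "(\<GG> t. \<GG> y. F (h, t, y) * ?R h t y) = (\<GG> y. \<GG> t. F (h, t, y) * ?R h t y)"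
   by (rule nn_integral_swap_gseq) measurable
  also have "\<dots> = (\<GG> y. \<GG> t. (\<GG> u. F (h, ?ov u t, y)) * ?R h t y)"
  proof (rule nn_integral_cong)
   fix y :: "nat \<Rightarrow> real"
   have [measurable]: "y \<in> space sq" by simp
   have "(\<GG> t. F (h, t, y) * ?R h t y) = (\<GG> t. \<GG> u. F (h, ?ov u t, y) * ?R h (?ov u t) y)"
    by (rule nn_integral_gseq_override[symmetric]) measurable
   also have "\<dots> = (\<GG> t. \<GG> u. F (h, ?ov u t, y) * ?R h t y)"
    by (simp only: override_J)
   also have "\<dots> = (\<GG> t. (\<GG> u. F (h, ?ov u t, y)) * ?R h t y)"
   proof (rule nn_integral_cong)
    fix t :: "nat \<Rightarrow> real"
    have [measurable]: "t \<in> space sq" by simp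
    show "(\<GG> u. F (h, ?ov u t, y) * ?R h t y) = (\<GG> u. F (h, ?ov u t, y)) * ?R h t y"
     by (rule nn_integral_multc) measurable
   qed
   finally show "(\<GG> t. F (h, t, y) * ?R h t y) = (\<GG> t. (\<GG> u. F (h, ?ov u t, y)) * ?R h t y)" .
  qed
  also have "\<dots> = (\<GG> t. \<GG> y. (\<GG> u. F (h, ?ov u t, y)) * ?R h t y)"
   by (rule nn_integral_swap_gseq) measurable
  finally show "(\<GG> t. \<GG> y. F (h, t, y) * ?R h t y)
   = (\<GG> t. \<GG> y. (\<GG> u. F (h, ?ov u t, y)) * ?R h t y)" .
 qed
 also have "\<dots> = (\<integral>\<^sup>+x. (\<lambda>(a, t, y). ennreal (qd J m (a, t, y)) * (\<GG> u. F (snd a, ?ov u t, y))) x \<partial>PP J (J + m))"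
  by (rule nn_PP_qd[of "\<lambda>h t y. (\<GG> u. F (h, ?ov u t, y))", symmetric]) measurable
 finally show ?thesis .
qed

text \<open>The divergences are bounded, so some window of length \<open>m\<close> adds at most
  \<open>(d / 2)\<^sup>2\<close>; the bound \<open>2 * sqrt\<close> of \<open>ratio_L1_close\<close>
  turns this into L1 distance \<open>d\<close>.\<close>

lemma white_window_ex:
 assumes d: "0 < d"
 shows "\<exists>J q. white_window m d J q"
proof -
 obtain J where J: "W.expectation (lnM (J + m)) - W.expectation (lnM J) \<le> (d / 2)\<^sup>2"
  using small_increment[of "\<lambda>k. W.expectation (lnM k)" _ "(d / 2)\<^sup>2" m] lnM_bound d by auto
 let ?q = "qd J m" and ?w = "{J..<J + m}"
 have q_m [measurable]: "(\<lambda>om. ?q (A om, T om, Y om)) \<in> borel_measurable M" by measurable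
 have "W.expectation (\<lambda>om. - ln (?q (A om, T om, Y om))) = W.expectation (\<lambda>om. lnM (J + m) om - lnM J om)"
  by (rule Bochner_Integration.integral_cong) (auto simp: qd_lnM)
 also have "\<dots> \<le> (d / 2)\<^sup>2" using J lnM_int by simp
 finally have E: "W.expectation (\<lambda>om. - ln (?q (A om, T om, Y om))) \<le> (d / 2)\<^sup>2" .
 have close: "(\<integral>\<^sup>+om. ennreal \<bar>1 - ?q (A om, T om, Y om)\<bar> \<partial>M) \<le> ennreal d"
 proof -
  have "(\<integral>\<^sup>+om. ennreal \<bar>1 - ?q (A om, T om, Y om)\<bar> \<partial>M) \<le> ennreal (2 * sqrt ((d / 2)\<^sup>2))"
  proof (rule W.ratio_L1_close)
   show "(\<integral>\<^sup>+om. ennreal (?q (A om, T om, Y om)) \<partial>M) = 1"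
    using nn_loop_qd[of "\<lambda>_. 1" J m] nn_integral_nh_1[OF param(1), of ?w] by simp
   show "integrable M (\<lambda>om. ln (?q (A om, T om, Y om)))"
    by (subst Bochner_Integration.integrable_cong[OF refl qd_lnM(2)]) (use lnM_int in auto)
  qed (use E qd_lnM in auto)
  then show ?thesis using d by (simp add: real_sqrt_abs)
 qed
 have "white_window m d J ?q"
  unfolding white_window_def
 proof (intro conjI ballI allI impI)
  show "(\<integral>\<^sup>+x. ennreal (?q x) \<partial>PP J (J + m)) = 1" by (rule PP_qd)
  fix F :: "'h \<times> (nat \<Rightarrow> real) \<times> (nat \<Rightarrow> real) \<Rightarrow> ennreal" assume F: "F \<in> borel_measurable (H \<Otimes>\<^sub>M sq \<Otimes>\<^sub>M sq)"
  show "(\<integral>\<^sup>+x. (\<lambda>(a, t, y). ennreal (?q (a, t, y)) * F (snd a, t, y)) x \<partial>PP J (J + m))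
   = (\<integral>\<^sup>+x. (\<lambda>(a, t, y). ennreal (?q (a, t, y)) * (\<GG> u. F (snd a, (\<lambda>i. if i \<in> ?w then u i else t i), y))) x \<partial>PP J (J + m))"
   using PP_qd_indep[OF F] .
 next
  fix a t y t' y' assume "\<forall>i<J + m. t i = (t' i :: real)" "\<forall>i<J + m. y i = (y' i :: real)"
  then show "?q (a, t, y) = ?q (a, t', y')" by (intro qd_causal) auto
 next
  fix k :: "(nat \<Rightarrow> real) \<Rightarrow> ennreal"
  assume k [measurable]: "k \<in> borel_measurable sq" and k1: "\<forall>y. k y \<le> 1" and kw: "\<forall>y y'. (\<forall>i\<in>?w. y i = y' i) \<longrightarrow> k y = k y'"
  have eq: "(\<integral>\<^sup>+om. k (Y om) * ennreal (?q (A om, T om, Y om)) \<partial>M) = (\<GG> u. k (\<lambda>j. sqrt (1 + P) * u j))"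
  proof -
   have kw': "k y = k y'" if "\<And>i. i \<in> ?w \<Longrightarrow> y i = y' i" for y y' using kw that by blast
   show ?thesis by (subst nn_loop_qd[OF k kw']) (auto intro!: nn_integral_window_scale kw' param)
  qed
  have [measurable]: "(\<lambda>om. k (Y om)) \<in> borel_measurable M" by measurable
  note t = close_transfer[where f="\<lambda>om. ?q (A om, T om, Y om)" and k="\<lambda>om. k (Y om)" and d=d, OF q_m _ qd_nonneg _ close, unfolded eq]
  show "(\<integral>\<^sup>+om. k (Y om) \<partial>M) \<le> (\<GG> u. k (\<lambda>j. sqrt (1 + P) * u j)) + ennreal d"
   "(\<GG> u. k (\<lambda>j. sqrt (1 + P) * u j)) \<le> (\<integral>\<^sup>+om. k (Y om) \<partial>M) + ennreal d"
   by (rule t; use k1 in simp)+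
 qed (use qd_nonneg close in \<open>simp_all\<close>)
 then show ?thesis by blast
qed

theorem contradiction: False
 using windows_contradiction white_window_ex by blast

end

section \<open>Noise entering the last hop\<close>

text \<open>Here the feedback may see \<open>x\<close>, so the certificate must keep all static
  data. Instead the state factor does not see \<open>t\<close>, so \<open>t\<close> can be
  integrated out before \<open>x\<close>.\<close>

locale upstream_loop = info_loop p H e s M A V Z T Y P Ce c0 Kg al gk
 for p :: "'x::euclidean_space \<Rightarrow> real" and H :: "'h measure" and e s and M :: "'w measure"
  and A V Z T Y P Ce c0 Kg al gk +
 assumes gk_static: "\<And>k a t t' y. gk k a t y = gk k a t' y"
  and gk_int: "\<And>k h t y. h \<in> space H \<Longrightarrow> (\<LL> x. ennreal (gk k (x, h) t y)) \<le> ennreal (c0 * exp (- (real k * al)))"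
begin

sublocale white_windows p H e s M A V Z T Y P Ce c0 Kg al gk M0 "\<lambda>a. a" e
 by unfold_locales (auto simp: e_meas)

declare G_m [measurable del]

text \<open>Likelihood of \<open>y\<close> given all static data, with the cut signal
  \<open>t\<close> averaged out.\<close>

definition Lt :: "nat \<Rightarrow> 'x \<times> 'h \<Rightarrow> (nat \<Rightarrow> real) \<Rightarrow> ennreal" where
 "Lt k a y = (\<GG> t. ennreal (re {..<k} a t y) * ennreal (ls {..<k} a t y))"

definition Ltr :: "nat \<Rightarrow> 'x \<times> 'h \<Rightarrow> (nat \<Rightarrow> real) \<Rightarrow> real" where
 "Ltr k a y = enn2real (Lt k a y)"

lemma Lt_m [measurable]:
 assumes [measurable]: "f \<in> measurable K M0" "g \<in> measurable K sq"
 shows "(\<lambda>z. Lt k (f z) (g z)) \<in> borel_measurable K"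
 unfolding Lt_def by (rule gseq_nn_m) (unfold split_beta', measurable)

lemma Ltr_m [measurable]:
 assumes [measurable]: "f \<in> measurable K M0" "g \<in> measurable K sq"
 shows "(\<lambda>z. Ltr k (f z) (g z)) \<in> borel_measurable K"
 unfolding Ltr_def by measurable

lemma Lt_le: "a \<in> space M0 \<Longrightarrow> Lt k a y \<le> ennreal (exp (\<Sum>j<k. (y j)\<^sup>2 / 2))"
proof -
 assume a [measurable]: "a \<in> space M0"
 have [measurable]: "y \<in> space sq" by simp
 have "Lt k a y \<le> (\<GG> t. ennreal (re {..<k} a t y) * ennreal (exp (\<Sum>j<k. (y j)\<^sup>2 / 2)))"
  unfolding Lt_def by (intro nn_integral_mono mult_left_mono ennreal_leI ls_le) auto
 also have "\<dots> = (\<GG> t. ennreal (re {..<k} a t y)) * ennreal (exp (\<Sum>j<k. (y j)\<^sup>2 / 2))"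
  by (rule nn_integral_multc) measurable
 finally show ?thesis by (simp add: re_int)
qed

lemma Lt_pos: "a \<in> space M0 \<Longrightarrow> Lt k a y \<noteq> 0"
proof
 assume a [measurable]: "a \<in> space M0" and "Lt k a y = 0"
 have [measurable]: "y \<in> space sq" by simp
 have pos: "ennreal (re {..<k} a t y) * ennreal (ls {..<k} a t y) \<noteq> 0" for t
  using re_pos[of "{..<k}" a t y] ls_pos[of "{..<k}" a t y] by (simp add: ennreal_eq_0_iff not_le)
 have "AE t in gseq. ennreal (re {..<k} a t y) * ennreal (ls {..<k} a t y) = 0"
  using \<open>Lt k a y = 0\<close> unfolding Lt_def by (subst (asm) nn_integral_0_iff_AE) auto
 then have "AE t in gseq. False" by eventually_elim (use pos in blast)
 then show False using prob_space.AE_False[OF prob_space_gseq] by simp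
qed

lemma Ltr_pos: "a \<in> space M0 \<Longrightarrow> 0 < Ltr k a y"
 and Ltr_eq: "a \<in> space M0 \<Longrightarrow> ennreal (Ltr k a y) = Lt k a y"
 and Ltr_le: "a \<in> space M0 \<Longrightarrow> Ltr k a y \<le> exp (\<Sum>j<k. (y j)\<^sup>2 / 2)"
proof -
 assume a: "a \<in> space M0"
 have fin: "Lt k a y < top" using Lt_le[OF a, of k y] by (simp add: order_le_less_trans)
 then show "ennreal (Ltr k a y) = Lt k a y" by (simp add: Ltr_def)
 show "0 < Ltr k a y"
  using fin Lt_pos[OF a, of k y] by (simp add: Ltr_def enn2real_positive_iff zero_less_iff_neq_zero)
 show "Ltr k a y \<le> exp (\<Sum>j<k. (y j)\<^sup>2 / 2)"
  using enn2real_mono[OF Lt_le[OF a, of k y]] by (simp add: Ltr_def)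
qed

lemma Ltr_nonneg: "0 \<le> Ltr k a y"
 by (simp add: Ltr_def)

lemma Lt_cong:
 assumes "\<And>i. i < k \<Longrightarrow> y i = y' i"
 shows "Lt k a y = Lt k a y'"
proof -
 have "ls {..<k} a t y = ls {..<k} a t y'" "re {..<k} a t y = re {..<k} a t y'" for t
  using assms by (auto intro!: ls_cong re_cong)
 then show ?thesis by (simp add: Lt_def)
qed

text \<open>Likelihood of \<open>y\<close> given \<open>h\<close> only.\<close>

definition Lx :: "nat \<Rightarrow> 'h \<Rightarrow> (nat \<Rightarrow> real) \<Rightarrow> ennreal" where
 "Lx k h y = (\<LL> x. ennreal (p x) * Lt k (x, h) y)"

definition Lxr :: "nat \<Rightarrow> 'h \<Rightarrow> (nat \<Rightarrow> real) \<Rightarrow> real" where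
 "Lxr k h y = enn2real (Lx k h y)"

lemma Lx_m [measurable]:
 assumes [measurable]: "f \<in> measurable K H" "g \<in> measurable K sq"
 shows "(\<lambda>z. Lx k (f z) (g z)) \<in> borel_measurable K"
proof -
 have "(\<lambda>(z, x). (x, f z)) \<in> measurable (K \<Otimes>\<^sub>M borel) M0"
  unfolding split_beta' by (rule Pair_M0) measurable
 then have [measurable]: "(\<lambda>z. (snd z, f (fst z))) \<in> measurable (K \<Otimes>\<^sub>M borel) M0" by (simp add: split_beta')
 show ?thesis unfolding Lx_def by (rule lborel_nn_m) (unfold split_beta', measurable)
qed

lemma Lxr_m [measurable]:
 assumes [measurable]: "f \<in> measurable K H" "g \<in> measurable K sq"
 shows "(\<lambda>z. Lxr k (f z) (g z)) \<in> borel_measurable K"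
 unfolding Lxr_def by measurable

lemma Lx_le: "h \<in> space H \<Longrightarrow> Lx k h y \<le> ennreal (exp (\<Sum>j<k. (y j)\<^sup>2 / 2))"
proof -
 assume h: "h \<in> space H"
 have "Lx k h y \<le> (\<LL> x. ennreal (p x) * ennreal (exp (\<Sum>j<k. (y j)\<^sup>2 / 2)))"
  unfolding Lx_def using h by (intro nn_integral_mono mult_left_mono Lt_le) (auto simp: space_pair_measure)
 then show ?thesis by (simp add: nn_integral_multc p_mass)
qed

lemma Lx_pos: "h \<in> space H \<Longrightarrow> Lx k h y \<noteq> 0"
proof
 assume h [measurable]: "h \<in> space H" and "Lx k h y = 0"
 have [measurable]: "y \<in> space sq" by auto
 have m: "(\<lambda>x. Lt k (x, h) y) \<in> borel_measurable lborel"
  by (rule Lt_m[OF Pair_M0]) (simp_all add: h)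
 have "AE x in lborel. ennreal (p x) * Lt k (x, h) y = 0"
  using \<open>Lx k h y = 0\<close> unfolding Lx_def by (subst (asm) nn_integral_0_iff_AE) (use m in auto)
 then have "AE x in lborel. ennreal (p x) = 0"
 proof eventually_elim
  fix x assume "ennreal (p x) * Lt k (x, h) y = 0"
  moreover have "Lt k (x, h) y \<noteq> 0" using h by (intro Lt_pos) (simp add: space_pair_measure)
  ultimately show "ennreal (p x) = 0" by simp
 qed
 then have "(\<LL> x. ennreal (p x)) = 0" by (subst nn_integral_0_iff_AE) auto
 then show False by (simp add: p_mass)
qed

lemma Lxr_pos: "h \<in> space H \<Longrightarrow> 0 < Lxr k h y"
 and Lxr_eq: "h \<in> space H \<Longrightarrow> ennreal (Lxr k h y) = Lx k h y"
 and Lxr_le: "h \<in> space H \<Longrightarrow> Lxr k h y \<le> exp (\<Sum>j<k. (y j)\<^sup>2 / 2)"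
proof -
 assume h: "h \<in> space H"
 have fin: "Lx k h y < top" using Lx_le[OF h, of k y] by (simp add: order_le_less_trans)
 then show "ennreal (Lxr k h y) = Lx k h y" by (simp add: Lxr_def)
 show "0 < Lxr k h y"
  using fin Lx_pos[OF h, of k y] by (simp add: Lxr_def enn2real_positive_iff zero_less_iff_neq_zero)
 show "Lxr k h y \<le> exp (\<Sum>j<k. (y j)\<^sup>2 / 2)"
  using enn2real_mono[OF Lx_le[OF h, of k y]] by (simp add: Lxr_def)
qed

lemma Lxr_nonneg: "0 \<le> Lxr k h y"
 by (simp add: Lxr_def)

lemma Lx_cong: "(\<And>i. i < k \<Longrightarrow> y i = y' i) \<Longrightarrow> Lx k h y = Lx k h y'"
 unfolding Lx_def using Lt_cong[of k y y'] by simp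

lemma nn_loop_Lt:
 assumes F [measurable]: "(\<lambda>(a, y). F a y) \<in> borel_measurable (M0 \<Otimes>\<^sub>M sq)"
  and c: "\<And>a y y'. (\<And>i. i < k \<Longrightarrow> y i = y' i) \<Longrightarrow> F a y = F a y'"
 shows "(\<integral>\<^sup>+om. F (A om) (Y om) \<partial>M) = (\<integral>\<^sup>+a. (\<GG> y. F a y * Lt k a y) \<partial>M0)"
proof -
 have F_m [measurable]: "(\<lambda>x. F (f x) (g x)) \<in> borel_measurable K"
  if "f \<in> measurable K M0" "g \<in> measurable K sq" for f g and K :: "'k measure"
  using measurable_compose[OF measurable_Pair[OF that] F] by simp
 have "(\<integral>\<^sup>+om. F (A om) (Y om) \<partial>M) = (\<integral>\<^sup>+om. (\<lambda>(a, t, y). F a y) (A om, T om, Y om) \<partial>M)" by simp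
 also have "\<dots> = (\<integral>\<^sup>+a. (\<GG> t. \<GG> y. (\<lambda>(a, t, y). F a y) (a, t, y) * ennreal (L k a t y)) \<partial>M0)"
 proof (rule nn_integral_loop)
  fix a t y t' y' assume "\<And>i. i < k \<Longrightarrow> t i = (t' i :: real)" "\<And>i. i < k \<Longrightarrow> y i = (y' i :: real)"
  from c[OF this(2)] show "(\<lambda>(a, t, y). F a y) (a, t, y) = (\<lambda>(a, t, y). F a y) (a, t', y')" by simp
 qed measurable
 also have "\<dots> = (\<integral>\<^sup>+a. (\<GG> y. F a y * Lt k a y) \<partial>M0)"
 proof (rule nn_integral_cong)
  fix a assume a [measurable]: "a \<in> space M0"
  have "(\<GG> t. \<GG> y. (\<lambda>(a, t, y). F a y) (a, t, y) * ennreal (L k a t y))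
   = (\<GG> t. \<GG> y. F a y * (ennreal (re {..<k} a t y) * ennreal (ls {..<k} a t y)))"
   by (simp add: L_def ennreal_mult re_pos ls_pos less_imp_le)
  also have "\<dots> = (\<GG> y. \<GG> t. F a y * (ennreal (re {..<k} a t y) * ennreal (ls {..<k} a t y)))"
   by (rule nn_integral_swap_gseq) measurable
  also have "\<dots> = (\<GG> y. F a y * Lt k a y)"
  proof (rule nn_integral_cong)
   fix y :: "nat \<Rightarrow> real"
   have [measurable]: "y \<in> space sq" by simp
   show "(\<GG> t. F a y * (ennreal (re {..<k} a t y) * ennreal (ls {..<k} a t y))) = F a y * Lt k a y"
    unfolding Lt_def by (rule nn_integral_cmult) measurable
  qed
  finally show "(\<GG> t. \<GG> y. (\<lambda>(a, t, y). F a y) (a, t, y) * ennreal (L k a t y))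
   = (\<GG> y. F a y * Lt k a y)" .
 qed
 finally show ?thesis .
qed

lemma Lt_mass: "(\<integral>\<^sup>+a. (\<GG> y. Lt k a y) \<partial>M0) = 1"
 using nn_loop_Lt[of "\<lambda>_ _. 1" k] by (simp add: W.emeasure_space_1)

lemma nn_loop_Lx:
 assumes F [measurable]: "(\<lambda>(h, y). F h y) \<in> borel_measurable (H \<Otimes>\<^sub>M sq)"
  and c: "\<And>h y y'. (\<And>i. i < k \<Longrightarrow> y i = y' i) \<Longrightarrow> F h y = F h y'"
 shows "(\<integral>\<^sup>+om. F (snd (A om)) (Y om) \<partial>M) = (\<integral>\<^sup>+h. (\<GG> y. F h y * Lx k h y) \<partial>H)"
proof -
 have F_m [measurable]: "(\<lambda>x. F (f x) (g x)) \<in> borel_measurable K"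
  if "f \<in> measurable K H" "g \<in> measurable K sq" for f g and K :: "'k measure"
  using measurable_compose[OF measurable_Pair[OF that] F] by simp
 have [measurable]: "(\<lambda>x. F (snd (fst x)) (snd x)) \<in> borel_measurable (M0 \<Otimes>\<^sub>M sq)"
  by (rule F_m) (rule snd_M0, measurable)
 have "(\<integral>\<^sup>+om. F (snd (A om)) (Y om) \<partial>M) = (\<integral>\<^sup>+a. (\<GG> y. F (snd a) y * Lt k a y) \<partial>M0)"
  by (rule nn_loop_Lt[of "\<lambda>a y. F (snd a) y" k]) (unfold split_beta', measurable, rule c)
 also have "\<dots> = (\<integral>\<^sup>+h. (\<LL> x. ennreal (p x) * (\<GG> y. F (snd (x, h)) y * Lt k (x, h) y)) \<partial>H)"
  by (rule nn_M0, rule gseq_nn_m) (unfold split_beta', measurable)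
 also have "\<dots> = (\<integral>\<^sup>+h. (\<GG> y. F h y * Lx k h y) \<partial>H)"
 proof (rule nn_integral_cong)
  fix h assume h [measurable]: "h \<in> space H"
  have Lm [measurable]: "(\<lambda>z. Lt k (f z, h) (g z)) \<in> borel_measurable K"
   if "f \<in> borel_measurable K" "g \<in> measurable K sq" for f g and K :: "'k measure"
   by (rule Lt_m[OF Pair_M0 that(2)]) (use that h in simp_all)
  have "(\<LL> x. ennreal (p x) * (\<GG> y. F (snd (x, h)) y * Lt k (x, h) y))
   = (\<LL> x. \<GG> y. F h y * (ennreal (p x) * Lt k (x, h) y))"
  proof (rule nn_integral_cong)
   fix x
   have "ennreal (p x) * (\<GG> y. F h y * Lt k (x, h) y) = (\<GG> y. ennreal (p x) * (F h y * Lt k (x, h) y))"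
    by (rule nn_integral_cmult[symmetric]) measurable
   then show "ennreal (p x) * (\<GG> y. F (snd (x, h)) y * Lt k (x, h) y) = (\<GG> y. F h y * (ennreal (p x) * Lt k (x, h) y))"
    by (simp only: mult.left_commute snd_conv)
  qed
  also have "\<dots> = (\<GG> y. \<LL> x. F h y * (ennreal (p x) * Lt k (x, h) y))"
   by (rule nn_integral_swap_lborel_gseq) measurable
  also have "\<dots> = (\<GG> y. F h y * Lx k h y)"
  proof (rule nn_integral_cong)
   fix y :: "nat \<Rightarrow> real"
   have [measurable]: "y \<in> space sq" by simp
   show "(\<LL> x. F h y * (ennreal (p x) * Lt k (x, h) y)) = F h y * Lx k h y"
    unfolding Lx_def by (rule nn_integral_cmult) measurable
  qed
  finally show "(\<LL> x. ennreal (p x) * (\<GG> y. F (snd (x, h)) y * Lt k (x, h) y)) = (\<GG> y. F h y * Lx k h y)" .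
 qed
 finally show ?thesis .
qed

lemma Lx_mass: "(\<integral>\<^sup>+h. (\<GG> y. Lx k h y) \<partial>H) = 1"
 using nn_loop_Lx[of "\<lambda>_ _. 1" k] by (simp add: W.emeasure_space_1)

end

section \<open>Decoupling the output from the cut noise\<close>

context upstream_loop
begin

text \<open>Predictive density of the window of \<open>y\<close> given static data and past
  \<open>y\<close>, relative to white noise.\<close>

definition rt :: "nat \<Rightarrow> nat \<Rightarrow> 'x \<times> 'h \<Rightarrow> (nat \<Rightarrow> real) \<Rightarrow> real" where
 "rt J m a y = Ltr (J + m) a y / Ltr J a y"

text \<open>Exchanges the window likelihood of \<open>y\<close> given \<open>t\<close> for the
  predictive one. Unlike in the downstream case \<open>y\<close> does not become white, only
  independent of the window of \<open>t\<close>.\<close>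

definition qu :: "nat \<Rightarrow> nat \<Rightarrow> ('x \<times> 'h) \<times> (nat \<Rightarrow> real) \<times> (nat \<Rightarrow> real) \<Rightarrow> real" where
 "qu J m = (\<lambda>(a, t, y). rt J m a y / ls {J..<J + m} a t y)"

lemma rt_m [measurable]:
 assumes [measurable]: "f \<in> measurable K M0" "g \<in> measurable K sq"
 shows "(\<lambda>z. rt J m (f z) (g z)) \<in> borel_measurable K"
 unfolding rt_def by measurable

lemma qu_m [measurable]: "qu J m \<in> borel_measurable (M0 \<Otimes>\<^sub>M sq \<Otimes>\<^sub>M sq)"
 unfolding qu_def split_beta' by measurable

lemma qu_comp [measurable]:
 assumes [measurable]: "f \<in> measurable K M0" "g \<in> measurable K sq" "h \<in> measurable K sq"
 shows "(\<lambda>x. qu J m (f x, g x, h x)) \<in> borel_measurable K"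
 by measurable

lemma rt_nonneg: "0 \<le> rt J m a y"
 by (simp add: rt_def Ltr_nonneg)

lemma qu_nonneg: "0 \<le> qu J m x"
 by (cases x) (simp add: qu_def rt_nonneg less_imp_le ls_pos)

lemma qu_ls: "ennreal (qu J m (a, t, y)) * ennreal (ls {..<J + m} a t y) = ennreal (rt J m a y) * ennreal (ls {..<J} a t y)"
proof -
 have "qu J m (a, t, y) * ls {..<J + m} a t y = rt J m a y * ls {..<J} a t y"
  using ls_pos[of "{J..<J + m}" a t y] by (simp add: qu_def ls_split)
 then show ?thesis
  by (simp only: ennreal_mult[symmetric] qu_nonneg rt_nonneg less_imp_le[OF ls_pos])
qed

lemma rt_Lt: "a \<in> space M0 \<Longrightarrow> ennreal (rt J m a y) * Lt J a y = Lt (J + m) a y"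
 using Ltr_pos[of a J y] Ltr_nonneg[of "J + m" a y]
 by (simp add: Ltr_eq[symmetric] rt_def ennreal_mult[symmetric])

lemma qu_causal:
 assumes "\<And>i. i < J + m \<Longrightarrow> t i = t' i" "\<And>i. i < J + m \<Longrightarrow> y i = y' i"
 shows "qu J m (a, t, y) = qu J m (a, t', y')"
proof -
 have "Lt J a y = Lt J a y'" "Lt (J + m) a y = Lt (J + m) a y'"
  using assms by (auto intro!: Lt_cong)
 moreover have "ls {J..<J + m} a t y = ls {J..<J + m} a t' y'" using assms by (intro ls_cong) auto
 ultimately show ?thesis by (simp add: qu_def rt_def Ltr_def)
qed

abbreviation (input) RL :: "nat \<Rightarrow> 'x \<times> 'h \<Rightarrow> (nat \<Rightarrow> real) \<Rightarrow> (nat \<Rightarrow> real) \<Rightarrow> ennreal" where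
 "RL k a t y \<equiv> ennreal (re {..<k} a t y) * ennreal (ls {..<k} a t y)"

lemma override_t:
 "re {..<J} a (\<lambda>i. if i \<in> {J..<J + m} then u i else t i) y = re {..<J} a t y"
 "ls {..<J} a (\<lambda>i. if i \<in> {J..<J + m} then u i else t i) y = ls {..<J} a t y"
 by (auto intro!: re_cong ls_cong)

lemma rt_mass: "(\<integral>\<^sup>+a. (\<GG> t. \<GG> y. ennreal (rt J m a y) * RL J a t y) \<partial>M0) = 1"
proof -
 have "(\<integral>\<^sup>+a. (\<GG> t. \<GG> y. ennreal (rt J m a y) * RL J a t y) \<partial>M0) = (\<integral>\<^sup>+a. (\<GG> y. Lt (J + m) a y) \<partial>M0)"
 proof (rule nn_integral_cong)
  fix a assume a [measurable]: "a \<in> space M0"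
  have "(\<GG> t. \<GG> y. ennreal (rt J m a y) * RL J a t y) = (\<GG> y. \<GG> t. ennreal (rt J m a y) * RL J a t y)"
   by (rule nn_integral_swap_gseq) measurable
  also have "\<dots> = (\<GG> y. Lt (J + m) a y)"
  proof (rule nn_integral_cong)
   fix y :: "nat \<Rightarrow> real"
   have [measurable]: "y \<in> space sq" by simp
   have "(\<GG> t. ennreal (rt J m a y) * RL J a t y) = ennreal (rt J m a y) * Lt J a y"
    unfolding Lt_def by (rule nn_integral_cmult) measurable
   then show "(\<GG> t. ennreal (rt J m a y) * RL J a t y) = Lt (J + m) a y"
    unfolding rt_Lt[OF a] .
  qed
  finally show "(\<GG> t. \<GG> y. ennreal (rt J m a y) * RL J a t y) = (\<GG> y. Lt (J + m) a y)" .
 qed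
 then show ?thesis by (simp only: Lt_mass)
qed

lemma nn_PP_qu:
 assumes [measurable]: "F \<in> borel_measurable (M0 \<Otimes>\<^sub>M sq \<Otimes>\<^sub>M sq)"
 shows "(\<integral>\<^sup>+x. (\<lambda>(a, t, y). ennreal (qu J m (a, t, y)) * F (a, t, y)) x \<partial>PP J (J + m))
  = (\<integral>\<^sup>+a. (\<GG> t. \<GG> y. F (a, t, y) * (ennreal (rt J m a y) * RL J a t y)) \<partial>M0)"
proof -
 have "(\<integral>\<^sup>+x. (\<lambda>(a, t, y). ennreal (qu J m (a, t, y)) * F (a, t, y)) x \<partial>PP J (J + m))
  = (\<integral>\<^sup>+a. (\<GG> t. \<GG> y. (\<lambda>(a, t, y). ennreal (qu J m (a, t, y)) * F (a, t, y)) (a, t, y) * ennreal (re {..<J} a t y * ls {..<J + m} a t y)) \<partial>M0)"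
  by (rule nn_PP) measurable
 also have "\<dots> = (\<integral>\<^sup>+a. (\<GG> t. \<GG> y. F (a, t, y) * (ennreal (rt J m a y) * RL J a t y)) \<partial>M0)"
 proof (rule nn_integral_cong, rule nn_integral_cong, rule nn_integral_cong)
  fix a t y
  have "(ennreal (qu J m (a, t, y)) * F (a, t, y)) * ennreal (re {..<J} a t y * ls {..<J + m} a t y)
   = (ennreal (qu J m (a, t, y)) * ennreal (ls {..<J + m} a t y)) * (F (a, t, y) * ennreal (re {..<J} a t y))"
   by (simp only: ennreal_mult[OF less_imp_le[OF re_pos] less_imp_le[OF ls_pos]] mult_ac)
  also have "\<dots> = F (a, t, y) * (ennreal (rt J m a y) * RL J a t y)"
   unfolding qu_ls by (simp only: mult_ac)
  finally show "(\<lambda>(a, t, y). ennreal (qu J m (a, t, y)) * F (a, t, y)) (a, t, y) * ennreal (re {..<J} a t y * ls {..<J + m} a t y)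
   = F (a, t, y) * (ennreal (rt J m a y) * RL J a t y)" by simp
 qed
 finally show ?thesis .
qed

lemma PP_qu: "(\<integral>\<^sup>+x. ennreal (qu J m x) \<partial>PP J (J + m)) = 1"
proof -
 have "(\<integral>\<^sup>+x. ennreal (qu J m x) \<partial>PP J (J + m)) = (\<integral>\<^sup>+x. (\<lambda>(a, t, y). ennreal (qu J m (a, t, y)) * (\<lambda>_. 1) (a, t, y)) x \<partial>PP J (J + m))"
  by (rule nn_integral_cong) auto
 also have "\<dots> = 1" by (subst nn_PP_qu) (simp_all add: rt_mass)
 finally show ?thesis .
qed

lemma PP_qu_indep:
 assumes F [measurable]: "F \<in> borel_measurable (M0 \<Otimes>\<^sub>M sq \<Otimes>\<^sub>M sq)"
 shows "(\<integral>\<^sup>+x. (\<lambda>(a, t, y). ennreal (qu J m (a, t, y)) * F (a, t, y)) x \<partial>PP J (J + m))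
  = (\<integral>\<^sup>+x. (\<lambda>(a, t, y). ennreal (qu J m (a, t, y)) * (\<GG> u. F (a, (\<lambda>i. if i \<in> {J..<J + m} then u i else t i), y))) x \<partial>PP J (J + m))"
proof -
 let ?ov = "\<lambda>u t i. if i \<in> {J..<J + m} then u i else t i :: real"
 let ?R = "\<lambda>a t y. ennreal (rt J m a y) * RL J a t y"
 let ?G = "\<lambda>(a, t, y). (\<GG> u. F (a, ?ov u t, y))"
 have [measurable]: "(\<lambda>x. ?ov (f x) (g x)) \<in> measurable K sq"
  if [measurable]: "f \<in> measurable K sq" "g \<in> measurable K sq" for f g and K :: "'k measure"
  by measurable
 have G_m: "?G \<in> borel_measurable (M0 \<Otimes>\<^sub>M sq \<Otimes>\<^sub>M sq)"
  unfolding split_beta' by measurable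
 have "(\<integral>\<^sup>+x. (\<lambda>(a, t, y). ennreal (qu J m (a, t, y)) * F (a, t, y)) x \<partial>PP J (J + m))
  = (\<integral>\<^sup>+a. (\<GG> t. \<GG> y. F (a, t, y) * ?R a t y) \<partial>M0)"
  by (rule nn_PP_qu) simp
 also have "\<dots> = (\<integral>\<^sup>+a. (\<GG> t. \<GG> y. (\<GG> u. F (a, ?ov u t, y)) * ?R a t y) \<partial>M0)"
 proof (rule nn_integral_cong)
  fix a assume a [measurable]: "a \<in> space M0"
  have "(\<GG> t. \<GG> y. F (a, t, y) * ?R a t y) = (\<GG> y. \<GG> t. F (a, t, y) * ?R a t y)"
   by (rule nn_integral_swap_gseq) measurable
  also have "\<dots> = (\<GG> y. \<GG> t. (\<GG> u. F (a, ?ov u t, y)) * ?R a t y)"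
  proof (rule nn_integral_cong)
   fix y :: "nat \<Rightarrow> real"
   have [measurable]: "y \<in> space sq" by simp
   have "(\<GG> t. F (a, t, y) * ?R a t y) = (\<GG> t. \<GG> u. F (a, ?ov u t, y) * ?R a (?ov u t) y)"
    by (rule nn_integral_gseq_override[symmetric]) measurable
   also have "\<dots> = (\<GG> t. \<GG> u. F (a, ?ov u t, y) * ?R a t y)"
    by (simp only: override_t)
   also have "\<dots> = (\<GG> t. (\<GG> u. F (a, ?ov u t, y)) * ?R a t y)"
   proof (rule nn_integral_cong)
    fix t :: "nat \<Rightarrow> real"
    have [measurable]: "t \<in> space sq" by simp
    show "(\<GG> u. F (a, ?ov u t, y) * ?R a t y) = (\<GG> u. F (a, ?ov u t, y)) * ?R a t y"
     by (rule nn_integral_multc) measurable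
   qed
   finally show "(\<GG> t. F (a, t, y) * ?R a t y) = (\<GG> t. (\<GG> u. F (a, ?ov u t, y)) * ?R a t y)" .
  qed
  also have "\<dots> = (\<GG> t. \<GG> y. (\<GG> u. F (a, ?ov u t, y)) * ?R a t y)"
   by (rule nn_integral_swap_gseq) measurable
  finally show "(\<GG> t. \<GG> y. F (a, t, y) * ?R a t y)
   = (\<GG> t. \<GG> y. (\<GG> u. F (a, ?ov u t, y)) * ?R a t y)" .
 qed
 also have "\<dots> = (\<integral>\<^sup>+x. (\<lambda>(a, t, y). ennreal (qu J m (a, t, y)) * ?G (a, t, y)) x \<partial>PP J (J + m))"
  using nn_PP_qu[OF G_m, of J m, symmetric] by (simp only: prod.case)
 finally show ?thesis by simp
qed

lemma nn_loop_qu: "(\<integral>\<^sup>+om. ennreal (qu J m (A om, T om, Y om)) \<partial>M) = 1"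
proof -
 let ?w = "{J..<J + m}"
 have "(\<integral>\<^sup>+om. ennreal (qu J m (A om, T om, Y om)) \<partial>M)
  = (\<integral>\<^sup>+a. (\<GG> t. \<GG> y. ennreal (qu J m (a, t, y)) * ennreal (L (J + m) a t y)) \<partial>M0)"
 proof (rule nn_integral_loop)
  fix a t y t' y' assume "\<And>i. i < J + m \<Longrightarrow> t i = (t' i :: real)" "\<And>i. i < J + m \<Longrightarrow> y i = (y' i :: real)"
  from qu_causal[OF this] show "ennreal (qu J m (a, t, y)) = ennreal (qu J m (a, t', y'))" by simp
 qed measurable
 also have "\<dots> = (\<integral>\<^sup>+a. (\<GG> t. \<GG> y. ennreal (rt J m a y) * RL J a t y) \<partial>M0)"
 proof (rule nn_integral_cong)
  fix a assume a [measurable]: "a \<in> space M0"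
  have "(\<GG> t. \<GG> y. ennreal (qu J m (a, t, y)) * ennreal (L (J + m) a t y))
   = (\<GG> t. \<GG> y. (ennreal (rt J m a y) * RL J a t y) * ennreal (re ?w a t y))"
  proof (rule nn_integral_cong, rule nn_integral_cong)
   fix t y
   have "ennreal (L (J + m) a t y) = (ennreal (re {..<J} a t y) * ennreal (re ?w a t y)) * ennreal (ls {..<J + m} a t y)"
    unfolding L_def re_split
    by (simp only: ennreal_mult[symmetric] less_imp_le[OF re_pos] less_imp_le[OF ls_pos] mult_nonneg_nonneg)
   then have "ennreal (qu J m (a, t, y)) * ennreal (L (J + m) a t y)
    = (ennreal (qu J m (a, t, y)) * ennreal (ls {..<J + m} a t y)) * (ennreal (re {..<J} a t y) * ennreal (re ?w a t y))"
    by (simp only: mult_ac)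
   then show "ennreal (qu J m (a, t, y)) * ennreal (L (J + m) a t y) = (ennreal (rt J m a y) * RL J a t y) * ennreal (re ?w a t y)"
    unfolding qu_ls by (simp only: mult_ac)
  qed
  also have "\<dots> = (\<GG> y. \<GG> t. (ennreal (rt J m a y) * RL J a t y) * ennreal (re ?w a t y))"
   by (rule nn_integral_swap_gseq) measurable
  also have "\<dots> = (\<GG> y. \<GG> t. ennreal (rt J m a y) * RL J a t y)"
  proof (rule nn_integral_cong)
   fix y :: "nat \<Rightarrow> real"
   have [measurable]: "y \<in> space sq" by simp
   have "(\<GG> t. (ennreal (rt J m a y) * RL J a t y) * ennreal (re ?w a t y))
    = (\<GG> t. ennreal (rt J m a y) * RL J a t y) * (\<GG> t. ennreal (re ?w a t y))"
   proof (rule nn_integral_gseq_split[where w="?w"])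
    fix u t
    show "ennreal (rt J m a y) * RL J a (\<lambda>i. if i \<in> ?w then u i else t i) y = ennreal (rt J m a y) * RL J a t y"
     by (simp only: override_t)
    have "re ?w a (\<lambda>i. if i \<in> ?w then u i else t i) y = re ?w a u y" by (rule re_cong) auto
    then show "ennreal (re ?w a (\<lambda>i. if i \<in> ?w then u i else t i) y) = ennreal (re ?w a u y)" by simp
   qed measurable
   then show "(\<GG> t. (ennreal (rt J m a y) * RL J a t y) * ennreal (re ?w a t y)) = (\<GG> t. ennreal (rt J m a y) * RL J a t y)"
    by (simp only: re_int[OF finite_atLeastLessThan] mult_1_right)
  qed
  also have "\<dots> = (\<GG> t. \<GG> y. ennreal (rt J m a y) * RL J a t y)"
   by (rule nn_integral_swap_gseq) measurable
  finally show "(\<GG> t. \<GG> y. ennreal (qu J m (a, t, y)) * ennreal (L (J + m) a t y))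
   = (\<GG> t. \<GG> y. ennreal (rt J m a y) * RL J a t y)" .
 qed
 finally show ?thesis by (simp only: rt_mass)
qed

end

section \<open>Whiteness of the averaged output\<close>

context upstream_loop
begin

lemma snd_A [measurable]: "(\<lambda>om. snd (A om)) \<in> measurable M H"
 by (rule snd_M0) measurable

lemma snd_A_space: "om \<in> space M \<Longrightarrow> snd (A om) \<in> space H"
 using measurable_space[OF snd_A] by simp

lemma A_space: "om \<in> space M \<Longrightarrow> A om \<in> space M0"
 using measurable_space[OF A] .

text \<open>A second exchange, for the law of \<open>y\<close> given \<open>h\<close>, from the
  predictive density to the white one. It is kept apart from \<open>qu\<close>: independence is
  needed with \<open>x\<close> as part of the static data, whereas whiteness is obtained after
  averaging over \<open>x\<close>.\<close>

lemma nn_loop_q2: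
 fixes J m :: nat
 defines "w \<equiv> {J..<J + m}"
 assumes k: "k \<in> borel_measurable sq" and kw: "\<And>y y'. (\<And>i. i \<in> w \<Longrightarrow> y i = y' i) \<Longrightarrow> k y = k y'"
 shows "(\<integral>\<^sup>+om. k (Y om) * ennreal (Lxr J (snd (A om)) (Y om) * nh P w (Y om) / Lxr (J + m) (snd (A om)) (Y om)) \<partial>M)
  = (\<GG> y. k y * ennreal (nh P w y))"
proof -
 have k_m [measurable]: "(\<lambda>x. k (f x)) \<in> borel_measurable K" if "f \<in> measurable K sq" for f and K :: "'k measure"
  using measurable_compose[OF that k] by simp
 let ?n = "\<lambda>y. k y * ennreal (nh P w y)"
 let ?q = "\<lambda>h y. Lxr J h y * nh P w y / Lxr (J + m) h y"
 have Lx_ov: "Lx J h (\<lambda>i. if i \<in> w then u i else y i) = Lx J h y" for h u y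
  by (rule Lx_cong) (simp add: w_def)
 have n_w: "?n (\<lambda>i. if i \<in> w then u i else y i) = ?n u" for u y
 proof -
  have "k (\<lambda>i. if i \<in> w then u i else y i) = k u" by (rule kw) simp
  moreover have "nh P w (\<lambda>i. if i \<in> w then u i else y i) = nh P w u" by (simp add: nh_def)
  ultimately show ?thesis by simp
 qed
 have "(\<integral>\<^sup>+om. k (Y om) * ennreal (?q (snd (A om)) (Y om)) \<partial>M)
  = (\<integral>\<^sup>+h. (\<GG> y. (k y * ennreal (?q h y)) * Lx (J + m) h y) \<partial>H)"
 proof (rule nn_loop_Lx[of "\<lambda>h y. k y * ennreal (?q h y)"])
  fix h y y' assume *: "\<And>i. i < J + m \<Longrightarrow> y i = (y' i :: real)"
  then have "Lx J h y = Lx J h y'" "Lx (J + m) h y = Lx (J + m) h y'" by (auto intro!: Lx_cong)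
  moreover have "nh P w y = nh P w y'" unfolding nh_def w_def using * by simp
  moreover have "k y = k y'" using * by (intro kw) (simp add: w_def)
  ultimately show "k y * ennreal (?q h y) = k y' * ennreal (?q h y')" by (simp add: Lxr_def)
 qed measurable
 also have "\<dots> = (\<integral>\<^sup>+h. (\<GG> y. Lx J h y) * (\<GG> y. ?n y) \<partial>H)"
 proof (rule nn_integral_cong)
  fix h assume h [measurable]: "h \<in> space H"
  have "(\<GG> y. (k y * ennreal (?q h y)) * Lx (J + m) h y) = (\<GG> y. Lx J h y * ?n y)"
  proof (rule nn_integral_cong)
   fix y
   have "?q h y * Lxr (J + m) h y = Lxr J h y * nh P w y" using Lxr_pos[OF h, of "J + m" y] by simp
   then have "ennreal (?q h y) * Lx (J + m) h y = Lx J h y * ennreal (nh P w y)"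
    unfolding Lxr_eq[OF h, symmetric] using nh_pos[OF param(1), of w y]
    by (subst (1 2) ennreal_mult[symmetric]) (auto simp: Lxr_nonneg less_imp_le)
   then show "(k y * ennreal (?q h y)) * Lx (J + m) h y = Lx J h y * ?n y"
    by (simp only: mult.assoc mult.left_commute[of "k y"])
  qed
  also have "\<dots> = (\<GG> y. Lx J h y) * (\<GG> y. ?n y)"
   by (rule nn_integral_gseq_split[where w=w]) (measurable, rule Lx_ov, rule n_w)
  finally show "(\<GG> y. (k y * ennreal (?q h y)) * Lx (J + m) h y) = (\<GG> y. Lx J h y) * (\<GG> y. ?n y)" .
 qed
 also have "\<dots> = (\<integral>\<^sup>+h. (\<GG> y. Lx J h y) \<partial>H) * (\<GG> y. ?n y)"
  by (rule nn_integral_multc) measurable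
 finally show ?thesis by (simp only: Lx_mass mult_1_left)
qed

text \<open>Its mean measures the information about \<open>y\<close> that \<open>t\<close> adds to
  the static data.\<close>

definition lnt :: "nat \<Rightarrow> 'w \<Rightarrow> real" where
 "lnt k om = ln (ls {..<k} (A om) (T om) (Y om)) - ln (Ltr k (A om) (Y om))"

text \<open>Its mean is the divergence from white noise of the law of \<open>y\<close> given
  \<open>h\<close>.\<close>

definition lnx :: "nat \<Rightarrow> 'w \<Rightarrow> real" where
 "lnx k om = ln (Lxr k (snd (A om)) (Y om)) - ln (nh P {..<k} (Y om))"

lemma ln_le_of_le_exp: "0 < a \<Longrightarrow> a \<le> exp b \<Longrightarrow> ln a \<le> (b :: real)"
 by (metis exp_gt_zero ln_exp ln_le_cancel_iff)

lemma ln_Ltr_int: "integrable M (\<lambda>om. ln (Ltr k (A om) (Y om)))"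
proof -
 note n = nh_pos[OF param(1), of "{..<k}"]
 have "integrable M (\<lambda>om. ln (Ltr k (A om) (Y om) / nh P {..<k} (Y om)))"
 proof (rule W.ln_integrable[where c=1])
  have "(\<integral>\<^sup>+om. ennreal (1 / (Ltr k (A om) (Y om) / nh P {..<k} (Y om))) \<partial>M)
   = (\<integral>\<^sup>+a. (\<GG> y. ennreal (1 / (Ltr k a y / nh P {..<k} y)) * Lt k a y) \<partial>M0)"
  proof (rule nn_loop_Lt[of "\<lambda>a y. ennreal (1 / (Ltr k a y / nh P {..<k} y))"])
   fix a y y' assume *: "\<And>i. i < k \<Longrightarrow> y i = (y' i :: real)"
   have "nh P {..<k} y = nh P {..<k} y'" unfolding nh_def using * by simp
   then show "ennreal (1 / (Ltr k a y / nh P {..<k} y)) = ennreal (1 / (Ltr k a y' / nh P {..<k} y'))"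
    using Lt_cong[OF *, where a=a] by (simp add: Ltr_def)
  qed measurable
  also have "\<dots> = (\<integral>\<^sup>+a. (\<GG> y. ennreal (nh P {..<k} y)) \<partial>M0)"
  proof (rule nn_integral_cong, rule nn_integral_cong)
   fix a y assume a: "a \<in> space M0"
   show "ennreal (1 / (Ltr k a y / nh P {..<k} y)) * Lt k a y = ennreal (nh P {..<k} y)"
    unfolding Ltr_eq[OF a, symmetric] using Ltr_pos[OF a, of k y] n[of y]
    by (subst ennreal_mult[symmetric]) (auto simp: less_imp_le)
  qed
  finally show "(\<integral>\<^sup>+om. ennreal (1 / (Ltr k (A om) (Y om) / nh P {..<k} (Y om))) \<partial>M) \<le> ennreal 1"
   by (simp add: nn_integral_nh_1[OF param(1)] emeasure_space_1)
  show "integrable M (\<lambda>om. (\<Sum>j<k. (Y om j)\<^sup>2 / 2) - ln (nh P {..<k} (Y om)))"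
   using Y_sq_sum_int[of "{..<k}"] ln_nh_int[of "{..<k}"] by simp
  fix om assume om: "om \<in> space M"
  note U = Ltr_pos[OF A_space[OF om], of k "Y om"]
  show "0 < Ltr k (A om) (Y om) / nh P {..<k} (Y om)" by (rule divide_pos_pos[OF U n])
  show "ln (Ltr k (A om) (Y om) / nh P {..<k} (Y om)) \<le> (\<Sum>j<k. (Y om j)\<^sup>2 / 2) - ln (nh P {..<k} (Y om))"
   unfolding ln_divide_pos[OF U n] using ln_le_of_le_exp[OF U Ltr_le[OF A_space[OF om]]] by simp
 qed measurable
 then have "integrable M (\<lambda>om. ln (Ltr k (A om) (Y om) / nh P {..<k} (Y om)) + ln (nh P {..<k} (Y om)))"
  using ln_nh_int[of "{..<k}"] by simp
 then show ?thesis
  by (subst Bochner_Integration.integrable_cong[OF refl, of _ _ "\<lambda>om. ln (Ltr k (A om) (Y om) / nh P {..<k} (Y om)) + ln (nh P {..<k} (Y om))"])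
   (auto simp: ln_divide_pos[OF Ltr_pos[OF A_space] n])
qed

lemma lnx_int: "integrable M (lnx k)"
proof -
 note n = nh_pos[OF param(1), of "{..<k}"]
 have Lxr_0: "Lxr 0 h y = 1" if "h \<in> space H" for h y
  by (simp add: Lxr_def Lx_def Lt_def ls_def re_def p_mass)
 have "integrable M (\<lambda>om. ln (Lxr k (snd (A om)) (Y om) / nh P {..<k} (Y om)))"
 proof (rule W.ln_integrable[where c=1])
  have "(\<integral>\<^sup>+om. ennreal (1 / (Lxr k (snd (A om)) (Y om) / nh P {..<k} (Y om))) \<partial>M)
   = (\<integral>\<^sup>+om. 1 * ennreal (Lxr 0 (snd (A om)) (Y om) * nh P {0..<0 + k} (Y om) / Lxr (0 + k) (snd (A om)) (Y om)) \<partial>M)"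
   by (rule nn_integral_cong) (simp add: Lxr_0 snd_A_space lessThan_atLeast0)
  also have "\<dots> = 1"
   by (subst nn_loop_q2[where k="\<lambda>_. 1"]) (simp_all add: nn_integral_nh_1[OF param(1)])
  finally show "(\<integral>\<^sup>+om. ennreal (1 / (Lxr k (snd (A om)) (Y om) / nh P {..<k} (Y om))) \<partial>M) \<le> ennreal 1" by simp
  show "integrable M (\<lambda>om. (\<Sum>j<k. (Y om j)\<^sup>2 / 2) - ln (nh P {..<k} (Y om)))"
   using Y_sq_sum_int[of "{..<k}"] ln_nh_int[of "{..<k}"] by simp
  fix om assume om: "om \<in> space M"
  note U = Lxr_pos[OF snd_A_space[OF om], of k "Y om"]
  show "0 < Lxr k (snd (A om)) (Y om) / nh P {..<k} (Y om)" by (rule divide_pos_pos[OF U n])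
  show "ln (Lxr k (snd (A om)) (Y om) / nh P {..<k} (Y om)) \<le> (\<Sum>j<k. (Y om j)\<^sup>2 / 2) - ln (nh P {..<k} (Y om))"
   unfolding ln_divide_pos[OF U n] using ln_le_of_le_exp[OF U Lxr_le[OF snd_A_space[OF om]]] by simp
 qed measurable
 then show ?thesis
  by (subst Bochner_Integration.integrable_cong[OF refl, of _ _ "\<lambda>om. ln (Lxr k (snd (A om)) (Y om) / nh P {..<k} (Y om))"])
   (auto simp: lnx_def ln_divide_pos[OF Lxr_pos[OF snd_A_space] n])
qed

lemma lnt_int: "integrable M (lnt k)"
proof -
 have "integrable M (\<lambda>om. (\<Sum>j<k. ((Y om j)\<^sup>2 - (Z om j)\<^sup>2) / 2) - ln (Ltr k (A om) (Y om)))"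
  using Y_int Z_int ln_Ltr_int by simp
 then show ?thesis
  by (subst Bochner_Integration.integrable_cong[OF refl, of _ _ "\<lambda>om. (\<Sum>j<k. ((Y om j)\<^sup>2 - (Z om j)\<^sup>2) / 2) - ln (Ltr k (A om) (Y om))"])
   (auto simp: lnt_def ln_ls)
qed

end

section \<open>Bounded information and the choice of a window\<close>

context upstream_loop
begin

text \<open>The extra factor \<open>ls * Lx / (Lt * nh)\<close> turns the comparison density into
  \<open>gk * (Lx / Lt) * re * ls\<close>. Integration over \<open>t\<close>, which
  \<open>gk\<close> ignores, turns \<open>re * ls\<close> into \<open>Lt\<close> and cancels it;
  \<open>gk\<close> over \<open>x\<close> gives the bound of \<open>gk_int\<close>, and
  \<open>Lx\<close> has mass one. Gibbs' inequality then bounds both quantities together.\<close>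

lemma lnt_lnx_bound: "W.expectation (lnt k) + W.expectation (lnx k) \<le> K1 - 1 + c0"
proof -
 let ?w = "{..<k}"
 let ?M = "\<lambda>a t y. ls ?w a t y * Lxr k (snd a) y / (Ltr k a y * nh P ?w y)"
 let ?c = "ennreal (c0 * exp (- (real k * al)))"
 note n = nh_pos[OF param(1), of ?w]
 have M_pos: "0 < ?M (A om) (T om) (Y om)" if "om \<in> space M" for om
  using Lxr_pos[OF snd_A_space[OF that]] Ltr_pos[OF A_space[OF that]] n ls_pos
  by (intro divide_pos_pos mult_pos_pos)
 have Lxr_snd_m [measurable]: "(\<lambda>x. Lxr k (snd (fst x)) (snd (snd x))) \<in> borel_measurable (M0 \<Otimes>\<^sub>M sq \<Otimes>\<^sub>M sq)"
  by (rule Lxr_m) (rule snd_M0, measurable)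
 have "(\<integral>\<^sup>+om. ennreal (1 / (exp (LL k om) / ?M (A om) (T om) (Y om))) \<partial>M)
  = (\<integral>\<^sup>+om. ennreal (exp (- LL k om)) * (\<lambda>a t y. ennreal (?M a t y)) (A om) (T om) (Y om) \<partial>M)"
 proof (rule nn_integral_cong)
  fix om assume "om \<in> space M"
  from M_pos[OF this] show "ennreal (1 / (exp (LL k om) / ?M (A om) (T om) (Y om))) = ennreal (exp (- LL k om)) * (\<lambda>a t y. ennreal (?M a t y)) (A om) (T om) (Y om)"
   by (subst ennreal_mult[symmetric]) (auto simp only: exp_minus divide_inverse inverse_mult_distrib inverse_inverse_eq mult_1_left mult_1_right exp_ge_zero less_imp_le inverse_nonnegative_iff_nonnegative)
 qed
 also have "\<dots> \<le> ennreal (exp (real k * al)) * (\<integral>\<^sup>+h. (\<GG> t. \<GG> y. \<LL> x. ennreal (gk k (x, h) t y * re ?w (x, h) t y * nh P ?w y)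
   * (\<lambda>a t y. ennreal (?M a t y)) (x, h) t y) \<partial>H)"
 proof (rule nn_exp_LL)
  fix a :: "'x \<times> 'h" and t y t' y' assume *: "\<And>i. i < k \<Longrightarrow> t i = (t' i :: real)" "\<And>i. i < k \<Longrightarrow> y i = (y' i :: real)"
  have "Lxr k (snd a) y = Lxr k (snd a) y'" unfolding Lxr_def using Lx_cong[OF *(2)] by simp
  moreover have "Ltr k a y = Ltr k a y'" unfolding Ltr_def using Lt_cong[OF *(2)] by simp
  moreover have "nh P ?w y = nh P ?w y'" unfolding nh_def using * by simp
  moreover have "ls ?w a t y = ls ?w a t' y'" using * by (intro ls_cong) auto
  ultimately show "ennreal (?M a t y) = ennreal (?M a t' y')" by simp
 qed (unfold split_beta', measurable)
 also have "\<dots> = ennreal (exp (real k * al)) * (\<integral>\<^sup>+h. (\<GG> y. \<LL> x. ennreal (gk k (x, h) (\<lambda>_. 0) y) * Lx k h y) \<partial>H)"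
 proof (rule arg_cong[where f="\<lambda>u. ennreal (exp (real k * al)) * u"], rule nn_integral_cong)
  fix h assume h [measurable]: "h \<in> space H"
  have xh: "(x, h) \<in> space M0" for x using h by (simp add: space_pair_measure)
  have [measurable]: "(\<lambda>z. (f z, h)) \<in> measurable K M0" if "f \<in> borel_measurable K" for f and K :: "'k measure"
   by (rule Pair_M0) (use that h in simp_all)
  let ?g = "\<lambda>x y. ennreal (gk k (x, h) (\<lambda>_. 0) y * Lxr k h y / Ltr k (x, h) y)"
  let ?R = "\<lambda>x t y. ennreal (re ?w (x, h) t y) * ennreal (ls ?w (x, h) t y)"
  have "(\<GG> t. \<GG> y. \<LL> x. ennreal (gk k (x, h) t y * re ?w (x, h) t y * nh P ?w y) * (\<lambda>a t y. ennreal (?M a t y)) (x, h) t y)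
   = (\<GG> t. \<GG> y. \<LL> x. ?g x y * ?R x t y)"
  proof (rule nn_integral_cong, rule nn_integral_cong, rule nn_integral_cong)
   fix t y x
   have pos: "0 \<le> gk k (x, h) (\<lambda>_. 0) y * Lxr k h y / Ltr k (x, h) y" "0 \<le> ?M (x, h) t y"
    "0 \<le> gk k (x, h) t y * re ?w (x, h) t y * nh P ?w y"
    using less_imp_le[OF gk_bounds(1)[of k "(x, h)"]] Lxr_nonneg[of k h y] Ltr_nonneg[of k "(x, h)" y]
     less_imp_le[OF ls_pos[of ?w "(x, h)" t y]] less_imp_le[OF n[of y]] less_imp_le[OF re_pos[of ?w "(x, h)" t y]]
    by (auto intro!: divide_nonneg_nonneg mult_nonneg_nonneg)
   have "(gk k (x, h) t y * re ?w (x, h) t y * nh P ?w y) * ?M (x, h) t y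
    = (gk k (x, h) (\<lambda>_. 0) y * Lxr k h y / Ltr k (x, h) y) * (re ?w (x, h) t y * ls ?w (x, h) t y)"
    using n[of y] Ltr_pos[OF xh[of x], of k y] gk_static[of k "(x, h)" t y "\<lambda>_. 0"] by simp
   then show "ennreal (gk k (x, h) t y * re ?w (x, h) t y * nh P ?w y) * (\<lambda>a t y. ennreal (?M a t y)) (x, h) t y = ?g x y * ?R x t y"
    using pos by (simp only: ennreal_mult[symmetric] less_imp_le[OF re_pos] less_imp_le[OF ls_pos] mult_nonneg_nonneg)
  qed
  also have "\<dots> = (\<GG> y. \<GG> t. \<LL> x. ?g x y * ?R x t y)"
   by (rule nn_integral_swap_gseq) measurable
  also have "\<dots> = (\<GG> y. \<LL> x. \<GG> t. ?g x y * ?R x t y)"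
   by (rule nn_integral_cong, rule nn_integral_swap[OF sigma_finite_gseq sigma_finite_lborel]) measurable
  also have "\<dots> = (\<GG> y. \<LL> x. ennreal (gk k (x, h) (\<lambda>_. 0) y) * Lx k h y)"
  proof (rule nn_integral_cong, rule nn_integral_cong)
   fix y :: "nat \<Rightarrow> real" and x
   have [measurable]: "y \<in> space sq" "(x, h) \<in> space M0" using xh by auto
   have "(\<GG> t. ?g x y * ?R x t y) = ?g x y * Lt k (x, h) y"
    unfolding Lt_def by (rule nn_integral_cmult) measurable
   also have "\<dots> = ennreal (gk k (x, h) (\<lambda>_. 0) y) * Lx k h y"
    unfolding Ltr_eq[OF xh, symmetric] Lxr_eq[OF h, symmetric]
    using Ltr_pos[OF xh[of x], of k y] gk_bounds(1)[of k "(x, h)" "\<lambda>_. 0" y] Lxr_nonneg[of k h y]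
    by (subst (1 2) ennreal_mult[symmetric]) (auto simp: less_imp_le)
   finally show "(\<GG> t. ?g x y * ?R x t y) = ennreal (gk k (x, h) (\<lambda>_. 0) y) * Lx k h y" .
  qed
  finally show "(\<GG> t. \<GG> y. \<LL> x. ennreal (gk k (x, h) t y * re ?w (x, h) t y * nh P ?w y) * (\<lambda>a t y. ennreal (?M a t y)) (x, h) t y)
   = (\<GG> y. \<LL> x. ennreal (gk k (x, h) (\<lambda>_. 0) y) * Lx k h y)" .
 qed
 also have "\<dots> \<le> ennreal (exp (real k * al)) * (\<integral>\<^sup>+h. (\<GG> y. ?c * Lx k h y) \<partial>H)"
 proof (intro mult_left_mono, rule nn_integral_mono, rule nn_integral_mono)
  fix h y assume h: "h \<in> space H"
  have m: "(\<lambda>x. gk k (x, h) (\<lambda>_. 0) y) \<in> borel_measurable lborel"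
   by (rule gk_comp[OF Pair_M0]) (use h in simp_all)
  have "(\<LL> x. ennreal (gk k (x, h) (\<lambda>_. 0) y) * Lx k h y) = (\<LL> x. ennreal (gk k (x, h) (\<lambda>_. 0) y)) * Lx k h y"
   by (rule nn_integral_multc, rule measurable_compose[OF m measurable_ennreal])
  also have "\<dots> \<le> ?c * Lx k h y" by (intro mult_right_mono gk_int h) auto
  finally show "(\<LL> x. ennreal (gk k (x, h) (\<lambda>_. 0) y) * Lx k h y) \<le> ?c * Lx k h y" .
 qed simp
 also have "\<dots> = ennreal (exp (real k * al)) * (\<integral>\<^sup>+om. ?c \<partial>M)"
  using nn_loop_Lx[of "\<lambda>_ _. ?c" k] by simp
 also have "\<dots> = ennreal c0"
  using param by (simp add: ennreal_mult[symmetric] exp_minus W.emeasure_space_1)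
 finally have le: "(\<integral>\<^sup>+om. ennreal (1 / (exp (LL k om) / ?M (A om) (T om) (Y om))) \<partial>M) \<le> ennreal c0" .
 have ln: "ln (exp (LL k om) / ?M (A om) (T om) (Y om)) = LL k om - (lnt k om + lnx k om)" if "om \<in> space M" for om
 proof -
  note pos = Lxr_pos[OF snd_A_space[OF that], of k "Y om"] Ltr_pos[OF A_space[OF that], of k "Y om"] n[of "Y om"] ls_pos[of ?w "A om" "T om" "Y om"]
  have "ln (?M (A om) (T om) (Y om)) = lnt k om + lnx k om"
   using pos by (simp add: lnt_def lnx_def ln_div ln_mult)
  then show ?thesis unfolding ln_divide_pos[OF exp_gt_zero M_pos[OF that]] by simp
 qed
 have i: "integrable M (\<lambda>om. ln (exp (LL k om) / ?M (A om) (T om) (Y om)))"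
  by (subst Bochner_Integration.integrable_cong[OF refl ln]) (use LL_int lnt_int lnx_int in auto)
 have "1 - c0 \<le> W.expectation (\<lambda>om. ln (exp (LL k om) / ?M (A om) (T om) (Y om)))"
 proof (rule W.ln_lower[OF _ _ le _ i])
  fix om assume om: "om \<in> space M"
  show "0 < exp (LL k om) / ?M (A om) (T om) (Y om)"
   by (rule divide_pos_pos[OF exp_gt_zero M_pos[OF om]])
 qed (measurable, simp add: param)
 also have "\<dots> = W.expectation (\<lambda>om. LL k om - (lnt k om + lnx k om))"
  by (rule Bochner_Integration.integral_cong[OF refl ln])
 also have "\<dots> = W.expectation (LL k) - (W.expectation (lnt k) + W.expectation (lnx k))" using LL_int lnt_int lnx_int by simp
 finally show ?thesis using LL_exp[of k] unfolding gap_0 by simp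
qed

abbreviation (input) q2 :: "nat \<Rightarrow> nat \<Rightarrow> 'w \<Rightarrow> real" where
 "q2 J m om \<equiv> Lxr J (snd (A om)) (Y om) * nh P {J..<J + m} (Y om) / Lxr (J + m) (snd (A om)) (Y om)"

lemma q_ln:
 assumes om: "om \<in> space M"
 shows "0 < qu J m (A om, T om, Y om)" "- ln (qu J m (A om, T om, Y om)) = lnt (J + m) om - lnt J om"
  "0 < q2 J m om" "- ln (q2 J m om) = lnx (J + m) om - lnx J om"
proof -
 note Lx = Lxr_pos[OF snd_A_space[OF om], of _ "Y om"] and Lt = Ltr_pos[OF A_space[OF om], of _ "Y om"]
  and n = nh_pos[OF param(1), of _ "Y om"] and l = ls_pos[of _ "A om" "T om" "Y om"]
 have nh: "nh P {..<J + m} (Y om) = nh P {..<J} (Y om) * nh P {J..<J + m} (Y om)"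
  unfolding nh_def by (subst prod.union_disjoint[symmetric]) (auto simp: ivl_disj_un_one)
 show "0 < qu J m (A om, T om, Y om)" "0 < q2 J m om"
  using Lt Lx n l by (auto simp: qu_def rt_def)
 have "qu J m (A om, T om, Y om) = Ltr (J + m) (A om) (Y om) / Ltr J (A om) (Y om) / ls {J..<J + m} (A om) (T om) (Y om)"
  by (simp add: qu_def rt_def)
 then show "- ln (qu J m (A om, T om, Y om)) = lnt (J + m) om - lnt J om"
  using Lt[of J] Lt[of "J + m"] l[of "{..<J}"] l[of "{J..<J + m}"] by (simp add: lnt_def ln_div ln_mult ls_split)
 show "- ln (q2 J m om) = lnx (J + m) om - lnx J om"
  using Lx[of J] Lx[of "J + m"] n[of "{..<J}"] n[of "{J..<J + m}"] by (simp add: lnx_def ln_div ln_mult nh)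
qed

text \<open>Nonnegativity of each increment is stated because a small sum of the two increments must
  make both of them small.\<close>

lemma close_of_ln:
 assumes [measurable]: "f \<in> borel_measurable M" and pos: "\<And>om. om \<in> space M \<Longrightarrow> 0 < f om"
  and 1: "(\<integral>\<^sup>+om. ennreal (f om) \<partial>M) = 1" and u: "integrable M u"
  and ln: "\<And>om. om \<in> space M \<Longrightarrow> - ln (f om) = u om"
 shows "0 \<le> W.expectation u"
  and "W.expectation u \<le> (d / 2)\<^sup>2 \<Longrightarrow> 0 < d \<Longrightarrow> (\<integral>\<^sup>+om. ennreal \<bar>1 - f om\<bar> \<partial>M) \<le> ennreal d"
proof -
 have i: "integrable M (\<lambda>om. ln (f om))"
  by (subst Bochner_Integration.integrable_cong[OF refl, of _ _ "\<lambda>om. - u om"]) (use ln u in \<open>auto simp: minus_equation_iff[of "ln _"]\<close>)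
 have E: "W.expectation (\<lambda>om. - ln (f om)) = W.expectation u"
  by (rule Bochner_Integration.integral_cong) (use ln in auto)
 have i': "integrable M (\<lambda>om. ln (1 / f om))"
  by (subst Bochner_Integration.integrable_cong[OF refl, of _ _ "\<lambda>om. - ln (f om)"]) (use i pos in \<open>auto simp: ln_div\<close>)
 have "1 - 1 \<le> W.expectation (\<lambda>om. ln (1 / f om))"
  by (rule W.ln_lower) (use 1 pos i' in auto)
 also have "\<dots> = W.expectation (\<lambda>om. - ln (f om))"
  by (rule Bochner_Integration.integral_cong) (use pos in \<open>auto simp: ln_div\<close>)
 finally show "0 \<le> W.expectation u" unfolding E by simp
 assume d: "W.expectation u \<le> (d / 2)\<^sup>2" "0 < d"
 have "(\<integral>\<^sup>+om. ennreal \<bar>1 - f om\<bar> \<partial>M) \<le> ennreal (2 * sqrt ((d / 2)\<^sup>2))"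
  by (rule W.ratio_L1_close) (use 1 pos i E d in auto)
 then show "(\<integral>\<^sup>+om. ennreal \<bar>1 - f om\<bar> \<partial>M) \<le> ennreal d" using d by (simp add: real_sqrt_abs)
qed

text \<open>One window serves both exchanges: it is chosen for the sum of the two increments, and
  each is nonnegative. Thus \<open>qu\<close> supplies independence and \<open>q2\<close>
  whiteness.\<close>

lemma white_window_ex:
 assumes d: "0 < d"
 shows "\<exists>J q. white_window m d J q"
proof -
 obtain J where J: "(W.expectation (lnt (J + m)) + W.expectation (lnx (J + m))) - (W.expectation (lnt J) + W.expectation (lnx J)) \<le> (d / 2)\<^sup>2"
  using small_increment[of "\<lambda>k. W.expectation (lnt k) + W.expectation (lnx k)" _ "(d / 2)\<^sup>2" m] lnt_lnx_bound d by auto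
 let ?q = "qu J m" and ?w = "{J..<J + m}"
 have q_m [measurable]: "(\<lambda>om. ?q (A om, T om, Y om)) \<in> borel_measurable M" "q2 J m \<in> borel_measurable M" by measurable
 have q2_1: "(\<integral>\<^sup>+om. ennreal (q2 J m om) \<partial>M) = 1"
  using nn_loop_q2[of "\<lambda>_. 1" J m] nn_integral_nh_1[OF param(1), of ?w] by simp
 have i: "integrable M (\<lambda>om. lnt (J + m) om - lnt J om)" "integrable M (\<lambda>om. lnx (J + m) om - lnx J om)"
  using lnt_int lnx_int by auto
 note c1 = close_of_ln[where f="\<lambda>om. ?q (A om, T om, Y om)", OF q_m(1) q_ln(1) nn_loop_qu i(1) q_ln(2)]
 note c2 = close_of_ln[where f="q2 J m", OF q_m(2) q_ln(3) q2_1 i(2) q_ln(4)]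
 have E: "W.expectation (\<lambda>om. lnt (J + m) om - lnt J om) + W.expectation (\<lambda>om. lnx (J + m) om - lnx J om) \<le> (d / 2)\<^sup>2"
  using J lnt_int lnx_int by simp
 have close: "(\<integral>\<^sup>+om. ennreal \<bar>1 - ?q (A om, T om, Y om)\<bar> \<partial>M) \<le> ennreal d"
  and close2: "(\<integral>\<^sup>+om. ennreal \<bar>1 - q2 J m om\<bar> \<partial>M) \<le> ennreal d"
  using c1(1) c2(1) E d by (auto intro!: c1(2) c2(2))
 have "white_window m d J ?q"
  unfolding white_window_def
 proof (intro conjI ballI allI impI)
  show "(\<integral>\<^sup>+x. ennreal (?q x) \<partial>PP J (J + m)) = 1" by (rule PP_qu)
  fix F :: "('x \<times> 'h) \<times> (nat \<Rightarrow> real) \<times> (nat \<Rightarrow> real) \<Rightarrow> ennreal" assume F: "F \<in> borel_measurable (M0 \<Otimes>\<^sub>M sq \<Otimes>\<^sub>M sq)"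
  show "(\<integral>\<^sup>+x. (\<lambda>(a, t, y). ennreal (?q (a, t, y)) * F (a, t, y)) x \<partial>PP J (J + m))
   = (\<integral>\<^sup>+x. (\<lambda>(a, t, y). ennreal (?q (a, t, y)) * (\<GG> u. F (a, (\<lambda>i. if i \<in> ?w then u i else t i), y))) x \<partial>PP J (J + m))"
   using PP_qu_indep[OF F] .
 next
  fix a t y t' y' assume "\<forall>i<J + m. t i = (t' i :: real)" "\<forall>i<J + m. y i = (y' i :: real)"
  then show "?q (a, t, y) = ?q (a, t', y')" by (intro qu_causal) auto
 next
  fix k :: "(nat \<Rightarrow> real) \<Rightarrow> ennreal"
  assume k [measurable]: "k \<in> borel_measurable sq" and k1: "\<forall>y. k y \<le> 1" and kw: "\<forall>y y'. (\<forall>i\<in>?w. y i = y' i) \<longrightarrow> k y = k y'"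
  have eq: "(\<integral>\<^sup>+om. k (Y om) * ennreal (q2 J m om) \<partial>M) = (\<GG> u. k (\<lambda>j. sqrt (1 + P) * u j))"
  proof -
   have kw': "k y = k y'" if "\<And>i. i \<in> ?w \<Longrightarrow> y i = y' i" for y y' using kw that by blast
   show ?thesis by (subst nn_loop_q2[OF k kw']) (auto intro!: nn_integral_window_scale kw' param)
  qed
  have k_m: "(\<lambda>om. k (Y om)) \<in> borel_measurable M" by measurable
  note t = close_transfer[where f="q2 J m" and k="\<lambda>om. k (Y om)" and d=d, OF q_m(2) k_m less_imp_le[OF q_ln(3)] _ close2, unfolded eq]
  show "(\<integral>\<^sup>+om. k (Y om) \<partial>M) \<le> (\<GG> u. k (\<lambda>j. sqrt (1 + P) * u j)) + ennreal d"
   "(\<GG> u. k (\<lambda>j. sqrt (1 + P) * u j)) \<le> (\<integral>\<^sup>+om. k (Y om) \<partial>M) + ennreal d"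
   by (rule t; use k1 in simp)+
 qed (use qu_nonneg close in \<open>simp_all\<close>)
 then show ?thesis by blast
qed

theorem contradiction: False
 using windows_contradiction white_window_ex by blast

end

section \<open>Linear change of variables\<close>

lemma nn_integral_lborel_translate:
 assumes [measurable]: "h \<in> borel_measurable borel"
 shows "(\<LL> x. h (x + c)) = (\<LL> x. h (x :: 'a::euclidean_space))"
proof -
 have "(\<LL> x. h x) = (\<integral>\<^sup>+x. h x \<partial>distr lborel borel ((+) c))" by (simp add: lborel_distr_plus)
 also have "\<dots> = (\<LL> x. h (c + x))" by (subst nn_integral_distr) auto
 finally show ?thesis by (simp add: add.commute)
qed

text \<open>
 Averaging over an auxiliary shift along the direction of the shear reduces its invariance to
 translation invariance.
\<close>

lemma nn_integral_lborel_shear: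
 fixes a b :: "'a::euclidean_space"
 assumes h [measurable]: "h \<in> borel_measurable borel" and ab: "a \<bullet> b = 0"
 shows "(\<LL> x. h (x + (x \<bullet> b) *\<^sub>R a)) = (\<LL> x. h x)"
proof -
 define f where "f s = ennreal (std_normal_density s)" for s
 have [measurable]: "f \<in> borel_measurable borel" unfolding f_def by measurable
 have f1: "(\<LL> s. f (s + c)) = 1" for c :: real
 proof -
  have "emeasure N01 (space N01) = 1" by (rule prob_space.emeasure_space_1[OF prob_space_N01])
  then have "(\<LL> s. f s) = 1" by (simp add: f_def emeasure_density)
  then show ?thesis by (simp add: nn_integral_lborel_translate)
 qed
 have mass: "(\<LL> x. g x) = (\<LL> x. \<LL> s. f (s + c x) * g x)"
  for g :: "'a \<Rightarrow> ennreal" and c :: "'a \<Rightarrow> real"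
  by (simp add: nn_integral_multc f1)
 have swap: "(\<LL> x. \<LL> s. g x s) = (\<LL> s. \<LL> x. g x s)"
  if "(\<lambda>(x, s). g x s) \<in> borel_measurable (borel \<Otimes>\<^sub>M borel)" for g :: "'a \<Rightarrow> real \<Rightarrow> ennreal"
  by (rule nn_integral_swap[OF sigma_finite_lborel sigma_finite_lborel]) (use that in \<open>simp cong: measurable_cong_sets\<close>)
 have "(\<LL> x. h (x + (x \<bullet> b) *\<^sub>R a)) = (\<LL> x. \<LL> s. f s * h (x + (x \<bullet> b) *\<^sub>R a))"
  using mass[of _ "\<lambda>_. 0"] by simp
 also have "\<dots> = (\<LL> s. \<LL> x. f s * h (x + (x \<bullet> b) *\<^sub>R a))"
  by (rule swap) measurable
 \<comment> \<open>Translating \<open>x\<close> by \<open>s *\<^sub>R a\<close> leaves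
   \<open>x \<bullet> b\<close> unchanged, so the shear amount becomes
   \<open>s + x \<bullet> b\<close>. Substituting in \<open>s\<close> next moves the dependence on
   \<open>x\<close> into the weight \<open>f\<close>.\<close>
 also have "\<dots> = (\<LL> s. \<LL> x. f s * h (x + (s + x \<bullet> b) *\<^sub>R a))"
 proof (rule nn_integral_cong)
  fix s
  show "(\<LL> x. f s * h (x + (x \<bullet> b) *\<^sub>R a)) = (\<LL> x. f s * h (x + (s + x \<bullet> b) *\<^sub>R a))"
   using nn_integral_lborel_translate[of "\<lambda>x. f s * h (x + (x \<bullet> b) *\<^sub>R a)" "s *\<^sub>R a"] ab
   by (simp add: inner_add_left algebra_simps)
 qed
 also have "\<dots> = (\<LL> x. \<LL> s. f s * h (x + (s + x \<bullet> b) *\<^sub>R a))"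
  by (rule swap[symmetric]) measurable
 also have "\<dots> = (\<LL> x. \<LL> s. f (s - x \<bullet> b) * h (x + s *\<^sub>R a))"
 proof (rule nn_integral_cong)
  fix x
  show "(\<LL> s. f s * h (x + (s + x \<bullet> b) *\<^sub>R a)) = (\<LL> s. f (s - x \<bullet> b) * h (x + s *\<^sub>R a))"
   using nn_integral_lborel_translate[of "\<lambda>s. f (s - x \<bullet> b) * h (x + s *\<^sub>R a)" "x \<bullet> b"] by simp
 qed
 also have "\<dots> = (\<LL> s. \<LL> x. f (s - x \<bullet> b) * h (x + s *\<^sub>R a))"
  by (rule swap) measurable
 also have "\<dots> = (\<LL> s. \<LL> x. f (s - x \<bullet> b) * h x)"
 proof (rule nn_integral_cong)
  fix s
  show "(\<LL> x. f (s - x \<bullet> b) * h (x + s *\<^sub>R a)) = (\<LL> x. f (s - x \<bullet> b) * h x)"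
   using nn_integral_lborel_translate[of "\<lambda>x. f (s - x \<bullet> b) * h x" "s *\<^sub>R a"] ab
   by (simp add: inner_add_left)
 qed
 also have "\<dots> = (\<LL> x. \<LL> s. f (s - x \<bullet> b) * h x)"
  by (rule swap[symmetric]) measurable
 also have "\<dots> = (\<LL> x. h x)"
  using mass[of h "\<lambda>x. - (x \<bullet> b)"] by simp
 finally show ?thesis .
qed

text \<open>The swap is self-adjoint and permutes \<open>Basis\<close>, so boxes are mapped to boxes
  of the same volume, and boxes determine \<open>lborel\<close>.\<close>

lemma nn_integral_lborel_swap_coords:
 fixes m n :: "'n::finite"
 assumes [measurable]: "h \<in> borel_measurable borel"
 shows "(\<LL> x. h (\<chi> i. x $ Transposition.transpose m n i)) = (\<LL> x. h (x :: real ^ 'n))"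
proof -
 let ?S = "\<lambda>x :: real ^ 'n. \<chi> i. x $ Transposition.transpose m n i"
 have SS [simp]: "?S (?S x) = x" for x by (simp add: vec_eq_iff)
 have S_m [measurable]: "?S \<in> borel_measurable borel"
  by (intro borel_measurable_continuous_onI continuous_intros)
 have S_in: "?S x \<bullet> y = x \<bullet> ?S y" for x y
  unfolding inner_vec_def
  by (rule sum.reindex_bij_witness[of _ "Transposition.transpose m n" "Transposition.transpose m n"]) auto
 have S_ax: "?S b \<in> Basis" if "b \<in> Basis" for b
 proof -
  from that obtain j where b: "b = axis j 1" by (auto simp: Basis_vec_def)
  have "?S b = axis (Transposition.transpose m n j) 1"
   unfolding b by (simp add: vec_eq_iff axis_def) (metis transpose_involutory)
  then show ?thesis by (auto simp: Basis_vec_def)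
 qed
 have "lborel = distr lborel borel ?S"
 proof (rule lborel_eqI)
  fix l u :: "real ^ 'n" assume le: "\<And>b. b \<in> Basis \<Longrightarrow> l \<bullet> b \<le> u \<bullet> b"
  have box: "?S -` box l u = box (?S l) (?S u)"
  proof (intro set_eqI iffI)
   fix x assume x: "x \<in> ?S -` box l u"
   have "l \<bullet> ?S b < ?S x \<bullet> ?S b" "?S x \<bullet> ?S b < u \<bullet> ?S b" if "b \<in> Basis" for b
    using x S_ax[OF that] by (auto simp: mem_box)
   then show "x \<in> box (?S l) (?S u)" by (auto simp: mem_box S_in)
  next
   fix x assume x: "x \<in> box (?S l) (?S u)"
   then have "?S l \<bullet> ?S b < x \<bullet> ?S b" "x \<bullet> ?S b < ?S u \<bullet> ?S b" if "b \<in> Basis" for b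
    using S_ax[OF that] by (auto simp: mem_box)
   then show "x \<in> ?S -` box l u" by (auto simp: mem_box S_in)
  qed
  have "emeasure (distr lborel borel ?S) (box l u) = emeasure lborel (box (?S l) (?S u))"
   by (subst emeasure_distr) (auto simp: box)
  also have "\<dots> = (\<Prod>b\<in>Basis. (?S u - ?S l) \<bullet> b)"
   by (rule emeasure_lborel_box) (auto simp: S_in intro: le S_ax)
  also have "(\<Prod>b\<in>Basis. (?S u - ?S l) \<bullet> b) = (\<Prod>b\<in>Basis. (u - l) \<bullet> b)"
   by (rule prod.reindex_bij_witness[of _ ?S ?S]) (auto simp: S_in S_ax inner_diff_left)
  finally show "emeasure (distr lborel borel ?S) (box l u) = (\<Prod>b\<in>Basis. (u - l) \<bullet> b)" .
 qed simp
 then have "(\<LL> x. h x) = (\<integral>\<^sup>+x. h x \<partial>distr lborel borel ?S)" by simp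
 then show ?thesis by (simp add: nn_integral_distr)
qed

text \<open>Induction over products of elementary matrices. In the form of an inequality the claim
  includes singular matrices, whose left side vanishes.\<close>

lemma nn_integral_lborel_linear_le:
 fixes A :: "real ^ 'n ^ 'n"
 assumes "h \<in> borel_measurable borel"
 shows "ennreal \<bar>det A\<bar> * (\<LL> x. h (A *v x)) \<le> (\<LL> x. h x)"
 using assms
proof (induction A arbitrary: h rule: induct_matrix_elementary_alt[case_names mult zero_row diagonal swap1 idplus])
 case (mult A B h)
 note [measurable] = mult(3)
 have [measurable]: "(\<lambda>x. A *v x) \<in> borel_measurable borel"
  by (intro borel_measurable_continuous_onI linear_continuous_on) (simp add: linear_conv_bounded_linear[symmetric])
 have "ennreal \<bar>det (A ** B)\<bar> * (\<LL> x. h ((A ** B) *v x))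
  = ennreal \<bar>det A\<bar> * (ennreal \<bar>det B\<bar> * (\<LL> x. h (A *v (B *v x))))"
  by (simp add: det_mul abs_mult ennreal_mult mult.assoc matrix_vector_mul_assoc)
 also have "\<dots> \<le> ennreal \<bar>det A\<bar> * (\<LL> x. h (A *v x))"
  by (intro mult_left_mono mult(2)) auto
 also have "\<dots> \<le> (\<LL> x. h x)" by (rule mult(1)) measurable
 finally show ?case .
next
 case (zero_row A i h)
 have "det A = 0" using zero_row(1) by (rule det_zero_row)
 then show ?case by simp
next
 case (diagonal A h)
 note [measurable] = diagonal(2)
 have d: "det A = (\<Prod>i\<in>UNIV. A $ i $ i)" using diagonal(1) by (rule det_diagonal)
 show ?case
 proof (cases "det A = 0")
  case False
  then have nz: "A $ i $ i \<noteq> 0" for i unfolding d by auto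
  \<comment> \<open>The scaling lemma wants a factor for each basis vector; on
    \<open>axis i 1\<close> this linear form is the diagonal entry.\<close>
  define c where "c j = (\<Sum>i\<in>UNIV. A $ i $ i * j $ i)" for j :: "real ^ 'n"
  have ax: "axis i (1 :: real) $ k = (if k = i then 1 else 0)" for i k :: 'n by (simp add: axis_def)
  have c_ax: "c (axis i 1) = A $ i $ i" for i by (simp add: c_def axis_def if_distrib cong: if_cong)
  have c0: "c j \<noteq> 0" if "j \<in> Basis" for j using that nz by (auto simp: Basis_vec_def c_ax)
  have A: "0 + (\<Sum>j\<in>Basis. (c j * (x \<bullet> j)) *\<^sub>R j) = A *v x" for x
  proof -
   have "(\<Sum>j\<in>Basis. (c j * (x \<bullet> j)) *\<^sub>R j) = (\<Sum>i\<in>UNIV. (c (axis i 1) * (x \<bullet> axis i 1)) *\<^sub>R axis i 1)"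
    unfolding Basis_vec_def by (simp add: UNION_singleton_eq_range sum.reindex inj_on_def axis_eq_axis)
   also have "\<dots> = A *v x"
   proof (rule vec_eq_iff[THEN iffD2], rule allI)
    fix k
    have "(A *v x) $ k = (\<Sum>j\<in>UNIV. if j = k then A $ k $ k * x $ k else 0)"
     unfolding matrix_vector_mult_def vec_lambda_beta by (rule sum.cong) (use diagonal(1) in auto)
    then show "(\<Sum>i\<in>UNIV. (c (axis i 1) * (x \<bullet> axis i 1)) *\<^sub>R axis i 1) $ k = (A *v x) $ k"
     by (simp add: c_ax inner_axis ax if_distrib cong: if_cong)
   qed
   finally show ?thesis by simp
  qed
  have prod: "(\<Prod>j\<in>Basis. \<bar>c j\<bar>) = \<bar>det A\<bar>"
   unfolding Basis_vec_def d by (simp add: UNION_singleton_eq_range prod.reindex inj_on_def axis_eq_axis c_ax abs_prod)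
  have [measurable]: "(\<lambda>x. A *v x) \<in> borel_measurable borel"
   by (intro borel_measurable_continuous_onI linear_continuous_on) (simp add: linear_conv_bounded_linear[symmetric])
  have "(\<LL> x. h x) = (\<integral>\<^sup>+x. h x \<partial>density (distr lborel borel ((*v) A)) (\<lambda>_. ennreal \<bar>det A\<bar>))"
   using lborel_affine_euclidean[of c 0, OF c0] unfolding A prod by simp
  also have "\<dots> = ennreal \<bar>det A\<bar> * (\<LL> x. h (A *v x))"
   by (simp add: nn_integral_density nn_integral_distr nn_integral_cmult)
  finally show ?thesis by simp
 qed simp
next
 case (swap1 m n h)
 let ?A = "\<chi> i j. mat 1 $ i $ Transposition.transpose m n j :: real ^ 'n ^ 'n"
 have "?A *v x = (\<chi> i. x $ Transposition.transpose m n i)" for x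
 proof (rule vec_eq_iff[THEN iffD2], rule allI)
  fix i
  let ?t = "Transposition.transpose m n"
  have t: "i = ?t j \<longleftrightarrow> j = ?t i" for j by (metis transpose_involutory)
  have "(?A *v x) $ i = (\<Sum>j\<in>UNIV. if j = ?t i then x $ ?t i else 0)"
   unfolding matrix_vector_mult_def vec_lambda_beta mat_def by (rule sum.cong) (simp_all add: t)
  then show "(?A *v x) $ i = (\<chi> i. x $ ?t i) $ i" by simp
 qed
 moreover have "\<bar>det ?A\<bar> = 1"
  by (subst det_permute_columns) (auto simp: permutes_swap_id sign_swap_id)
 ultimately show ?case using nn_integral_lborel_swap_coords[OF swap1(2), of m n] by simp
next
 case (idplus m n h)
 let ?A = "\<chi> i j. of_bool (i = m \<and> j = n \<or> i = j) :: real ^ 'n ^ 'n"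
 have A: "?A = (\<chi> k. if k = m then row m (mat 1) + 1 *s row n (mat 1) else row k (mat 1))"
  using idplus(1) by (auto simp: vec_eq_iff row_def mat_def)
 have "\<bar>det ?A\<bar> = 1" unfolding A det_row_operation[OF idplus(1), of "mat 1" 1] by simp
 moreover have "?A *v x = x + (x \<bullet> axis n 1) *\<^sub>R axis m 1" for x
 proof (rule vec_eq_iff[THEN iffD2], rule allI)
  fix k
  have "(?A *v x) $ k = (\<Sum>j\<in>UNIV. (if j = n then of_bool (k = m) * x $ n else 0) + (if j = k then x $ k else 0))"
   unfolding matrix_vector_mult_def vec_lambda_beta by (rule sum.cong) (use idplus(1) in auto)
  then show "(?A *v x) $ k = (x + (x \<bullet> axis n 1) *\<^sub>R axis m 1) $ k"
   by (simp add: sum.distrib inner_axis) (simp add: axis_def)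
 qed
 ultimately show ?case
  using nn_integral_lborel_shear[OF idplus(2), of "axis m 1" "axis n 1"] idplus(1) by (simp add: inner_axis_axis)
qed

section \<open>Gaussian integrals and powers of the plant matrix\<close>

lemma nn_integral_gauss_finite:
 "(\<LL> x. ennreal (exp (- (norm (x :: 'a::euclidean_space))\<^sup>2 / 2))) < top"
proof -
 have 1: "(\<LL> x. ennreal (exp (- x\<^sup>2 / 2))) < (top :: ennreal)"
 proof -
  have "emeasure N01 (space N01) = 1" by (rule prob_space.emeasure_space_1[OF prob_space_N01])
  then have "(\<LL> x. ennreal (std_normal_density x)) = 1" by (simp add: emeasure_density)
  moreover have "(\<LL> x. ennreal (exp (- x\<^sup>2 / 2))) = (\<LL> x. ennreal (sqrt (2 * pi)) * ennreal (std_normal_density x))"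
   by (rule nn_integral_cong) (simp add: ennreal_mult[symmetric] std_normal_density_def)
  ultimately show ?thesis by (simp add: nn_integral_cmult)
 qed
 have "(\<LL> x. ennreal (exp (- (norm (x :: 'a))\<^sup>2 / 2))) = (\<LL> x. (\<Prod>b\<in>Basis. ennreal (exp (- ((x :: 'a) \<bullet> b)\<^sup>2 / 2))))"
 proof (rule nn_integral_cong)
  fix x :: 'a
  have "- (norm x)\<^sup>2 / 2 = (\<Sum>b\<in>Basis. - (x \<bullet> b)\<^sup>2 / 2)"
   unfolding norm_eq_sqrt_inner euclidean_inner[of x x] real_sqrt_pow2[OF sum_nonneg]
   by (simp add: sum_nonneg power2_eq_square sum_negf sum_divide_distrib)
  then show "ennreal (exp (- (norm x)\<^sup>2 / 2)) = (\<Prod>b\<in>Basis. ennreal (exp (- (x \<bullet> b)\<^sup>2 / 2)))"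
   by (simp add: exp_sum prod_ennreal)
 qed
 also have "\<dots> = (\<Prod>b\<in>(Basis :: 'a set). (\<LL> x. ennreal (exp (- x\<^sup>2 / 2))))"
  by (rule nn_integral_lborel_prod) auto
 also have "\<dots> < top" using 1 by (simp add: power_less_top_ennreal)
 finally show ?thesis .
qed

primrec matpow :: "real ^ 'n ^ 'n \<Rightarrow> nat \<Rightarrow> real ^ 'n ^ 'n" where
 "matpow A 0 = mat 1"
| "matpow A (Suc k) = A ** matpow A k"

lemma det_matpow: "det (matpow A k) = det A ^ k"
 by (induction k) (auto simp: det_mul)

text \<open>The offset \<open>c\<close>, which will collect plant noise and control, is removed by
  translation; the bound is therefore uniform in it and loses \<open>\<bar>det A\<bar>\<close> at
  each power.\<close>

lemma gauss_matpow_le: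
 fixes A :: "real ^ 'n ^ 'n"
 assumes "det A \<noteq> 0"
 shows "(\<LL> x. ennreal (exp (- (norm (matpow A k *v x + c))\<^sup>2 / 2)))
  \<le> ennreal (enn2real (\<LL> x. ennreal (exp (- (norm (x :: real ^ 'n))\<^sup>2 / 2))) * exp (- (real k * ln \<bar>det A\<bar>)))"
proof -
 let ?I = "(\<LL> x. ennreal (exp (- (norm (matpow A k *v x + c))\<^sup>2 / 2)))"
 let ?C = "(\<LL> x. ennreal (exp (- (norm (x :: real ^ 'n))\<^sup>2 / 2)))"
 have "ennreal \<bar>det (matpow A k)\<bar> * ?I \<le> (\<LL> x. ennreal (exp (- (norm (x + c))\<^sup>2 / 2)))"
  by (rule nn_integral_lborel_linear_le) measurable
 also have "\<dots> = ?C" by (rule nn_integral_lborel_translate) measurable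
 finally have le: "ennreal (\<bar>det A\<bar> ^ k) * ?I \<le> ?C" by (simp add: det_matpow power_abs)
 have d: "exp (- (real k * ln \<bar>det A\<bar>)) * \<bar>det A\<bar> ^ k = 1"
  using assms by (simp add: exp_minus exp_of_nat_mult)
 have "?I = ennreal (exp (- (real k * ln \<bar>det A\<bar>))) * (ennreal (\<bar>det A\<bar> ^ k) * ?I)"
  unfolding mult.assoc[symmetric] by (subst ennreal_mult[symmetric]) (auto simp: d)
 also have "\<dots> \<le> ennreal (exp (- (real k * ln \<bar>det A\<bar>))) * ?C" by (intro mult_left_mono le) auto
 also have "\<dots> = ennreal (enn2real ?C * exp (- (real k * ln \<bar>det A\<bar>)))"
  using nn_integral_gauss_finite[where 'a="real ^ 'n"] by (simp add: ennreal_mult mult.commute)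
 finally show ?thesis .
qed

section \<open>The cascade network\<close>

context prob_space
begin

lemma pair_law_of_indep_rv:
 assumes "indep_rv S X T Y"
 shows "distr M (S \<Otimes>\<^sub>M T) (\<lambda>om. (X om, Y om)) = distr M S X \<Otimes>\<^sub>M distr M T Y"
proof -
 have [measurable]: "X \<in> measurable M S" "Y \<in> measurable M T" using assms by (auto simp: indep_rv_def)
 have ind: "indep_set {X -` E \<inter> space M | E. E \<in> sets S} {Y -` E \<inter> space M | E. E \<in> sets T}"
  using assms by (simp add: indep_rv_def)
 interpret X: prob_space "distr M S X" by (rule prob_space_distr) measurable
 interpret Y: prob_space "distr M T Y" by (rule prob_space_distr) measurable
 have "distr M S X \<Otimes>\<^sub>M distr M T Y = distr M (S \<Otimes>\<^sub>M T) (\<lambda>om. (X om, Y om))"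
 proof (rule pair_measure_eqI)
  fix E F assume "E \<in> sets (distr M S X)" "F \<in> sets (distr M T Y)"
  then have [measurable]: "E \<in> sets S" "F \<in> sets T" by auto
  have "prob ((X -` E \<inter> space M) \<inter> (Y -` F \<inter> space M)) = prob (X -` E \<inter> space M) * prob (Y -` F \<inter> space M)"
   by (rule indep_setD[OF ind]) auto
  moreover have "(X -` E \<inter> space M) \<inter> (Y -` F \<inter> space M) = (\<lambda>om. (X om, Y om)) -` (E \<times> F) \<inter> space M" by auto
  ultimately show "emeasure (distr M S X) E * emeasure (distr M T Y) F = emeasure (distr M (S \<Otimes>\<^sub>M T) (\<lambda>om. (X om, Y om))) (E \<times> F)"
   by (simp add: emeasure_distr emeasure_eq_measure ennreal_mult)
 qed (auto intro: X.sigma_finite_measure_axioms Y.sigma_finite_measure_axioms)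
 then show ?thesis ..
qed

lemma nn_integral_pair_law:
 assumes law: "distr M (S \<Otimes>\<^sub>M T) (\<lambda>om. (X om, Y om)) = distr M S X \<Otimes>\<^sub>M distr M T Y"
  and [measurable]: "X \<in> measurable M S" "Y \<in> measurable M T" "F \<in> borel_measurable (S \<Otimes>\<^sub>M T)"
 shows "(\<integral>\<^sup>+om. F (X om, Y om) \<partial>M) = (\<integral>\<^sup>+x. \<integral>\<^sup>+om. F (x, Y om) \<partial>M \<partial>distr M S X)"
proof -
 interpret Y: prob_space "distr M T Y" by (rule prob_space_distr) measurable
 have "(\<integral>\<^sup>+om. F (X om, Y om) \<partial>M) = (\<integral>\<^sup>+z. F z \<partial>(distr M S X \<Otimes>\<^sub>M distr M T Y))"
  unfolding law[symmetric] by (subst nn_integral_distr) auto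
 also have "\<dots> = (\<integral>\<^sup>+x. \<integral>\<^sup>+y. F (x, y) \<partial>distr M T Y \<partial>distr M S X)"
  by (subst Y.nn_integral_fst[symmetric]) auto
 also have "\<dots> = (\<integral>\<^sup>+x. \<integral>\<^sup>+om. F (x, Y om) \<partial>M \<partial>distr M S X)"
 proof (rule nn_integral_cong)
  fix x assume "x \<in> space (distr M S X)"
  then have [measurable]: "x \<in> space S" by simp
  show "(\<integral>\<^sup>+y. F (x, y) \<partial>distr M T Y) = (\<integral>\<^sup>+om. F (x, Y om) \<partial>M)"
   by (subst nn_integral_distr) auto
 qed
 finally show ?thesis .
qed

lemma noise_law:
 assumes zi: "indep_vars (\<lambda>_. borel) Z I" and I: "I \<noteq> {}"
  and c: "\<And>p. p \<in> I \<Longrightarrow> distr M borel (\<lambda>om. Z p om / c p) = N01"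
  and va: "inj va" "range va \<subseteq> I"
 shows "distr M sq (\<lambda>om n. Z (va n) om / c (va n)) = gseq"
proof -
 have zc: "indep_vars (\<lambda>_. borel) (\<lambda>p om. Z p om / c p) I"
  by (rule indep_vars_compose2[OF zi]) measurable
 have m: "(\<lambda>om. Z p om / c p) \<in> borel_measurable M" if "p \<in> I" for p
  using zc that by (auto simp: indep_vars_def)
 have law: "distr M (Pi\<^sub>M I (\<lambda>_. borel)) (\<lambda>om. \<lambda>p\<in>I. Z p om / c p) = Pi\<^sub>M I (\<lambda>_. N01)"
 proof -
  have "distr M (Pi\<^sub>M I (\<lambda>_. borel)) (\<lambda>om. \<lambda>p\<in>I. Z p om / c p) = Pi\<^sub>M I (\<lambda>p. distr M borel (\<lambda>om. Z p om / c p))"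
   using indep_vars_iff_distr_eq_PiM'[where M'="\<lambda>_. borel" and X="\<lambda>p om. Z p om / c p", OF I m] zc by blast
  also have "\<dots> = Pi\<^sub>M I (\<lambda>_. N01)" by (rule PiM_cong) (use c in auto)
  finally show ?thesis .
 qed
 have "distr M sq (\<lambda>om n. Z (va n) om / c (va n))
  = distr (distr M (Pi\<^sub>M I (\<lambda>_. borel)) (\<lambda>om. \<lambda>p\<in>I. Z p om / c p)) sq (\<lambda>z. \<lambda>n\<in>UNIV. z (va n))"
 proof (subst distr_distr)
  show "(\<lambda>z. \<lambda>n\<in>UNIV. z (va n)) \<in> measurable (Pi\<^sub>M I (\<lambda>_. borel)) sq"
   using va by (intro measurable_restrict measurable_component_singleton) auto
  show "(\<lambda>om. \<lambda>p\<in>I. Z p om / c p) \<in> measurable M (Pi\<^sub>M I (\<lambda>_. borel))"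
   by (rule measurable_restrict) (rule m)
  show "distr M sq (\<lambda>om n. Z (va n) om / c (va n)) = distr M sq ((\<lambda>z. \<lambda>n\<in>UNIV. z (va n)) \<circ> (\<lambda>om. \<lambda>p\<in>I. Z p om / c p))"
   by (rule distr_cong) (use va in \<open>auto simp: fun_eq_iff\<close>)
 qed
 also have "\<dots> = distr (Pi\<^sub>M I (\<lambda>_. N01)) (Pi\<^sub>M UNIV (\<lambda>_. N01)) (\<lambda>z. \<lambda>n\<in>UNIV. z (va n))"
  unfolding law by (rule distr_cong) (auto intro!: sets_PiM_cong)
 also have "\<dots> = gseq"
  unfolding gseq_def by (rule distr_PiM_reindex) (use va prob_space_N01 in auto)
 finally show ?thesis .
qed

text \<open>Channel uses are split into those at \<open>va\<close>, those at \<open>zb\<close> and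
  the rest \<open>u\<close>. Independence is unpacked in layers: plant data against all channel
  noise, \<open>x\<close> against \<open>w\<close>, and the three groups of channel noise among
  themselves. Dividing by \<open>c\<close> makes the two selected groups standard white
  noise.\<close>

lemma joint_law:
 fixes x :: "'a \<Rightarrow> 'x" and w :: "'a \<Rightarrow> 'v" and Z :: "'i \<Rightarrow> 'a \<Rightarrow> real" and I :: "'i set" and va zb :: "nat \<Rightarrow> 'i"
  and c :: "'i \<Rightarrow> real" and SX :: "'x measure" and SW :: "'v measure"
 defines "J \<equiv> I - (range va \<union> range zb)"
 defines "u \<equiv> \<lambda>om. \<lambda>p\<in>J. Z p om" and "V \<equiv> \<lambda>om n. Z (va n) om / c (va n)" and "Y \<equiv> \<lambda>om n. Z (zb n) om / c (zb n)"
 defines "H \<equiv> distr M SW w \<Otimes>\<^sub>M distr M (Pi\<^sub>M J (\<lambda>_. borel)) u"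
 assumes xw: "indep_rv SX x SW w"
  and xwz: "indep_rv (SX \<Otimes>\<^sub>M SW) (\<lambda>om. (x om, w om)) (Pi\<^sub>M I (\<lambda>_. borel)) (\<lambda>om. \<lambda>p\<in>I. Z p om)"
  and zi: "indep_vars (\<lambda>_. borel) Z I"
  and c: "\<And>p. p \<in> I \<Longrightarrow> distr M borel (\<lambda>om. Z p om / c p) = N01"
  and va: "inj va" "range va \<subseteq> I" and zb: "inj zb" "range zb \<subseteq> I" and disj: "range va \<inter> range zb = {}"
 shows "distr M ((distr M SX x \<Otimes>\<^sub>M H) \<Otimes>\<^sub>M gseq \<Otimes>\<^sub>M gseq) (\<lambda>om. ((x om, (w om, u om)), V om, Y om))
  = (distr M SX x \<Otimes>\<^sub>M H) \<Otimes>\<^sub>M gseq \<Otimes>\<^sub>M gseq"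
  and "prob_space H" and "(\<lambda>om. (w om, u om)) \<in> measurable M H" "V \<in> measurable M sq" "Y \<in> measurable M sq"
  "sets H = sets (SW \<Otimes>\<^sub>M Pi\<^sub>M J (\<lambda>_. borel))"
proof -
 have I: "I \<noteq> {}" using va by auto
 have xm [measurable]: "x \<in> measurable M SX" and wm [measurable]: "w \<in> measurable M SW" using xw by (auto simp: indep_rv_def)
 have Zm: "Z p \<in> borel_measurable M" if "p \<in> I" for p using zi that by (auto simp: indep_vars_def)
 have R_m [measurable]: "(\<lambda>om. \<lambda>p\<in>K. Z p om) \<in> measurable M (Pi\<^sub>M K (\<lambda>_. borel))" if "K \<subseteq> I" for K
  by (rule measurable_restrict) (use that Zm in auto)
 have JI: "J \<subseteq> I" by (auto simp: J_def)
 have um [measurable]: "u \<in> measurable M (Pi\<^sub>M J (\<lambda>_. borel))" unfolding u_def by (rule R_m[OF JI])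
 show V_m [measurable]: "V \<in> measurable M sq" and Y_m [measurable]: "Y \<in> measurable M sq"
  unfolding V_def Y_def by (rule measurable_sqI, rule borel_measurable_divide, rule Zm, use va zb in auto)+
 interpret Hw: prob_space "distr M SW w" by (rule prob_space_distr) measurable
 interpret Hu: prob_space "distr M (Pi\<^sub>M J (\<lambda>_. borel)) u" by (rule prob_space_distr) measurable
 interpret Hx: prob_space "distr M SX x" by (rule prob_space_distr) measurable
 interpret P: pair_prob_space "distr M SW w" "distr M (Pi\<^sub>M J (\<lambda>_. borel)) u" by unfold_locales
 show H: "prob_space H" unfolding H_def by (rule P.P.prob_space_axioms)
 then interpret H: prob_space H .
 interpret G: prob_space gseq by (rule prob_space_gseq)
 interpret XH: pair_prob_space "distr M SX x" H by unfold_locales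
 interpret GG: pair_prob_space gseq gseq by unfold_locales
 show sets_H [measurable_cong]: "sets H = sets (SW \<Otimes>\<^sub>M Pi\<^sub>M J (\<lambda>_. borel))"
  unfolding H_def by (intro sets_pair_measure_cong) auto
 then show wu_m [measurable]: "(\<lambda>om. (w om, u om)) \<in> measurable M H" by (simp cong: measurable_cong_sets)
 let ?T = "(SX \<Otimes>\<^sub>M (SW \<Otimes>\<^sub>M Pi\<^sub>M J (\<lambda>_. borel))) \<Otimes>\<^sub>M sq \<Otimes>\<^sub>M sq"
 let ?R = "(distr M SX x \<Otimes>\<^sub>M H) \<Otimes>\<^sub>M gseq \<Otimes>\<^sub>M gseq"
 have sets_R [measurable_cong]: "sets ?R = sets ?T"
  by (intro sets_pair_measure_cong) (auto simp: sets_H)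
 have rV: "(\<lambda>z. \<lambda>n. z (va n) / c (va n)) \<in> measurable (Pi\<^sub>M K (\<lambda>_. borel)) sq" if "range va \<subseteq> K" for K
  by (rule measurable_sqI, rule borel_measurable_divide, rule measurable_component_singleton) (use that in auto)
 have rY: "(\<lambda>z. \<lambda>n. z (zb n) / c (zb n)) \<in> measurable (Pi\<^sub>M K (\<lambda>_. borel)) sq" if "range zb \<subseteq> K" for K
  by (rule measurable_sqI, rule borel_measurable_divide, rule measurable_component_singleton) (use that in auto)
 have split: "distr M (Pi\<^sub>M K1 (\<lambda>_. borel) \<Otimes>\<^sub>M Pi\<^sub>M K2 (\<lambda>_. borel)) (\<lambda>om. (\<lambda>p\<in>K1. Z p om, \<lambda>p\<in>K2. Z p om))
   = distr M (Pi\<^sub>M K1 (\<lambda>_. borel)) (\<lambda>om. \<lambda>p\<in>K1. Z p om) \<Otimes>\<^sub>M distr M (Pi\<^sub>M K2 (\<lambda>_. borel)) (\<lambda>om. \<lambda>p\<in>K2. Z p om)"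
  if "K1 \<subseteq> I" "K2 \<subseteq> I" "K1 \<inter> K2 = {}" for K1 K2
  using indep_var_restrict[OF zi that(3,1,2)] by (simp add: indep_var_distribution_eq)
 have Y_law: "(\<integral>\<^sup>+om. F (Y om) \<partial>M) = (\<GG> z. F z)" if [measurable]: "F \<in> borel_measurable sq" for F
 proof -
  have g: "distr M sq Y = gseq" unfolding Y_def by (rule noise_law[OF zi I c zb])
  have "(\<integral>\<^sup>+z. F z \<partial>distr M sq Y) = (\<integral>\<^sup>+om. F (Y om) \<partial>M)" by (rule nn_integral_distr) measurable
  then show ?thesis by (simp only: g)
 qed
 have V_law: "(\<integral>\<^sup>+om. F (V om) \<partial>M) = (\<GG> z. F z)" if [measurable]: "F \<in> borel_measurable sq" for F
 proof -
  have g: "distr M sq V = gseq" unfolding V_def by (rule noise_law[OF zi I c va])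
  have "(\<integral>\<^sup>+z. F z \<partial>distr M sq V) = (\<integral>\<^sup>+om. F (V om) \<partial>M)" by (rule nn_integral_distr) measurable
  then show ?thesis by (simp only: g)
 qed
 have law_VY: "(\<integral>\<^sup>+om. F (V om, Y om) \<partial>M) = (\<GG> v. \<GG> z. F (v, z))"
  if [measurable]: "F \<in> borel_measurable (sq \<Otimes>\<^sub>M sq)" for F
 proof -
  let ?K = "range va" and ?K2 = "range zb"
  let ?G = "\<lambda>(r, r'). F (\<lambda>n. r (va n) / c (va n), \<lambda>n. r' (zb n) / c (zb n))"
  have G_m: "?G \<in> borel_measurable (Pi\<^sub>M ?K (\<lambda>_. borel) \<Otimes>\<^sub>M Pi\<^sub>M ?K2 (\<lambda>_. borel))"
   unfolding split_beta'
   by (rule measurable_compose[OF measurable_Pair[OF measurable_compose[OF measurable_fst rV] measurable_compose[OF measurable_snd rY]]]) auto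
  have "(\<integral>\<^sup>+om. F (V om, Y om) \<partial>M) = (\<integral>\<^sup>+om. ?G (\<lambda>p\<in>?K. Z p om, \<lambda>p\<in>?K2. Z p om) \<partial>M)"
   by (simp add: V_def Y_def)
  also have "\<dots> = (\<integral>\<^sup>+r. \<integral>\<^sup>+om. ?G (r, \<lambda>p\<in>?K2. Z p om) \<partial>M \<partial>distr M (Pi\<^sub>M ?K (\<lambda>_. borel)) (\<lambda>om. \<lambda>p\<in>?K. Z p om))"
   by (rule nn_integral_pair_law[OF split[OF va(2) zb(2) disj] R_m[OF va(2)] R_m[OF zb(2)] G_m])
  also have "\<dots> = (\<integral>\<^sup>+r. (\<GG> z. F (\<lambda>n. r (va n) / c (va n), z)) \<partial>distr M (Pi\<^sub>M ?K (\<lambda>_. borel)) (\<lambda>om. \<lambda>p\<in>?K. Z p om))"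
  proof (rule nn_integral_cong)
   fix r assume "r \<in> space (distr M (Pi\<^sub>M ?K (\<lambda>_. borel)) (\<lambda>om. \<lambda>p\<in>?K. Z p om))"
   have [measurable]: "(\<lambda>n. r (va n) / c (va n)) \<in> space sq" by simp
   show "(\<integral>\<^sup>+om. ?G (r, \<lambda>p\<in>?K2. Z p om) \<partial>M) = (\<GG> z. F (\<lambda>n. r (va n) / c (va n), z))"
    using Y_law[of "\<lambda>z. F (\<lambda>n. r (va n) / c (va n), z)"] by (simp add: Y_def)
  qed
  also have "\<dots> = (\<integral>\<^sup>+om. (\<GG> z. F (\<lambda>n. (\<lambda>p\<in>?K. Z p om) (va n) / c (va n), z)) \<partial>M)"
  proof (rule nn_integral_distr)
   show "(\<lambda>r. (\<GG> z. F (\<lambda>n. r (va n) / c (va n), z))) \<in> borel_measurable (distr M (Pi\<^sub>M ?K (\<lambda>_. borel)) (\<lambda>om. \<lambda>p\<in>?K. Z p om))"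
    unfolding measurable_distr_eq1
    by (rule measurable_compose[OF rV[OF order_refl], of "\<lambda>v. (\<GG> z. F (v, z))"]) measurable
  qed (rule R_m[OF va(2)])
  also have "\<dots> = (\<integral>\<^sup>+om. (\<GG> z. F (V om, z)) \<partial>M)" by (simp add: V_def)
  also have "\<dots> = (\<GG> v. \<GG> z. F (v, z))"
   by (rule V_law[of "\<lambda>v. (\<GG> z. F (v, z))"]) measurable
  finally show ?thesis .
 qed
 have law_uVY: "(\<integral>\<^sup>+om. F (u om, V om, Y om) \<partial>M) = (\<integral>\<^sup>+r. (\<GG> v. \<GG> z. F (r, v, z)) \<partial>distr M (Pi\<^sub>M J (\<lambda>_. borel)) u)"
  if [measurable]: "F \<in> borel_measurable (Pi\<^sub>M J (\<lambda>_. borel) \<Otimes>\<^sub>M sq \<Otimes>\<^sub>M sq)" for F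
 proof -
  let ?K = "range va \<union> range zb"
  let ?G = "\<lambda>(r, r'). F (r, \<lambda>n. r' (va n) / c (va n), \<lambda>n. r' (zb n) / c (zb n))"
  have K: "?K \<subseteq> I" "J \<inter> ?K = {}" using va zb by (auto simp: J_def)
  have G_m: "?G \<in> borel_measurable (Pi\<^sub>M J (\<lambda>_. borel) \<Otimes>\<^sub>M Pi\<^sub>M ?K (\<lambda>_. borel))"
   unfolding split_beta'
   by (rule measurable_compose[OF measurable_Pair[OF measurable_fst measurable_Pair[OF measurable_compose[OF measurable_snd rV] measurable_compose[OF measurable_snd rY]]]]) auto
  have "(\<integral>\<^sup>+om. F (u om, V om, Y om) \<partial>M) = (\<integral>\<^sup>+om. ?G (u om, \<lambda>p\<in>?K. Z p om) \<partial>M)"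
   by (simp add: V_def Y_def)
  also have "\<dots> = (\<integral>\<^sup>+r. \<integral>\<^sup>+om. ?G (r, \<lambda>p\<in>?K. Z p om) \<partial>M \<partial>distr M (Pi\<^sub>M J (\<lambda>_. borel)) u)"
   unfolding u_def by (rule nn_integral_pair_law[OF split[OF JI K] R_m[OF JI] R_m[OF K(1)] G_m])
  also have "\<dots> = (\<integral>\<^sup>+r. (\<GG> v. \<GG> z. F (r, v, z)) \<partial>distr M (Pi\<^sub>M J (\<lambda>_. borel)) u)"
  proof (rule nn_integral_cong)
   fix r assume "r \<in> space (distr M (Pi\<^sub>M J (\<lambda>_. borel)) u)"
   then have [measurable]: "r \<in> space (Pi\<^sub>M J (\<lambda>_. borel))" by simp
   show "(\<integral>\<^sup>+om. ?G (r, \<lambda>p\<in>?K. Z p om) \<partial>M) = (\<GG> v. \<GG> z. F (r, v, z))"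
    using law_VY[of "\<lambda>q. F (r, q)"] by (simp add: V_def Y_def)
  qed
  finally show ?thesis .
 qed
 have law_all: "(\<integral>\<^sup>+om. F ((x om, (w om, u om)), V om, Y om) \<partial>M)
  = (\<integral>\<^sup>+a. \<integral>\<^sup>+b. \<integral>\<^sup>+r. (\<GG> v. \<GG> z. F ((a, (b, r)), v, z)) \<partial>distr M (Pi\<^sub>M J (\<lambda>_. borel)) u \<partial>distr M SW w \<partial>distr M SX x)"
  if F [measurable]: "F \<in> borel_measurable ?T" for F
 proof -
  let ?G = "\<lambda>((a, b), r). F ((a, (b, \<lambda>p\<in>J. r p)), \<lambda>n. r (va n) / c (va n), \<lambda>n. r (zb n) / c (zb n))"
  have rJ: "(\<lambda>r. \<lambda>p\<in>J. r p) \<in> measurable (Pi\<^sub>M I (\<lambda>_. borel)) (Pi\<^sub>M J (\<lambda>_. borel))"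
   by (rule measurable_restrict_subset[OF JI])
  note [measurable] = rJ rV[OF va(2)] rY[OF zb(2)]
  have G_m: "?G \<in> borel_measurable ((SX \<Otimes>\<^sub>M SW) \<Otimes>\<^sub>M Pi\<^sub>M I (\<lambda>_. borel))"
   unfolding split_beta'
   by (rule measurable_compose[OF _ F])
    (intro measurable_Pair measurable_compose[OF measurable_snd rJ] measurable_compose[OF measurable_snd rV[OF va(2)]] measurable_compose[OF measurable_snd rY[OF zb(2)]]; measurable)
  let ?U = "\<lambda>a b. \<integral>\<^sup>+r. (\<GG> v. \<GG> z. F ((a, (b, r)), v, z)) \<partial>distr M (Pi\<^sub>M J (\<lambda>_. borel)) u"
  have U_m [measurable]: "(\<lambda>(a, b). ?U a b) \<in> borel_measurable (SX \<Otimes>\<^sub>M SW)"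
   by measurable
  have "(\<integral>\<^sup>+om. F ((x om, (w om, u om)), V om, Y om) \<partial>M) = (\<integral>\<^sup>+om. ?G ((x om, w om), \<lambda>p\<in>I. Z p om) \<partial>M)"
  proof (rule nn_integral_cong)
   fix om
   have "u om = (\<lambda>p\<in>J. (\<lambda>p\<in>I. Z p om) p)" using JI by (auto simp: u_def fun_eq_iff)
   moreover have "V om = (\<lambda>n. (\<lambda>p\<in>I. Z p om) (va n) / c (va n))" "Y om = (\<lambda>n. (\<lambda>p\<in>I. Z p om) (zb n) / c (zb n))"
    using va zb by (auto simp: V_def Y_def fun_eq_iff)
   ultimately show "F ((x om, (w om, u om)), V om, Y om) = ?G ((x om, w om), \<lambda>p\<in>I. Z p om)" by (simp only: prod.case)
  qed
  also have "\<dots> = (\<integral>\<^sup>+q. \<integral>\<^sup>+om. ?G (q, \<lambda>p\<in>I. Z p om) \<partial>M \<partial>distr M (SX \<Otimes>\<^sub>M SW) (\<lambda>om. (x om, w om)))"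
   by (rule nn_integral_pair_law[OF pair_law_of_indep_rv[OF xwz] _ R_m[OF order_refl] G_m]) measurable
  also have "\<dots> = (\<integral>\<^sup>+q. (\<lambda>(a, b). ?U a b) q \<partial>distr M (SX \<Otimes>\<^sub>M SW) (\<lambda>om. (x om, w om)))"
  proof (rule nn_integral_cong)
   fix q assume "q \<in> space (distr M (SX \<Otimes>\<^sub>M SW) (\<lambda>om. (x om, w om)))"
   then obtain a b where q: "q = (a, b)" and [measurable]: "a \<in> space SX" "b \<in> space SW" by (auto simp: space_pair_measure)
   have "(\<integral>\<^sup>+om. ?G (q, \<lambda>p\<in>I. Z p om) \<partial>M) = (\<integral>\<^sup>+om. (\<lambda>(r, v, z). F ((a, (b, r)), v, z)) (u om, V om, Y om) \<partial>M)"
   proof (rule nn_integral_cong)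
    fix om
    have "u om = (\<lambda>p\<in>J. (\<lambda>p\<in>I. Z p om) p)" using JI by (auto simp: u_def fun_eq_iff)
    moreover have "V om = (\<lambda>n. (\<lambda>p\<in>I. Z p om) (va n) / c (va n))" "Y om = (\<lambda>n. (\<lambda>p\<in>I. Z p om) (zb n) / c (zb n))"
     using va zb by (auto simp: V_def Y_def fun_eq_iff)
    ultimately show "?G (q, \<lambda>p\<in>I. Z p om) = (\<lambda>(r, v, z). F ((a, (b, r)), v, z)) (u om, V om, Y om)" by (simp only: prod.case q)
   qed
   also have "\<dots> = ?U a b"
   proof -
    have m: "(\<lambda>(r, v, z). F ((a, (b, r)), v, z)) \<in> borel_measurable (Pi\<^sub>M J (\<lambda>_. borel) \<Otimes>\<^sub>M sq \<Otimes>\<^sub>M sq)"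
     unfolding split_beta' by (rule measurable_compose[OF _ F]) measurable
    show ?thesis using law_uVY[OF m] by simp
   qed
   finally show "(\<integral>\<^sup>+om. ?G (q, \<lambda>p\<in>I. Z p om) \<partial>M) = (\<lambda>(a, b). ?U a b) q" by (simp add: q)
  qed
  also have "\<dots> = (\<integral>\<^sup>+om. (\<lambda>(a, b). ?U a b) (x om, w om) \<partial>M)"
   by (rule nn_integral_distr) measurable
  also have "\<dots> = (\<integral>\<^sup>+a. \<integral>\<^sup>+om. (\<lambda>(a, b). ?U a b) (a, w om) \<partial>M \<partial>distr M SX x)"
   by (rule nn_integral_pair_law[OF pair_law_of_indep_rv[OF xw] xm wm U_m])
  also have "\<dots> = (\<integral>\<^sup>+a. \<integral>\<^sup>+b. ?U a b \<partial>distr M SW w \<partial>distr M SX x)"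
  proof (rule nn_integral_cong)
   fix a assume "a \<in> space (distr M SX x)"
   then have [measurable]: "a \<in> space SX" by simp
   have "(\<lambda>b. (\<lambda>(a, b). ?U a b) (a, b)) \<in> borel_measurable (distr M SW w)"
    unfolding measurable_distr_eq1 by (rule measurable_compose[OF _ U_m]) measurable
   from nn_integral_distr[OF wm this]
   show "(\<integral>\<^sup>+om. (\<lambda>(a, b). ?U a b) (a, w om) \<partial>M) = (\<integral>\<^sup>+b. ?U a b \<partial>distr M SW w)" by simp
  qed
  finally show ?thesis .
 qed
 show "distr M ?R (\<lambda>om. ((x om, (w om, u om)), V om, Y om)) = ?R"
 proof (rule measure_eqI)
  fix E assume "E \<in> sets (distr M ?R (\<lambda>om. ((x om, (w om, u om)), V om, Y om)))"
  then have E: "E \<in> sets ?R" by simp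
  then have Em [measurable]: "E \<in> sets ?T" by (simp only: sets_R)
  have ind [measurable]: "(indicator E :: _ \<Rightarrow> ennreal) \<in> borel_measurable ?T" by measurable
  have all_m: "(\<lambda>om. ((x om, (w om, u om)), V om, Y om)) \<in> measurable M ?R"
   unfolding measurable_cong_sets[OF refl sets_R] by measurable
  have "emeasure (distr M ?R (\<lambda>om. ((x om, (w om, u om)), V om, Y om))) E = (\<integral>\<^sup>+om. indicator E ((x om, (w om, u om)), V om, Y om) \<partial>M)"
  proof -
   have "emeasure (distr M ?R (\<lambda>om. ((x om, (w om, u om)), V om, Y om))) E = (\<integral>\<^sup>+q. indicator E q \<partial>distr M ?R (\<lambda>om. ((x om, (w om, u om)), V om, Y om)))"
    using E by simp
   also have "\<dots> = (\<integral>\<^sup>+om. indicator E ((x om, (w om, u om)), V om, Y om) \<partial>M)"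
    by (rule nn_integral_distr[OF all_m]) (use E in simp)
   finally show ?thesis .
  qed
  also have "\<dots> = (\<integral>\<^sup>+a. \<integral>\<^sup>+b. \<integral>\<^sup>+r. (\<GG> v. \<GG> z. indicator E ((a, (b, r)), v, z)) \<partial>distr M (Pi\<^sub>M J (\<lambda>_. borel)) u \<partial>distr M SW w \<partial>distr M SX x)"
   by (rule law_all) measurable
  also have "\<dots> = (\<integral>\<^sup>+a. \<integral>\<^sup>+h. (\<GG> v. \<GG> z. indicator E ((a, h), v, z)) \<partial>H \<partial>distr M SX x)"
  proof (rule nn_integral_cong)
   fix a assume "a \<in> space (distr M SX x)"
   then have [measurable]: "a \<in> space SX" by simp
   have "(\<lambda>h. (\<GG> v. \<GG> z. indicator E ((a, h), v, z))) \<in> borel_measurable (distr M SW w \<Otimes>\<^sub>M distr M (Pi\<^sub>M J (\<lambda>_. borel)) u)"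
    by measurable
   from Hu.nn_integral_fst[OF this]
   show "(\<integral>\<^sup>+b. \<integral>\<^sup>+r. (\<GG> v. \<GG> z. indicator E ((a, (b, r)), v, z)) \<partial>distr M (Pi\<^sub>M J (\<lambda>_. borel)) u \<partial>distr M SW w)
    = (\<integral>\<^sup>+h. (\<GG> v. \<GG> z. indicator E ((a, h), v, z)) \<partial>H)"
    unfolding H_def .
  qed
  also have "\<dots> = (\<integral>\<^sup>+q. (\<GG> v. \<GG> z. indicator E (q, v, z)) \<partial>(distr M SX x \<Otimes>\<^sub>M H))"
   by (rule H.nn_integral_fst) measurable
  also have "\<dots> = (\<integral>\<^sup>+q. \<integral>\<^sup>+g. indicator E (q, g) \<partial>(gseq \<Otimes>\<^sub>M gseq) \<partial>(distr M SX x \<Otimes>\<^sub>M H))"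
  proof (rule nn_integral_cong)
   fix q assume "q \<in> space (distr M SX x \<Otimes>\<^sub>M H)"
   then have [measurable]: "q \<in> space (SX \<Otimes>\<^sub>M (SW \<Otimes>\<^sub>M Pi\<^sub>M J (\<lambda>_. borel)))"
    by (auto simp: space_pair_measure H_def)
   have "(\<lambda>g. indicator E (q, g) :: ennreal) \<in> borel_measurable (gseq \<Otimes>\<^sub>M gseq)" by measurable
   from G.nn_integral_fst[OF this]
   show "(\<GG> v. \<GG> z. indicator E (q, v, z)) = (\<integral>\<^sup>+g. indicator E (q, g) \<partial>(gseq \<Otimes>\<^sub>M gseq))" .
  qed
  also have "\<dots> = (\<integral>\<^sup>+q. indicator E q \<partial>?R)"
   by (rule GG.P.nn_integral_fst) (use E in simp)
  also have "\<dots> = emeasure ?R E" using E by simp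
  finally show "emeasure (distr M ?R (\<lambda>om. ((x om, (w om, u om)), V om, Y om))) E = emeasure ?R E" .
 qed simp
qed

end

section \<open>Network signals as functions of noises and cut signals\<close>

context cascade_loop
begin

definition uo :: "(nat \<Rightarrow> real) \<Rightarrow> nat \<Rightarrow> real ^ 'm" where
 "uo r t = ctrl t (\<lambda>s\<in>{..t}. r s)"

text \<open>The state as a function of initial state, plant noise and an arbitrary received signal
  \<open>r\<close>; leaving \<open>r\<close> free is what allows the loop to be cut.\<close>

primrec xo :: "real ^ 'n \<Rightarrow> (nat \<Rightarrow> real ^ 'n) \<Rightarrow> (nat \<Rightarrow> real) \<Rightarrow> nat \<Rightarrow> real ^ 'n" where
 "xo x w r 0 = x"
| "xo x w r (Suc t) = A *v xo x w r t + B *v uo r t + w t"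

definition enc :: "real ^ 'n \<Rightarrow> (nat \<Rightarrow> real ^ 'n) \<Rightarrow> (nat \<Rightarrow> real) \<Rightarrow> nat \<Rightarrow> real" where
 "enc x w r n = f (1 + n * L) (\<lambda>s\<in>{..1 + n * L}. xo x w r s, \<lambda>s\<in>{..<1 + n * L}. uo r s)"

text \<open>Time \<open>n * L + i\<close> is the \<open>n\<close>-th use of hop \<open>i\<close>.
  Signals are re-indexed by such rounds, and \<open>hist\<close> restores the input history that a
  relay policy expects, with 0 at idle times.\<close>

definition hist :: "nat \<Rightarrow> (nat \<Rightarrow> real) \<Rightarrow> nat \<Rightarrow> real" where
 "hist i q s = (if \<exists>n. s = n * L + i then q ((s - i) div L) else 0)"

definition rel :: "nat \<Rightarrow> (nat \<Rightarrow> real) \<Rightarrow> nat \<Rightarrow> real" where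
 "rel i q n = g i (1 + i + n * L) (\<lambda>s\<in>{..1 + i + n * L}. hist i q s)"

text \<open>\<open>chain s0 i z d\<close> is the signal sent over hop \<open>i + d\<close> when \<open>s0\<close> is sent over hop \<open>i\<close>.\<close>

primrec chain :: "(nat \<Rightarrow> real) \<Rightarrow> nat \<Rightarrow> (nat \<times> nat \<Rightarrow> real) \<Rightarrow> nat \<Rightarrow> nat \<Rightarrow> real" where
 "chain s0 i z 0 = s0"
| "chain s0 i z (Suc d) = rel (i + d) (\<lambda>n. chain s0 i z d n + z (i + d, n * L + (i + d)))"

lemma L_pos: "0 < L"
 using hops by simp

lemma uo_cong: "(\<And>s. s \<le> t \<Longrightarrow> r s = r' s) \<Longrightarrow> uo r t = uo r' t"
 unfolding uo_def by (rule arg_cong[where f="ctrl t"]) (auto simp: restrict_def)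

lemma xo_cong: "(\<And>s. s < t \<Longrightarrow> r s = r' s) \<Longrightarrow> xo x w r t = xo x w r' t"
proof (induction t)
 case (Suc t)
 have "uo r t = uo r' t" using Suc.prems by (intro uo_cong) auto
 moreover have "xo x w r t = xo x w r' t" using Suc.prems by (intro Suc.IH) auto
 ultimately show ?case by simp
qed simp

text \<open>In round \<open>n\<close> the encoder acts at time \<open>1 + n * L\<close>, and the
  state at that time depends on received values up to time \<open>n * L\<close> only.\<close>

lemma enc_cong:
 assumes "\<And>s. s \<le> n * L \<Longrightarrow> r s = r' s"
 shows "enc x w r n = enc x w r' n"
proof -
 have "xo x w r s = xo x w r' s" if "s \<le> 1 + n * L" for s using that assms by (intro xo_cong) auto
 moreover have "uo r s = uo r' s" if "s < 1 + n * L" for s using that assms by (intro uo_cong) auto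
 ultimately show ?thesis unfolding enc_def
  by (intro arg_cong[where f="f (1 + n * L)"] prod_eqI) (auto simp: restrict_def)
qed

lemma hist_at: "hist i q (n * L + i) = q n"
 using L_pos by (auto simp: hist_def)

text \<open>In round \<open>n\<close> relay \<open>i\<close> acts at time
  \<open>1 + i + n * L\<close>, which precedes its reception in round \<open>n + 1\<close> because
  \<open>L \<ge> 2\<close>.\<close>

lemma rel_cong:
 assumes "\<And>m. m \<le> n \<Longrightarrow> q m = q' m"
 shows "rel i q n = rel i q' n"
proof -
 have "hist i q s = hist i q' s" if "s \<le> 1 + i + n * L" for s
 proof (cases "\<exists>m. s = m * L + i")
  case True
  then obtain m where s: "s = m * L + i" by blast
  have "m \<le> n"
  proof (rule ccontr)
   assume "\<not> m \<le> n"
   then have "Suc n * L \<le> m * L" by (intro mult_le_mono1) simp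
   then show False using that hops unfolding s by simp
  qed
  then show ?thesis unfolding s hist_at by (rule assms)
 qed (simp add: hist_def)
 then show ?thesis unfolding rel_def by (intro arg_cong[where f="g i _"]) (auto simp: restrict_def)
qed

lemma chain_cong:
 assumes "\<And>m. m \<le> n \<Longrightarrow> s0 m = s0' m" "\<And>j m. i \<le> j \<Longrightarrow> j < i + d \<Longrightarrow> z (j, m * L + j) = z' (j, m * L + j)"
 shows "chain s0 i z d n = chain s0' i z' d n"
 using assms
proof (induction d arbitrary: n)
 case (Suc d)
 have "chain s0 i z d m + z (i + d, m * L + (i + d)) = chain s0' i z' d m + z' (i + d, m * L + (i + d))" if "m \<le> n" for m
 proof -
  have "chain s0 i z d m = chain s0' i z' d m" using Suc.prems that by (intro Suc.IH) auto
  moreover have "z (i + d, m * L + (i + d)) = z' (i + d, m * L + (i + d))" by (rule Suc.prems(2)) auto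
  ultimately show ?thesis by simp
 qed
 then show ?case unfolding chain.simps by (rule rel_cong)
qed simp

text \<open>For fixed received signal and plant noise the initial state enters only through
  \<open>matpow A t\<close>; the integral of the state factor over \<open>x\<close> sees nothing
  else.\<close>

lemma xo_affine: "xo x w r t = matpow A t *v x + xo 0 w r t"
 by (induction t) (simp_all add: matrix_vector_right_distrib matrix_vector_mul_assoc)

lemma mv_m: "(\<lambda>x. C *v x) \<in> borel_measurable borel" for C :: "real ^ 'k ^ 'l"
 by (intro borel_measurable_continuous_onI linear_continuous_on) (simp add: linear_conv_bounded_linear[symmetric])

lemma uo_m:
 assumes "\<And>s. (\<lambda>a. r a s) \<in> borel_measurable K"
 shows "(\<lambda>a. uo (r a) t) \<in> borel_measurable K"
 unfolding uo_def by (rule measurable_compose[OF measurable_restrict ctrl_meas]) (rule assms)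

lemma xo_m:
 assumes x: "x \<in> borel_measurable K" and w: "\<And>s. (\<lambda>a. w a s) \<in> borel_measurable K" and r: "\<And>s. (\<lambda>a. r a s) \<in> borel_measurable K"
 shows "(\<lambda>a. xo (x a) (w a) (r a) t) \<in> borel_measurable K"
proof (induction t)
 case (Suc t)
 show ?case unfolding xo.simps
  by (intro borel_measurable_add w measurable_compose[OF _ mv_m] Suc uo_m r)
qed (simp add: x)

lemma enc_m:
 assumes x: "x \<in> borel_measurable K" and w: "\<And>s. (\<lambda>a. w a s) \<in> borel_measurable K" and r: "\<And>s. (\<lambda>a. r a s) \<in> borel_measurable K"
 shows "(\<lambda>a. enc (x a) (w a) (r a) n) \<in> borel_measurable K"
 unfolding enc_def
 by (rule measurable_compose[OF measurable_Pair[OF measurable_restrict measurable_restrict] f_meas])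
  (intro xo_m uo_m assms)+

lemma rel_m:
 assumes q: "\<And>n. (\<lambda>a. q a n) \<in> borel_measurable K" and i: "i \<in> {1..L - 1}"
 shows "(\<lambda>a. rel i (q a) n) \<in> borel_measurable K"
 unfolding rel_def
proof (rule measurable_compose[OF measurable_restrict g_meas[OF i]])
 fix s show "(\<lambda>a. hist i (q a) s) \<in> borel_measurable K"
  unfolding hist_def by (cases "\<exists>n. s = n * L + i") (simp_all add: q)
qed

lemma chain_m:
 assumes s0: "\<And>n. (\<lambda>a. s0 a n) \<in> borel_measurable K" and i: "1 \<le> i" "i + d \<le> L"
  and z: "\<And>j n. i \<le> j \<Longrightarrow> j < i + d \<Longrightarrow> (\<lambda>a. z a (j, n * L + j)) \<in> borel_measurable K"
 shows "(\<lambda>a. chain (s0 a) i (z a) d n) \<in> borel_measurable K"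
 using i(2) z
proof (induction d arbitrary: n)
 case (Suc d)
 have IH: "(\<lambda>a. chain (s0 a) i (z a) d m) \<in> borel_measurable K" for m
  using Suc.prems by (intro Suc.IH) auto
 have zz: "(\<lambda>a. z a (i + d, m * L + (i + d))) \<in> borel_measurable K" for m
  using Suc.prems(2)[of "i + d" m] by simp
 show ?case unfolding chain.simps
  by (rule rel_m, rule borel_measurable_add[OF IH zz]) (use i Suc.prems in auto)
qed (simp add: s0)

section \<open>The actual signals, hop by hop\<close>

definition sig :: "nat \<Rightarrow> nat \<Rightarrow> 'w \<Rightarrow> real" where
 "sig i n om = (if i = 1 then Se (1 + n * L) om else Sr (i - 1) (i + n * L) om)"

definition rcv :: "nat \<Rightarrow> nat \<Rightarrow> 'w \<Rightarrow> real" where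
 "rcv i n om = sig i n om + Z i (n * L + i) om"

definition Pw :: "nat \<Rightarrow> real" where
 "Pw i = (if i = 1 then P_S else P_r (i - 1))"

lemma X_xo: "om \<in> space M \<Longrightarrow> X t om = xo (X 0 om) (\<lambda>t. W t om) (\<lambda>s. R s om) t"
 by (induction t) (simp_all add: dynamics U_eq uo_def)

lemma sig_1: "om \<in> space M \<Longrightarrow> sig 1 n om = enc (X 0 om) (\<lambda>t. W t om) (\<lambda>s. R s om) n"
proof -
 assume om: "om \<in> space M"
 have "(\<lambda>s\<in>{..1 + n * L}. X s om) = (\<lambda>s\<in>{..1 + n * L}. xo (X 0 om) (\<lambda>t. W t om) (\<lambda>s. R s om) s)"
  by (rule restrict_ext) (rule X_xo[OF om])
 moreover have "(\<lambda>s\<in>{..<1 + n * L}. U s om) = (\<lambda>s\<in>{..<1 + n * L}. uo (\<lambda>s. R s om) s)"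
  by (rule restrict_ext) (simp add: U_eq[OF om] uo_def)
 moreover have "\<exists>m. 1 + n * L = 1 + m * L" by blast
 ultimately show ?thesis using Se_eq[OF om, of "1 + n * L"] by (simp only: sig_def enc_def if_True refl)
qed

lemma Y_hist:
 assumes om: "om \<in> space M" and i: "i \<in> {1..L - 1}"
 shows "Y i s om = hist i (\<lambda>n. rcv i n om) s"
proof (cases "\<exists>n. s = n * L + i")
 case True
 then obtain n where s: "s = n * L + i" by blast
 show ?thesis
 proof (cases "i = 1")
  case True
  then show ?thesis unfolding s hist_at using Y1_eq[OF om, of "n * L + 1"] by (auto simp: rcv_def sig_def add.commute)
 next
  case False
  then have "i \<in> {2..L - 1}" using i by auto
  then show ?thesis unfolding s hist_at using Y_eq[OF _ om, of i "n * L + i"] False by (auto simp: rcv_def sig_def add.commute)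
 qed
next
 case False
 show ?thesis
 proof (cases "i = 1")
  case True
  then show ?thesis using False Y1_eq[OF om, of s] by (simp add: hist_def)
 next
  case i1: False
  then have "i \<in> {2..L - 1}" using i by auto
  then show ?thesis using False Y_eq[OF _ om, of i s] by (simp add: hist_def)
 qed
qed

lemma sig_rel:
 assumes om: "om \<in> space M" and i: "i \<in> {1..L - 1}"
 shows "sig (i + 1) n om = rel i (\<lambda>n. rcv i n om) n"
proof -
 have "(\<lambda>s\<in>{..1 + i + n * L}. Y i s om) = (\<lambda>s\<in>{..1 + i + n * L}. hist i (\<lambda>n. rcv i n om) s)"
  by (rule restrict_ext) (rule Y_hist[OF om i])
 moreover have "\<exists>m. 1 + i + n * L = 1 + i + m * L" by blast
 moreover have "sig (i + 1) n om = Sr i (1 + i + n * L) om" using i by (simp add: sig_def)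
 ultimately show ?thesis using Sr_eq[OF i om, of "1 + i + n * L"] by (simp only: rel_def if_True)
qed

lemma chain_sig:
 assumes om: "om \<in> space M" and i: "1 \<le> i" "i + d \<le> L"
 shows "chain (\<lambda>n. sig i n om) i (\<lambda>(i, t). Z i t om) d = (\<lambda>n. sig (i + d) n om)"
 using i(2)
proof (induction d)
 case (Suc d)
 then have "chain (\<lambda>n. sig i n om) i (\<lambda>(i, t). Z i t om) d = (\<lambda>n. sig (i + d) n om)" by simp
 then have "chain (\<lambda>n. sig i n om) i (\<lambda>(i, t). Z i t om) (Suc d) = rel (i + d) (\<lambda>n. rcv (i + d) n om)"
  by (simp add: rcv_def)
 also have "\<dots> = (\<lambda>n. sig (i + d + 1) n om)"
  by (rule ext, rule sig_rel[OF om, symmetric]) (use i Suc.prems in auto)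
 finally show ?case by simp
qed simp

text \<open>Hop \<open>L\<close> of round \<open>n\<close> falls on time \<open>(n + 1) * L\<close>,
  one step before the encoder starts the next round.\<close>

lemma R_rcv: "om \<in> space M \<Longrightarrow> R ((n + 1) * L) om = rcv L n om"
proof -
 assume om: "om \<in> space M"
 have "\<exists>m. (n + 1) * L = m * L" by blast
 then have "R ((n + 1) * L) om = Sr (L - 1) ((n + 1) * L) om + Z L ((n + 1) * L) om"
  using R_eq[OF om, of "(n + 1) * L"] by simp
 then show ?thesis using hops by (simp add: rcv_def sig_def algebra_simps)
qed

text \<open>The last relay first transmits at time \<open>L\<close>, so the controller receives
  noise alone at time 0. This noise value belongs to no round and has to be accommodated by each cut
  separately.\<close>

lemma R_0: "om \<in> space M \<Longrightarrow> R 0 om = Z L 0 om"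
proof -
 assume om: "om \<in> space M"
 have "Sr (L - 1) 0 om = 0" using Sr_eq[OF _ om, of "L - 1" 0] hops by auto
 then show ?thesis using R_eq[OF om, of 0] by auto
qed

lemma R_off: "om \<in> space M \<Longrightarrow> \<not> L dvd s \<Longrightarrow> R s om = 0"
 using R_eq[of om s] by (auto simp: dvd_def mult.commute)

lemma sig_sq:
 assumes i: "i \<in> {1..L}"
 shows "integrable M (\<lambda>om. (sig i n om)\<^sup>2)" "expectation (\<lambda>om. (sig i n om)\<^sup>2) = real L * Pw i" "0 \<le> Pw i"
proof -
 have *: "integrable M (\<lambda>om. (sig i n om)\<^sup>2) \<and> expectation (\<lambda>om. (sig i n om)\<^sup>2) = real L * Pw i" for n
 proof (cases "i = 1")
  case True
  then show ?thesis using Se_power[of n] by (simp add: sig_def Pw_def)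
 next
  case False
  then have "i - 1 \<in> {1..L - 1}" "1 + (i - 1) = i" using i by auto
  then show ?thesis using Sr_power[of "i - 1" n] False by (simp add: sig_def Pw_def)
 qed
 then show "integrable M (\<lambda>om. (sig i n om)\<^sup>2)" "expectation (\<lambda>om. (sig i n om)\<^sup>2) = real L * Pw i" by auto
 have "0 \<le> expectation (\<lambda>om. (sig i 0 om)\<^sup>2)" by (rule integral_nonneg_AE) simp
 then show "0 \<le> Pw i" using *[of 0] L_pos by (simp add: zero_le_mult_iff)
qed

lemma sig_power:
 assumes i: "i \<in> {1..L}"
 shows "(\<integral>\<^sup>+om. ennreal ((sig i n om / sqrt (N i))\<^sup>2) \<partial>M) = ennreal (real L * Pw i / N i)"
proof -
 have N: "0 < N i" using noise_var_pos[OF i] .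
 have "(\<integral>\<^sup>+om. ennreal ((sig i n om / sqrt (N i))\<^sup>2) \<partial>M) = (\<integral>\<^sup>+om. ennreal ((sig i n om)\<^sup>2 / N i) \<partial>M)"
  using N by (simp add: power_divide)
 also have "\<dots> = ennreal (expectation (\<lambda>om. (sig i n om)\<^sup>2 / N i))"
  by (rule nn_integral_eq_integral) (use N sig_sq(1)[OF i] in auto)
 also have "expectation (\<lambda>om. (sig i n om)\<^sup>2 / N i) = real L * Pw i / N i"
  using sig_sq(2)[OF i] by simp
 finally show ?thesis .
qed

end

text \<open>If the feedback does not see \<open>x\<close>, the state can be integrated out before the likelihood ratios.\<close>

lemma gibbs_downstream:
 fixes p :: "'x::euclidean_space \<Rightarrow> real"
 assumes "feedback (density lborel (\<lambda>x. ennreal (p x)) \<Otimes>\<^sub>M H) e s" and H: "prob_space H" and P: "0 \<le> P"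
  and gk: "\<And>h t y. h \<in> space H \<Longrightarrow> (\<lambda>x. gk (x, h) t y) \<in> borel_measurable borel" "\<And>a t y. 0 < gk a t y"
  and e: "\<And>n x x' h y. e n (x, h) y = e n (x', h) y"
  and c: "\<And>h t y. h \<in> space H \<Longrightarrow> (\<LL> x. ennreal (gk (x, h) t y)) \<le> ennreal c"
 shows "(\<integral>\<^sup>+h. (\<GG> t. \<GG> y. \<LL> x. ennreal (gk (x, h) t y * feedback.re e {..<k} (x, h) t y * nh P {..<k} y)) \<partial>H) \<le> ennreal c"
proof -
 interpret feedback "density lborel (\<lambda>x. ennreal (p x)) \<Otimes>\<^sub>M H" e s by fact
 interpret H: prob_space H by fact
 let ?w = "{..<k}"
 have "(\<integral>\<^sup>+h. (\<GG> t. \<GG> y. \<LL> x. ennreal (gk (x, h) t y * re ?w (x, h) t y * nh P ?w y)) \<partial>H)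
  \<le> (\<integral>\<^sup>+h. ennreal c \<partial>H)"
 proof (rule nn_integral_mono)
  fix h assume h: "h \<in> space H"
  have a0 [measurable]: "(0, h) \<in> space (density lborel (\<lambda>x. ennreal (p x)) \<Otimes>\<^sub>M H)" using h by (simp add: space_pair_measure)
  have "(\<GG> t. \<GG> y. \<LL> x. ennreal (gk (x, h) t y * re ?w (x, h) t y * nh P ?w y))
   \<le> (\<GG> t. \<GG> y. (ennreal c * ennreal (nh P ?w y)) * ennreal (re ?w (0, h) t y))"
  proof (rule nn_integral_mono, rule nn_integral_mono)
   fix t y
   have r: "re ?w (x, h) t y = re ?w (0, h) t y" for x unfolding re_def using e[of _ x h y 0] by simp
   have "(\<LL> x. ennreal (gk (x, h) t y * re ?w (x, h) t y * nh P ?w y))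
    = (\<LL> x. ennreal (gk (x, h) t y) * (ennreal (nh P ?w y) * ennreal (re ?w (0, h) t y)))"
   proof (rule nn_integral_cong)
    fix x
    show "ennreal (gk (x, h) t y * re ?w (x, h) t y * nh P ?w y) = ennreal (gk (x, h) t y) * (ennreal (nh P ?w y) * ennreal (re ?w (0, h) t y))"
     unfolding r[of x] by (simp add: ennreal_mult[symmetric] gk(2) re_pos nh_pos[OF P] less_imp_le mult_ac)
   qed
   also have "\<dots> = (\<LL> x. ennreal (gk (x, h) t y)) * (ennreal (nh P ?w y) * ennreal (re ?w (0, h) t y))"
    by (rule nn_integral_multc) (use gk(1)[OF h] in simp)
   also have "\<dots> \<le> ennreal c * (ennreal (nh P ?w y) * ennreal (re ?w (0, h) t y))"
    by (intro mult_right_mono c h) auto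
   finally show "(\<LL> x. ennreal (gk (x, h) t y * re ?w (x, h) t y * nh P ?w y))
    \<le> (ennreal c * ennreal (nh P ?w y)) * ennreal (re ?w (0, h) t y)" by (simp only: mult.assoc)
  qed
  also have "\<dots> = (\<GG> y. \<GG> t. (ennreal c * ennreal (nh P ?w y)) * ennreal (re ?w (0, h) t y))"
   by (rule nn_integral_swap_gseq) measurable
  also have "\<dots> = (\<GG> y. ennreal c * ennreal (nh P ?w y))"
  proof (rule nn_integral_cong)
   fix y :: "nat \<Rightarrow> real"
   have [measurable]: "y \<in> space sq" by simp
   have "(\<GG> t. (ennreal c * ennreal (nh P ?w y)) * ennreal (re ?w (0, h) t y))
    = (ennreal c * ennreal (nh P ?w y)) * (\<GG> t. ennreal (re ?w (0, h) t y))"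
    by (rule nn_integral_cmult) measurable
   then show "(\<GG> t. (ennreal c * ennreal (nh P ?w y)) * ennreal (re ?w (0, h) t y)) = ennreal c * ennreal (nh P ?w y)"
    by (simp only: re_int[OF finite_lessThan] mult_1_right)
  qed
  also have "\<dots> = ennreal c * (\<GG> y. ennreal (nh P ?w y))" by (rule nn_integral_cmult) measurable
  also have "\<dots> = ennreal c" by (simp add: nn_integral_nh_1[OF P])
  finally show "(\<GG> t. \<GG> y. \<LL> x. ennreal (gk (x, h) t y * re ?w (x, h) t y * nh P ?w y)) \<le> ennreal c" .
 qed
 then show ?thesis by (simp add: H.emeasure_space_1)
qed

text \<open>If the state does not see \<open>t\<close>, the likelihood ratios integrate to one first.\<close>

lemma gibbs_upstream:
 fixes p :: "'x::euclidean_space \<Rightarrow> real"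
 assumes "feedback (density lborel (\<lambda>x. ennreal (p x)) \<Otimes>\<^sub>M H) e s" and H: "prob_space H" and P: "0 \<le> P"
  and gk: "\<And>h t. h \<in> space H \<Longrightarrow> (\<lambda>(x, y). gk (x, h) t y) \<in> borel_measurable (borel \<Otimes>\<^sub>M sq)" "\<And>a t y. 0 < gk a t y"
  and t: "\<And>a t t' y. gk a t y = gk a t' y"
  and c: "\<And>h t y. h \<in> space H \<Longrightarrow> (\<LL> x. ennreal (gk (x, h) t y)) \<le> ennreal c"
 shows "(\<integral>\<^sup>+h. (\<GG> t. \<GG> y. \<LL> x. ennreal (gk (x, h) t y * feedback.re e {..<k} (x, h) t y * nh P {..<k} y)) \<partial>H) \<le> ennreal c"
proof -
 interpret feedback "density lborel (\<lambda>x. ennreal (p x)) \<Otimes>\<^sub>M H" e s by fact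
 interpret H: prob_space H by fact
 let ?w = "{..<k}"
 have "(\<integral>\<^sup>+h. (\<GG> t. \<GG> y. \<LL> x. ennreal (gk (x, h) t y * re ?w (x, h) t y * nh P ?w y)) \<partial>H)
  \<le> (\<integral>\<^sup>+h. ennreal c \<partial>H)"
 proof (rule nn_integral_mono)
  fix h assume h: "h \<in> space H"
  let ?g = "\<lambda>x y. ennreal (gk (x, h) (\<lambda>_. 0) y)"
  have g_m [measurable]: "(\<lambda>z. gk (f z, h) (\<lambda>_. 0) (g z)) \<in> borel_measurable K"
   if "f \<in> borel_measurable K" "g \<in> measurable K sq" for f g and K :: "'k measure"
   using measurable_compose[OF measurable_Pair[OF that] gk(1)[OF h]] by simp
  have xh [measurable]: "(\<lambda>z. (f z, h)) \<in> measurable K (density lborel (\<lambda>x. ennreal (p x)) \<Otimes>\<^sub>M H)"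
   if [measurable]: "f \<in> borel_measurable K" for f and K :: "'k measure"
   using h by (intro measurable_Pair) auto
  have lb_m [measurable]: "(\<lambda>z. (\<LL> x. q z x)) \<in> borel_measurable K"
   if [measurable]: "(\<lambda>(z, x). q z x) \<in> borel_measurable (K \<Otimes>\<^sub>M borel)" for q :: "'k \<Rightarrow> 'x \<Rightarrow> ennreal" and K
   by (intro sigma_finite_measure.borel_measurable_nn_integral[OF sigma_finite_lborel]) (simp cong: measurable_cong_sets)
  have "(\<GG> t. \<GG> y. \<LL> x. ennreal (gk (x, h) t y * re ?w (x, h) t y * nh P ?w y))
   = (\<GG> t. \<GG> y. \<LL> x. (?g x y * ennreal (nh P ?w y)) * ennreal (re ?w (x, h) t y))"
  proof (rule nn_integral_cong, rule nn_integral_cong, rule nn_integral_cong)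
   fix s y x
   have "gk (x, h) s y = gk (x, h) (\<lambda>_. 0) y" by (rule t)
   then show "ennreal (gk (x, h) s y * re ?w (x, h) s y * nh P ?w y) = (?g x y * ennreal (nh P ?w y)) * ennreal (re ?w (x, h) s y)"
    by (simp add: ennreal_mult[symmetric] gk(2) re_pos nh_pos[OF P] less_imp_le mult_ac)
  qed
  also have "\<dots> = (\<GG> y. \<GG> t. \<LL> x. (?g x y * ennreal (nh P ?w y)) * ennreal (re ?w (x, h) t y))"
   by (rule nn_integral_swap_gseq) measurable
  also have "\<dots> = (\<GG> y. \<LL> x. \<GG> t. (?g x y * ennreal (nh P ?w y)) * ennreal (re ?w (x, h) t y))"
   by (rule nn_integral_cong, rule nn_integral_swap[OF sigma_finite_gseq sigma_finite_lborel]) measurable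
  also have "\<dots> = (\<GG> y. \<LL> x. ?g x y * ennreal (nh P ?w y))"
  proof (rule nn_integral_cong, rule nn_integral_cong)
   fix y :: "nat \<Rightarrow> real" and x :: 'x
   have [measurable]: "y \<in> space sq" "(x, h) \<in> space (density lborel (\<lambda>x. ennreal (p x)) \<Otimes>\<^sub>M H)"
    using h by (simp_all add: space_pair_measure)
   have "(\<GG> t. (?g x y * ennreal (nh P ?w y)) * ennreal (re ?w (x, h) t y))
    = (?g x y * ennreal (nh P ?w y)) * (\<GG> t. ennreal (re ?w (x, h) t y))"
    by (rule nn_integral_cmult) measurable
   then show "(\<GG> t. (?g x y * ennreal (nh P ?w y)) * ennreal (re ?w (x, h) t y)) = ?g x y * ennreal (nh P ?w y)"
    by (simp only: re_int[OF finite_lessThan] mult_1_right)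
  qed
  also have "\<dots> \<le> (\<GG> y. ennreal c * ennreal (nh P ?w y))"
  proof (rule nn_integral_mono)
   fix y :: "nat \<Rightarrow> real"
   have "(\<LL> x. ?g x y * ennreal (nh P ?w y)) = (\<LL> x. ?g x y) * ennreal (nh P ?w y)"
    by (rule nn_integral_multc, rule measurable_compose[OF g_m measurable_ennreal]) auto
   also have "\<dots> \<le> ennreal c * ennreal (nh P ?w y)" by (intro mult_right_mono c h) auto
   finally show "(\<LL> x. ?g x y * ennreal (nh P ?w y)) \<le> ennreal c * ennreal (nh P ?w y)" .
  qed
  also have "\<dots> = ennreal c * (\<GG> y. ennreal (nh P ?w y))" by (rule nn_integral_cmult) measurable
  also have "\<dots> = ennreal c" by (simp add: nn_integral_nh_1[OF P])
  finally show "(\<GG> t. \<GG> y. \<LL> x. ennreal (gk (x, h) t y * re ?w (x, h) t y * nh P ?w y)) \<le> ennreal c" .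
 qed
 then show ?thesis by (simp add: H.emeasure_space_1)
qed

section \<open>Splitting the noise and instantiating the loop\<close>

context cascade_loop
begin

abbreviation (input) hop_times :: "(nat \<times> nat) set" where "hop_times \<equiv> {1..L} \<times> UNIV"

definition Zp :: "nat \<times> nat \<Rightarrow> 'w \<Rightarrow> real" where "Zp = (\<lambda>(i, t). Z i t)"

definition nz :: "nat \<times> nat \<Rightarrow> real" where "nz p = sqrt (N (fst p))"

definition JJ :: "(nat \<Rightarrow> nat \<times> nat) \<Rightarrow> (nat \<Rightarrow> nat \<times> nat) \<Rightarrow> (nat \<times> nat) set" where
 "JJ va zb = hop_times - (range va \<union> range zb)"

definition UU :: "(nat \<Rightarrow> nat \<times> nat) \<Rightarrow> (nat \<Rightarrow> nat \<times> nat) \<Rightarrow> 'w \<Rightarrow> nat \<times> nat \<Rightarrow> real" where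
 "UU va zb om = (\<lambda>p\<in>JJ va zb. Zp p om)"

definition HH :: "(nat \<Rightarrow> nat \<times> nat) \<Rightarrow> (nat \<Rightarrow> nat \<times> nat) \<Rightarrow> ((nat \<Rightarrow> real ^ 'n) \<times> (nat \<times> nat \<Rightarrow> real)) measure" where
 "HH va zb = distr M (\<Pi>\<^sub>M t\<in>UNIV. borel) (\<lambda>om t. W t om) \<Otimes>\<^sub>M distr M (Pi\<^sub>M (JJ va zb) (\<lambda>_. borel)) (UU va zb)"

definition AA :: "(nat \<Rightarrow> nat \<times> nat) \<Rightarrow> (nat \<Rightarrow> nat \<times> nat) \<Rightarrow> 'w \<Rightarrow> (real ^ 'n) \<times> (nat \<Rightarrow> real ^ 'n) \<times> (nat \<times> nat \<Rightarrow> real)" where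
 "AA va zb om = (X 0 om, ((\<lambda>t. W t om), UU va zb om))"

definition VV :: "(nat \<Rightarrow> nat \<times> nat) \<Rightarrow> 'w \<Rightarrow> nat \<Rightarrow> real" where
 "VV va om = (\<lambda>n. Zp (va n) om / nz (va n))"

definition cg :: real where
 "cg = enn2real (\<LL> x. ennreal (exp (- (norm (x :: real ^ 'n))\<^sup>2 / 2)))"

lemma Zp_N01: "p \<in> hop_times \<Longrightarrow> distr M borel (\<lambda>om. Zp p om / nz p) = N01"
proof -
 assume p: "p \<in> hop_times"
 obtain i t where it: "p = (i, t)" "i \<in> {1..L}" using p by auto
 have "0 < sqrt (N i)" using noise_var_pos[OF it(2)] by simp
 from normal_standard_normal_convert[OF this, of "Z i t" 0] Z_dist[OF it(2), of t]
 have "distributed M lborel (\<lambda>om. Z i t om / sqrt (N i)) std_normal_density" by simp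
 from distributed_distr_eq_density[OF this]
 have "distr M lborel (\<lambda>om. Zp p om / nz p) = N01" by (simp add: it Zp_def nz_def)
 moreover have "distr M borel (\<lambda>om. Zp p om / nz p) = distr M lborel (\<lambda>om. Zp p om / nz p)" by (rule distr_cong) auto
 ultimately show ?thesis by simp
qed

lemma law_AA:
 assumes p: "finite_entropy lborel (X 0) p"
  and va: "inj va" "range va \<subseteq> hop_times" and zb: "inj zb" "range zb \<subseteq> hop_times" and disj: "range va \<inter> range zb = {}"
 defines "M0 \<equiv> density lborel (\<lambda>x. ennreal (p x)) \<Otimes>\<^sub>M HH va zb"
 shows "distr M (M0 \<Otimes>\<^sub>M gseq \<Otimes>\<^sub>M gseq) (\<lambda>om. (AA va zb om, VV va om, VV zb om)) = M0 \<Otimes>\<^sub>M gseq \<Otimes>\<^sub>M gseq"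
  and "prob_space (HH va zb)" and "prob_space (density lborel (\<lambda>x. ennreal (p x)))" and "AA va zb \<in> measurable M M0"
  and "VV va \<in> measurable M sq" "VV zb \<in> measurable M sq"
  and "sets (HH va zb) = sets ((\<Pi>\<^sub>M t\<in>UNIV. borel) \<Otimes>\<^sub>M Pi\<^sub>M (JJ va zb) (\<lambda>_. borel))"
  and "sets M0 = sets (borel \<Otimes>\<^sub>M (\<Pi>\<^sub>M t\<in>UNIV. borel) \<Otimes>\<^sub>M Pi\<^sub>M (JJ va zb) (\<lambda>_. borel))"
proof -
 have Zr: "(\<lambda>om. \<lambda>(i, t)\<in>hop_times. Z i t om) = (\<lambda>om. \<lambda>p\<in>hop_times. Zp p om)"
  by (intro ext) (auto simp: Zp_def restrict_def)
 have xwz: "indep_rv (borel \<Otimes>\<^sub>M (\<Pi>\<^sub>M t\<in>UNIV. borel)) (\<lambda>om. (X 0 om, \<lambda>t. W t om)) (Pi\<^sub>M hop_times (\<lambda>_. borel)) (\<lambda>om. \<lambda>p\<in>hop_times. Zp p om)"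
  using Z_indep_plant unfolding Zr .
 have zi: "indep_vars (\<lambda>_. borel) Zp hop_times" using Z_indep by (simp add: Zp_def)
 have d: "distributed M lborel (X 0) (\<lambda>x. ennreal (p x))" using p by (simp add: finite_entropy_def)
 have dp: "distr M borel (X 0) = density lborel (\<lambda>x. ennreal (p x))"
 proof -
  have "distr M borel (X 0) = distr M lborel (X 0)" by (rule distr_cong) auto
  then show ?thesis using distributed_distr_eq_density[OF d] by simp
 qed
 have Xm [measurable]: "X 0 \<in> borel_measurable M" using noise_indep_init by (simp add: indep_rv_def)
 have e: "UU va zb = (\<lambda>om. \<lambda>p\<in>JJ va zb. Zp p om)" "VV va = (\<lambda>om n. Zp (va n) om / nz (va n))" "VV zb = (\<lambda>om n. Zp (zb n) om / nz (zb n))"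
  by (simp_all add: fun_eq_iff UU_def VV_def)
 note jl = joint_law[OF noise_indep_init xwz zi Zp_N01 va zb disj, folded JJ_def,
  unfolded dp implies_True_equals triv_forall_equality True_implies_equals]
 show "distr M (M0 \<Otimes>\<^sub>M gseq \<Otimes>\<^sub>M gseq) (\<lambda>om. (AA va zb om, VV va om, VV zb om)) = M0 \<Otimes>\<^sub>M gseq \<Otimes>\<^sub>M gseq"
  unfolding M0_def HH_def AA_def e by (rule jl(1))
 show H: "prob_space (HH va zb)" unfolding HH_def e by (rule jl(2))
 show "prob_space (density lborel (\<lambda>x. ennreal (p x)))"
  unfolding dp[symmetric] by (rule prob_space_distr) measurable
 show "AA va zb \<in> measurable M M0"
 proof -
  have "(\<lambda>om. ((\<lambda>t. W t om), UU va zb om)) \<in> measurable M (HH va zb)" unfolding HH_def e by (rule jl(3))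
  then show ?thesis unfolding AA_def[abs_def] M0_def by (intro measurable_Pair) simp_all
 qed
 show "VV va \<in> measurable M sq" unfolding e by (rule jl(4))
 show "VV zb \<in> measurable M sq" unfolding e by (rule jl(5))
 show sH: "sets (HH va zb) = sets ((\<Pi>\<^sub>M t\<in>UNIV. borel) \<Otimes>\<^sub>M Pi\<^sub>M (JJ va zb) (\<lambda>_. borel))" unfolding HH_def e by (rule jl(6))
 show "sets M0 = sets (borel \<Otimes>\<^sub>M (\<Pi>\<^sub>M t\<in>UNIV. borel) \<Otimes>\<^sub>M Pi\<^sub>M (JJ va zb) (\<lambda>_. borel))"
  unfolding M0_def by (intro sets_pair_measure_cong sH) simp
qed

lemma static_m:
 fixes M0 :: "((real ^ 'n) \<times> (nat \<Rightarrow> real ^ 'n) \<times> (nat \<times> nat \<Rightarrow> real)) measure"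
 assumes sets: "sets M0 = sets (borel \<Otimes>\<^sub>M (\<Pi>\<^sub>M t\<in>UNIV. borel) \<Otimes>\<^sub>M Pi\<^sub>M J (\<lambda>_. borel))"
  and "a \<in> measurable K M0"
 shows "(\<lambda>z. fst (a z)) \<in> borel_measurable K" "(\<lambda>z. fst (snd (a z)) t) \<in> borel_measurable K"
  "q \<in> J \<Longrightarrow> (\<lambda>z. snd (snd (a z)) q) \<in> borel_measurable K"
proof -
 have a_m [measurable]: "a \<in> measurable K (borel \<Otimes>\<^sub>M (\<Pi>\<^sub>M t\<in>UNIV. borel) \<Otimes>\<^sub>M Pi\<^sub>M J (\<lambda>_. borel))"
  using assms(2) by (simp cong: measurable_cong_sets add: sets)
 show "(\<lambda>z. fst (a z)) \<in> borel_measurable K" by measurable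
 show "(\<lambda>z. fst (snd (a z)) t) \<in> borel_measurable K"
  by (rule measurable_compose[OF measurable_compose[OF measurable_compose[OF a_m measurable_snd] measurable_fst] measurable_component_singleton]) simp
 show "(\<lambda>z. snd (snd (a z)) q) \<in> borel_measurable K" if "q \<in> J"
  by (rule measurable_compose[OF measurable_compose[OF measurable_compose[OF a_m measurable_snd] measurable_snd] measurable_component_singleton[OF that]])
qed

end

context cascade_loop
begin

text \<open>The state factor after \<open>k\<close> rounds, at time \<open>k * L\<close>, where
  \<open>r\<close> reconstructs the controller input from \<open>h\<close> and the cut signals.
  Minus its logarithm is half the squared norm of the state, whose mean is bounded by
  stability.\<close>

definition gkf :: "((nat \<Rightarrow> real ^ 'n) \<times> (nat \<times> nat \<Rightarrow> real) \<Rightarrow> (nat \<Rightarrow> real) \<Rightarrow> (nat \<Rightarrow> real) \<Rightarrow> nat \<Rightarrow> real)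
  \<Rightarrow> nat \<Rightarrow> (real ^ 'n) \<times> (nat \<Rightarrow> real ^ 'n) \<times> (nat \<times> nat \<Rightarrow> real) \<Rightarrow> (nat \<Rightarrow> real) \<Rightarrow> (nat \<Rightarrow> real) \<Rightarrow> real" where
 "gkf r k a t y = exp (- (norm (xo (fst a) (fst (snd a)) (r (snd a) t y) (k * L)))\<^sup>2 / 2)"

lemma gkf_int:
 assumes "1 < \<bar>det A\<bar>"
 shows "(\<LL> x. ennreal (gkf r k (x, h) t y)) \<le> ennreal (cg * exp (- (real k * (real L * ln \<bar>det A\<bar>))))"
proof -
 have "det A \<noteq> 0" using assms by auto
 from gauss_matpow_le[OF this, of "k * L" "xo 0 (fst h) (r h t y) (k * L)"]
 show ?thesis
  unfolding gkf_def fst_conv snd_conv xo_affine[of _ _ _ "k * L", symmetric] cg_def by (simp add: mult.assoc)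
qed

text \<open>The part common to both cuts. The alternative \<open>tx\<close> decides the order of
  integration in the Gibbs estimate: either the feedback does not see \<open>x\<close>, or the
  received signal does not depend on \<open>t\<close>.\<close>

lemma info_loopI:
 fixes T Yn :: "'w \<Rightarrow> nat \<Rightarrow> real" and P Ce C :: real
 assumes p: "finite_entropy lborel (X 0) p"
  and ss: "\<And>t. integrable M (\<lambda>om. (norm (X t om))\<^sup>2) \<and> (\<integral>om. (norm (X t om))\<^sup>2 \<partial>M) < C"
  and dA: "1 < \<bar>det A\<bar>"
  and va: "inj va" "range va \<subseteq> hop_times" and zb: "inj zb" "range zb \<subseteq> hop_times" and disj: "range va \<inter> range zb = {}"
  and em: "\<And>n. (\<lambda>(a, y). e n a y) \<in> borel_measurable ((density lborel (\<lambda>x. ennreal (p x)) \<Otimes>\<^sub>M HH va zb) \<Otimes>\<^sub>M sq)"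
  and sm: "\<And>n. (\<lambda>(a, t). s n a t) \<in> borel_measurable ((density lborel (\<lambda>x. ennreal (p x)) \<Otimes>\<^sub>M HH va zb) \<Otimes>\<^sub>M sq)"
  and ec: "\<And>n a y y'. (\<And>i. i < n \<Longrightarrow> y i = y' i) \<Longrightarrow> e n a y = e n a y'"
  and sc: "\<And>n a t t'. (\<And>i. i \<le> n \<Longrightarrow> t i = t' i) \<Longrightarrow> s n a t = s n a t'"
  and Teq: "\<And>om n. om \<in> space M \<Longrightarrow> T om n = e n (AA va zb om) (Yn om) + VV va om n"
  and Yeq: "\<And>om n. om \<in> space M \<Longrightarrow> Yn om n = s n (AA va zb om) (T om) + VV zb om n"
  and sp: "\<And>n. (\<integral>\<^sup>+om. ennreal ((s n (AA va zb om) (T om))\<^sup>2) \<partial>M) = ennreal P"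
  and ep: "\<And>n. (\<integral>\<^sup>+om. ennreal ((e n (AA va zb om) (Yn om))\<^sup>2) \<partial>M) \<le> ennreal Ce"
  and rm: "\<And>i. (\<lambda>(a, t, y). r (snd a) t y i) \<in> borel_measurable ((density lborel (\<lambda>x. ennreal (p x)) \<Otimes>\<^sub>M HH va zb) \<Otimes>\<^sub>M sq \<Otimes>\<^sub>M sq)"
  and rc: "\<And>k h t y t' y' i. (\<And>i. i < k \<Longrightarrow> t i = t' i) \<Longrightarrow> (\<And>i. i < k \<Longrightarrow> y i = y' i) \<Longrightarrow> i < k * L \<Longrightarrow> r h t y i = r h t' y' i"
  and rR: "\<And>om. om \<in> space M \<Longrightarrow> r (snd (AA va zb om)) (T om) (Yn om) = (\<lambda>i. R i om)"
  and par: "0 \<le> P" "0 \<le> Ce" "ln (1 + P) / 2 \<le> real L * ln \<bar>det A\<bar>"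
  and tx: "(\<forall>n x x' h y. e n (x, h) y = e n (x', h) y) \<or> (\<forall>h t t' y. r h t y = r h t' y)"
 shows "info_loop p (HH va zb) e s M (AA va zb) (VV va) (VV zb) T Yn P Ce cg (C / 2) (real L * ln \<bar>det A\<bar>) (gkf r)"
proof -
 let ?D = "density lborel (\<lambda>x. ennreal (p x))"
 let ?M0 = "?D \<Otimes>\<^sub>M HH va zb"
 note law = law_AA[OF p va zb disj]
 interpret H: prob_space "HH va zb" by (rule law(2))
 interpret D: prob_space ?D by (rule law(3))
 interpret DH: pair_prob_space ?D "HH va zb" by unfold_locales
 have fb: "feedback ?M0 e s"
  by (intro feedback.intro feedback_axioms.intro DH.prob_space_axioms em sm ec sc)
 have d: "distributed M lborel (X 0) (\<lambda>x. ennreal (p x))" and p0: "\<And>x. 0 \<le> p x"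
  and pe: "integrable lborel (\<lambda>x. p x * log 2 (p x))" using p by (auto simp: finite_entropy_def)
 have pm: "p \<in> borel_measurable borel" using distributed_real_measurable[OF _ d] p0 by simp
 have gm: "(\<lambda>z. gkf r k (fst z) (fst (snd z)) (snd (snd z))) \<in> borel_measurable (?M0 \<Otimes>\<^sub>M sq \<Otimes>\<^sub>M sq)" for k
 proof -
  have [measurable]: "(\<lambda>z. xo (fst (fst z)) (fst (snd (fst z))) (r (snd (fst z)) (fst (snd z)) (snd (snd z))) (k * L)) \<in> borel_measurable (?M0 \<Otimes>\<^sub>M sq \<Otimes>\<^sub>M sq)"
   by (rule xo_m) (use static_m[OF law(8) measurable_fst] rm in \<open>simp_all add: split_beta'\<close>)
  show ?thesis unfolding gkf_def by measurable
 qed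
 have gk_pos: "0 < gkf r k a t y" for k a t y by (simp add: gkf_def)
 have al: "0 < real L * ln \<bar>det A\<bar>" using dA L_pos by simp
 have cg0: "0 \<le> cg" by (simp add: cg_def)
 have C0: "0 \<le> C"
 proof -
  have "0 \<le> (\<integral>om. (norm (X 0 om))\<^sup>2 \<partial>M)" by (rule integral_nonneg_AE) simp
  then show ?thesis using ss[of 0] by linarith
 qed
 have sets_M0: "sets (borel \<Otimes>\<^sub>M HH va zb) = sets ?M0" by (intro sets_pair_measure_cong) auto
 have gx: "(\<lambda>(x, y). gkf r k (x, h) t y) \<in> borel_measurable (borel \<Otimes>\<^sub>M sq)" if h: "h \<in> space (HH va zb)" for k h t
 proof -
  have "(\<lambda>z. ((fst z, h), t, snd z)) \<in> measurable (borel \<Otimes>\<^sub>M sq) (?M0 \<Otimes>\<^sub>M sq \<Otimes>\<^sub>M sq)"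
   using h by (intro measurable_Pair) auto
  from measurable_compose[OF this gm[of k]] show ?thesis by (simp add: split_beta')
 qed
 have gibbs: "(\<integral>\<^sup>+h. (\<GG> t. \<GG> y. \<LL> x. ennreal (gkf r k (x, h) t y * feedback.re e {..<k} (x, h) t y * nh P {..<k} y)) \<partial>HH va zb)
   \<le> ennreal (cg * exp (- (real k * (real L * ln \<bar>det A\<bar>))))" for k
 proof (rule disjE[OF tx])
  assume t: "\<forall>n x x' h y. e n (x, h) y = e n (x', h) y"
  show ?thesis
  proof (rule gibbs_downstream[OF fb law(2) par(1)])
   fix h t y assume h: "h \<in> space (HH va zb)"
   show "(\<lambda>x. gkf r k (x, h) t y) \<in> borel_measurable borel"
    using measurable_compose[OF measurable_Pair[OF measurable_ident measurable_const] gx[OF h, of k t], of y] by (simp add: id_def)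
  qed (use t gk_pos gkf_int[OF dA] in auto)
 next
  assume t: "\<forall>h t t' y. r h t y = r h t' y"
  have t': "gkf r k a s y = gkf r k a s' y" for a s s' y
  proof -
   have "r (snd a) s y = r (snd a) s' y" using t by blast
   then show ?thesis by (simp add: gkf_def)
  qed
  show ?thesis
   by (rule gibbs_upstream[OF fb law(2) par(1) gx gk_pos t' gkf_int[OF dA]])
 qed
 have lnX: "- ln (gkf r k (AA va zb om) (T om) (Yn om)) = (norm (X (k * L) om))\<^sup>2 / 2" if "om \<in> space M" for k om
  unfolding gkf_def rR[OF that] using X_xo[OF that, of "k * L"] by (simp add: AA_def)
 show ?thesis
 proof (intro info_loop.intro closed_loop.intro closed_loop_axioms.intro info_loop_axioms.intro fb)
  show "prob_space M" by (rule prob_space_axioms)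
  show "distr M (?M0 \<Otimes>\<^sub>M gseq \<Otimes>\<^sub>M gseq) (\<lambda>om. (AA va zb om, VV va om, VV zb om)) = ?M0 \<Otimes>\<^sub>M gseq \<Otimes>\<^sub>M gseq" by (rule law(1))
  show "integrable lborel (\<lambda>x. p x * ln (p x))"
  proof -
   have "(\<lambda>x. p x * ln (p x)) = (\<lambda>x. ln 2 * (p x * log 2 (p x)))" by (simp add: log_def fun_eq_iff)
   then show ?thesis using pe by (simp only: integrable_mult_right)
  qed
  fix k
  show "(\<lambda>(a, t, y). gkf r k a t y) \<in> borel_measurable ((borel \<Otimes>\<^sub>M HH va zb) \<Otimes>\<^sub>M sq \<Otimes>\<^sub>M sq)"
  proof -
   have "sets ((borel \<Otimes>\<^sub>M HH va zb) \<Otimes>\<^sub>M sq \<Otimes>\<^sub>M sq) = sets (?M0 \<Otimes>\<^sub>M sq \<Otimes>\<^sub>M sq)" by (intro sets_pair_measure_cong sets_M0) auto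
   from measurable_cong_sets[OF this refl] show ?thesis using gm[of k] by (simp add: split_beta')
  qed
  show "gkf r k a t y \<le> 1" for a t y by (simp add: gkf_def)
  show "gkf r k a t y = gkf r k a t' y'" if "\<And>i. i < k \<Longrightarrow> t i = t' i" "\<And>i. i < k \<Longrightarrow> y i = y' i" for a t y t' y'
  proof -
   have "xo (fst a) (fst (snd a)) (r (snd a) t y) (k * L) = xo (fst a) (fst (snd a)) (r (snd a) t' y') (k * L)"
    by (rule xo_cong, rule rc[OF that])
   then show ?thesis by (simp only: gkf_def)
  qed
  have "(\<integral>\<^sup>+om. ennreal (- ln (gkf r k (AA va zb om) (T om) (Yn om))) \<partial>M) = (\<integral>\<^sup>+om. ennreal ((norm (X (k * L) om))\<^sup>2 / 2) \<partial>M)"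
   by (rule nn_integral_cong) (simp only: lnX)
  also have "\<dots> = ennreal (\<integral>om. (norm (X (k * L) om))\<^sup>2 / 2 \<partial>M)"
   by (rule nn_integral_eq_integral) (use ss[of "k * L"] in auto)
  also have "\<dots> \<le> ennreal (C / 2)" using ss[of "k * L"] by (intro ennreal_leI) simp
  finally show "(\<integral>\<^sup>+om. ennreal (- ln (gkf r k (AA va zb om) (T om) (Yn om))) \<partial>M) \<le> ennreal (C / 2)" .
 qed (use law pm p0 par al cg0 C0 gk_pos gibbs Teq Yeq sp ep in auto)
qed

lemma UU_eq: "q \<in> JJ va zb \<Longrightarrow> UU va zb om q = Zp q om"
 by (simp add: UU_def)

lemma chain_UU:
 assumes om: "om \<in> space M" and i: "1 \<le> i" "i + d \<le> L"
  and J: "\<And>j m. i \<le> j \<Longrightarrow> j < i + d \<Longrightarrow> (j, m * L + j) \<in> JJ va zb"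
 shows "chain (\<lambda>n. sig i n om) i (UU va zb om) d n = sig (i + d) n om"
proof -
 have "chain (\<lambda>n. sig i n om) i (UU va zb om) d n = chain (\<lambda>n. sig i n om) i (\<lambda>(i, t). Z i t om) d n"
  by (rule chain_cong) (simp_all add: UU_eq[OF J] Zp_def)
 then show ?thesis by (simp only: chain_sig[OF om i])
qed

lemma sq_m: "y \<in> measurable K sq \<Longrightarrow> (\<lambda>z. y z n) \<in> borel_measurable K"
 using measurable_compose[of y K sq "\<lambda>x. x n" borel] measurable_component_singleton[of n UNIV "\<lambda>_. borel"] by simp

end

section \<open>The two cuts of the network\<close>

context cascade_loop
begin

text \<open>
 For a hop \<open>b < L\<close> the loop is cut at hops \<open>L\<close> and \<open>b\<close>: the white noise entering the
 controller plays the role of \<open>V\<close>. The shift by one round in \<open>eB\<close> is due to \<open>R 0\<close> being pure noise.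
\<close>

definition rB :: "'h \<Rightarrow> (nat \<Rightarrow> real) \<Rightarrow> (nat \<Rightarrow> real) \<Rightarrow> nat \<Rightarrow> real" where
 "rB h t y s = (if L dvd s then sqrt (N L) * t (s div L) else 0)"

definition eB :: "nat \<Rightarrow> nat \<Rightarrow> (nat \<Rightarrow> real ^ 'n) \<times> (nat \<times> nat \<Rightarrow> real) \<Rightarrow> (nat \<Rightarrow> real) \<Rightarrow> real" where
 "eB b n h y = (if n = 0 then 0
  else chain (rel b (\<lambda>m. sqrt (N b) * y m)) (b + 1) (snd h) (L - b - 1) (n - 1) / sqrt (N L))"

definition sB :: "nat \<Rightarrow> nat \<Rightarrow> (real ^ 'n) \<times> (nat \<Rightarrow> real ^ 'n) \<times> (nat \<times> nat \<Rightarrow> real) \<Rightarrow> (nat \<Rightarrow> real) \<Rightarrow> real" where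
 "sB b n a t = chain (enc (fst a) (fst (snd a)) (rB () t t)) 1 (snd (snd a)) (b - 1) n / sqrt (N b)"

lemma rB_m:
 assumes t: "t \<in> measurable K sq"
 shows "(\<lambda>z. rB (h z) (t z) (u z) i) \<in> borel_measurable K"
proof -
 have [measurable]: "(\<lambda>z. t z (i div L)) \<in> borel_measurable K" by (rule sq_m[OF t])
 have "(\<lambda>z. sqrt (N L) * t z (i div L)) \<in> borel_measurable K" by measurable
 then show ?thesis by (cases "L dvd i") (simp_all add: rB_def)
qed

text \<open>With the controller input as cut signal \<open>t\<close>, the state is affine in
  \<open>x\<close> for fixed \<open>t\<close>. The path from hop \<open>b\<close> to hop
  \<open>L\<close> runs through relays only, so the feedback does not see \<open>x\<close>: a
  downstream loop.\<close>

lemma hop_contradiction_inner: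
 assumes b: "1 \<le> b" "b < L" and dA: "1 < \<bar>det A\<bar>"
  and ss: "\<And>t. integrable M (\<lambda>om. (norm (X t om))\<^sup>2) \<and> (\<integral>om. (norm (X t om))\<^sup>2 \<partial>M) < C"
  and cap: "ln (1 + real L * Pw b / N b) / 2 \<le> real L * ln \<bar>det A\<bar>"
 shows False
proof -
 obtain p where p: "finite_entropy lborel (X 0) p" using init_entropy by blast
 \<comment> \<open>Hop \<open>L\<close> is taken at all multiples of \<open>L\<close>, including
   time 0, where the controller receives pure noise.\<close>
 define va zb where "va = (\<lambda>n :: nat. (L, n * L))" and "zb = (\<lambda>n :: nat. (b, n * L + b))"
 let ?M0 = "density lborel (\<lambda>x. ennreal (p x)) \<Otimes>\<^sub>M HH va zb"
 have va: "inj va" "range va \<subseteq> hop_times" and zb: "inj zb" "range zb \<subseteq> hop_times" and disj: "range va \<inter> range zb = {}"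
  using b L_pos by (auto simp: va_def zb_def inj_on_def)
 note law = law_AA[OF p va zb disj]
 have J: "(j, q) \<in> JJ va zb" if "1 \<le> j" "j < L" "j \<noteq> b" for j q
  using that by (auto simp: JJ_def va_def zb_def)
 have NL: "0 < N L" "0 < N b" using b hops by (auto intro: noise_var_pos)
 \<comment> \<open>Time \<open>n * L\<close> closes round \<open>n - 1\<close>, so
   \<open>T n\<close> depends on \<open>Yn\<close> of earlier rounds only; this is the strict
   causality of the feedback.\<close>
 define T Yn where "T om n = R (n * L) om / sqrt (N L)" and "Yn om n = rcv b n om / sqrt (N b)" for om n
 define e where "e n a y = eB b n (snd a) y" for n and a :: "(real ^ 'n) \<times> (nat \<Rightarrow> real ^ 'n) \<times> (nat \<times> nat \<Rightarrow> real)" and y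
 have e_m: "(\<lambda>z. e n (a z) (y z)) \<in> borel_measurable K" if a: "a \<in> measurable K ?M0" and y: "y \<in> measurable K sq" for a y n and K :: "'k measure"
 proof (cases "n = 0")
  case False
  have "(\<lambda>z. chain (rel b (\<lambda>m. sqrt (N b) * y z m)) (b + 1) (snd (snd (a z))) (L - b - 1) (n - 1)) \<in> borel_measurable K"
  proof (rule chain_m)
   show "(\<lambda>z. rel b (\<lambda>m. sqrt (N b) * y z m) n) \<in> borel_measurable K" for n
    by (rule rel_m, rule borel_measurable_times[OF borel_measurable_const sq_m[OF y]]) (use b in auto)
   show "(\<lambda>z. snd (snd (a z)) (j, n * L + j)) \<in> borel_measurable K" if "b + 1 \<le> j" "j < b + 1 + (L - b - 1)" for j n
    by (rule static_m(3)[OF law(8) a], rule J) (use that b in auto)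
  qed (use b in auto)
  then show ?thesis using False by (simp add: e_def eB_def)
 qed (simp add: e_def eB_def)
 have s_m: "(\<lambda>z. sB b n (a z) (t z)) \<in> borel_measurable K" if a: "a \<in> measurable K ?M0" and t: "t \<in> measurable K sq" for a t n and K :: "'k measure"
 proof -
  have r: "(\<lambda>z. rB () (t z) (t z) s) \<in> borel_measurable K" for s
   by (rule rB_m[OF t])
  have "(\<lambda>z. chain (enc (fst (a z)) (fst (snd (a z))) (rB () (t z) (t z))) 1 (snd (snd (a z))) (b - 1) n) \<in> borel_measurable K"
  proof (rule chain_m)
   show "(\<lambda>z. enc (fst (a z)) (fst (snd (a z))) (rB () (t z) (t z)) n) \<in> borel_measurable K" for n
    by (rule enc_m[OF static_m(1)[OF law(8) a] static_m(2)[OF law(8) a] r])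
   show "(\<lambda>z. snd (snd (a z)) (j, n * L + j)) \<in> borel_measurable K" if "1 \<le> j" "j < 1 + (b - 1)" for j n
    by (rule static_m(3)[OF law(8) a], rule J) (use that b in auto)
  qed (use b in auto)
  then show ?thesis by (simp add: sB_def)
 qed
 have rR: "rB h (T om) y = (\<lambda>i. R i om)" if "om \<in> space M" for om y and h :: 'g
  using NL R_off[OF that] by (auto simp: rB_def T_def fun_eq_iff)
 have rcvY: "(\<lambda>m. sqrt (N b) * Yn om m) = (\<lambda>m. rcv b m om)" for om using NL by (simp add: Yn_def)
 have es: "e (Suc m) (AA va zb om) (Yn om) = sig L m om / sqrt (N L)" if om: "om \<in> space M" for om m
 proof -
  have "rel b (\<lambda>m. rcv b m om) = (\<lambda>n. sig (b + 1) n om)" using sig_rel[OF om, of b] b by (auto simp: fun_eq_iff)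
  moreover have "chain (\<lambda>n. sig (b + 1) n om) (b + 1) (UU va zb om) (L - b - 1) m = sig (b + 1 + (L - b - 1)) m om"
   by (rule chain_UU[OF om]) (use b in \<open>auto intro!: J\<close>)
  ultimately show ?thesis using b by (simp add: e_def eB_def AA_def rcvY)
 qed
 have V: "VV va om n = Z L (n * L) om / sqrt (N L)" "VV zb om n = Z b (n * L + b) om / sqrt (N b)" for om n
  by (simp_all add: VV_def va_def zb_def Zp_def nz_def)
 have e0: "e 0 a y = 0" for a y by (simp add: e_def eB_def)
 have ss': "sB b n (AA va zb om) (T om) = sig b n om / sqrt (N b)" if om: "om \<in> space M" for om n
 proof -
  have "enc (X 0 om) (\<lambda>t. W t om) (\<lambda>i. R i om) = (\<lambda>n. sig 1 n om)" using sig_1[OF om] by (simp add: fun_eq_iff)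
  moreover have "chain (\<lambda>n. sig 1 n om) 1 (UU va zb om) (b - 1) n = sig (1 + (b - 1)) n om"
   by (rule chain_UU[OF om]) (use b in \<open>auto intro!: J\<close>)
  ultimately show ?thesis using b by (simp add: sB_def AA_def rR[OF om])
 qed
 have info: "info_loop p (HH va zb) e (sB b) M (AA va zb) (VV va) (VV zb) T Yn (real L * Pw b / N b) (real L * Pw L / N L) cg (C / 2) (real L * ln \<bar>det A\<bar>) (gkf rB)"
 proof (rule info_loopI[OF p ss dA va zb disj])
  show "(\<lambda>(a, y). e n a y) \<in> borel_measurable (?M0 \<Otimes>\<^sub>M sq)" for n
   unfolding split_beta' by (rule e_m) measurable
  show "(\<lambda>(a, t). sB b n a t) \<in> borel_measurable (?M0 \<Otimes>\<^sub>M sq)" for n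
   unfolding split_beta' by (rule s_m) measurable
  show "e n a y = e n a y'" if "\<And>i. i < n \<Longrightarrow> y i = y' i" for n a y y'
  proof (cases "n = 0")
   case False
   have "chain (rel b (\<lambda>m. sqrt (N b) * y m)) (b + 1) (snd (snd a)) (L - b - 1) (n - 1)
    = chain (rel b (\<lambda>m. sqrt (N b) * y' m)) (b + 1) (snd (snd a)) (L - b - 1) (n - 1)"
   proof (rule chain_cong)
    fix m assume "m \<le> n - 1"
    then show "rel b (\<lambda>m. sqrt (N b) * y m) m = rel b (\<lambda>m. sqrt (N b) * y' m) m"
     using that False by (intro rel_cong) simp
   qed simp
   then show ?thesis by (simp add: e_def eB_def)
  qed (simp add: e0)
  show "sB b n a t = sB b n a t'" if *: "\<And>i. i \<le> n \<Longrightarrow> t i = t' i" for n a t t'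
  proof -
   \<comment> \<open>The encoder in round \<open>n\<close> uses received values up to time
     \<open>n * L\<close>, that is, \<open>t\<close> up to index \<open>n\<close>.\<close>
   have "rB () t t s = rB () t' t' s" if "m \<le> n" "s \<le> m * L" for m s
   proof -
    have "s div L \<le> (m * L) div L" using that by (intro div_le_mono)
    then have "s div L \<le> n" using that L_pos by simp
    then show ?thesis using * by (simp add: rB_def)
   qed
   then show ?thesis unfolding sB_def by (intro arg_cong[where f="\<lambda>u. u / sqrt (N b)"] chain_cong enc_cong) auto
  qed
  show "T om n = e n (AA va zb om) (Yn om) + VV va om n" if om: "om \<in> space M" for om n
  proof (cases n)
   case 0
   then show ?thesis using R_0[OF om] by (simp add: T_def e0 V)
  next
   case (Suc m)
   then show ?thesis using R_rcv[OF om, of m]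
    by (simp add: T_def es[OF om] V rcv_def add_divide_distrib add.commute)
  qed
  show "Yn om n = sB b n (AA va zb om) (T om) + VV zb om n" if om: "om \<in> space M" for om n
   by (simp add: Yn_def ss'[OF om] V rcv_def add_divide_distrib)
  show "(\<integral>\<^sup>+om. ennreal ((sB b n (AA va zb om) (T om))\<^sup>2) \<partial>M) = ennreal (real L * Pw b / N b)" for n
  proof -
   have "(\<integral>\<^sup>+om. ennreal ((sB b n (AA va zb om) (T om))\<^sup>2) \<partial>M) = (\<integral>\<^sup>+om. ennreal ((sig (b) n om / sqrt (N (b)))\<^sup>2) \<partial>M)"
    by (rule nn_integral_cong) (simp only: ss')
   also have "\<dots> = ennreal (real L * Pw (b) / N (b))" by (rule sig_power) (use b in auto)
   finally show ?thesis by (simp only: order_refl)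
  qed
  show "(\<integral>\<^sup>+om. ennreal ((e n (AA va zb om) (Yn om))\<^sup>2) \<partial>M) \<le> ennreal (real L * Pw L / N L)" for n
  proof (cases n)
   case (Suc m)
   have "(\<integral>\<^sup>+om. ennreal ((e (Suc m) (AA va zb om) (Yn om))\<^sup>2) \<partial>M) = (\<integral>\<^sup>+om. ennreal ((sig (L) m om / sqrt (N (L)))\<^sup>2) \<partial>M)"
    by (rule nn_integral_cong) (simp only: es)
   also have "\<dots> = ennreal (real L * Pw (L) / N (L))" by (rule sig_power) (use hops in auto)
   finally show ?thesis by (simp only: Suc order_refl)
  qed (simp add: e0)
  show "(\<lambda>(a, t, y). rB (snd a) t y i) \<in> borel_measurable (?M0 \<Otimes>\<^sub>M sq \<Otimes>\<^sub>M sq)" for i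
   unfolding split_beta' by (rule rB_m[OF measurable_compose[OF measurable_snd measurable_fst]])
  show "rB h t y i = rB h t' y' i" if "\<And>i. i < k \<Longrightarrow> t i = t' i" "i < k * L" for k t t' i h y y'
   using that(1)[of "i div L"] less_mult_imp_div_less[OF that(2)] by (simp add: rB_def)
  show "rB (snd (AA va zb om)) (T om) (Yn om) = (\<lambda>i. R i om)" if "om \<in> space M" for om by (rule rR[OF that])
  show "0 \<le> real L * Pw b / N b" "0 \<le> real L * Pw L / N L"
   using sig_sq(3)[of b] sig_sq(3)[of L] NL b hops by auto
  show "ln (1 + real L * Pw b / N b) / 2 \<le> real L * ln \<bar>det A\<bar>" by (rule cap)
  show "(\<forall>n x x' h y. e n (x, h) y = e n (x', h) y) \<or> (\<forall>h t t' y. rB h t y = rB h t' y)"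
   by (simp add: e_def)
 qed
 have "downstream_loop p (HH va zb) e (sB b) M (AA va zb) (VV va) (VV zb) T Yn (real L * Pw b / N b) (real L * Pw L / N L) cg (C / 2) (real L * ln \<bar>det A\<bar>) (gkf rB) (eB b)"
 proof (intro downstream_loop.intro[OF info] downstream_loop_axioms.intro)
  show "(\<lambda>(h, y). eB b n h y) \<in> borel_measurable (HH va zb \<Otimes>\<^sub>M sq)" for n
  proof -
   have a: "(\<lambda>z. (0, fst z)) \<in> measurable (HH va zb \<Otimes>\<^sub>M sq) ?M0" by (intro measurable_Pair) auto
   show ?thesis using e_m[OF a measurable_snd, of n] by (simp add: e_def split_beta')
  qed
 qed (simp add: e_def, rule gkf_int[OF dA])
 then show False by (rule downstream_loop.contradiction)
qed

text \<open>
 For the last hop the loop is cut at hops \<open>L - 1\<close> and \<open>L\<close>; the initial channel output \<open>R 0\<close>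
 is part of the static noise.
\<close>

definition rC :: "'g \<times> (nat \<times> nat \<Rightarrow> real) \<Rightarrow> (nat \<Rightarrow> real) \<Rightarrow> (nat \<Rightarrow> real) \<Rightarrow> nat \<Rightarrow> real" where
 "rC h t y s = (if s = 0 then snd h (L, 0) else if L dvd s then sqrt (N L) * y (s div L - 1) else 0)"

definition eC :: "nat \<Rightarrow> (real ^ 'n) \<times> (nat \<Rightarrow> real ^ 'n) \<times> (nat \<times> nat \<Rightarrow> real) \<Rightarrow> (nat \<Rightarrow> real) \<Rightarrow> real" where
 "eC n a y = chain (enc (fst a) (fst (snd a)) (rC (snd a) y y)) 1 (snd (snd a)) (L - 2) n / sqrt (N (L - 1))"

definition sC :: "nat \<Rightarrow> (nat \<Rightarrow> real) \<Rightarrow> real" where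
 "sC n t = rel (L - 1) (\<lambda>m. sqrt (N (L - 1)) * t m) n / sqrt (N L)"

text \<open>Here the bounded hop ends at the controller, so \<open>y\<close> itself, together with
  the static noise at time 0, determines the control and the state factor does not see
  \<open>t\<close>. The feedback runs through plant and encoder and does see \<open>x\<close>: an
  upstream loop. Hop \<open>L - 1\<close>, which for \<open>L = 2\<close> is the encoder's own hop,
  supplies the noise in \<open>t\<close>.\<close>

lemma hop_contradiction_last:
 assumes dA: "1 < \<bar>det A\<bar>"
  and ss: "\<And>t. integrable M (\<lambda>om. (norm (X t om))\<^sup>2) \<and> (\<integral>om. (norm (X t om))\<^sup>2 \<partial>M) < C"
  and cap: "ln (1 + real L * Pw L / N L) / 2 \<le> real L * ln \<bar>det A\<bar>"
 shows False
proof -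
 obtain p where p: "finite_entropy lborel (X 0) p" using init_entropy by blast
 \<comment> \<open>The use of hop \<open>L\<close> at time 0 is left out: it precedes every round
   and stays in the static noise.\<close>
 define va zb where "va = (\<lambda>n :: nat. (L - 1, n * L + (L - 1)))" and "zb = (\<lambda>n :: nat. (L, (n + 1) * L))"
 let ?M0 = "density lborel (\<lambda>x. ennreal (p x)) \<Otimes>\<^sub>M HH va zb"
 have "inj va" "inj zb"
 proof -
  have "n = m" if "n * L + (L - 1) = m * L + (L - 1)" for n m
   using add_right_imp_eq[OF that] hops by simp
  then show "inj va" by (intro injI) (simp only: va_def prod.inject)
  have "n = m" if "(n + 1) * L = (m + 1) * L" for n m using that hops by simp
  then show "inj zb" by (intro injI) (simp only: zb_def prod.inject)
 qed
 then have va: "inj va" "range va \<subseteq> hop_times" and zb: "inj zb" "range zb \<subseteq> hop_times" and disj: "range va \<inter> range zb = {}"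
  using hops by (auto simp: va_def zb_def)
 note law = law_AA[OF p va zb disj]
 have J: "(j, q) \<in> JJ va zb" if "1 \<le> j" "j < L - 1" for j q
  using that by (auto simp: JJ_def va_def zb_def)
 have JL: "(L, 0) \<in> JJ va zb" using hops by (auto simp: JJ_def va_def zb_def)
 have NL: "0 < N L" "0 < N (L - 1)" using hops by (auto intro: noise_var_pos)
 define T Yn where "T om n = rcv (L - 1) n om / sqrt (N (L - 1))" and "Yn om n = rcv L n om / sqrt (N L)" for om n
 define s where "s n a t = sC n t" for n and a :: "(real ^ 'n) \<times> (nat \<Rightarrow> real ^ 'n) \<times> (nat \<times> nat \<Rightarrow> real)" and t
 have r_m: "(\<lambda>z. rC (snd (a z)) (t z) (y z) i) \<in> borel_measurable K"
  if a: "a \<in> measurable K ?M0" and y: "y \<in> measurable K sq" for a t y i and K :: "'k measure"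
 proof -
  have [measurable]: "(\<lambda>z. y z (i div L - 1)) \<in> borel_measurable K" by (rule sq_m[OF y])
  have "(\<lambda>z. sqrt (N L) * y z (i div L - 1)) \<in> borel_measurable K" by measurable
  then show ?thesis using static_m(3)[OF law(8) a JL] by (cases "i = 0"; cases "L dvd i") (simp_all add: rC_def)
 qed
 have e_m: "(\<lambda>z. eC n (a z) (y z)) \<in> borel_measurable K" if a: "a \<in> measurable K ?M0" and y: "y \<in> measurable K sq" for a y n and K :: "'k measure"
 proof -
  have "(\<lambda>z. chain (enc (fst (a z)) (fst (snd (a z))) (rC (snd (a z)) (y z) (y z))) 1 (snd (snd (a z))) (L - 2) n) \<in> borel_measurable K"
  proof (rule chain_m)
   show "(\<lambda>z. enc (fst (a z)) (fst (snd (a z))) (rC (snd (a z)) (y z) (y z)) n) \<in> borel_measurable K" for n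
    by (rule enc_m[OF static_m(1)[OF law(8) a] static_m(2)[OF law(8) a] r_m[OF a y]])
   show "(\<lambda>z. snd (snd (a z)) (j, n * L + j)) \<in> borel_measurable K" if "1 \<le> j" "j < 1 + (L - 2)" for j n
    by (rule static_m(3)[OF law(8) a], rule J) (use that in auto)
  qed (use hops in auto)
  then show ?thesis by (simp add: eC_def)
 qed
 have s_m: "(\<lambda>z. s n (a z) (t z)) \<in> borel_measurable K" if t: "t \<in> measurable K sq" for a t n and K :: "'k measure"
 proof -
  have "(\<lambda>z. rel (L - 1) (\<lambda>m. sqrt (N (L - 1)) * t z m) n) \<in> borel_measurable K"
   by (rule rel_m, rule borel_measurable_times[OF borel_measurable_const sq_m[OF t]]) (use hops in auto)
  then show ?thesis by (simp add: s_def sC_def)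
 qed
 have rR: "rC (snd (AA va zb om)) t (Yn om) = (\<lambda>i. R i om)" if om: "om \<in> space M" for om t
 proof
  fix i
  consider "i = 0" | m where "i = (m + 1) * L" | "\<not> L dvd i"
   by (metis Suc_eq_plus1 dvd_div_mult_self mult_0 not0_implies_Suc)
  then show "rC (snd (AA va zb om)) t (Yn om) i = R i om"
  proof cases
   case 1
   then show ?thesis using R_0[OF om] UU_eq[OF JL] by (simp add: rC_def AA_def Zp_def)
  next
   case (2 m)
   have "i \<noteq> 0" "L dvd i" "i div L - 1 = m" using 2 L_pos by auto
   then have "rC (snd (AA va zb om)) t (Yn om) i = rcv L m om" using NL by (simp add: rC_def Yn_def)
   then show ?thesis using R_rcv[OF om, of m] by (simp only: 2)
  next
   case 3
   then show ?thesis using R_off[OF om 3] by (auto simp: rC_def)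
  qed
 qed
 have rcvT: "(\<lambda>m. sqrt (N (L - 1)) * T om m) = (\<lambda>m. rcv (L - 1) m om)" for om using NL by (simp add: T_def)
 have ss': "s n a (T om) = sig L n om / sqrt (N L)" if om: "om \<in> space M" for om n a
 proof -
  have "L - 1 \<in> {1..L - 1}" "L - 1 + 1 = L" using hops by auto
  then show ?thesis using sig_rel[OF om, of "L - 1" n] by (simp only: s_def sC_def rcvT)
 qed
 have es: "eC n (AA va zb om) (Yn om) = sig (L - 1) n om / sqrt (N (L - 1))" if om: "om \<in> space M" for om n
 proof -
  have "enc (X 0 om) (\<lambda>t. W t om) (\<lambda>i. R i om) = (\<lambda>n. sig 1 n om)" using sig_1[OF om] by (simp add: fun_eq_iff)
  moreover have "chain (\<lambda>n. sig 1 n om) 1 (UU va zb om) (L - 2) n = sig (1 + (L - 2)) n om"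
   by (rule chain_UU[OF om]) (use hops in \<open>auto intro!: J\<close>)
  moreover have "1 + (L - 2) = L - 1" using hops by auto
  moreover have "fst (AA va zb om) = X 0 om" "fst (snd (AA va zb om)) = (\<lambda>t. W t om)" "snd (snd (AA va zb om)) = UU va zb om"
   by (simp_all add: AA_def)
  ultimately show ?thesis by (simp only: eC_def rR[OF om])
 qed
 have V: "VV va om n = Z (L - 1) (n * L + (L - 1)) om / sqrt (N (L - 1))" "VV zb om n = Z L (n * L + L) om / sqrt (N L)" for om n
  by (simp_all add: VV_def va_def zb_def Zp_def nz_def add.commute)
 have info: "info_loop p (HH va zb) eC s M (AA va zb) (VV va) (VV zb) T Yn (real L * Pw L / N L) (real L * Pw (L - 1) / N (L - 1)) cg (C / 2) (real L * ln \<bar>det A\<bar>) (gkf rC)"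
 proof (rule info_loopI[OF p ss dA va zb disj])
  show "(\<lambda>(a, y). eC n a y) \<in> borel_measurable (?M0 \<Otimes>\<^sub>M sq)" for n
   unfolding split_beta' by (rule e_m) measurable
  show "(\<lambda>(a, t). s n a t) \<in> borel_measurable (?M0 \<Otimes>\<^sub>M sq)" for n
   unfolding split_beta' by (rule s_m) measurable
  show "eC n a y = eC n a y'" if *: "\<And>i. i < n \<Longrightarrow> y i = y' i" for n a y y'
  proof -
   \<comment> \<open>The received value at time \<open>q * L\<close> is \<open>y\<close> at index
     \<open>q - 1\<close>; up to time \<open>n * L\<close> the encoder sees \<open>y\<close>
     strictly before \<open>n\<close>.\<close>
   have "rC (snd a) y y i = rC (snd a) y' y' i" if "m \<le> n" "i \<le> m * L" for m i
   proof (cases "i \<noteq> 0 \<and> L dvd i")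
    case True
    then obtain q where q: "i = L * q" "q \<noteq> 0" by auto
    then have "q \<le> m" using that L_pos by (simp add: mult.commute)
    then have "q - 1 < n" using q that by auto
    then show ?thesis using * q L_pos by (simp add: rC_def)
   qed (auto simp: rC_def)
   then show ?thesis unfolding eC_def by (intro arg_cong[where f="\<lambda>u. u / sqrt (N (L - 1))"] chain_cong enc_cong) auto
  qed
  show "s n a t = s n a t'" if "\<And>i. i \<le> n \<Longrightarrow> t i = t' i" for n a t t'
  proof -
   have "rel (L - 1) (\<lambda>m. sqrt (N (L - 1)) * t m) n = rel (L - 1) (\<lambda>m. sqrt (N (L - 1)) * t' m) n"
    using that by (intro rel_cong) simp
   then show ?thesis by (simp only: s_def sC_def)
  qed
  show "T om n = eC n (AA va zb om) (Yn om) + VV va om n" if om: "om \<in> space M" for om n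
   by (simp only: T_def es[OF om] V rcv_def add_divide_distrib)
  show "Yn om n = s n (AA va zb om) (T om) + VV zb om n" if om: "om \<in> space M" for om n
   by (simp only: Yn_def ss'[OF om] V rcv_def add_divide_distrib)
  show "(\<integral>\<^sup>+om. ennreal ((s n (AA va zb om) (T om))\<^sup>2) \<partial>M) = ennreal (real L * Pw L / N L)" for n
  proof -
   have "(\<integral>\<^sup>+om. ennreal ((s n (AA va zb om) (T om))\<^sup>2) \<partial>M) = (\<integral>\<^sup>+om. ennreal ((sig (L) n om / sqrt (N (L)))\<^sup>2) \<partial>M)"
    by (rule nn_integral_cong) (simp only: ss')
   also have "\<dots> = ennreal (real L * Pw (L) / N (L))" by (rule sig_power) (use hops in auto)
   finally show ?thesis by (simp only: order_refl)
  qed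
  show "(\<integral>\<^sup>+om. ennreal ((eC n (AA va zb om) (Yn om))\<^sup>2) \<partial>M) \<le> ennreal (real L * Pw (L - 1) / N (L - 1))" for n
  proof -
   have "(\<integral>\<^sup>+om. ennreal ((eC n (AA va zb om) (Yn om))\<^sup>2) \<partial>M) = (\<integral>\<^sup>+om. ennreal ((sig (L - 1) n om / sqrt (N (L - 1)))\<^sup>2) \<partial>M)"
    by (rule nn_integral_cong) (simp only: es)
   also have "\<dots> = ennreal (real L * Pw (L - 1) / N (L - 1))" by (rule sig_power) (use hops in auto)
   finally show ?thesis by (simp only: order_refl)
  qed
  show "(\<lambda>(a, t, y). rC (snd a) t y i) \<in> borel_measurable (?M0 \<Otimes>\<^sub>M sq \<Otimes>\<^sub>M sq)" for i
   unfolding split_beta' by (rule r_m) measurable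
  show "rC h t y i = rC h t' y' i" if "\<And>i. i < k \<Longrightarrow> y i = y' i" "i < k * L" for k t t' y y' i h
   using that(1)[of "i div L - 1"] less_mult_imp_div_less[OF that(2)] by (simp add: rC_def less_imp_diff_less)
  show "rC (snd (AA va zb om)) (T om) (Yn om) = (\<lambda>i. R i om)" if "om \<in> space M" for om by (rule rR[OF that])
  show "0 \<le> real L * Pw L / N L" "0 \<le> real L * Pw (L - 1) / N (L - 1)"
   using sig_sq(3)[of "L - 1"] sig_sq(3)[of L] NL hops by auto
  show "ln (1 + real L * Pw L / N L) / 2 \<le> real L * ln \<bar>det A\<bar>" by (rule cap)
  show "(\<forall>n x x' h y. eC n (x, h) y = eC n (x', h) y) \<or> (\<forall>h t t' y. rC h t y = rC h t' y)"
   by (simp add: rC_def fun_eq_iff)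
 qed
 have "upstream_loop p (HH va zb) eC s M (AA va zb) (VV va) (VV zb) T Yn (real L * Pw L / N L) (real L * Pw (L - 1) / N (L - 1)) cg (C / 2) (real L * ln \<bar>det A\<bar>) (gkf rC)"
 proof (intro upstream_loop.intro[OF info] upstream_loop_axioms.intro)
  show "gkf rC k a t y = gkf rC k a t' y" for k a t t' y
  proof -
   have "rC (snd a) t y = rC (snd a) t' y" by (simp add: rC_def fun_eq_iff)
   then show ?thesis by (simp only: gkf_def)
  qed
 qed (rule gkf_int[OF dA])
 then show False by (rule upstream_loop.contradiction)
qed

section \<open>From single hops to the network\<close>

lemma hop_bound:
 assumes "i \<in> {1..L}" "1 < \<bar>det A\<bar>" "mean_square_stable M X"
 shows "real L * ln \<bar>det A\<bar> < ln (1 + real L * Pw i / N i) / 2"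
proof (rule ccontr)
 assume n: "\<not> ?thesis"
 obtain C where C: "\<And>t. integrable M (\<lambda>om. (norm (X t om))\<^sup>2) \<and> (\<integral>om. (norm (X t om))\<^sup>2 \<partial>M) < C"
  using assms(3) unfolding mean_square_stable_def by blast
 show False
 proof (cases "i = L")
  case True
  then show False using hop_contradiction_last[OF assms(2) C] n by simp
 next
  case False
  then show False using hop_contradiction_inner[OF _ _ assms(2) C, of i] n assms(1) by simp
 qed
qed

lemma weakest_hop: "\<exists>i\<in>{1..L}. Pw i / N i \<le> min (P_S / N 1) (P_R / (\<Sum>i = 2..L. N i))"
proof (cases "P_S / N 1 \<le> P_R / (\<Sum>i = 2..L. N i)")
 case True
 then show ?thesis using hops by (intro bexI[of _ 1]) (auto simp: Pw_def)
next
 case False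
 let ?S = "\<Sum>i = 2..L. N i"
 have S: "0 < ?S" using hops by (intro sum_pos) (auto intro: noise_var_pos)
 \<comment> \<open>\<open>N i * (P_R / ?S)\<close> is the allocation of \<open>P_R\<close> that
   equalises the signal-to-noise ratios of the hops after the first; not every relay can exceed its
   share.\<close>
 have "\<exists>i\<in>{2..L}. P_r (i - 1) \<le> N i * (P_R / ?S)"
 proof (rule ccontr)
  assume "\<not> ?thesis"
  then have "(\<Sum>i = 2..L. N i * (P_R / ?S)) < (\<Sum>i = 2..L. P_r (i - 1))"
   using hops by (intro sum_strict_mono) (auto simp: not_le)
  also have "(\<Sum>i = 2..L. P_r (i - 1)) = (\<Sum>i = 1..L - 1. P_r i)"
   by (rule sum.reindex_bij_witness[of _ "\<lambda>i. i + 1" "\<lambda>i. i - 1"]) auto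
  also have "\<dots> \<le> P_R" by (rule relay_power)
  finally have "(\<Sum>i = 2..L. N i * (P_R / ?S)) < P_R" .
  moreover have "(\<Sum>i = 2..L. N i * (P_R / ?S)) = ?S * (P_R / ?S)" by (rule sum_distrib_right[symmetric])
  moreover have "?S * (P_R / ?S) = P_R" using S by simp
  ultimately show False by (simp only: less_irrefl)
 qed
 then obtain i where i: "i \<in> {2..L}" "P_r (i - 1) \<le> N i * (P_R / ?S)" by blast
 then have "Pw i / N i \<le> P_R / ?S" using noise_var_pos[of i] by (simp add: Pw_def divide_le_eq mult.commute)
 then show ?thesis using i False by (intro bexI[of _ i]) auto
qed

end

theorem theorem3p1:
  fixes M :: "'w measure"
    and A :: "real ^ 'n ^ 'n" and B :: "real ^ 'm ^ 'n"
    and Lambda0 K_W :: "real ^ 'n ^ 'n"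
    and X W :: "nat \<Rightarrow> 'w \<Rightarrow> real ^ 'n"
    and U :: "nat \<Rightarrow> 'w \<Rightarrow> real ^ 'm"
    and L :: nat
    and P_S P_R :: real and P_r N :: "nat \<Rightarrow> real"
    and f :: "nat \<Rightarrow> (nat \<Rightarrow> real ^ 'n) \<times> (nat \<Rightarrow> real ^ 'm) \<Rightarrow> real"
    and g :: "nat \<Rightarrow> nat \<Rightarrow> (nat \<Rightarrow> real) \<Rightarrow> real"
    and ctrl :: "nat \<Rightarrow> (nat \<Rightarrow> real) \<Rightarrow> real ^ 'm"
    and Se R :: "nat \<Rightarrow> 'w \<Rightarrow> real"
    and Sr Y Z :: "nat \<Rightarrow> nat \<Rightarrow> 'w \<Rightarrow> real"
  assumes "cascade_loop M A B Lambda0 K_W X U W L P_S P_R P_r N f g ctrl Se R Sr Y Z"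
    and "mean_square_stable M X"
  shows "log 2 \<bar>det A\<bar>
    < 1 / (2 * real L) * log 2 (1 + real L * min (P_S / N 1) (P_R / (\<Sum>i = 2..L. N i)))"
proof -
  interpret cascade_loop M A B Lambda0 K_W X U W L P_S P_R P_r N f g ctrl Se R Sr Y Z by fact
  let ?m = "min (P_S / N 1) (P_R / (\<Sum>i = 2..L. N i))"
  have S: "0 < (\<Sum>i = 2..L. N i)" using hops by (intro sum_pos) (auto intro: noise_var_pos)
  have N1: "0 < N 1" using hops by (intro noise_var_pos) auto
  have m: "0 < ?m" using powers_pos N1 S by simp
  have L0: "0 < real L" using L_pos by simp
  have pos: "0 < ln (1 + real L * ?m)" using m L0 by (intro ln_gt_zero) simp
  have "real L * ln \<bar>det A\<bar> < ln (1 + real L * ?m) / 2"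
  proof (cases "1 < \<bar>det A\<bar>")
    case True
    obtain i where i: "i \<in> {1..L}" "Pw i / N i \<le> ?m" using weakest_hop by blast
    have "real L * ln \<bar>det A\<bar> < ln (1 + real L * Pw i / N i) / 2" by (rule hop_bound[OF i(1) True assms(2)])
    also have "\<dots> \<le> ln (1 + real L * ?m) / 2"
    proof -
      have "0 \<le> Pw i / N i" using sig_sq(3)[OF i(1)] noise_var_pos[OF i(1)] by simp
      from mult_nonneg_nonneg[OF less_imp_le[OF L0] this] have "0 \<le> real L * (Pw i / N i)" .
      moreover have "real L * (Pw i / N i) \<le> real L * ?m" by (rule mult_left_mono[OF i(2) less_imp_le[OF L0]])
      ultimately have "ln (1 + real L * (Pw i / N i)) \<le> ln (1 + real L * ?m)"
        by (intro ln_le_cancel_iff[THEN iffD2]) linarith+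
      then show ?thesis by simp
    qed
    finally show ?thesis .
  next
    \<comment> \<open>Here the left side is at most 0, the convention \<open>ln 0 = 0\<close>
      covering a vanishing determinant, while the right side is positive.\<close>
    case False
    then have "ln \<bar>det A\<bar> \<le> 0" by (cases "det A = 0") (auto simp: ln_le_zero_iff)
    then have "real L * ln \<bar>det A\<bar> \<le> 0" using L0 by (simp add: mult_le_0_iff)
    then show ?thesis using pos by simp
  qed
  then have "ln \<bar>det A\<bar> < ln (1 + real L * ?m) / 2 / real L"
    by (simp only: pos_less_divide_eq[OF L0] mult.commute)
  also have "\<dots> = 1 / (2 * real L) * ln (1 + real L * ?m)" by simp
  finally have "ln \<bar>det A\<bar> < 1 / (2 * real L) * ln (1 + real L * ?m)" .
  then have "ln \<bar>det A\<bar> / ln 2 < (1 / (2 * real L) * ln (1 + real L * ?m)) / ln 2"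
    by (intro divide_strict_right_mono) auto
  then show ?thesis by (simp only: log_def times_divide_eq_right)
qed

end
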